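(* Let $(M,\pi)$ be a Poisson manifold, $\mathcal{P}$ a graded operad concentrated in degrees $\leq0$, and $\mathcal{P}\to\mathcal{EBV}$ an operad morphism. Equip $\Omega(M)$ with the $\mathcal{P}$-algebra structure obtained by restriction of scalars along $\mathcal{P}\to\mathcal{EBV}$ from the $\mathcal{EBV}$-algebra structure given by the exterior differential, the exterior product, and $i=i_\pi$. Then this $\mathcal{P}$-algebra is quasi-isomorphic to $\Omega(M)$ with the trivial $\mathcal{P}$-algebra structure.
   Context: The ground field is $k=\mathbb{R}$; complexes are cochain complexes; operads are symmetric DG operads. $[a,b]=ab-(-1)^{|a||b|}ba$. Two algebras over an operad are quasi-isomorphic if connected by a zig-zag of quasi-isomorphisms of such algebras. Poisson manifold: smooth manifold $M$ with bivector field $\pi\in\Gamma(\Lambda^2T(M))$, $[\pi,\pi]=0$ (Schouten--Nijenhuis bracket). $\Omega(M)$ is the de Rham complex and $i_\pi$ the interior product. $\mathcal{EBV}$ (exact Batalin--Vilkovisky operad) is the DG operad whose algebras are DG commutative algebras $A$ equipped with a differential operator $i\colon A\to A$ of degree $-2$ and order $\leq2$ with $[i,[i,d]]=0$. It is generated as a DG operad by $\mu$ (arity $2$, degree $0$, symmetric) and $i$ (arity $1$, degree $-2$), subject to $d(\mu)=0$, $\mu\circ_1\mu=\mu\circ_2\mu$, $i\,d(i)=d(i)\,i$, and the order $\leq2$ relation, which on an algebra reads (with Koszul signs) $$i(xyz)=i(xy)z\pm i(xz)y\pm i(yz)x-i(x)yz\mp i(y)xz\mp i(z)xy.$$ A graded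 operad is a DG operad with trivial differential. For a graded operad $\mathcal{P}$ concentrated in degrees $\leq0$, $\mathcal{P}^0\subset\mathcal{P}$ is its degree $0$ suboperad and there is a unique retraction $\mathcal{P}\to\mathcal{P}^0$. The trivial $\mathcal{P}$-algebra structure is the restriction of scalars along $\mathcal{P}\to\mathcal{P}^0$ of the underlying $\mathcal{P}^0$-algebra structure. *)

theory Defs
  imports
    "HOL-Analysis.Analysis"
    "HOL-Analysis.Finite_Function_Topology"
    "HOL-Combinatorics.Permutations"
    "HOL-Library.Function_Algebras"
    "HOL-Library.Poly_Mapping"
begin

section \<open>Linear preliminaries\<close>

instantiation "fun" :: (type, real_vector) real_vector
begin

definition scaleR_fun :: "real \<Rightarrow> ('a \<Rightarrow> 'b) \<Rightarrow> 'a \<Rightarrow> 'b"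
  where "scaleR_fun c f = (\<lambda>x. c *\<^sub>R f x)"

instance
  by standard (simp_all add: scaleR_fun_def fun_eq_iff scaleR_add_right scaleR_add_left)

end

definition linear_map_on :: "'a::real_vector set \<Rightarrow> ('a \<Rightarrow> 'b::real_vector) \<Rightarrow> bool" where
  "linear_map_on V f \<longleftrightarrow>
     (\<forall>x\<in>V. \<forall>y\<in>V. f (x + y) = f x + f y) \<and> (\<forall>c. \<forall>x\<in>V. f (c *\<^sub>R x) = c *\<^sub>R f x)"

text \<open>The sign \<open>(-1)^k\<close>.\<close>

definition ksign :: "int \<Rightarrow> real" where
  "ksign k = (if even k then 1 else -1)"


section \<open>Cochain complexes\<close>

text \<open>
  A graded vector space is an internally direct family of subspaces of an ambient vector space.
  Maps between graded vector spaces are only ever constrained on homogeneous elements.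
\<close>

record 'a cochains =
  comps :: "int \<Rightarrow> 'a set"
  differential :: "'a \<Rightarrow> 'a"

definition graded_space :: "(int \<Rightarrow> 'a::real_vector set) \<Rightarrow> bool" where
  "graded_space V \<longleftrightarrow> (\<forall>k. subspace (V k)) \<and>
     (\<forall>K x. finite K \<longrightarrow> (\<forall>k\<in>K. x k \<in> V k) \<longrightarrow> (\<Sum>k\<in>K. x k) = 0 \<longrightarrow> (\<forall>k\<in>K. x k = 0))"

definition cochain_complex :: "'a::real_vector cochains \<Rightarrow> bool" where
  "cochain_complex A \<longleftrightarrow> graded_space (comps A) \<and>
     (\<forall>k. linear_map_on (comps A k) (differential A)) \<and>
     (\<forall>k. \<forall>x\<in>comps A k. differential A x \<in> comps A (k + 1) \<and>
                        differential A (differential A x) = 0)"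

definition cochain_map ::
  "'a::real_vector cochains \<Rightarrow> 'b::real_vector cochains \<Rightarrow> ('a \<Rightarrow> 'b) \<Rightarrow> bool" where
  "cochain_map A B f \<longleftrightarrow>
     (\<forall>k. linear_map_on (comps A k) f) \<and>
     (\<forall>k. \<forall>x\<in>comps A k. f x \<in> comps B k \<and> f (differential A x) = differential B (f x))"

definition cocycles :: "'a::real_vector cochains \<Rightarrow> int \<Rightarrow> 'a set" where
  "cocycles A k = {x \<in> comps A k. differential A x = 0}"

definition cohomologous :: "'a::real_vector cochains \<Rightarrow> int \<Rightarrow> ('a \<times> 'a) set" where
  "cohomologous A k = {(x, y). x \<in> cocycles A k \<and> y \<in> cocycles A k \<and>
                               x - y \<in> differential A ` comps A (k - 1)}"

definition cohomology :: "'a::real_vector cochains \<Rightarrow> int \<Rightarrow> 'a set set" where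
  "cohomology A k = cocycles A k // cohomologous A k"

definition quasi_iso_map ::
  "'a::real_vector cochains \<Rightarrow> 'b::real_vector cochains \<Rightarrow> ('a \<Rightarrow> 'b) \<Rightarrow> bool" where
  "quasi_iso_map A B f \<longleftrightarrow> cochain_map A B f \<and>
     (\<forall>k. bij_betw (\<lambda>c. cohomologous B k `` (f ` c)) (cohomology A k) (cohomology B k))"


section \<open>Symmetric DG operads and their algebras\<close>

text \<open>
  Inputs are numbered from \<open>0\<close>.  For \<open>p\<close> of arity \<open>m\<close> and \<open>q\<close> of arity \<open>n\<close>,
  \<open>circ m n i p q\<close> is the partial composite \<open>p \<circ>\<^sub>i q\<close>, of arity \<open>m + n - 1\<close>.
  The symmetric groups act from the left, \<open>(\<sigma> p)(x\<^sub>0, \<dots>) = \<plusminus> p(x\<^bsub>\<sigma> 0\<^esub>, x\<^bsub>\<sigma> 1\<^esub>, \<dots>)\<close>.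
\<close>

record 'p operad =
  arity :: "nat \<Rightarrow> 'p cochains"
  op_unit :: 'p
  circ :: "nat \<Rightarrow> nat \<Rightarrow> nat \<Rightarrow> 'p \<Rightarrow> 'p \<Rightarrow> 'p"
  perm_act :: "nat \<Rightarrow> (nat \<Rightarrow> nat) \<Rightarrow> 'p \<Rightarrow> 'p"

text \<open>
  The block permutation with \<open>(\<sigma> p) \<circ>\<^bsub>\<sigma> i\<^esub> (\<tau> q) = (block_perm m n i \<sigma> \<tau>) (p \<circ>\<^sub>i q)\<close>
  for \<open>p\<close> of arity \<open>m\<close> and \<open>q\<close> of arity \<open>n\<close>: slot \<open>i\<close> of \<open>p\<close> is blown up to \<open>n\<close> slots.
\<close>

definition block_perm ::
  "nat \<Rightarrow> nat \<Rightarrow> nat \<Rightarrow> (nat \<Rightarrow> nat) \<Rightarrow> (nat \<Rightarrow> nat) \<Rightarrow> nat \<Rightarrow> nat" where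
  "block_perm m n i \<sigma> \<tau> j =
     (let blow = (\<lambda>a. if a < \<sigma> i then a else a + n - 1) in
      if j < i then blow (\<sigma> j)
      else if j < i + n then \<sigma> i + \<tau> (j - i)
      else if j < m + n - 1 then blow (\<sigma> (j + 1 - n))
      else j)"

definition dg_operad :: "'p::real_vector operad \<Rightarrow> bool" where
  "dg_operad P \<longleftrightarrow>
     (let V = (\<lambda>n. comps (arity P n)); d = (\<lambda>n. differential (arity P n)) in
      (\<forall>n. cochain_complex (arity P n)) \<and>
      op_unit P \<in> V 1 0 \<and>
      (\<forall>m n i k l. i < m \<longrightarrow> (\<forall>p\<in>V m k. \<forall>q\<in>V n l.
         circ P m n i p q \<in> V (m + n - 1) (k + l) \<and>
         linear_map_on (V n l) (circ P m n i p) \<and>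
         linear_map_on (V m k) (\<lambda>p. circ P m n i p q) \<and>
         d (m + n - 1) (circ P m n i p q) =
           circ P m n i (d m p) q + ksign k *\<^sub>R circ P m n i p (d n q))) \<and>
      (\<forall>m k. \<forall>p\<in>V m k. circ P 1 m 0 (op_unit P) p = p \<and>
         (\<forall>i<m. circ P m 1 i p (op_unit P) = p)) \<and>
      (\<forall>m n r i j k l h. i < m \<longrightarrow> j < n \<longrightarrow>
         (\<forall>p\<in>V m k. \<forall>q\<in>V n l. \<forall>s\<in>V r h.
            circ P (m + n - 1) r (i + j) (circ P m n i p q) s =
            circ P m (n + r - 1) i p (circ P n r j q s))) \<and>
      (\<forall>m n r i j k l h. i < j \<longrightarrow> j < m \<longrightarrow>
         (\<forall>p\<in>V m k. \<forall>q\<in>V n l. \<forall>s\<in>V r h.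
            circ P (m + n - 1) r i (circ P m n j p q) s =
            ksign (l * h) *\<^sub>R circ P (m + r - 1) n (j + r - 1) (circ P m r i p s) q)) \<and>
      (\<forall>n \<sigma>. \<sigma> permutes {..<n} \<longrightarrow> cochain_map (arity P n) (arity P n) (perm_act P n \<sigma>)) \<and>
      (\<forall>n k. \<forall>p\<in>V n k. perm_act P n id p = p \<and>
         (\<forall>\<sigma> \<tau>. \<sigma> permutes {..<n} \<longrightarrow> \<tau> permutes {..<n} \<longrightarrow>
            perm_act P n (\<sigma> \<circ> \<tau>) p = perm_act P n \<sigma> (perm_act P n \<tau> p))) \<and>
      (\<forall>m n i k l \<sigma> \<tau>. i < m \<longrightarrow> \<sigma> permutes {..<m} \<longrightarrow> \<tau> permutes {..<n} \<longrightarrow>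
         (\<forall>p\<in>V m k. \<forall>q\<in>V n l.
            circ P m n (\<sigma> i) (perm_act P m \<sigma> p) (perm_act P n \<tau> q) =
            perm_act P (m + n - 1) (block_perm m n i \<sigma> \<tau>) (circ P m n i p q))))"

definition operad_morphism ::
  "'p::real_vector operad \<Rightarrow> 'q::real_vector operad \<Rightarrow> (nat \<Rightarrow> 'p \<Rightarrow> 'q) \<Rightarrow> bool" where
  "operad_morphism P Q \<phi> \<longleftrightarrow>
     (\<forall>n. cochain_map (arity P n) (arity Q n) (\<phi> n)) \<and>
     \<phi> 1 (op_unit P) = op_unit Q \<and>
     (\<forall>m n i k l. i < m \<longrightarrow> (\<forall>p\<in>comps (arity P m) k. \<forall>q\<in>comps (arity P n) l.
        \<phi> (m + n - 1) (circ P m n i p q) = circ Q m n i (\<phi> m p) (\<phi> n q))) \<and>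
     (\<forall>n k \<sigma>. \<sigma> permutes {..<n} \<longrightarrow> (\<forall>p\<in>comps (arity P n) k.
        \<phi> n (perm_act P n \<sigma> p) = perm_act Q n \<sigma> (\<phi> n p)))"

definition graded_operad :: "'p::real_vector operad \<Rightarrow> bool" where
  "graded_operad P \<longleftrightarrow> dg_operad P \<and>
     (\<forall>n k. \<forall>p\<in>comps (arity P n) k. differential (arity P n) p = 0)"

definition nonpositively_graded :: "'p::real_vector operad \<Rightarrow> bool" where
  "nonpositively_graded P \<longleftrightarrow> (\<forall>n k. k > 0 \<longrightarrow> comps (arity P n) k = {0})"

definition homogeneous :: "'a cochains \<Rightarrow> int list \<Rightarrow> 'a list \<Rightarrow> bool" where
  "homogeneous A ks xs \<longleftrightarrow> list_all2 (\<lambda>k x. x \<in> comps A k) ks xs"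

text \<open>The Koszul sign of \<open>x\<^sub>0 \<otimes> x\<^sub>1 \<otimes> \<dots> \<mapsto> x\<^bsub>\<sigma> 0\<^esub> \<otimes> x\<^bsub>\<sigma> 1\<^esub> \<otimes> \<dots>\<close> for \<open>x\<^sub>j\<close> of degree \<open>ks ! j\<close>.\<close>

definition koszul_sign :: "(nat \<Rightarrow> nat) \<Rightarrow> int list \<Rightarrow> real" where
  "koszul_sign \<sigma> ks =
     (\<Prod>(i, j) \<in> {(i, j). i < j \<and> j < length ks \<and> \<sigma> i > \<sigma> j}. ksign (ks ! \<sigma> i * ks ! \<sigma> j))"

text \<open>
  An algebra is a cochain complex \<open>A\<close> with an action \<open>\<alpha>\<close>; here \<open>\<alpha> p xs\<close> is the value on \<open>xs\<close> of
  the image of \<open>p\<close> in the endomorphism operad of \<open>A\<close>, the arity of \<open>p\<close> being \<open>length xs\<close>.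
\<close>

type_synonym ('p, 'a) alg = "'a cochains \<times> ('p \<Rightarrow> 'a list \<Rightarrow> 'a)"

definition operad_algebra ::
  "'p::real_vector operad \<Rightarrow> ('p, 'a::real_vector) alg \<Rightarrow> bool" where
  "operad_algebra P = (\<lambda>(A, \<alpha>).
     cochain_complex A \<and>
     (\<forall>n k ks xs. length ks = n \<longrightarrow> homogeneous A ks xs \<longrightarrow>
        linear_map_on (comps (arity P n) k) (\<lambda>p. \<alpha> p xs) \<and>
        (\<forall>p\<in>comps (arity P n) k.
           \<alpha> p xs \<in> comps A (k + sum_list ks) \<and>
           (\<forall>j<n. linear_map_on (comps A (ks ! j)) (\<lambda>x. \<alpha> p (xs[j := x]))) \<and>
           differential A (\<alpha> p xs) =
             \<alpha> (differential (arity P n) p) xs +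
             ksign k *\<^sub>R (\<Sum>j<n. ksign (sum_list (take j ks)) *\<^sub>R
                              \<alpha> p (xs[j := differential A (xs ! j)])) \<and>
           (\<forall>\<sigma>. \<sigma> permutes {..<n} \<longrightarrow>
              \<alpha> (perm_act P n \<sigma> p) xs =
              koszul_sign \<sigma> ks *\<^sub>R \<alpha> p (map (\<lambda>j. xs ! \<sigma> j) [0..<n])))) \<and>
     (\<forall>k. \<forall>x\<in>comps A k. \<alpha> (op_unit P) [x] = x) \<and>
     (\<forall>m n i k l ks xs. i < m \<longrightarrow> length ks = m + n - 1 \<longrightarrow> homogeneous A ks xs \<longrightarrow>
        (\<forall>p\<in>comps (arity P m) k. \<forall>q\<in>comps (arity P n) l.
           \<alpha> (circ P m n i p q) xs =
           ksign (l * sum_list (take i ks)) *\<^sub>R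
           \<alpha> p (take i xs @ \<alpha> q (take n (drop i xs)) # drop (i + n) xs))))"

definition algebra_morphism ::
  "'p::real_vector operad \<Rightarrow> ('p, 'a::real_vector) alg \<Rightarrow> ('p, 'b::real_vector) alg
    \<Rightarrow> ('a \<Rightarrow> 'b) \<Rightarrow> bool" where
  "algebra_morphism P = (\<lambda>(A, \<alpha>) (B, \<beta>) f.
     cochain_map A B f \<and>
     (\<forall>n k ks xs. length ks = n \<longrightarrow> homogeneous A ks xs \<longrightarrow>
        (\<forall>p\<in>comps (arity P n) k. f (\<alpha> p xs) = \<beta> p (map f xs))))"

definition algebra_quasi_iso ::
  "'p::real_vector operad \<Rightarrow> ('p, 'a::real_vector) alg \<Rightarrow> ('p, 'b::real_vector) alg \<Rightarrow> bool" where
  "algebra_quasi_iso P \<A> \<B> \<longleftrightarrow>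
     operad_algebra P \<A> \<and> operad_algebra P \<B> \<and>
     (\<exists>f. algebra_morphism P \<A> \<B> f \<and> quasi_iso_map (fst \<A>) (fst \<B>) f)"

definition zigzag_link ::
  "'p::real_vector operad \<Rightarrow> ('p, 'a::real_vector) alg \<Rightarrow> ('p, 'b::real_vector) alg \<Rightarrow> bool" where
  "zigzag_link P \<A> \<B> \<longleftrightarrow> algebra_quasi_iso P \<A> \<B> \<or> algebra_quasi_iso P \<B> \<A>"

text \<open>
  Since one cannot quantify over types, the type \<open>'u\<close> in which the intermediate algebras of
  the zig-zag live is a parameter.  The smaller \<open>'u\<close>, the stronger the assertion.
\<close>

definition quasi_isomorphic ::
  "'u::real_vector itself \<Rightarrow> 'p::real_vector operad
    \<Rightarrow> ('p, 'a::real_vector) alg \<Rightarrow> ('p, 'b::real_vector) alg \<Rightarrow> bool" where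
  "quasi_isomorphic U P \<A> \<B> \<longleftrightarrow>
     (\<exists>\<C> \<D> :: ('p, 'u) alg.
        zigzag_link P \<A> \<C> \<and> (zigzag_link P)\<^sup>*\<^sup>* \<C> \<D> \<and> zigzag_link P \<D> \<B>)"

definition restrict_scalars ::
  "(nat \<Rightarrow> 'p \<Rightarrow> 'q) \<Rightarrow> ('q, 'a) alg \<Rightarrow> ('p, 'a) alg" where
  "restrict_scalars \<phi> = (\<lambda>(A, \<alpha>). (A, \<lambda>p xs. \<alpha> (\<phi> (length xs) p) xs))"

definition degree0_suboperad :: "'p::real_vector operad \<Rightarrow> 'p operad" where
  "degree0_suboperad P =
     P\<lparr>arity := (\<lambda>n. (arity P n)\<lparr>comps := (\<lambda>k. if k = 0 then comps (arity P n) 0 else {0})\<rparr>)\<rparr>"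

text \<open>
  The retraction of \<open>P\<close> onto its degree \<open>0\<close> suboperad; being of degree \<open>0\<close>, it has to kill
  the components of nonzero degree.
\<close>

definition degree0_retraction :: "'p::real_vector operad \<Rightarrow> nat \<Rightarrow> 'p \<Rightarrow> 'p" where
  "degree0_retraction P n p = (if p \<in> comps (arity (degree0_suboperad P) n) 0 then p else 0)"

text \<open>
  An action of \<open>P\<close> and the underlying action of its degree \<open>0\<close> suboperad are given by the
  same function \<open>\<alpha>\<close>.
\<close>

definition trivial_algebra :: "'p::real_vector operad \<Rightarrow> ('p, 'a) alg \<Rightarrow> ('p, 'a) alg" where
  "trivial_algebra P \<A> = restrict_scalars (degree0_retraction P) \<A>"


section \<open>The exact Batalin--Vilkovisky operad\<close>

text \<open>
  The free DG operad on \<open>\<mu>\<close> and \<open>i\<close>, with \<open>d \<mu> = 0\<close> already imposed, is the free graded operad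
  on \<open>\<mu>\<close>, \<open>i\<close> and \<open>d i\<close> (\<open>Mu\<close>, \<open>Iop\<close>, \<open>DIop\<close>).  Arity \<open>n\<close> has as a basis the planar trees whose leaves
  carry the labels \<open>0, \<dots>, n - 1\<close>, each exactly once.  A tree denotes the tensor product of its
  vertices taken in preorder (the order in which they are read in prefix notation).
\<close>

datatype ebv_tree = Leaf nat | Mu ebv_tree ebv_tree | Iop ebv_tree | DIop ebv_tree

primrec leaves :: "ebv_tree \<Rightarrow> nat list" where
  "leaves (Leaf a) = [a]"
| "leaves (Mu S T) = leaves S @ leaves T"
| "leaves (Iop T) = leaves T"
| "leaves (DIop T) = leaves T"

primrec tree_degree :: "ebv_tree \<Rightarrow> int" where
  "tree_degree (Leaf a) = 0"
| "tree_degree (Mu S T) = tree_degree S + tree_degree T"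
| "tree_degree (Iop T) = tree_degree T - 2"
| "tree_degree (DIop T) = tree_degree T - 1"

definition tree_arity :: "nat \<Rightarrow> ebv_tree \<Rightarrow> bool" where
  "tree_arity n T \<longleftrightarrow> distinct (leaves T) \<and> set (leaves T) = {..<n}"

primrec relabel :: "(nat \<Rightarrow> nat) \<Rightarrow> ebv_tree \<Rightarrow> ebv_tree" where
  "relabel \<sigma> (Leaf a) = Leaf (\<sigma> a)"
| "relabel \<sigma> (Mu S T) = Mu (relabel \<sigma> S) (relabel \<sigma> T)"
| "relabel \<sigma> (Iop T) = Iop (relabel \<sigma> T)"
| "relabel \<sigma> (DIop T) = DIop (relabel \<sigma> T)"

text \<open>\<open>graft n i T S\<close> plugs \<open>S\<close>, of arity \<open>n\<close>, into the leaf of \<open>T\<close> labelled \<open>i\<close>.\<close>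

primrec graft :: "nat \<Rightarrow> nat \<Rightarrow> ebv_tree \<Rightarrow> ebv_tree \<Rightarrow> ebv_tree" where
  "graft n i (Leaf a) U =
     (if a < i then Leaf a else if a = i then relabel (\<lambda>b. i + b) U else Leaf (a + n - 1))"
| "graft n i (Mu S T) U = Mu (graft n i S U) (graft n i T U)"
| "graft n i (Iop T) U = Iop (graft n i T U)"
| "graft n i (DIop T) U = DIop (graft n i T U)"

text \<open>
  The total degree, modulo \<open>2\<close>, of the vertices of a tree following leaf \<open>i\<close> in preorder:
  grafting \<open>U\<close> at leaf \<open>i\<close> moves the vertices of \<open>U\<close> past them.
\<close>

primrec degree_after :: "nat \<Rightarrow> ebv_tree \<Rightarrow> int" where
  "degree_after i (Leaf a) = 0"
| "degree_after i (Mu S T) =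
     (if i \<in> set (leaves S) then degree_after i S + tree_degree T else degree_after i T)"
| "degree_after i (Iop T) = degree_after i T"
| "degree_after i (DIop T) = degree_after i T"

primrec tree_diff :: "ebv_tree \<Rightarrow> (real \<times> ebv_tree) list" where
  "tree_diff (Leaf a) = []"
| "tree_diff (Mu S T) =
     map (\<lambda>(c, U). (c, Mu U T)) (tree_diff S) @
     map (\<lambda>(c, U). (ksign (tree_degree S) * c, Mu S U)) (tree_diff T)"
| "tree_diff (Iop T) = (1, DIop T) # map (\<lambda>(c, U). (c, Iop U)) (tree_diff T)"
| "tree_diff (DIop T) = map (\<lambda>(c, U). (- c, DIop U)) (tree_diff T)"

abbreviation tree :: "ebv_tree \<Rightarrow> (ebv_tree \<Rightarrow>\<^sub>0 real)" where
  "tree T \<equiv> Poly_Mapping.single T 1"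

definition lin_ext :: "('a \<Rightarrow> 'b::real_vector) \<Rightarrow> ('a \<Rightarrow>\<^sub>0 real) \<Rightarrow> 'b" where
  "lin_ext f x = (\<Sum>t\<in>Poly_Mapping.keys x. Poly_Mapping.lookup x t *\<^sub>R f t)"

definition free_circ ::
  "nat \<Rightarrow> nat \<Rightarrow> nat \<Rightarrow> (ebv_tree \<Rightarrow>\<^sub>0 real) \<Rightarrow> (ebv_tree \<Rightarrow>\<^sub>0 real) \<Rightarrow> (ebv_tree \<Rightarrow>\<^sub>0 real)" where
  "free_circ m n i x y = lin_ext (\<lambda>T. lin_ext (\<lambda>U.
     if i < m \<and> tree_arity m T \<and> tree_arity n U
     then ksign (tree_degree U * degree_after i T) *\<^sub>R tree (graft n i T U) else 0) y) x"

definition free_perm_act :: "nat \<Rightarrow> (nat \<Rightarrow> nat) \<Rightarrow> (ebv_tree \<Rightarrow>\<^sub>0 real) \<Rightarrow> (ebv_tree \<Rightarrow>\<^sub>0 real)" where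
  "free_perm_act n \<sigma> x = lin_ext (\<lambda>T.
     if \<sigma> permutes {..<n} \<and> tree_arity n T then tree (relabel \<sigma> T) else 0) x"

definition free_diff :: "(ebv_tree \<Rightarrow>\<^sub>0 real) \<Rightarrow> (ebv_tree \<Rightarrow>\<^sub>0 real)" where
  "free_diff x = lin_ext (\<lambda>T. \<Sum>(c, U) \<leftarrow> tree_diff T. c *\<^sub>R tree U) x"

definition ebv_relations :: "(ebv_tree \<Rightarrow>\<^sub>0 real) set" where
  "ebv_relations =
     {tree (Mu (Leaf 0) (Leaf 1)) - tree (Mu (Leaf 1) (Leaf 0)),
      tree (Mu (Mu (Leaf 0) (Leaf 1)) (Leaf 2)) - tree (Mu (Leaf 0) (Mu (Leaf 1) (Leaf 2))),
      tree (Iop (DIop (Leaf 0))) - tree (DIop (Iop (Leaf 0))),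
      tree (Iop (Mu (Mu (Leaf 0) (Leaf 1)) (Leaf 2)))
        - (tree (Mu (Iop (Mu (Leaf 0) (Leaf 1))) (Leaf 2))
         + tree (Mu (Iop (Mu (Leaf 0) (Leaf 2))) (Leaf 1))
         + tree (Mu (Iop (Mu (Leaf 1) (Leaf 2))) (Leaf 0))
         - tree (Mu (Mu (Iop (Leaf 0)) (Leaf 1)) (Leaf 2))
         - tree (Mu (Mu (Iop (Leaf 1)) (Leaf 0)) (Leaf 2))
         - tree (Mu (Mu (Iop (Leaf 2)) (Leaf 0)) (Leaf 1)))}"

inductive_set ebv_ideal :: "(ebv_tree \<Rightarrow>\<^sub>0 real) set" where
  relation: "x \<in> ebv_relations \<Longrightarrow> x \<in> ebv_ideal"
| zero: "0 \<in> ebv_ideal"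
| add: "x \<in> ebv_ideal \<Longrightarrow> y \<in> ebv_ideal \<Longrightarrow> x + y \<in> ebv_ideal"
| scale: "x \<in> ebv_ideal \<Longrightarrow> c *\<^sub>R x \<in> ebv_ideal"
| circ_left: "x \<in> ebv_ideal \<Longrightarrow> free_circ m n i x y \<in> ebv_ideal"
| circ_right: "x \<in> ebv_ideal \<Longrightarrow> free_circ m n i y x \<in> ebv_ideal"
| perm_act: "x \<in> ebv_ideal \<Longrightarrow> free_perm_act n \<sigma> x \<in> ebv_ideal"
| diff: "x \<in> ebv_ideal \<Longrightarrow> free_diff x \<in> ebv_ideal"

lemma ebv_ideal_uminus: "x \<in> ebv_ideal \<Longrightarrow> - x \<in> ebv_ideal"
  using ebv_ideal.scale[of x "-1"] by simp

lemma ebv_ideal_minus: "x \<in> ebv_ideal \<Longrightarrow> y \<in> ebv_ideal \<Longrightarrow> x - y \<in> ebv_ideal"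
  using ebv_ideal.add[of x "- y"] ebv_ideal_uminus[of y] by simp

lemma lin_ext_superset:
  assumes "finite K" "Poly_Mapping.keys x \<subseteq> K"
  shows "lin_ext f x = (\<Sum>t\<in>K. Poly_Mapping.lookup x t *\<^sub>R f t)"
  unfolding lin_ext_def using assms
  by (intro sum.mono_neutral_left) (auto simp: in_keys_iff)

lemma lin_ext_minus: "lin_ext f (x - y) = lin_ext f x - lin_ext f y"
proof -
  let ?K = "Poly_Mapping.keys x \<union> Poly_Mapping.keys y"
  have "Poly_Mapping.keys (x - y) \<subseteq> ?K"
    by (auto simp: in_keys_iff lookup_minus)
  then show ?thesis
    by (simp add: lin_ext_superset[of ?K] lookup_minus scaleR_diff_left sum_subtractf)
qed

lemma lin_ext_fun_minus: "lin_ext (\<lambda>t. f t - g t) x = lin_ext f x - lin_ext g x"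
  by (simp add: lin_ext_def scaleR_diff_right sum_subtractf)

lemma free_circ_minus_left: "free_circ m n i (x - x') y = free_circ m n i x y - free_circ m n i x' y"
  by (simp add: free_circ_def lin_ext_minus)

lemma free_circ_minus_right: "free_circ m n i x (y - y') = free_circ m n i x y - free_circ m n i x y'"
  by (simp add: free_circ_def lin_ext_minus lin_ext_fun_minus)

lemma free_perm_act_minus: "free_perm_act n \<sigma> (x - y) = free_perm_act n \<sigma> x - free_perm_act n \<sigma> y"
  by (simp add: free_perm_act_def lin_ext_minus)

lemma free_diff_minus: "free_diff (x - y) = free_diff x - free_diff y"
  by (simp add: free_diff_def lin_ext_minus)

lemma ebv_congruence_equivp: "equivp (\<lambda>x y. x - y \<in> ebv_ideal)"
proof (rule equivpI)
  show "reflp (\<lambda>x y. x - y \<in> ebv_ideal)"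
    by (rule reflpI) (simp only: diff_self ebv_ideal.zero)
  show "symp (\<lambda>x y. x - y \<in> ebv_ideal)"
  proof (rule sympI)
    fix x y
    assume "x - y \<in> ebv_ideal"
    then have "- (x - y) \<in> ebv_ideal"
      by (rule ebv_ideal_uminus)
    then show "y - x \<in> ebv_ideal"
      by (simp only: minus_diff_eq)
  qed
  show "transp (\<lambda>x y. x - y \<in> ebv_ideal)"
  proof (rule transpI)
    fix x y z
    assume "x - y \<in> ebv_ideal" "y - z \<in> ebv_ideal"
    then have "(x - y) + (y - z) \<in> ebv_ideal"
      by (rule ebv_ideal.add)
    moreover have "(x - y) + (y - z) = x - z"
      by simp
    ultimately show "x - z \<in> ebv_ideal"
      by (simp only:)
  qed
qed

quotient_type ebv = "ebv_tree \<Rightarrow>\<^sub>0 real" / "\<lambda>x y. x - y \<in> ebv_ideal"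
  by (rule ebv_congruence_equivp)

instantiation ebv :: real_vector
begin

lift_definition zero_ebv :: ebv is 0 .

lift_definition plus_ebv :: "ebv \<Rightarrow> ebv \<Rightarrow> ebv" is "(+)"
  by (simp only: add_diff_add ebv_ideal.add)

lift_definition uminus_ebv :: "ebv \<Rightarrow> ebv" is uminus
  by (simp only: minus_diff_minus ebv_ideal_uminus)

lift_definition minus_ebv :: "ebv \<Rightarrow> ebv \<Rightarrow> ebv" is "(-)"
proof -
  fix x x' y y'
  assume "x - x' \<in> ebv_ideal" "y - y' \<in> ebv_ideal"
  then have "(x - x') - (y - y') \<in> ebv_ideal"
    by (rule ebv_ideal_minus)
  moreover have "(x - x') - (y - y') = (x - y) - (x' - y')"
    by simp
  ultimately show "(x - y) - (x' - y') \<in> ebv_ideal"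
    by (simp only:)
qed

lift_definition scaleR_ebv :: "real \<Rightarrow> ebv \<Rightarrow> ebv" is "(*\<^sub>R)"
  by (simp only: scaleR_diff_right[symmetric] ebv_ideal.scale)

instance
  by standard (transfer, simp add: ebv_ideal.zero algebra_simps)+

end

lift_definition ebv_circ :: "nat \<Rightarrow> nat \<Rightarrow> nat \<Rightarrow> ebv \<Rightarrow> ebv \<Rightarrow> ebv" is free_circ
proof -
  fix m n i x x' y y'
  assume "x - x' \<in> ebv_ideal" "y - y' \<in> ebv_ideal"
  then have "free_circ m n i (x - x') y + free_circ m n i x' (y - y') \<in> ebv_ideal"
    by (intro ebv_ideal.add ebv_ideal.circ_left ebv_ideal.circ_right)
  then show "free_circ m n i x y - free_circ m n i x' y' \<in> ebv_ideal"
    by (simp add: free_circ_minus_left free_circ_minus_right)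
qed

lift_definition ebv_perm_act :: "nat \<Rightarrow> (nat \<Rightarrow> nat) \<Rightarrow> ebv \<Rightarrow> ebv" is free_perm_act
  by (metis ebv_ideal.perm_act free_perm_act_minus)

lift_definition ebv_diff :: "ebv \<Rightarrow> ebv" is free_diff
  by (metis ebv_ideal.diff free_diff_minus)

definition ebv_operad :: "ebv operad" where
  "ebv_operad = \<lparr>
     arity = (\<lambda>n. \<lparr>
       comps = (\<lambda>k. abs_ebv ` {x. \<forall>T\<in>Poly_Mapping.keys x. tree_arity n T \<and> tree_degree T = k}),
       differential = ebv_diff\<rparr>),
     op_unit = abs_ebv (tree (Leaf 0)),
     circ = ebv_circ,
     perm_act = ebv_perm_act\<rparr>"

definition ebv_mu :: ebv where
  "ebv_mu = abs_ebv (tree (Mu (Leaf 0) (Leaf 1)))"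

definition ebv_i :: ebv where
  "ebv_i = abs_ebv (tree (Iop (Leaf 0)))"

text \<open>
  The \<open>EBV\<close>-algebra structures on a complex whose product is \<open>prd\<close> and whose operator is \<open>i\<close>;
  there is at most one up to values at non-homogeneous arguments.
\<close>

definition is_ebv_structure ::
  "'a::real_vector cochains \<Rightarrow> ('a \<Rightarrow> 'a \<Rightarrow> 'a) \<Rightarrow> ('a \<Rightarrow> 'a) \<Rightarrow> (ebv \<Rightarrow> 'a list \<Rightarrow> 'a) \<Rightarrow> bool" where
  "is_ebv_structure A prd i \<theta> \<longleftrightarrow>
     operad_algebra ebv_operad (A, \<theta>) \<and>
     (\<forall>k l. \<forall>x\<in>comps A k. \<forall>y\<in>comps A l. \<theta> ebv_mu [x, y] = prd x y) \<and>
     (\<forall>k. \<forall>x\<in>comps A k. \<theta> ebv_i [x] = i x)"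


section \<open>Smooth manifolds\<close>

text \<open>
  The model space is a linear subspace \<open>E\<close> of a Euclidean space, so that the dimension
  \<open>dim E\<close> may be any natural number, including \<open>0\<close>.
\<close>

primrec continuously_diff_on ::
  "nat \<Rightarrow> 'a::euclidean_space set \<Rightarrow> 'a set \<Rightarrow> ('a \<Rightarrow> 'b::real_normed_vector) \<Rightarrow> bool" where
  "continuously_diff_on 0 E W f \<longleftrightarrow> continuous_on W f"
| "continuously_diff_on (Suc r) E W f \<longleftrightarrow>
     (\<forall>x\<in>W. f differentiable (at x within E)) \<and>
     (\<forall>v\<in>E. continuously_diff_on r E W (\<lambda>x. frechet_derivative f (at x within E) v))"

text \<open>\<open>W\<close> is meant to be open in the linear subspace \<open>E\<close>.\<close>

definition smooth_on ::
  "'a::euclidean_space set \<Rightarrow> 'a set \<Rightarrow> ('a \<Rightarrow> 'b::real_normed_vector) \<Rightarrow> bool" where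
  "smooth_on E W f \<longleftrightarrow> (\<forall>r. continuously_diff_on r E W f)"

record ('m, 'e) manifold =
  mtop :: "'m topology"
  model :: "'e set"
  atlas :: "('m set \<times> ('m \<Rightarrow> 'e)) set"

definition smooth_manifold :: "('m, 'e::euclidean_space) manifold \<Rightarrow> bool" where
  "smooth_manifold M \<longleftrightarrow>
     Hausdorff_space (mtop M) \<and> second_countable (mtop M) \<and> subspace (model M) \<and>
     (\<Union>(U, \<phi>)\<in>atlas M. U) = topspace (mtop M) \<and>
     (\<forall>(U, \<phi>)\<in>atlas M. openin (mtop M) U \<and>
        openin (top_of_set (model M)) (\<phi> ` U) \<and>
        homeomorphic_map (subtopology (mtop M) U) (top_of_set (\<phi> ` U)) \<phi>) \<and>
     (\<forall>(U, \<phi>)\<in>atlas M. \<forall>(V, \<psi>)\<in>atlas M.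
        smooth_on (model M) (\<phi> ` (U \<inter> V)) (\<psi> \<circ> inv_into U \<phi>))"

text \<open>
  Functions, tangent vectors, multivector fields and forms are extended by \<open>0\<close> outside of their
  proper domains, so that equality of functions is the right notion of equality for them.
\<close>

definition smooth_functions :: "('m, 'e::euclidean_space) manifold \<Rightarrow> ('m \<Rightarrow> real) set" where
  "smooth_functions M = {f.
     (\<forall>p. p \<notin> topspace (mtop M) \<longrightarrow> f p = 0) \<and>
     (\<forall>(U, \<phi>)\<in>atlas M. smooth_on (model M) (\<phi> ` U) (f \<circ> inv_into U \<phi>))}"

type_synonym 'm tvec = "('m \<Rightarrow> real) \<Rightarrow> real"

definition tangent_space :: "('m, 'e::euclidean_space) manifold \<Rightarrow> 'm \<Rightarrow> 'm tvec set" where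
  "tangent_space M p = {v.
     linear_map_on (smooth_functions M) v \<and>
     (\<forall>f\<in>smooth_functions M. \<forall>g\<in>smooth_functions M.
        v (\<lambda>q. f q * g q) = f p * v g + g p * v f) \<and>
     (\<forall>f. f \<notin> smooth_functions M \<longrightarrow> v f = 0)}"

definition vector_fields :: "('m, 'e::euclidean_space) manifold \<Rightarrow> ('m \<Rightarrow> 'm tvec) set" where
  "vector_fields M = {X.
     (\<forall>p\<in>topspace (mtop M). X p \<in> tangent_space M p) \<and>
     (\<forall>p. p \<notin> topspace (mtop M) \<longrightarrow> X p = 0) \<and>
     (\<forall>f\<in>smooth_functions M. (\<lambda>p. X p f) \<in> smooth_functions M)}"

definition lie_bracket :: "('m \<Rightarrow> 'm tvec) \<Rightarrow> ('m \<Rightarrow> 'm tvec) \<Rightarrow> 'm \<Rightarrow> 'm tvec" where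
  "lie_bracket X Y = (\<lambda>p f. X p (\<lambda>q. Y q f) - Y p (\<lambda>q. X q f))"

text \<open>The sign of the permutation listing first \<open>S\<close> and then \<open>{..<n} - S\<close>, both increasingly.\<close>

definition shuffle_sign :: "nat \<Rightarrow> nat set \<Rightarrow> real" where
  "shuffle_sign n S = (-1) ^ card {(i, j). i \<in> S \<and> j \<in> {..<n} - S \<and> j < i}"


section \<open>Multivector fields and Poisson structures\<close>

text \<open>
  Elements of \<open>\<Lambda>\<^sup>k T\<^sub>pM\<close> are identified with the skew-symmetric \<open>k\<close>-linear functions
  \<open>(f\<^sub>1, \<dots>, f\<^sub>k) \<mapsto> \<langle>P, df\<^sub>1 \<and> \<dots> \<and> df\<^sub>k\<rangle>\<close> of smooth functions.
\<close>

type_synonym 'm multivec = "('m \<Rightarrow> real) list \<Rightarrow> real"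

definition decomposable :: "'m tvec list \<Rightarrow> 'm multivec" where
  "decomposable us = (\<lambda>fs.
     if length fs = length us
     then \<Sum>\<sigma> | \<sigma> permutes {..<length us}.
            of_int (sign \<sigma>) * (\<Prod>j<length us. (us ! j) (fs ! \<sigma> j))
     else 0)"

definition multivectors ::
  "('m, 'e::euclidean_space) manifold \<Rightarrow> nat \<Rightarrow> 'm \<Rightarrow> 'm multivec set" where
  "multivectors M k p =
     span (decomposable ` {us. length us = k \<and> set us \<subseteq> tangent_space M p})"

definition multivector_fields ::
  "('m, 'e::euclidean_space) manifold \<Rightarrow> nat \<Rightarrow> ('m \<Rightarrow> 'm multivec) set" where
  "multivector_fields M k = {P.
     (\<forall>p\<in>topspace (mtop M). P p \<in> multivectors M k p) \<and>
     (\<forall>p. p \<notin> topspace (mtop M) \<longrightarrow> P p = 0) \<and>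
     (\<forall>fs. length fs = k \<longrightarrow> set fs \<subseteq> smooth_functions M \<longrightarrow>
        (\<lambda>p. P p fs) \<in> smooth_functions M)}"

text \<open>
  The Schouten--Nijenhuis bracket of an \<open>a\<close>-vector field \<open>P\<close> and a \<open>b\<close>-vector field \<open>Q\<close>,
  evaluated on functions:
  \<open>\<Sum>\<^sub>\<sigma> sgn \<sigma> P(Q(f\<^bsub>\<sigma> 1\<^esub>, \<dots>, f\<^bsub>\<sigma> b\<^esub>), f\<^bsub>\<sigma> (b+1)\<^esub>, \<dots>)
   - (-1)\<^bsup>(a-1)(b-1)\<^esup> \<Sum>\<^sub>\<sigma> sgn \<sigma> Q(P(f\<^bsub>\<sigma> 1\<^esub>, \<dots>, f\<^bsub>\<sigma> a\<^esub>), f\<^bsub>\<sigma> (a+1)\<^esub>, \<dots>)\<close>,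
  the sums being over \<open>(b, a-1)\<close>- and \<open>(a, b-1)\<close>-shuffles.
\<close>

definition schouten_bracket ::
  "nat \<Rightarrow> nat \<Rightarrow> ('m \<Rightarrow> 'm multivec) \<Rightarrow> ('m \<Rightarrow> 'm multivec) \<Rightarrow> 'm \<Rightarrow> 'm multivec" where
  "schouten_bracket a b P Q = (\<lambda>p fs.
     if length fs = a + b - 1
     then (\<Sum>S | S \<subseteq> {..<a + b - 1} \<and> card S = b. shuffle_sign (a + b - 1) S *
             P p ((\<lambda>q. Q q (nths fs S)) # nths fs (- S)))
        - ksign ((int a - 1) * (int b - 1)) *
          (\<Sum>S | S \<subseteq> {..<a + b - 1} \<and> card S = a. shuffle_sign (a + b - 1) S *
             Q p ((\<lambda>q. P q (nths fs S)) # nths fs (- S)))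
     else 0)"

definition poisson_manifold ::
  "('m, 'e::euclidean_space) manifold \<Rightarrow> ('m \<Rightarrow> 'm multivec) \<Rightarrow> bool" where
  "poisson_manifold M \<pi> \<longleftrightarrow>
     smooth_manifold M \<and> \<pi> \<in> multivector_fields M 2 \<and> schouten_bracket 2 2 \<pi> \<pi> = 0"


section \<open>The de Rham complex\<close>

text \<open>
  An (inhomogeneous) form assigns to a point and a list of tangent vectors at it a number;
  a \<open>k\<close>-form vanishes on lists of length other than \<open>k\<close>.
\<close>

type_synonym 'm form = "'m \<Rightarrow> 'm tvec list \<Rightarrow> real"

definition forms :: "('m, 'e::euclidean_space) manifold \<Rightarrow> nat \<Rightarrow> 'm form set" where
  "forms M k = {\<omega>.
     (\<forall>p vs. \<not> (p \<in> topspace (mtop M) \<and> length vs = k \<and> set vs \<subseteq> tangent_space M p)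
        \<longrightarrow> \<omega> p vs = 0) \<and>
     (\<forall>p\<in>topspace (mtop M). \<forall>vs. length vs = k \<longrightarrow> set vs \<subseteq> tangent_space M p \<longrightarrow>
        (\<forall>j<k. linear_map_on (tangent_space M p) (\<lambda>v. \<omega> p (vs[j := v]))) \<and>
        (\<forall>i<k. \<forall>j<k. i \<noteq> j \<longrightarrow> vs ! i = vs ! j \<longrightarrow> \<omega> p vs = 0)) \<and>
     (\<forall>Xs. length Xs = k \<longrightarrow> set Xs \<subseteq> vector_fields M \<longrightarrow>
        (\<lambda>p. \<omega> p (map (\<lambda>X. X p) Xs)) \<in> smooth_functions M)}"

definition wedge :: "'m form \<Rightarrow> 'm form \<Rightarrow> 'm form" where
  "wedge \<omega> \<eta> = (\<lambda>p vs. \<Sum>S\<in>Pow {..<length vs}.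
     shuffle_sign (length vs) S * \<omega> p (nths vs S) * \<eta> p (nths vs (- S)))"

text \<open>
  The invariant formula for \<open>d\<omega>(X\<^sub>0, \<dots>, X\<^bsub>n-1\<^esub>)\<close>.  Its value at \<open>p\<close> depends only on the values
  of the \<open>X\<^sub>i\<close> at \<open>p\<close>, hence the choice of extending vector fields in \<open>ext_deriv\<close> is immaterial.
\<close>

definition ext_deriv_fields :: "'m form \<Rightarrow> ('m \<Rightarrow> 'm tvec) list \<Rightarrow> 'm \<Rightarrow> real" where
  "ext_deriv_fields \<omega> Xs p =
     (\<Sum>i<length Xs. (-1) ^ i * (Xs ! i) p (\<lambda>q. \<omega> q (map (\<lambda>X. X q) (nths Xs (- {i}))))) +
     (\<Sum>(i, j) \<in> {(i, j). i < j \<and> j < length Xs}. (-1) ^ (i + j) *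
        \<omega> p (map (\<lambda>X. X p) (lie_bracket (Xs ! i) (Xs ! j) # nths Xs (- {i, j}))))"

definition ext_deriv :: "('m, 'e::euclidean_space) manifold \<Rightarrow> 'm form \<Rightarrow> 'm form" where
  "ext_deriv M \<omega> = (\<lambda>p vs.
     if p \<in> topspace (mtop M) \<and> set vs \<subseteq> tangent_space M p
     then ext_deriv_fields \<omega>
            (SOME Xs. set Xs \<subseteq> vector_fields M \<and> map (\<lambda>X. X p) Xs = vs) p
     else 0)"

definition de_rham :: "('m, 'e::euclidean_space) manifold \<Rightarrow> 'm form cochains" where
  "de_rham M = \<lparr>comps = (\<lambda>k. if k < 0 then {0} else forms M (nat k)), differential = ext_deriv M\<rparr>"

text \<open>
  If \<open>\<pi>\<^sub>p = \<Sum> u \<and> w\<close> then \<open>i\<^sub>\<pi> \<omega>\<close> at \<open>p\<close> is \<open>\<Sum> \<omega>\<^sub>p(u, w, \<dots>)\<close>, whichever decomposition is chosen.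
\<close>

definition interior_product ::
  "('m, 'e::euclidean_space) manifold \<Rightarrow> ('m \<Rightarrow> 'm multivec) \<Rightarrow> 'm form \<Rightarrow> 'm form" where
  "interior_product M \<pi> \<omega> = (\<lambda>p vs.
     let ds = (SOME ds. set ds \<subseteq> tangent_space M p \<times> tangent_space M p \<and>
                        \<pi> p = (\<Sum>(u, w) \<leftarrow> ds. decomposable [u, w]))
     in \<Sum>(u, w) \<leftarrow> ds. \<omega> p (u # w # vs))"

end

theory Submission
  imports Defs
begin

text \<open>
  The path object \<open>A[t, dt]\<close> of \<open>A = \<Omega>(M)\<close>, with the operator \<open>t i\<close>, is again an algebra over the exact
  BV operad: \<open>t i\<close> has order two, and \<open>[t i, d]\<close> commutes with \<open>t i\<close> as soon as \<open>[i, d]\<close> commutes with \<open>i\<close>.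
  Evaluation at \<open>t = 1\<close> and at \<open>t = 0\<close> are morphisms to \<open>A\<close> with the operator \<open>i\<close> and to \<open>A\<close> with the zero
  operator, and both are quasi-isomorphisms by integration over the interval
  (\<open>path_ebv_data\<close>, \<open>at_one_quasi_iso\<close>, \<open>at_zero_quasi_iso\<close>).  Restricting along the given morphism joins the action to
  the one in which every operation of negative degree acts by zero (\<open>theta_degree_0\<close>): the trivial action.
  Since the given operad has neither a differential nor positive degrees, the retraction to degree zero is a
  morphism (\<open>degree0_retraction_morphism\<close>), and the zig-zag consists of algebras over it.

  Two things are needed to apply this.  First, algebras over the operad given by trees modulo relations have to be
  the same as products with an operator (\<open>theta_is_ebv_structure\<close>, \<open>ebv_structure_unique\<close>).
  Trees are evaluated with explicit Koszul signs; evaluation is compatible with relabelling, grafting and the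
  differential, hence kills the ideal of relations.
  Second, \<open>i\<^sub>\<pi>\<close> has to have order two and to satisfy \<open>[i\<^sub>\<pi>, [i\<^sub>\<pi>, d]] = 0\<close> (\<open>interior_product_koszul\<close>).  The
  commutator of \<open>i\<^sub>\<pi>\<close> with \<open>df \<and>\<close> is the contraction with the Hamiltonian field of \<open>f\<close>, along which \<open>i\<^sub>\<pi>\<close> is
  invariant by the Jacobi identity.  So \<open>[i\<^sub>\<pi>, [i\<^sub>\<pi>, d]]\<close> (anti)commutes with functions and their differentials,
  and such an operator is zero if it vanishes on functions (\<open>operator_vanishes\<close>).
\<close>

notation scaleR (infixr "*r" 75)

section \<open>Linear maps\<close>

lemma linear_onD:
 assumes "linear_map_on W f"
 shows "x \<in> W ==> y \<in> W ==> f (x + y) = f x + f y" "x \<in> W ==> f (c *r x) = c *r f x"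
 using assms by (auto simp: linear_map_on_def)

lemma linear_on_diff:
 assumes "subspace W" "linear_map_on W f" "x \<in> W" "y \<in> W"
 shows "f (x - y) = f x - f y"
 using linear_onD(1)[OF assms(2,3), of "(-1) *r y"] linear_onD(2)[OF assms(2,4), of "-1"]
  subspace_scale[OF assms(1,4), of "-1"] by simp

lemma linear_on_0: "subspace W ==> linear_map_on W f ==> f 0 = 0"
 using linear_onD(2)[OF _ subspace_0, of W f 0] by simp

lemma linear_on_sum:
 assumes "subspace W" "linear_map_on W f" "!!b. b \<in> B ==> v b \<in> W"
 shows "f (\<Sum>b\<in>B. c b *r v b) = (\<Sum>b\<in>B. c b *r f (v b))"
 using assms(3)
proof (induction B rule: infinite_finite_induct)
 case (insert b B)
 have "(\<Sum>b\<in>B. c b *r v b) \<in> W" "c b *r v b \<in> W"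
  using insert.prems assms(1) by (auto intro!: subspace_sum subspace_scale)
 with insert show ?case
  using linear_onD[OF assms(2)] by simp
qed (use linear_on_0[OF assms(1,2)] in auto)

section \<open>Signs\<close>

lemma ksign_add: "ksign (a + b) = ksign a * ksign b"
 and ksign_0 [simp]: "ksign 0 = 1"
 and ksign_1 [simp]: "ksign 1 = -1"
 and ksign_minus [simp]: "ksign (- a) = ksign a"
 and ksign_square [simp]: "ksign a * ksign a = 1"
 and ksign_square_left [simp]: "ksign a * (ksign a * c) = c"
 by (auto simp: ksign_def)

lemma ksign_eqI: "even (a - b) ==> ksign a = ksign b"
 by (auto simp: ksign_def)

lemma ksign_sum: "finite I ==> ksign (\<Sum>i\<in>I. f i) = (\<Prod>i\<in>I. ksign (f i))"
 by (induction I rule: finite_induct) (auto simp: ksign_add)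

section \<open>Algebras with an operator of order two\<close>

text \<open>
  What an algebra has to satisfy for the four defining relations of the operad to hold.  The last axiom is
  \<open>[i, [i, d]] = 0\<close> written out.  In each term of the order two axiom the arguments stand in the order of
  the leaves of the corresponding tree of the relation, which accounts for the signs.
\<close>
locale ebv_data =
 fixes A :: "'a::real_vector cochains" and prd :: "'a => 'a => 'a" and iop :: "'a => 'a"
 assumes cc: "cochain_complex A"
  and prd_comp: "!!k l x y. x \<in> comps A k ==> y \<in> comps A l ==> prd x y \<in> comps A (k + l)"
  and prd_linear_left: "!!k l y. y \<in> comps A l ==> linear_map_on (comps A k) (%x. prd x y)"
  and prd_linear_right: "!!k l x. x \<in> comps A k ==> linear_map_on (comps A l) (prd x)"
  and prd_assoc: "!!k l m x y z. x \<in> comps A k ==> y \<in> comps A l ==> z \<in> comps A m ==>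
   prd (prd x y) z = prd x (prd y z)"
  and prd_commute: "!!k l x y. x \<in> comps A k ==> y \<in> comps A l ==> prd x y = ksign (k * l) *r prd y x"
  and leibniz: "!!k l x y. x \<in> comps A k ==> y \<in> comps A l ==>
   differential A (prd x y) = prd (differential A x) y + ksign k *r prd x (differential A y)"
  and iop_comp: "!!k x. x \<in> comps A k ==> iop x \<in> comps A (k - 2)"
  and iop_linear: "!!k. linear_map_on (comps A k) iop"
  and iop_second_order: "!!k l m x y z. x \<in> comps A k ==> y \<in> comps A l ==> z \<in> comps A m ==>
   iop (prd (prd x y) z) = prd (iop (prd x y)) z + ksign (l * m) *r prd (iop (prd x z)) y
    + ksign (k * l + k * m) *r prd (iop (prd y z)) x - prd (prd (iop x) y) z
    - ksign (k * l) *r prd (prd (iop y) x) z - ksign (k * m + l * m) *r prd (prd (iop z) x) y"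
  and iop_koszul: "!!k x. x \<in> comps A k ==>
   iop (iop (differential A x)) - 2 *r iop (differential A (iop x)) + differential A (iop (iop x)) = 0"
begin

abbreviation "V \<equiv> comps A"
abbreviation "dA \<equiv> differential A"

lemma V_subspace: "subspace (V k)"
 and V_direct: "finite K ==> (!!k. k \<in> K ==> x k \<in> V k) ==> (\<Sum>k\<in>K. x k) = 0 ==> k \<in> K ==> x k = 0"
 using cc unfolding cochain_complex_def graded_space_def by blast+

lemma dA_linear: "linear_map_on (V k) dA"
 and dA_comp: "x \<in> V k ==> dA x \<in> V (k + 1)"
 and dA_dA: "x \<in> V k ==> dA (dA x) = 0"
 using cc unfolding cochain_complex_def by blast+

lemma degree_unique:
 assumes "x \<in> V k" "x \<in> V l" "x \<noteq> 0" shows "k = l"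
proof (rule ccontr)
 assume "k \<noteq> l"
 then have "(if k = k then x else - x) = 0"
  using assms(1,2) subspace_neg[OF V_subspace]
  by (intro V_direct[of "{k, l}" "%j. if j = k then x else - x" k]) auto
 then show False using assms(3) by simp
qed

definition di :: "'a => 'a" where "di x = dA (iop x) - iop (dA x)"

lemma di_comp: "x \<in> V k ==> di x \<in> V (k - 1)"
 unfolding di_def using dA_comp[OF iop_comp, of x k] iop_comp[OF dA_comp, of x k]
 by (intro subspace_diff[OF V_subspace]) (simp_all add: algebra_simps)

lemma di_linear: "linear_map_on (V k) di"
 unfolding di_def linear_map_on_def
 by (auto simp: linear_onD[OF iop_linear] linear_onD[OF dA_linear] iop_comp dA_comp
   linear_onD[OF dA_linear iop_comp] linear_onD[OF iop_linear dA_comp] scaleR_diff_right)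

lemma iop_di: "x \<in> V k ==> iop (di x) = di (iop x)"
proof -
 assume x: "x \<in> V k"
 have "dA (iop x) \<in> V (k - 1)" "iop (dA x) \<in> V (k - 1)"
  using dA_comp[OF iop_comp[OF x]] iop_comp[OF dA_comp[OF x]] by (simp_all add: algebra_simps)
 then have "iop (di x) = iop (dA (iop x)) - iop (iop (dA x))"
  unfolding di_def by (rule linear_on_diff[OF V_subspace iop_linear])
 moreover have "dA (iop (iop x)) = 2 *r iop (dA (iop x)) - iop (iop (dA x))"
  using iop_koszul[OF x] by (simp add: algebra_simps)
 ultimately show ?thesis by (simp add: di_def scaleR_2)
qed

lemma dA_iop: "dA (iop x) = di x + iop (dA x)"
 by (simp add: di_def)

lemma dA_di: "x \<in> V k ==> dA (di x) = - di (dA x)"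
proof -
 assume x: "x \<in> V k"
 have "dA (iop x) \<in> V (k - 1)" "iop (dA x) \<in> V (k - 1)"
  using dA_comp[OF iop_comp[OF x]] iop_comp[OF dA_comp[OF x]] by (simp_all add: algebra_simps)
 then have "dA (di x) = dA (dA (iop x)) - dA (iop (dA x))"
  unfolding di_def by (rule linear_on_diff[OF V_subspace dA_linear])
 then show ?thesis
  by (simp add: dA_dA[OF iop_comp[OF x]] di_def dA_dA[OF x] linear_on_0[OF V_subspace iop_linear])
qed

section \<open>Evaluation of trees\<close>

abbreviation lf :: "ebv_tree => nat set" where "lf T \<equiv> set (leaves T)"

definition lsum :: "(nat => int) => ebv_tree => int" where "lsum k T = (\<Sum>a\<in>lf T. k a)"

definition cross :: "(nat => int) => nat set => nat set => int" where
 "cross k P Q = (\<Sum>b\<in>P. \<Sum>a\<in>Q. if a < b then k a * k b else 0)"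

text \<open>
  The value of a tree at inputs \<open>x a\<close> of degree \<open>k a\<close>.  In preorder all inputs stand to the right of
  all vertices, so at a product the vertices of the right subtree move past the inputs of the left
  one, and the inputs move from the order of their labels to the order of the leaves; \<open>cross\<close>
 counts the inversions between the two subtrees.
\<close>
primrec ev :: "(nat => 'a) => (nat => int) => ebv_tree => 'a" where
 "ev x k (Leaf a) = x a"
| "ev x k (Mu S T) = ksign (tree_degree T * lsum k S + cross k (lf S) (lf T)) *r prd (ev x k S) (ev x k T)"
| "ev x k (Iop T) = iop (ev x k T)"
| "ev x k (DIop T) = di (ev x k T)"

definition hom :: "(nat => 'a) => (nat => int) => nat set => bool" where
 "hom x k P \<longleftrightarrow> (\<forall>a\<in>P. x a \<in> V (k a))"

lemma ev_comp:
 assumes "distinct (leaves T)" "hom x k (lf T)" shows "ev x k T \<in> V (tree_degree T + lsum k T)"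
 using assms
proof (induction T)
 case (Mu S T)
 then have "ev x k S \<in> V (tree_degree S + lsum k S)" "ev x k T \<in> V (tree_degree T + lsum k T)"
  by (auto simp: hom_def)
 from prd_comp[OF this] have "prd (ev x k S) (ev x k T) \<in> V (tree_degree S + lsum k S + (tree_degree T + lsum k T))" .
 moreover have "lsum k (Mu S T) = lsum k S + lsum k T"
  unfolding lsum_def using Mu.prems by (simp add: sum.union_disjoint)
 ultimately show ?case by (simp add: subspace_scale[OF V_subspace] algebra_simps)
next
 case (Iop T)
 then have "ev x k T \<in> V (tree_degree T + lsum k T)" by simp
 from iop_comp[OF this] show ?case by (simp add: lsum_def algebra_simps)
next
 case (DIop T)
 then have "ev x k T \<in> V (tree_degree T + lsum k T)" by simp
 from di_comp[OF this] show ?case by (simp add: lsum_def algebra_simps)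
qed (simp add: hom_def lsum_def)

lemma lsum_cong: "(!!a. a \<in> lf T ==> k a = l a) ==> lsum k T = lsum l T"
 by (simp add: lsum_def)

lemma cross_cong: "(!!a. a \<in> P \<union> Q ==> k a = l a) ==> cross k P Q = cross l P Q"
 unfolding cross_def by (intro sum.cong refl) auto

lemma ev_cong:
 "(!!a. a \<in> lf T ==> x a = y a) ==> (!!a. a \<in> lf T ==> k a = l a) ==> ev x k T = ev y l T"
proof (induction T)
 case (Mu S T)
 have "lsum k S = lsum l S" "cross k (lf S) (lf T) = cross l (lf S) (lf T)"
  using Mu.prems(2) by (auto intro!: lsum_cong cross_cong)
 with Mu show ?case by simp
qed auto

lemma ev_linear:
 assumes "distinct (leaves T)" "hom x k (lf T - {a})" "a \<in> lf T"
 shows "linear_map_on (V (k a)) (%v. ev (x(a := v)) k T)"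
 using assms
proof (induction T)
 case (Leaf b)
 then show ?case by (simp add: linear_map_on_def)
next
 case (Mu S T)
 have hu: "hom (x(a := v)) k (lf R)" if "R \<in> {S, T}" "v \<in> V (k a)" for R v
  using Mu.prems(2) that by (auto simp: hom_def)
 show ?case
 proof (cases "a \<in> lf S")
  case True
  then have aT: "a \<notin> lf T" using Mu.prems by auto
  have l: "linear_map_on (V (k a)) (%v. ev (x(a := v)) k S)"
   using Mu.prems True by (intro Mu.IH) (auto simp: hom_def)
  have T: "ev (x(a := v)) k T = ev x k T" for v by (rule ev_cong) (use aT in auto)
  have xT: "ev x k T \<in> V (tree_degree T + lsum k T)"
   using Mu.prems aT by (intro ev_comp) (auto simp: hom_def)
  have xS: "ev (x(a := v)) k S \<in> V (tree_degree S + lsum k S)" if "v \<in> V (k a)" for v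
   using Mu.prems hu[OF _ that] by (intro ev_comp) auto
  show ?thesis
   unfolding linear_map_on_def ev.simps T
   by (auto simp: linear_onD[OF l] linear_onD(1)[OF prd_linear_left[OF xT] xS xS] linear_onD(2)[OF prd_linear_left[OF xT] xS] scaleR_add_right)
 next
  case False
  then have aT: "a \<in> lf T" using Mu.prems by auto
  have l: "linear_map_on (V (k a)) (%v. ev (x(a := v)) k T)"
   using Mu.prems aT by (intro Mu.IH) (auto simp: hom_def)
  have S: "ev (x(a := v)) k S = ev x k S" for v by (rule ev_cong) (use False in auto)
  have xS: "ev x k S \<in> V (tree_degree S + lsum k S)"
   using Mu.prems False by (intro ev_comp) (auto simp: hom_def)
  have xT: "ev (x(a := v)) k T \<in> V (tree_degree T + lsum k T)" if "v \<in> V (k a)" for v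
   using Mu.prems hu[OF _ that] by (intro ev_comp) auto
  show ?thesis
   unfolding linear_map_on_def ev.simps S
   by (auto simp: linear_onD[OF l] linear_onD(1)[OF prd_linear_right[OF xS] xT xT] linear_onD(2)[OF prd_linear_right[OF xS] xT] scaleR_add_right mult.commute)
 qed
next
 case (Iop T)
 have l: "linear_map_on (V (k a)) (%v. ev (x(a := v)) k T)"
  by (rule Iop.IH) (use Iop.prems in auto)
 have xT: "ev (x(a := v)) k T \<in> V (tree_degree T + lsum k T)" if "v \<in> V (k a)" for v
  using Iop.prems that by (intro ev_comp) (auto simp: hom_def)
 show ?case
  unfolding linear_map_on_def ev.simps by (auto simp: linear_onD[OF l] linear_onD(1)[OF iop_linear xT xT] linear_onD(2)[OF iop_linear xT])
next
 case (DIop T)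
 have l: "linear_map_on (V (k a)) (%v. ev (x(a := v)) k T)"
  by (rule DIop.IH) (use DIop.prems in auto)
 have xT: "ev (x(a := v)) k T \<in> V (tree_degree T + lsum k T)" if "v \<in> V (k a)" for v
  using DIop.prems that by (intro ev_comp) (auto simp: hom_def)
 show ?case
  unfolding linear_map_on_def ev.simps by (auto simp: linear_onD[OF l] linear_onD(1)[OF di_linear xT xT] linear_onD(2)[OF di_linear xT])
qed

lemma ev_zero:
 assumes "distinct (leaves T)" "hom x k (lf T)" "a \<in> lf T" "x a = 0"
 shows "ev x k T = 0"
proof -
 have "linear_map_on (V (k a)) (%v. ev (x(a := v)) k T)"
  using assms by (intro ev_linear) (auto simp: hom_def)
 from linear_on_0[OF V_subspace this] show ?thesis using assms(4) by (simp add: fun_upd_idem)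
qed

lemma ev_degree_irrelevant:
 assumes "distinct (leaves T)" "hom x k (lf T)" "hom x l (lf T)"
 shows "ev x k T = ev x l T"
proof (cases "\<exists>a\<in>lf T. x a = 0")
 case True
 then show ?thesis using ev_zero assms by metis
next
 case False
 then have "k a = l a" if "a \<in> lf T" for a
  using degree_unique[of "x a" "k a" "l a"] assms that by (auto simp: hom_def)
 then show ?thesis by (intro ev_cong) auto
qed

subsection \<open>Relabelling\<close>

definition inversion_exponent :: "(nat => int) => (nat => nat) => nat set => int" where
 "inversion_exponent k si P = (\<Sum>a\<in>P. \<Sum>b\<in>P. if a < b \<and> si b < si a then k (si a) * k (si b) else 0)"

lemma leaves_relabel: "leaves (relabel si T) = map si (leaves T)"
 by (induction T) auto

lemma tree_degree_relabel: "tree_degree (relabel si T) = tree_degree T"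
 by (induction T) auto

lemma relabel_cong: "(!!a. a \<in> lf T ==> si a = \<tau> a) ==> relabel si T = relabel \<tau> T"
 by (induction T) auto

lemma relabel_id: "relabel (%a. a) T = T"
 by (induction T) auto

lemma relabel_relabel: "relabel si (relabel \<tau> T) = relabel (%a. si (\<tau> a)) T"
 by (induction T) auto

text \<open>
  Every inversion created or removed by relabelling occurs at the one product that separates
  the two leaves, so the signs can be compared one product at a time.
\<close>
lemma ev_relabel:
 assumes "distinct (leaves T)" "inj_on si (lf T)"
 shows "ev x k (relabel si T) = ksign (inversion_exponent k si (lf T)) *r ev (%a. x (si a)) (%a. k (si a)) T
  \<or> \<not> hom (%a. x (si a)) (%a. k (si a)) (lf T)"
 using assms
proof (induction T)
 case (Leaf a)
 then show ?case by (simp add: inversion_exponent_def)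
next
 case (Mu S T)
 let ?P = "lf S" and ?Q = "lf T"
 have disj: "?P \<inter> ?Q = {}" using Mu.prems by auto
 have inj: "inj_on si ?P" "inj_on si ?Q" "inj_on si (?P \<union> ?Q)" using Mu.prems by (auto simp: inj_on_Un)
 show ?case
 proof (cases "hom (%a. x (si a)) (%a. k (si a)) (lf (Mu S T))")
  case True
  then have h: "hom (%a. x (si a)) (%a. k (si a)) ?P" "hom (%a. x (si a)) (%a. k (si a)) ?Q" by (auto simp: hom_def)
  have IH: "ev x k (relabel si S) = ksign (inversion_exponent k si ?P) *r ev (%a. x (si a)) (%a. k (si a)) S"
   "ev x k (relabel si T) = ksign (inversion_exponent k si ?Q) *r ev (%a. x (si a)) (%a. k (si a)) T"
   using Mu h inj by auto
  have c: "ev (%a. x (si a)) (%a. k (si a)) S \<in> V (tree_degree S + lsum (%a. k (si a)) S)"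
   "ev (%a. x (si a)) (%a. k (si a)) T \<in> V (tree_degree T + lsum (%a. k (si a)) T)"
   using Mu.prems h by (auto intro: ev_comp)
  have ls: "lsum k (relabel si S) = lsum (%a. k (si a)) S"
   unfolding lsum_def leaves_relabel set_map using inj(1) by (simp add: sum.reindex)
  let ?t = "%a b. k (si a) * k (si b)"
  let ?g = "%a b. if a < b \<and> si b < si a then ?t a b else 0"
  have cr: "cross k (lf (relabel si S)) (lf (relabel si T)) = (\<Sum>b\<in>?P. \<Sum>a\<in>?Q. if si a < si b then ?t a b else 0)"
   unfolding cross_def leaves_relabel set_map using inj by (simp add: sum.reindex)
  have "inversion_exponent k si (?P \<union> ?Q) = (\<Sum>a\<in>?P. (\<Sum>b\<in>?P. ?g a b) + (\<Sum>b\<in>?Q. ?g a b)) + (\<Sum>a\<in>?Q. (\<Sum>b\<in>?P. ?g a b) + (\<Sum>b\<in>?Q. ?g a b))"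
   unfolding inversion_exponent_def using disj by (simp add: sum.union_disjoint)
  also have "... = inversion_exponent k si ?P + inversion_exponent k si ?Q + ((\<Sum>a\<in>?P. \<Sum>b\<in>?Q. ?g a b) + (\<Sum>a\<in>?Q. \<Sum>b\<in>?P. ?g a b))"
   by (simp add: inversion_exponent_def sum.distrib)
  also have "(\<Sum>a\<in>?Q. \<Sum>b\<in>?P. ?g a b) = (\<Sum>b\<in>?P. \<Sum>a\<in>?Q. ?g a b)" by (rule sum.swap)
  finally have ie: "inversion_exponent k si (?P \<union> ?Q) = inversion_exponent k si ?P + inversion_exponent k si ?Q
    + (\<Sum>b\<in>?P. \<Sum>a\<in>?Q. ?g b a + ?g a b)"
   by (simp add: sum.distrib)
  have "ksign (cross k (lf (relabel si S)) (lf (relabel si T))) =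
    ksign ((\<Sum>b\<in>?P. \<Sum>a\<in>?Q. ?g b a + ?g a b) + cross (%a. k (si a)) ?P ?Q)"
   unfolding cr
   unfolding cross_def sum.distrib[symmetric]
  proof (rule ksign_eqI, unfold sum_subtractf[symmetric], intro dvd_sum)
   fix b a assume ab: "b \<in> ?P" "a \<in> ?Q"
   then have "a \<noteq> b" "si a \<noteq> si b" using disj inj(3) by (auto dest: inj_onD)
   then show "even ((if si a < si b then ?t a b else 0) - (?g b a + ?g a b + (if a < b then ?t a b else 0)))"
    by (auto simp: mult.commute)
  qed
  then have sg: "ksign (cross k (lf (relabel si S)) (lf (relabel si T))) * ksign (inversion_exponent k si ?P) * ksign (inversion_exponent k si ?Q) =
    ksign (inversion_exponent k si (?P \<union> ?Q)) * ksign (cross (%a. k (si a)) ?P ?Q)"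
   by (simp add: ie ksign_add mult_ac)
  have "ev x k (relabel si (Mu S T)) = (ksign (tree_degree T * lsum (%a. k (si a)) S) *
    (ksign (cross k (lf (relabel si S)) (lf (relabel si T))) * ksign (inversion_exponent k si ?P) * ksign (inversion_exponent k si ?Q)))
     *r prd (ev (%a. x (si a)) (%a. k (si a)) S) (ev (%a. x (si a)) (%a. k (si a)) T)"
   using linear_onD(2)[OF prd_linear_left[OF subspace_scale[OF V_subspace c(2)]] c(1)] linear_onD(2)[OF prd_linear_right[OF c(1)] c(2)]
   by (simp add: IH ls tree_degree_relabel ksign_add mult_ac)
  also have "... = ksign (inversion_exponent k si (lf (Mu S T))) *r ev (%a. x (si a)) (%a. k (si a)) (Mu S T)"
   unfolding sg by (simp add: ksign_add mult_ac)
  finally show ?thesis by simp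
 qed simp
next
 case (Iop T)
 then show ?case
  using linear_onD(2)[OF iop_linear ev_comp[of T "%a. x (si a)" "%a. k (si a)"]] by auto
next
 case (DIop T)
 then show ?case
  using linear_onD(2)[OF di_linear ev_comp[of T "%a. x (si a)" "%a. k (si a)"]] by auto
qed

lemma ev_relabel_mono:
 assumes "distinct (leaves T)" "!!a b. a \<in> lf T ==> b \<in> lf T ==> a < b ==> si a < si b" "hom (%a. x (si a)) (%a. k (si a)) (lf T)"
 shows "ev x k (relabel si T) = ev (%a. x (si a)) (%a. k (si a)) T"
proof -
 have "inj_on si (lf T)" using assms(2) by (intro inj_onI) (metis nat_neq_iff)
 moreover have "inversion_exponent k si (lf T) = 0"
  unfolding inversion_exponent_def by (intro sum.neutral ballI) (use assms(2) in force)
 ultimately show ?thesis using ev_relabel[OF assms(1), of si x k] assms(3) by simp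
qed

end

subsection \<open>Grafting\<close>

lemma ksign_minus_2 [simp]: "ksign (a - 2) = ksign a" and ksign_minus_1 [simp]: "ksign (a - 1) = - ksign a"
 by (auto simp: ksign_def)

definition shift :: "nat => nat => nat => nat" where
 "shift n i a = (if a < i then a else a + n - 1)"

definition blow :: "nat => nat => nat set => nat set" where
 "blow n i P = shift n i ` (P - {i}) \<union> (if i \<in> P then (+) i ` {..<n} else {})"

lemma shift_less_iff: "0 < n ==> a \<noteq> i ==> b \<noteq> i ==> shift n i a < shift n i b \<longleftrightarrow> a < b"
 by (auto simp: shift_def)

lemma shift_less_block: "0 < n ==> a \<noteq> i ==> c < n ==> shift n i a < i + c \<longleftrightarrow> a < i"
 and block_less_shift: "0 < n ==> a \<noteq> i ==> c < n ==> i + c < shift n i a \<longleftrightarrow> i < a"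
 and shift_neq_block: "0 < n ==> a \<noteq> i ==> c < n ==> shift n i a \<noteq> i + c"
 by (auto simp: shift_def)

lemma shift_inj: "0 < n ==> inj_on (shift n i) (P - {i})"
 by (auto simp: inj_on_def shift_def split: if_splits)

lemma sum_blow:
 assumes "0 < n" "finite P"
 shows "(\<Sum>a\<in>blow n i P. f a) = (\<Sum>a\<in>P - {i}. f (shift n i a)) + (if i \<in> P then \<Sum>c<n. f (i + c) else 0)"
proof -
 have "shift n i ` (P - {i}) \<inter> (+) i ` {..<n} = {}"
  using shift_neq_block[OF assms(1)] by auto
 moreover have "sum f (shift n i ` (P - {i})) = (\<Sum>a\<in>P - {i}. f (shift n i a))"
  by (simp add: sum.reindex[OF shift_inj[OF assms(1)]])
 moreover have "sum f ((+) i ` {..<n}) = (\<Sum>c<n. f (i + c))"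
  by (simp add: sum.reindex)
 ultimately show ?thesis
  unfolding blow_def using assms(2) by (simp add: sum.union_disjoint)
qed

lemma graft_notin: "i \<notin> set (leaves T) ==> graft n i T U = relabel (shift n i) T"
 by (induction T) (auto simp: shift_def)

context ebv_data
begin

lemma leaves_graft:
 assumes "lf U = {..<n}"
 shows "lf (graft n i T U) = blow n i (lf T)"
proof (induction T)
 case (Leaf a)
 then show ?case by (auto simp: blow_def shift_def assms leaves_relabel)
next
 case (Mu S T)
 then show ?case by (simp add: blow_def image_Un Un_Diff Un_ac)
qed auto

lemma blow_disjoint:
 assumes "0 < n" "P \<inter> Q = {}" shows "blow n i P \<inter> blow n i Q = {}"
proof -
 have "shift n i ` (P - {i}) \<inter> shift n i ` (Q - {i}) = {}"
  using inj_onD[OF shift_inj[OF assms(1), of i "P \<union> Q"]] assms(2) by blast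
 moreover have "shift n i ` (P - {i}) \<inter> (+) i ` {..<n} = {}" "shift n i ` (Q - {i}) \<inter> (+) i ` {..<n} = {}"
  using shift_neq_block[OF assms(1)] by auto
 moreover have "\<not> (i \<in> P \<and> i \<in> Q)" using assms(2) by blast
 ultimately show ?thesis
  unfolding blow_def
  by (cases "i \<in> P"; cases "i \<in> Q"; simp only: if_True if_False Un_empty_right not_False_eq_True; blast)
qed

lemma distinct_graft:
 assumes "distinct (leaves T)" "distinct (leaves U)" "lf U = {..<n}" "0 < n"
 shows "distinct (leaves (graft n i T U))"
 using assms(1)
proof (induction T)
 case (Leaf a)
 then show ?case using assms(2) by (auto simp: leaves_relabel distinct_map inj_on_def)
next
 case (Mu S T)
 then show ?case using blow_disjoint[OF assms(4), of "lf S" "lf T" i] by (simp add: leaves_graft[OF assms(3)])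
qed auto

lemma tree_arity_pos: "tree_arity n U ==> 0 < n"
proof -
 assume "tree_arity n U"
 moreover have "leaves U \<noteq> []" by (induction U) simp_all
 ultimately show ?thesis unfolding tree_arity_def by (cases n) simp_all
qed

lemma blow_lessThan: "i < m ==> 0 < n ==> blow n i {..<m} = {..<m + n - 1}"
proof -
 assume *: "i < m" "0 < n"
 have "a \<in> blow n i {..<m}" if "a < m + n - 1" for a
 proof (cases "a < i")
  case True
  then have "a = shift n i a" "a \<in> {..<m} - {i}" using * by (auto simp: shift_def)
  then show ?thesis unfolding blow_def by blast
 next
  case False
  show ?thesis
  proof (cases "a < i + n")
   case True
   then have "a = i + (a - i)" "a - i \<in> {..<n}" using False by auto
   then show ?thesis using * unfolding blow_def by auto
  next
   case F: False
   then have "a = shift n i (a + 1 - n)" "a + 1 - n \<in> {..<m} - {i}" using * that by (auto simp: shift_def)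
   then show ?thesis unfolding blow_def by blast
  qed
 qed
 then show ?thesis using * by (auto simp: blow_def shift_def)
qed

lemma tree_arity_graft:
 assumes "tree_arity m T" "tree_arity n U" "i < m" shows "tree_arity (m + n - 1) (graft n i T U)"
 using assms distinct_graft[of T U n i] leaves_graft[of U n i T] blow_lessThan[of i m n] tree_arity_pos[OF assms(2)]
 by (simp add: tree_arity_def)

lemma tree_degree_graft:
 "distinct (leaves T) ==> tree_degree (graft n i T U) = tree_degree T + (if i \<in> lf T then tree_degree U else 0)"
 by (induction T) (auto simp: tree_degree_relabel)

definition graft_degrees :: "nat => nat => int => (nat => int) => nat => int" where
 "graft_degrees n i r k a = (if a = i then r + (\<Sum>c<n. k (i + c)) else k (shift n i a))"

definition graft_inputs :: "nat => nat => 'a => (nat => 'a) => nat => 'a" where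
 "graft_inputs n i v x a = (if a = i then v else x (shift n i a))"

definition below :: "(nat => int) => nat => nat set => int" where
 "below k i P = (\<Sum>a\<in>P. if a < i then k a else 0)"

lemma below_union: "finite P ==> finite Q ==> P \<inter> Q = {} ==> below k i (P \<union> Q) = below k i P + below k i Q"
 unfolding below_def by (rule sum.union_disjoint)

text \<open>
  A grafted tree of degree \<open>r\<close> with its inputs acts as one input of degree \<open>r + \<Sum> k\<close>.
  Only the part \<open>r\<close> of that degree makes a difference to the inversions, as a vertex of the grafted
  tree crosses nothing in the list of inputs.
\<close>
lemma cross_blow:
 fixes k :: "nat => int" and n i :: nat and r :: int
 assumes n: "0 < n" and fin: "finite P" "finite Q" and disj: "P \<inter> Q = {}"
 defines "l \<equiv> graft_degrees n i r k"
 shows "cross k (blow n i P) (blow n i Q) = cross l P Q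
  - (if i \<in> P then r * below l i Q else 0)
  - (if i \<in> Q then r * (\<Sum>b\<in>P. if i < b then l b else 0) else 0)"
proof -
 let ?s = "shift n i"
 have k: "k (?s a) = l a" if "a \<noteq> i" for a using that by (simp add: l_def graft_degrees_def)
 have bl: "(\<Sum>c<n. k (i + c)) = l i - r" by (simp add: l_def graft_degrees_def)
 have inner1: "(\<Sum>a\<in>blow n i Q. if a < ?s b then k a * k (?s b) else 0) =
   (\<Sum>a\<in>Q. if a < b then l a * l b else 0) - (if i \<in> Q \<and> i < b then r * l b else 0)" if "b \<noteq> i" for b
 proof -
  have "(\<Sum>a\<in>blow n i Q. if a < ?s b then k a * k (?s b) else 0) =
    (\<Sum>a\<in>Q - {i}. if a < b then l a * l b else 0) + (if i \<in> Q then \<Sum>c<n. if i < b then k (i + c) * l b else 0 else 0)"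
   unfolding sum_blow[OF n fin(2)]
   by (intro arg_cong2[where f = "(+)"] sum.cong if_cong refl)
     (auto simp: shift_less_iff[OF n _ that] block_less_shift[OF n that] k that)
  also have "(if i \<in> Q then \<Sum>c<n. if i < b then k (i + c) * l b else 0 else 0) =
    (if i \<in> Q then (if i < b then l i * l b else 0) - (if i < b then r * l b else 0) else 0)"
   using bl by (simp add: sum_distrib_right[symmetric] left_diff_distrib)
  also have "(\<Sum>a\<in>Q - {i}. if a < b then l a * l b else 0) =
    (\<Sum>a\<in>Q. if a < b then l a * l b else 0) - (if i \<in> Q then (if i < b then l i * l b else 0) else 0)"
   using fin(2) by (simp add: sum_diff1)
  finally show ?thesis by simp
 qed
 have inner2: "(\<Sum>c<n. \<Sum>a\<in>blow n i Q. if a < i + c then k a * k (i + c) else 0) =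
   (\<Sum>a\<in>Q. if a < i then l a * l i else 0) - r * below l i Q" if "i \<notin> Q"
 proof -
  have "(\<Sum>c<n. \<Sum>a\<in>blow n i Q. if a < i + c then k a * k (i + c) else 0) =
    (\<Sum>c<n. \<Sum>a\<in>Q. if a < i then l a * k (i + c) else 0)"
  proof (rule sum.cong[OF refl])
   fix c assume "c \<in> {..<n}"
   then have c: "c < n" by simp
   have ne: "a \<noteq> i" if "a \<in> Q" for a using that \<open>i \<notin> Q\<close> by blast
   show "(\<Sum>a\<in>blow n i Q. if a < i + c then k a * k (i + c) else 0) = (\<Sum>a\<in>Q. if a < i then l a * k (i + c) else 0)"
    unfolding sum_blow[OF n fin(2)] using \<open>i \<notin> Q\<close> ne
    by (auto simp: shift_less_block[OF n _ c] k intro!: sum.cong)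
  qed
  also have "... = (\<Sum>a\<in>Q. \<Sum>c<n. if a < i then l a * k (i + c) else 0)" by (rule sum.swap)
  also have "... = (\<Sum>a\<in>Q. (if a < i then l a * l i else 0) - r * (if a < i then l a else 0))"
   using bl by (intro sum.cong refl) (simp add: sum_distrib_left[symmetric] right_diff_distrib mult.commute)
  finally show ?thesis by (simp add: sum_subtractf below_def sum_distrib_left)
 qed
 have "cross k (blow n i P) (blow n i Q) =
   (\<Sum>b\<in>P - {i}. (\<Sum>a\<in>Q. if a < b then l a * l b else 0) - (if i \<in> Q \<and> i < b then r * l b else 0))
   + (if i \<in> P then \<Sum>c<n. \<Sum>a\<in>blow n i Q. if a < i + c then k a * k (i + c) else 0 else 0)"
  unfolding cross_def sum_blow[OF n fin(1)] using inner1 by (intro arg_cong2[where f = "(+)"] sum.cong refl) (simp_all add: k)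
 also have "(\<Sum>b\<in>P - {i}. (\<Sum>a\<in>Q. if a < b then l a * l b else 0) - (if i \<in> Q \<and> i < b then r * l b else 0)) =
   cross l P Q - (if i \<in> P then \<Sum>a\<in>Q. if a < i then l a * l i else 0 else 0) - (if i \<in> Q then r * (\<Sum>b\<in>P. if i < b then l b else 0) else 0)"
 proof -
  have "(\<Sum>b\<in>P - {i}. if i \<in> Q \<and> i < b then r * l b else 0) = (if i \<in> Q then r * (\<Sum>b\<in>P. if i < b then l b else 0) else 0)"
  proof (cases "i \<in> Q")
   case True
   then have "P - {i} = P" using disj by blast
   then show ?thesis using True by (simp add: sum_distrib_left if_distrib cong: if_cong)
  qed simp
  then show ?thesis using fin(1) by (simp add: sum_subtractf cross_def sum_diff1)
 qed
 finally have cr: "cross k (blow n i P) (blow n i Q) = cross l P Q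
   - (if i \<in> P then \<Sum>a\<in>Q. if a < i then l a * l i else 0 else 0)
   - (if i \<in> Q then r * (\<Sum>b\<in>P. if i < b then l b else 0) else 0)
   + (if i \<in> P then \<Sum>c<n. \<Sum>a\<in>blow n i Q. if a < i + c then k a * k (i + c) else 0 else 0)" .
 show ?thesis
 proof (cases "i \<in> P")
  case True
  then have "i \<notin> Q" using disj by blast
  then show ?thesis using cr inner2 True by simp
 qed (simp add: cr)
qed

lemma lsum_graft:
 assumes "0 < n" "lf U = {..<n}"
 shows "lsum k (graft n i S U) = lsum (graft_degrees n i r k) S - (if i \<in> lf S then r else 0)"
 unfolding lsum_def leaves_graft[OF assms(2)] sum_blow[OF assms(1) finite_set]
 by (cases "i \<in> lf S") (auto simp: sum.remove[of "lf S" i] graft_degrees_def intro!: sum.cong)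

text \<open>
  The grafted tree moves past the vertices after leaf \<open>i\<close>, and its vertices past the inputs
  before \<open>i\<close>; this is the sign of a partial composite in the endomorphism operad.
\<close>
lemma ev_graft:
 fixes k :: "nat => int" and n i :: nat and x :: "nat => 'a" and T U :: ebv_tree
 assumes T: "distinct (leaves T)" and U: "distinct (leaves U)" "lf U = {..<n}" and n: "0 < n"
  and h: "hom x k (lf (graft n i T U))"
 defines "l \<equiv> graft_degrees n i (tree_degree U) k"
  and "y \<equiv> graft_inputs n i (ev (%b. x (i + b)) (%b. k (i + b)) U) x"
 shows "ev x k (graft n i T U) = (if i \<in> lf T then ksign (tree_degree U * (degree_after i T + below l i (lf T))) else 1) *r ev y l T
  \<and> hom y l (lf T)"
proof -
 have notin: "ev x k (graft n i T U) = ev y l T \<and> hom y l (lf T)"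
  if "distinct (leaves T)" "i \<notin> lf T" "hom x k (lf (graft n i T U))" for T
 proof -
  have h': "hom (%a. x (shift n i a)) (%a. k (shift n i a)) (lf T)"
   using that unfolding hom_def graft_notin[OF that(2)] leaves_relabel by auto
  have mono: "shift n i a < shift n i b" if "a \<in> lf T" "b \<in> lf T" "a < b" for a b
  proof -
   have "a \<noteq> i" "b \<noteq> i" using that(1,2) \<open>i \<notin> lf T\<close> by blast+
   then show ?thesis using shift_less_iff[OF n] that(3) by blast
  qed
  have "ev x k (graft n i T U) = ev (%a. x (shift n i a)) (%a. k (shift n i a)) T"
   unfolding graft_notin[OF that(2)]
   by (rule ev_relabel_mono[where si = "shift n i" and x = x and k = k, OF that(1) mono h'])
  also have "... = ev y l T"
   using that(2) by (intro ev_cong) (auto simp: y_def l_def graft_degrees_def graft_inputs_def)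
  finally show ?thesis
   using h' that(2) by (auto simp: hom_def y_def l_def graft_degrees_def graft_inputs_def)
 qed
 show ?thesis
  using T h
 proof (induction T)
  case (Leaf a)
  show ?case
  proof (cases "a = i")
   case False
   then show ?thesis using notin[of "Leaf a"] Leaf by simp
  next
   case True
   have h': "hom (%b. x (i + b)) (%b. k (i + b)) (lf U)"
    using Leaf True unfolding hom_def by (auto simp: leaves_relabel)
   have "ev x k (relabel (%b. i + b) U) = ev (%b. x (i + b)) (%b. k (i + b)) U"
    by (rule ev_relabel_mono[where si = "%b. i + b" and x = x and k = k, OF U(1) _ h']) simp
   moreover have "ev (%b. x (i + b)) (%b. k (i + b)) U \<in> V (l i)"
    using ev_comp[OF U(1) h'] by (simp add: l_def graft_degrees_def lsum_def U(2))
   ultimately show ?thesis using True by (simp add: y_def graft_inputs_def below_def hom_def)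
  qed
 next
  case (Mu S T)
  have d: "distinct (leaves S)" "distinct (leaves T)" "lf S \<inter> lf T = {}" using Mu.prems by auto
  have h: "hom x k (lf (graft n i S U))" "hom x k (lf (graft n i T U))" using Mu.prems(2) by (auto simp: hom_def)
  have IH: "ev x k (graft n i S U) = (if i \<in> lf S then ksign (tree_degree U * (degree_after i S + below l i (lf S))) else 1) *r ev y l S"
   "ev x k (graft n i T U) = (if i \<in> lf T then ksign (tree_degree U * (degree_after i T + below l i (lf T))) else 1) *r ev y l T"
   and hS: "hom y l (lf S)" and hT: "hom y l (lf T)"
   using Mu.IH d h by auto
  note c = ev_comp[OF d(1) hS] ev_comp[OF d(2) hT]
  have pull: "prd (a *r ev y l S) (b *r ev y l T) = (a * b) *r prd (ev y l S) (ev y l T)" for a b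
   using linear_onD(2)[OF prd_linear_left[OF subspace_scale[OF V_subspace c(2)]] c(1)] linear_onD(2)[OF prd_linear_right[OF c(1)] c(2)]
   by simp
  note pull = pull pull[where a = 1, simplified] pull[where b = 1, simplified]
  let ?u = "tree_degree U"
  have cr: "cross k (lf (graft n i S U)) (lf (graft n i T U)) = cross l (lf S) (lf T) - (if i \<in> lf S then ?u * below l i (lf T) else 0)
    - (if i \<in> lf T then ?u * (\<Sum>b\<in>lf S. if i < b then l b else 0) else 0)"
   unfolding leaves_graft[OF U(2)] l_def by (rule cross_blow[OF n finite_set finite_set d(3)])
  have ls: "lsum k (graft n i S U) = lsum l S - (if i \<in> lf S then ?u else 0)"
   unfolding l_def by (rule lsum_graft[OF n U(2)])
  have bu: "below l i (lf S \<union> lf T) = below l i (lf S) + below l i (lf T)"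
   using d(3) by (simp add: below_union)
  have "hom y l (lf (Mu S T))" using hS hT by (auto simp: hom_def)
  moreover have "ev x k (graft n i (Mu S T) U) =
    (if i \<in> lf (Mu S T) then ksign (?u * (degree_after i (Mu S T) + below l i (lf (Mu S T)))) else 1) *r ev y l (Mu S T)"
  proof (cases "i \<in> lf S")
   case True
   then have iT: "i \<notin> lf T" using d(3) by blast
   have "ksign (tree_degree T * (lsum l S - ?u) + (cross l (lf S) (lf T) - ?u * below l i (lf T)) + ?u * (degree_after i S + below l i (lf S))) =
     ksign (?u * (degree_after i S + tree_degree T + (below l i (lf S) + below l i (lf T))) + (tree_degree T * lsum l S + cross l (lf S) (lf T)))"
    by (rule ksign_eqI) (auto simp: algebra_simps)
   then show ?thesis
    using True iT
    by (simp add: IH cr ls pull tree_degree_graft[OF d(2)] bu ksign_add[symmetric])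
  next
   case iS: False
   show ?thesis
   proof (cases "i \<in> lf T")
    case True
    have split: "lsum l S = below l i (lf S) + (\<Sum>b\<in>lf S. if i < b then l b else 0)"
     unfolding lsum_def below_def sum.distrib[symmetric] using iS by (intro sum.cong) (auto simp: not_less_iff_gr_or_eq)
    have "ksign ((tree_degree T + ?u) * lsum l S + (cross l (lf S) (lf T) - ?u * (\<Sum>b\<in>lf S. if i < b then l b else 0)) + ?u * (degree_after i T + below l i (lf T))) =
      ksign (?u * (degree_after i T + (below l i (lf S) + below l i (lf T))) + (tree_degree T * lsum l S + cross l (lf S) (lf T)))"
     unfolding split by (rule ksign_eqI) (auto simp: algebra_simps)
    then show ?thesis
     using True iS
     by (simp add: IH cr ls pull tree_degree_graft[OF d(2)] bu ksign_add[symmetric])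
   next
    case False
    then show ?thesis using notin[of "Mu S T"] iS Mu.prems by simp
   qed
  qed
  ultimately show ?case by blast
 next
  case (Iop T)
  then show ?case
   using linear_onD(2)[OF iop_linear ev_comp[of T y l]] by auto
 next
  case (DIop T)
  then show ?case
   using linear_onD(2)[OF di_linear ev_comp[of T y l]] by auto
 qed
qed

subsection \<open>The differential\<close>

definition ev_list :: "(nat => 'a) => (nat => int) => (real \<times> ebv_tree) list => 'a" where
 "ev_list x k l = (\<Sum>cU\<leftarrow>l. fst cU *r ev x k (snd cU))"

lemma tree_diff_leaves: "cU \<in> set (tree_diff T) ==> leaves (snd cU) = leaves T \<and> tree_degree (snd cU) = tree_degree T + 1"
 by (induction T arbitrary: cU) auto

lemma scaleR_sum_list: "c *r sum_list l = (\<Sum>v\<leftarrow>l. c *r v)" for l :: "'b::real_vector list"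
 by (induction l) (auto simp: scaleR_add_right)

lemma linear_on_sum_list:
 assumes "subspace W" "linear_map_on W f" "!!u. u \<in> set l ==> g u \<in> W"
 shows "f (\<Sum>u\<leftarrow>l. c u *r g u) = (\<Sum>u\<leftarrow>l. c u *r f (g u)) \<and> (\<Sum>u\<leftarrow>l. c u *r g u) \<in> W"
 using assms(3)
proof (induction l)
 case Nil
 then show ?case using linear_on_0[OF assms(1,2)] subspace_0[OF assms(1)] by simp
next
 case (Cons u l)
 have "c u *r g u \<in> W" using Cons.prems assms(1) by (auto intro: subspace_scale)
 with Cons show ?case
  using linear_onD[OF assms(2)] subspace_add[OF assms(1)] by simp
qed

lemma cross_increment_left:
 assumes "finite P" "finite Q" "j \<in> P" "j \<notin> Q"
 shows "cross (k(j := k j + 1)) P Q = cross k P Q + below k j Q"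
proof -
 have "(\<Sum>b\<in>P - {j}. \<Sum>a\<in>Q. if a < b then (k(j := k j + 1)) a * (k(j := k j + 1)) b else 0) =
   (\<Sum>b\<in>P - {j}. \<Sum>a\<in>Q. if a < b then k a * k b else 0)"
  using assms by (intro sum.cong refl) auto
 moreover have "(\<Sum>a\<in>Q. if a < j then (k(j := k j + 1)) a * (k(j := k j + 1)) j else 0) =
   (\<Sum>a\<in>Q. if a < j then k a * k j else 0) + below k j Q"
  unfolding below_def sum.distrib[symmetric] using assms by (intro sum.cong refl) (auto simp: algebra_simps)
 ultimately show ?thesis unfolding cross_def sum.remove[OF assms(1,3)] by simp
qed

lemma cross_increment_right:
 assumes "finite P" "finite Q" "j \<in> Q" "j \<notin> P"
 shows "cross (k(j := k j + 1)) P Q = cross k P Q + (\<Sum>b\<in>P. if j < b then k b else 0)"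
proof -
 have "(\<Sum>a\<in>Q. if a < b then (k(j := k j + 1)) a * (k(j := k j + 1)) b else 0) =
   (\<Sum>a\<in>Q. if a < b then k a * k b else 0) + (if j < b then k b else 0)" if "b \<in> P" for b
 proof -
  have "(\<Sum>a\<in>Q - {j}. if a < b then (k(j := k j + 1)) a * (k(j := k j + 1)) b else 0) =
    (\<Sum>a\<in>Q - {j}. if a < b then k a * k b else 0)"
   using assms that by (intro sum.cong refl) auto
  moreover have "b \<noteq> j" using assms that by blast
  ultimately show ?thesis unfolding sum.remove[OF assms(2,3)] by (simp add: algebra_simps)
 qed
 then show ?thesis unfolding cross_def sum.distrib[symmetric] by (rule sum.cong[OF refl])
qed

definition ev_at_d :: "(nat => 'a) => (nat => int) => nat => ebv_tree => 'a" where
 "ev_at_d x k j T = ev (x(j := dA (x j))) (k(j := k j + 1)) T"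

lemma ev_at_d_comp:
 assumes "distinct (leaves T)" "hom x k (lf T)" "j \<in> lf T"
 shows "ev_at_d x k j T \<in> V (tree_degree T + 1 + lsum k T)"
proof -
 have "lsum (k(j := k j + 1)) T = lsum k T + 1"
  unfolding lsum_def using assms(3) by (simp add: sum.remove[of "lf T" j])
 moreover have "hom (x(j := dA (x j))) (k(j := k j + 1)) (lf T)"
  using assms(2,3) dA_comp by (auto simp: hom_def)
 ultimately show ?thesis
  using ev_comp[OF assms(1), of "x(j := dA (x j))" "k(j := k j + 1)"] by (simp add: ev_at_d_def algebra_simps)
qed

lemma ev_at_d_notin: "j \<notin> lf T ==> ev_at_d x k j T = ev x k T"
 unfolding ev_at_d_def by (rule ev_cong) auto

lemma push_linear:
 assumes "linear_map_on (V m) f" "!!u. u \<in> set l ==> ev x k (snd u) \<in> V m" "!!j. j \<in> J ==> v j \<in> V m"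
 shows "f (ev_list x k l + e *r (\<Sum>j\<in>J. c j *r v j)) =
  (\<Sum>u\<leftarrow>l. fst u *r f (ev x k (snd u))) + e *r (\<Sum>j\<in>J. c j *r f (v j))"
proof -
 have l: "f (ev_list x k l) = (\<Sum>u\<leftarrow>l. fst u *r f (ev x k (snd u)))" "ev_list x k l \<in> V m"
  unfolding ev_list_def using linear_on_sum_list[where W = "V m" and f = f and l = l and g = "%u. ev x k (snd u)" and c = fst, OF V_subspace assms(1,2)] by blast+
 have s: "(\<Sum>j\<in>J. c j *r v j) \<in> V m"
  by (intro subspace_sum[OF V_subspace] subspace_scale[OF V_subspace] assms(3))
 show ?thesis
  using linear_onD(1)[OF assms(1) l(2) subspace_scale[OF V_subspace s]] linear_onD(2)[OF assms(1) s]
   linear_on_sum[where W = "V m" and f = f and B = J and v = v and c = c, OF V_subspace assms(1,3)] l(1) by simp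
qed

text \<open>
  The differential falls on a vertex, which is \<open>tree_diff\<close>, or on an input, which it reaches after
  crossing all vertices and the inputs with smaller labels.
\<close>
lemma ev_diff:
 assumes "distinct (leaves T)" "hom x k (lf T)"
 shows "dA (ev x k T) = ev_list x k (tree_diff T)
  + ksign (tree_degree T) *r (\<Sum>j\<in>lf T. ksign (below k j (lf T)) *r ev_at_d x k j T)"
 using assms
proof (induction T)
 case (Leaf a)
 then show ?case by (simp add: ev_list_def below_def ev_at_d_def)
next
 case (Iop T)
 have h: "distinct (leaves T)" "hom x k (lf T)" using Iop.prems by auto
 have c: "ev x k (snd cU) \<in> V (tree_degree T + 1 + lsum k T)" if "cU \<in> set (tree_diff T)" for cU
  using ev_comp[of "snd cU" x k] tree_diff_leaves[OF that] h by (simp add: lsum_def)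
 note push = push_linear[OF iop_linear c ev_at_d_comp[OF h]]
 show ?case
  unfolding ev.simps dA_iop Iop.IH[OF h]
  by (simp add: push) (simp add: ev_list_def ev_at_d_def o_def case_prod_unfold)
next
 case (DIop T)
 have h: "distinct (leaves T)" "hom x k (lf T)" using DIop.prems by auto
 have c: "ev x k (snd cU) \<in> V (tree_degree T + 1 + lsum k T)" if "cU \<in> set (tree_diff T)" for cU
  using ev_comp[of "snd cU" x k] tree_diff_leaves[OF that] h by (simp add: lsum_def)
 note push = push_linear[OF di_linear c ev_at_d_comp[OF h]]
 show ?case
  unfolding ev.simps dA_di[OF ev_comp[OF h]] DIop.IH[OF h]
  by (simp add: push) (simp add: ev_list_def ev_at_d_def o_def case_prod_unfold uminus_sum_list_map)
next
 case (Mu S T)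
 have d: "distinct (leaves S)" "distinct (leaves T)" "lf S \<inter> lf T = {}" using Mu.prems by auto
 have h: "hom x k (lf S)" "hom x k (lf T)" using Mu.prems(2) by (auto simp: hom_def)
 note eS = ev_comp[OF d(1) h(1)] and eT = ev_comp[OF d(2) h(2)]
 have cS: "ev x k (snd cU) \<in> V (tree_degree S + 1 + lsum k S)" if "cU \<in> set (tree_diff S)" for cU
  using ev_comp[of "snd cU" x k] tree_diff_leaves[OF that] d h by (simp add: lsum_def)
 have cT: "ev x k (snd cU) \<in> V (tree_degree T + 1 + lsum k T)" if "cU \<in> set (tree_diff T)" for cU
  using ev_comp[of "snd cU" x k] tree_diff_leaves[OF that] d h by (simp add: lsum_def)
 let ?X = "prd (ev x k S) (ev x k T)"
 let ?e = "ksign (tree_degree T * lsum k S + cross k (lf S) (lf T))"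
 have left: "prd (dA (ev x k S)) (ev x k T) = (\<Sum>cU\<leftarrow>tree_diff S. fst cU *r prd (ev x k (snd cU)) (ev x k T))
   + ksign (tree_degree S) *r (\<Sum>j\<in>lf S. ksign (below k j (lf S)) *r prd (ev_at_d x k j S) (ev x k T))"
  unfolding Mu.IH(1)[OF d(1) h(1)] by (rule push_linear[OF prd_linear_left[OF eT] cS ev_at_d_comp[OF d(1) h(1)]])
 have right: "prd (ev x k S) (dA (ev x k T)) = (\<Sum>cU\<leftarrow>tree_diff T. fst cU *r prd (ev x k S) (ev x k (snd cU)))
   + ksign (tree_degree T) *r (\<Sum>j\<in>lf T. ksign (below k j (lf T)) *r prd (ev x k S) (ev_at_d x k j T))"
  unfolding Mu.IH(2)[OF d(2) h(2)] by (rule push_linear[OF prd_linear_right[OF eS] cT ev_at_d_comp[OF d(2) h(2)]])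
 have lists: "ev_list x k (tree_diff (Mu S T)) =
   ?e *r (\<Sum>cU\<leftarrow>tree_diff S. fst cU *r prd (ev x k (snd cU)) (ev x k T))
   + (?e * ksign (tree_degree S + lsum k S)) *r (\<Sum>cU\<leftarrow>tree_diff T. fst cU *r prd (ev x k S) (ev x k (snd cU)))"
 proof -
  have "(\<Sum>cU\<leftarrow>tree_diff S. fst cU *r ev x k (Mu (snd cU) T)) =
    (\<Sum>cU\<leftarrow>tree_diff S. ?e *r fst cU *r prd (ev x k (snd cU)) (ev x k T))"
   by (intro arg_cong[where f = sum_list] map_cong refl) (simp add: tree_diff_leaves lsum_def)
  moreover have "(\<Sum>cU\<leftarrow>tree_diff T. (ksign (tree_degree S) * fst cU) *r ev x k (Mu S (snd cU))) =
    (\<Sum>cU\<leftarrow>tree_diff T. (?e * ksign (tree_degree S + lsum k S)) *r fst cU *r prd (ev x k S) (ev x k (snd cU)))"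
   by (intro arg_cong[where f = sum_list] map_cong refl) (simp add: tree_diff_leaves ksign_add distrib_right distrib_left mult_ac)
  ultimately show ?thesis
   by (simp add: ev_list_def o_def case_prod_unfold scaleR_sum_list)
 qed
 have "ksign (tree_degree (Mu S T)) *r (\<Sum>j\<in>lf S. ksign (below k j (lf (Mu S T))) *r ev_at_d x k j (Mu S T)) =
   (?e * ksign (tree_degree S)) *r (\<Sum>j\<in>lf S. ksign (below k j (lf S)) *r prd (ev_at_d x k j S) (ev x k T))"
  unfolding scaleR_sum_right
 proof (rule sum.cong[OF refl])
  fix j assume j: "j \<in> lf S"
  then have jT: "j \<notin> lf T" using d(3) by blast
  have ls: "lsum (k(j := k j + 1)) S = lsum k S + 1"
   unfolding lsum_def using j by (simp add: sum.remove[of "lf S" j])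
  have b: "below k j (lf (Mu S T)) = below k j (lf S) + below k j (lf T)"
   using d(3) by (simp add: below_union)
  have cr: "cross (k(j := k j + 1)) (lf S) (lf T) = cross k (lf S) (lf T) + below k j (lf T)"
   using j jT by (intro cross_increment_left) auto
  have "ksign (tree_degree S + tree_degree T + (below k j (lf S) + below k j (lf T)) + (tree_degree T * (lsum k S + 1) + (cross k (lf S) (lf T) + below k j (lf T)))) =
    ksign (tree_degree T * lsum k S + cross k (lf S) (lf T) + tree_degree S + below k j (lf S))"
   by (rule ksign_eqI) (auto simp: algebra_simps)
  moreover have "ev_at_d x k j (Mu S T) = ksign (tree_degree T * (lsum k S + 1) + (cross k (lf S) (lf T) + below k j (lf T))) *r prd (ev_at_d x k j S) (ev x k T)"
   using ev_at_d_notin[OF jT] by (simp add: ev_at_d_def ls cr)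
  ultimately show "ksign (tree_degree (Mu S T)) *r ksign (below k j (lf (Mu S T))) *r ev_at_d x k j (Mu S T) =
    (?e * ksign (tree_degree S)) *r ksign (below k j (lf S)) *r prd (ev_at_d x k j S) (ev x k T)"
   by (simp only: b scaleR_scaleR tree_degree.simps ksign_add[symmetric]) (simp only: add.assoc)
 qed
 moreover have "ksign (tree_degree (Mu S T)) *r (\<Sum>j\<in>lf T. ksign (below k j (lf (Mu S T))) *r ev_at_d x k j (Mu S T)) =
   (?e * ksign (tree_degree S + lsum k S) * ksign (tree_degree T)) *r (\<Sum>j\<in>lf T. ksign (below k j (lf T)) *r prd (ev x k S) (ev_at_d x k j T))"
  unfolding scaleR_sum_right
 proof (rule sum.cong[OF refl])
  fix j assume j: "j \<in> lf T"
  then have jS: "j \<notin> lf S" using d(3) by blast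
  define a where "a = (\<Sum>b\<in>lf S. if j < b then k b else 0)"
  have ls: "lsum k S = below k j (lf S) + a"
   unfolding a_def lsum_def below_def sum.distrib[symmetric] using jS by (intro sum.cong) (auto simp: not_less_iff_gr_or_eq)
  have ls': "lsum (k(j := k j + 1)) S = lsum k S"
   using jS by (intro lsum_cong) auto
  have b: "below k j (lf (Mu S T)) = below k j (lf S) + below k j (lf T)"
   using d(3) by (simp add: below_union)
  have cr: "cross (k(j := k j + 1)) (lf S) (lf T) = cross k (lf S) (lf T) + a"
   unfolding a_def using j jS by (intro cross_increment_right) auto
  have "ksign (tree_degree S + tree_degree T + (below k j (lf S) + below k j (lf T)) + (tree_degree T * lsum k S + (cross k (lf S) (lf T) + a))) =
    ksign (tree_degree T * lsum k S + cross k (lf S) (lf T) + (tree_degree S + lsum k S) + tree_degree T + below k j (lf T))"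
   unfolding ls by (rule ksign_eqI) (auto simp: algebra_simps)
  moreover have "ev_at_d x k j (Mu S T) = ksign (tree_degree T * lsum k S + (cross k (lf S) (lf T) + a)) *r prd (ev x k S) (ev_at_d x k j T)"
   using ev_at_d_notin[OF jS] by (simp add: ev_at_d_def ls' cr)
  ultimately show "ksign (tree_degree (Mu S T)) *r ksign (below k j (lf (Mu S T))) *r ev_at_d x k j (Mu S T) =
    (?e * ksign (tree_degree S + lsum k S) * ksign (tree_degree T)) *r ksign (below k j (lf T)) *r prd (ev x k S) (ev_at_d x k j T)"
   by (simp only: b scaleR_scaleR tree_degree.simps ksign_add[symmetric]) (simp only: add.assoc)
 qed
 moreover have "dA (ev x k (Mu S T)) = ?e *r (prd (dA (ev x k S)) (ev x k T) + ksign (tree_degree S + lsum k S) *r prd (ev x k S) (dA (ev x k T)))"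
  using linear_onD(2)[OF dA_linear prd_comp[OF eS eT]] leibniz[OF eS eT] by simp
 moreover have "(\<Sum>j\<in>lf (Mu S T). f j) = (\<Sum>j\<in>lf S. f j) + (\<Sum>j\<in>lf T. f j)" for f :: "nat => 'a"
  using d(3) by (simp add: sum.union_disjoint)
 ultimately show ?case
  unfolding lists left right by (simp add: scaleR_add_right mult.assoc)
qed

end

section \<open>Linear extension\<close>

lemma lookup_scaleR: "Poly_Mapping.lookup (c *r x) t = c * Poly_Mapping.lookup x t"
 for x :: "'t \<Rightarrow>\<^sub>0 real"
proof -
 have "finite {t. c *r Poly_Mapping.lookup x t \<noteq> 0}"
  by (rule finite_subset[OF _ finite_keys[of x]]) (auto simp: in_keys_iff)
 then show ?thesis
  by (simp add: scaleR_poly_mapping_def Abs_poly_mapping_inverse)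
qed

lemma keys_scaleR: "Poly_Mapping.keys (c *r x) \<subseteq> Poly_Mapping.keys x" for x :: "'t \<Rightarrow>\<^sub>0 real"
 by (auto simp: in_keys_iff lookup_scaleR)

lemma linear_lin_ext: "linear (lin_ext f)"
proof (rule linearI)
 fix x y :: "'a \<Rightarrow>\<^sub>0 real" and c
 let ?K = "Poly_Mapping.keys x \<union> Poly_Mapping.keys y"
 have K: "Poly_Mapping.keys (x + y) \<subseteq> ?K" "finite ?K"
  by (auto simp: in_keys_iff lookup_add)
 show "lin_ext f (x + y) = lin_ext f x + lin_ext f y"
  unfolding lin_ext_superset[OF K(2,1)] lin_ext_superset[OF K(2) Un_upper1] lin_ext_superset[OF K(2) Un_upper2]
  by (simp add: lookup_add scaleR_add_left sum.distrib)
 show "lin_ext f (c *r x) = c *r lin_ext f x"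
  unfolding lin_ext_superset[OF finite_keys keys_scaleR]
  by (simp add: lin_ext_def lookup_scaleR scaleR_sum_right)
qed

lemmas lin_ext_add = linear_add[OF linear_lin_ext]
 and lin_ext_scale = linear_scale[OF linear_lin_ext]
 and lin_ext_sum = linear_sum[OF linear_lin_ext]

lemma lin_ext_0 [simp]: "lin_ext f 0 = 0"
 by (simp add: lin_ext_def)

lemma lin_ext_fun_0 [simp]: "lin_ext (%t. 0) x = 0"
 by (simp add: lin_ext_def)

lemma lin_ext_tree [simp]: "lin_ext f (Poly_Mapping.single t 1) = f t"
 by (simp add: lin_ext_def)

lemma lin_ext_cong: "(!!t. t \<in> Poly_Mapping.keys x ==> f t = g t) ==> lin_ext f x = lin_ext g x"
 by (simp add: lin_ext_def)

lemma lin_ext_compose: "lin_ext g (lin_ext h x) = lin_ext (%t. lin_ext g (h t)) x"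
 unfolding lin_ext_def[of h] lin_ext_def[of "%t. lin_ext g (h t)"] by (simp add: lin_ext_sum lin_ext_scale)

lemma lin_ext_swap: "lin_ext (%t. lin_ext (%u. f t u) y) x = lin_ext (%u. lin_ext (%t. f t u) x) y"
 unfolding lin_ext_def scaleR_sum_right by (subst sum.swap) (simp add: mult.commute)

lemma lin_ext_fun_scale: "lin_ext (%t. c *r f t) x = c *r lin_ext f x"
 by (simp add: lin_ext_def scaleR_sum_right mult.commute)

lemma lin_ext_fun_sum: "lin_ext (%t. \<Sum>j\<in>J. f j t) x = (\<Sum>j\<in>J. lin_ext (f j) x)"
 unfolding lin_ext_def scaleR_sum_right by (rule sum.swap)

lemma lin_ext_fun_add: "lin_ext (%t. f t + g t) x = lin_ext f x + lin_ext g x"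
 by (simp add: lin_ext_def scaleR_add_right sum.distrib)

lemma lin_ext_singles: "lin_ext (%t. Poly_Mapping.single t 1) x = x"
proof (rule poly_mapping_eqI)
 fix t
 have "Poly_Mapping.lookup (\<Sum>s\<in>K. c s *r Poly_Mapping.single s (1::real)) t = (\<Sum>s\<in>K. c s * (1 when s = t))"
  if "finite K" for K :: "'a set" and c :: "'a => real"
  using that by (induction K rule: finite_induct) (auto simp: lookup_add lookup_scaleR lookup_single)
 then have "Poly_Mapping.lookup (lin_ext (%t. Poly_Mapping.single t 1) x) t =
   (\<Sum>s\<in>Poly_Mapping.keys x. Poly_Mapping.lookup x s * (1 when s = t))"
  by (simp add: lin_ext_def)
 also have "... = (\<Sum>s\<in>Poly_Mapping.keys x. if s = t then Poly_Mapping.lookup x s else 0)"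
  by (intro sum.cong) (auto simp: when_def)
 finally show "Poly_Mapping.lookup (lin_ext (%t. Poly_Mapping.single t 1) x) t = Poly_Mapping.lookup x t"
  by (simp add: in_keys_iff)
qed

lemma tree_arity_unique: "tree_arity m T ==> tree_arity n T \<longleftrightarrow> n = m"
 by (auto simp: tree_arity_def)

lemma lin_ext_tree_diff_list: "lin_ext g (\<Sum>(c, U)\<leftarrow>l. c *r tree U) = (\<Sum>cU\<leftarrow>l. fst cU *r g (snd cU))"
 by (induction l) (auto simp: lin_ext_add lin_ext_scale)

context ebv_data
begin

lemma lin_ext_linear_on:
 assumes "subspace W" "linear_map_on W f" "!!t. t \<in> Poly_Mapping.keys x ==> g t \<in> W"
 shows "f (lin_ext g x) = lin_ext (%t. f (g t)) x"
 unfolding lin_ext_def by (rule linear_on_sum[OF assms])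

lemma lin_ext_mem:
 assumes "subspace W" "!!t. t \<in> Poly_Mapping.keys x ==> g t \<in> W"
 shows "lin_ext g x \<in> W"
 unfolding lin_ext_def using assms by (intro subspace_sum subspace_scale)

section \<open>Evaluation vanishes on the ideal of relations\<close>

text \<open>
  Evaluation restricted to one arity and one degree.  The ideal is closed under composition with inhomogeneous
  elements, and the sign of a composite depends on the degree of the inner factor; so vanishing has to be
  shown in each degree separately.
\<close>
definition evr :: "nat => (nat => 'a) => (nat => int) => int => ebv_tree => 'a" where
 "evr n x k r T = (if tree_arity n T \<and> tree_degree T = r then ev x k T else 0)"

lemma evr_comp: "hom x k {..<n} ==> evr n x k r T \<in> V (r + (\<Sum>a<n. k a))"
proof (cases "tree_arity n T \<and> tree_degree T = r")
 case True
 assume "hom x k {..<n}"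
 with True show ?thesis using ev_comp[of T x k] by (simp add: evr_def tree_arity_def lsum_def)
next
 case False
 then show ?thesis using subspace_0[OF V_subspace] by (simp only: evr_def if_False)
qed

lemma lin_ext_evr_comp: "hom x k {..<n} ==> lin_ext (evr n x k r) y \<in> V (r + (\<Sum>a<n. k a))"
 by (intro lin_ext_mem[OF V_subspace] evr_comp)

lemma evr_relation:
 assumes "y \<in> ebv_relations" "hom x k {..<n}"
 shows "lin_ext (evr n x k r) y = 0"
proof -
 have evr: "evr n x k r T = (if n = m \<and> r = s then ev x k T else 0)" if "tree_arity m T" "tree_degree T = s" for m s T
  using that tree_arity_unique[of m T n] by (auto simp: evr_def)
 have ar: "tree_arity 2 (Mu (Leaf 0) (Leaf 1))" "tree_arity 2 (Mu (Leaf 1) (Leaf 0))"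
  "tree_arity 3 (Mu (Mu (Leaf 0) (Leaf 1)) (Leaf 2))" "tree_arity 3 (Mu (Leaf 0) (Mu (Leaf 1) (Leaf 2)))"
  "tree_arity 1 (Iop (DIop (Leaf 0)))" "tree_arity 1 (DIop (Iop (Leaf 0)))"
  "tree_arity 3 (Iop (Mu (Mu (Leaf 0) (Leaf 1)) (Leaf 2)))"
  "tree_arity 3 (Mu (Iop (Mu (Leaf 0) (Leaf 1))) (Leaf 2))"
  "tree_arity 3 (Mu (Iop (Mu (Leaf 0) (Leaf 2))) (Leaf 1))"
  "tree_arity 3 (Mu (Iop (Mu (Leaf 1) (Leaf 2))) (Leaf 0))"
  "tree_arity 3 (Mu (Mu (Iop (Leaf 0)) (Leaf 1)) (Leaf 2))"
  "tree_arity 3 (Mu (Mu (Iop (Leaf 1)) (Leaf 0)) (Leaf 2))"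
  "tree_arity 3 (Mu (Mu (Iop (Leaf 2)) (Leaf 0)) (Leaf 1))"
  by (simp_all add: tree_arity_def lessThan_nat_numeral lessThan_Suc numeral_3_eq_3 numeral_2_eq_2 insert_commute)
 note e = evr[OF ar(1) refl] evr[OF ar(2) refl] evr[OF ar(3) refl] evr[OF ar(4) refl] evr[OF ar(5) refl]
  evr[OF ar(6) refl] evr[OF ar(7) refl] evr[OF ar(8) refl] evr[OF ar(9) refl] evr[OF ar(10) refl]
  evr[OF ar(11) refl] evr[OF ar(12) refl] evr[OF ar(13) refl]
 have x: "x a \<in> V (k a)" if "a < n" for a using assms(2) that by (auto simp: hom_def)
 note l = lin_ext_minus lin_ext_add lin_ext_tree
 consider "y = tree (Mu (Leaf 0) (Leaf 1)) - tree (Mu (Leaf 1) (Leaf 0))"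
  | "y = tree (Mu (Mu (Leaf 0) (Leaf 1)) (Leaf 2)) - tree (Mu (Leaf 0) (Mu (Leaf 1) (Leaf 2)))"
  | "y = tree (Iop (DIop (Leaf 0))) - tree (DIop (Iop (Leaf 0)))"
  | "y = tree (Iop (Mu (Mu (Leaf 0) (Leaf 1)) (Leaf 2)))
    - (tree (Mu (Iop (Mu (Leaf 0) (Leaf 1))) (Leaf 2))
     + tree (Mu (Iop (Mu (Leaf 0) (Leaf 2))) (Leaf 1))
     + tree (Mu (Iop (Mu (Leaf 1) (Leaf 2))) (Leaf 0))
     - tree (Mu (Mu (Iop (Leaf 0)) (Leaf 1)) (Leaf 2))
     - tree (Mu (Mu (Iop (Leaf 1)) (Leaf 0)) (Leaf 2))
     - tree (Mu (Mu (Iop (Leaf 2)) (Leaf 0)) (Leaf 1)))"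
  using assms(1) unfolding ebv_relations_def by blast
 then show ?thesis
 proof cases
  case 1
  show ?thesis
  proof (cases "n = 2 \<and> r = 0")
   case True
   then show ?thesis
    unfolding 1 l e using prd_commute[OF x x, of 0 1] by (simp add: cross_def)
  next
   case False
   then show ?thesis unfolding 1 l e by auto
  qed
 next
  case 2
  show ?thesis
  proof (cases "n = 3 \<and> r = 0")
   case True
   then show ?thesis
    unfolding 2 l e using prd_assoc[OF x x x, of 0 1 2] by (simp add: cross_def)
  next
   case False
   then show ?thesis unfolding 2 l e by auto
  qed
 next
  case 3
  show ?thesis
  proof (cases "n = 1 \<and> r = -3")
   case True
   then show ?thesis
    unfolding 3 l e using iop_di[OF x, of 0] by simp
  next
   case False
   then show ?thesis unfolding 3 l e by auto
  qed
 next
  case 4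
  show ?thesis
  proof (cases "n = 3 \<and> r = -2")
   case True
   then have "x 0 \<in> V (k 0)" "x 1 \<in> V (k 1)" "x 2 \<in> V (k 2)" using x by auto
   note x = this
   note scale = linear_onD(2)[OF prd_linear_left[OF x(3)] prd_comp[OF iop_comp[OF x(2)] x(1)]]
    linear_onD(2)[OF prd_linear_left[OF x(2)] prd_comp[OF iop_comp[OF x(3)] x(1)]]
   from iop_second_order[OF x] True show ?thesis
    unfolding 4 l e using scale by (simp add: cross_def ksign_add mult.commute)
  next
   case False
   then show ?thesis unfolding 4 l e by auto
  qed
 qed
qed

definition circ_term :: "nat => nat => nat => (nat => 'a) => (nat => int) => ebv_tree => ebv_tree => 'a" where
 "circ_term m n i x k T U = (if tree_arity m T \<and> tree_arity n U
   then ksign (tree_degree U * (\<Sum>a<i. k a)) *r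
    ev (graft_inputs n i (ev (%b. x (i + b)) (%b. k (i + b)) U) x) (graft_degrees n i (tree_degree U) k) T
   else 0)"

lemma hom_graft:
 assumes "i < m" "hom x k {..<m + n - 1}" "v \<in> V (s + (\<Sum>c<n. k (i + c)))"
 shows "hom (graft_inputs n i v x) (graft_degrees n i s k) {..<m}"
 using assms by (auto simp: hom_def graft_inputs_def graft_degrees_def shift_def)

lemma hom_block:
 assumes "i < m" "hom x k {..<m + n - 1}"
 shows "hom (%b. x (i + b)) (%b. k (i + b)) {..<n}"
 using assms by (auto simp: hom_def)

lemma circ_term_eq:
 assumes h: "hom x k {..<m + n - 1}" and i: "i < m" and T: "tree_arity m T" and U: "tree_arity n U"
 shows "evr N x k r (graft n i T U) = (if N = m + n - 1 \<and> tree_degree T + tree_degree U = r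
   then ksign (tree_degree U * degree_after i T) *r circ_term m n i x k T U else 0)"
proof -
 have ar: "tree_arity (m + n - 1) (graft n i T U)" by (rule tree_arity_graft[OF T U i])
 have dg: "tree_degree (graft n i T U) = tree_degree T + tree_degree U"
  using T i by (simp add: tree_arity_def tree_degree_graft)
 have n: "0 < n" by (rule tree_arity_pos[OF U])
 have T': "distinct (leaves T)" "lf T = {..<m}" and U': "distinct (leaves U)" "lf U = {..<n}"
  using T U by (auto simp: tree_arity_def)
 have h': "hom x k (lf (graft n i T U))" using h ar by (simp add: tree_arity_def)
 have "below (graft_degrees n i (tree_degree U) k) i {..<m} = (\<Sum>a\<in>{a\<in>{..<m}. a < i}. graft_degrees n i (tree_degree U) k a)"
  unfolding below_def by (rule sum.inter_filter[symmetric]) simp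
 also have "{a\<in>{..<m}. a < i} = {..<i}" using i by auto
 also have "(\<Sum>a<i. graft_degrees n i (tree_degree U) k a) = (\<Sum>a<i. k a)"
  by (intro sum.cong) (auto simp: graft_degrees_def shift_def)
 finally have b: "below (graft_degrees n i (tree_degree U) k) i {..<m} = (\<Sum>a<i. k a)" .
 have "ev x k (graft n i T U) = ksign (tree_degree U * degree_after i T) *r circ_term m n i x k T U"
  using conjunct1[OF ev_graft[OF T'(1) U' n h']] T U i
  unfolding circ_term_def by (simp add: T'(2) b ksign_add distrib_left)
 then show ?thesis
  unfolding evr_def using tree_arity_unique[OF ar, of N] dg by auto
qed

lemma evr_free_circ:
 assumes h: "hom x k {..<m + n - 1}" and i: "i < m"
 shows "lin_ext (evr N x k r) (free_circ m n i p q) = (if N = m + n - 1 then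
  lin_ext (%T. lin_ext (%U. if tree_degree T + tree_degree U = r then circ_term m n i x k T U else 0) q) p else 0)"
proof -
 have t: "lin_ext (evr N x k r) (if i < m \<and> tree_arity m T \<and> tree_arity n U
    then ksign (tree_degree U * degree_after i T) *r tree (graft n i T U) else 0) =
   (if N = m + n - 1 \<and> tree_degree T + tree_degree U = r then circ_term m n i x k T U else 0)" for T U
 proof (cases "tree_arity m T \<and> tree_arity n U")
  case True
  then show ?thesis
   using i by (simp add: lin_ext_scale circ_term_eq[OF h i])
 next
  case False
  then show ?thesis by (auto simp: circ_term_def)
 qed
 show ?thesis
  unfolding free_circ_def lin_ext_compose t by simp
qed

lemma circ_term_right:
 assumes h: "hom x k {..<m + n - 1}" and i: "i < m" and T: "tree_arity m T"
 shows "lin_ext (%U. if tree_degree U = s then circ_term m n i x k T U else 0) q =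
  ksign (s * (\<Sum>a<i. k a)) *r ev (graft_inputs n i (lin_ext (evr n (%b. x (i + b)) (%b. k (i + b)) s) q) x) (graft_degrees n i s k) T"
proof -
 let ?v = "evr n (%b. x (i + b)) (%b. k (i + b)) s" and ?l = "graft_degrees n i s k"
 have h': "hom (%b. x (i + b)) (%b. k (i + b)) {..<n}" by (rule hom_block[OF i h])
 have li: "?l i = s + (\<Sum>c<n. k (i + c))" by (simp add: graft_degrees_def)
 have upd: "graft_inputs n i v x = (graft_inputs n i 0 x)(i := v)" for v
  by (auto simp: graft_inputs_def)
 have "hom (graft_inputs n i 0 x) ?l (lf T - {i})"
  using hom_graft[OF i h subspace_0[OF V_subspace], of s] T by (auto simp: hom_def tree_arity_def)
 then have "linear_map_on (V (?l i)) (%v. ev ((graft_inputs n i 0 x)(i := v)) ?l T)"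
  using T i by (intro ev_linear) (auto simp: tree_arity_def)
 then have lin: "linear_map_on (V (?l i)) (%v. ev (graft_inputs n i v x) ?l T)"
  by (simp only: upd[symmetric])
 have "lin_ext (%U. if tree_degree U = s then circ_term m n i x k T U else 0) q =
   lin_ext (%U. ksign (s * (\<Sum>a<i. k a)) *r ev (graft_inputs n i (?v U) x) ?l T) q"
 proof (rule lin_ext_cong)
  fix U
  show "(if tree_degree U = s then circ_term m n i x k T U else 0) = ksign (s * (\<Sum>a<i. k a)) *r ev (graft_inputs n i (?v U) x) ?l T"
   using T linear_on_0[OF V_subspace lin] by (auto simp: circ_term_def evr_def)
 qed
 also have "... = ksign (s * (\<Sum>a<i. k a)) *r lin_ext (%U. ev (graft_inputs n i (?v U) x) ?l T) q"
  by (rule lin_ext_fun_scale)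
 also have "lin_ext (%U. ev (graft_inputs n i (?v U) x) ?l T) q = ev (graft_inputs n i (lin_ext ?v q) x) ?l T"
  using evr_comp[OF h', of s] by (intro lin_ext_linear_on[OF V_subspace lin, symmetric]) (simp add: li)
 finally show ?thesis .
qed

lemma evr_free_perm_act:
 assumes "si permutes {..<m}" "hom x k {..<m}"
 shows "lin_ext (evr n x k r) (free_perm_act m si p) =
  (if n = m then ksign (inversion_exponent k si {..<m}) *r lin_ext (evr m (%a. x (si a)) (%a. k (si a)) r) p else 0)"
proof -
 have im: "si ` {..<m} = {..<m}" by (rule permutes_image[OF assms(1)])
 have h: "hom (%a. x (si a)) (%a. k (si a)) {..<m}"
  using assms(2) im unfolding hom_def by blast
 have "lin_ext (evr n x k r) (if si permutes {..<m} \<and> tree_arity m T then tree (relabel si T) else 0) =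
   (if n = m then ksign (inversion_exponent k si {..<m}) *r evr m (%a. x (si a)) (%a. k (si a)) r T else 0)" for T
 proof (cases "tree_arity m T")
  case True
  then have T: "distinct (leaves T)" "lf T = {..<m}" by (auto simp: tree_arity_def)
  have inj: "inj_on si (lf T)" using permutes_inj_on[OF assms(1)] by blast
  have "tree_arity m (relabel si T)"
   unfolding tree_arity_def leaves_relabel using T inj im by (simp add: distinct_map)
  then show ?thesis
   using True assms(1) ev_relabel[OF T(1) inj, of x k] h T(2)
   by (auto simp: evr_def tree_degree_relabel dest: tree_arity_unique)
 qed (simp add: evr_def)
 then show ?thesis
  unfolding free_perm_act_def lin_ext_compose by (simp add: lin_ext_fun_scale)
qed

lemma evr_free_diff:
 assumes h: "hom x k {..<n}"
 shows "lin_ext (evr n x k r) (free_diff p) = dA (lin_ext (evr n x k (r - 1)) p)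
  + ksign r *r (\<Sum>j<n. ksign (\<Sum>a<j. k a) *r lin_ext (evr n (x(j := dA (x j))) (k(j := k j + 1)) (r - 1)) p)"
proof -
 have t: "lin_ext (evr n x k r) (\<Sum>(c, U)\<leftarrow>tree_diff T. c *r tree U) = dA (evr n x k (r - 1) T)
   + ksign r *r (\<Sum>j<n. ksign (\<Sum>a<j. k a) *r evr n (x(j := dA (x j))) (k(j := k j + 1)) (r - 1) T)" for T
 proof (cases "tree_arity n T \<and> tree_degree T = r - 1")
  case True
  then have T: "distinct (leaves T)" "lf T = {..<n}" by (auto simp: tree_arity_def)
  have b: "below k j {..<n} = (\<Sum>a<j. k a)" if "j < n" for j
  proof -
   have "below k j {..<n} = (\<Sum>a\<in>{a\<in>{..<n}. a < j}. k a)"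
    unfolding below_def by (rule sum.inter_filter[symmetric]) simp
   also have "{a\<in>{..<n}. a < j} = {..<j}" using that by auto
   finally show ?thesis .
  qed
  have "evr n x k r (snd cU) = ev x k (snd cU)" if "cU \<in> set (tree_diff T)" for cU
   using tree_diff_leaves[OF that] True by (simp add: evr_def tree_arity_def)
  then have "lin_ext (evr n x k r) (\<Sum>(c, U)\<leftarrow>tree_diff T. c *r tree U) = ev_list x k (tree_diff T)"
   unfolding lin_ext_tree_diff_list ev_list_def by (intro arg_cong[where f = sum_list] map_cong refl) simp
  moreover have "dA (ev x k T) = ev_list x k (tree_diff T) - ksign r *r (\<Sum>j<n. ksign (\<Sum>a<j. k a) *r ev_at_d x k j T)"
  proof -
   have "(\<Sum>j<n. ksign (below k j {..<n}) *r ev_at_d x k j T) = (\<Sum>j<n. ksign (\<Sum>a<j. k a) *r ev_at_d x k j T)"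
    using b by (intro sum.cong refl) simp
   then show ?thesis using ev_diff[OF T(1), of x k] h True by (simp add: T(2))
  qed
  ultimately show ?thesis using True by (simp add: evr_def ev_at_d_def)
 next
  case False
  then have "evr n y l (r - 1) T = 0" for y l by (auto simp: evr_def)
  moreover have "evr n x k r (snd cU) = 0" if "cU \<in> set (tree_diff T)" for cU
  proof -
   have "leaves (snd cU) = leaves T" "tree_degree (snd cU) = tree_degree T + 1"
    using tree_diff_leaves[OF that] by auto
   then have "\<not> (tree_arity n (snd cU) \<and> tree_degree (snd cU) = r)"
    using False unfolding tree_arity_def by simp linarith
   then show ?thesis by (simp only: evr_def if_False)
  qed
  then have "(\<Sum>cU\<leftarrow>tree_diff T. fst cU *r evr n x k r (snd cU)) = (\<Sum>cU\<leftarrow>tree_diff T. 0)"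
   by (intro arg_cong[where f = sum_list] map_cong refl) simp
  ultimately show ?thesis
   unfolding lin_ext_tree_diff_list by (simp add: linear_on_0[OF V_subspace dA_linear])
 qed
 have "lin_ext (%T. dA (evr n x k (r - 1) T)) p = dA (lin_ext (evr n x k (r - 1)) p)"
  by (rule lin_ext_linear_on[OF V_subspace dA_linear evr_comp[OF h], symmetric])
 then show ?thesis
  unfolding free_diff_def lin_ext_compose t
  by (simp add: lin_ext_fun_add lin_ext_fun_scale lin_ext_fun_sum)
qed

text \<open>
  For a composite with a relation on the left, the right factor becomes an input; for one on the right, the value
  of the relation is an input of the left factor, in which that factor is linear.
\<close>
lemma evr_ideal:
 assumes "y \<in> ebv_ideal" "hom x k {..<n}"
 shows "lin_ext (evr n x k r) y = 0"
 using assms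
proof (induction y arbitrary: n x k r rule: ebv_ideal.induct)
 case (relation y)
 then show ?case by (rule evr_relation)
next
 case (circ_left p m n' i q)
 show ?case
 proof (cases "i < m \<and> n = m + n' - 1")
  case True
  then have i: "i < m" and h: "hom x k {..<m + n' - 1}" using circ_left.prems by auto
  have "lin_ext (%T. if tree_degree T + tree_degree U = r then circ_term m n' i x k T U else 0) p = 0" for U
  proof (cases "tree_arity n' U")
   case U: True
   let ?x = "graft_inputs n' i (ev (%b. x (i + b)) (%b. k (i + b)) U) x" and ?k = "graft_degrees n' i (tree_degree U) k"
   have "ev (%b. x (i + b)) (%b. k (i + b)) U \<in> V (tree_degree U + (\<Sum>c<n'. k (i + c)))"
    using ev_comp[of U "%b. x (i + b)" "%b. k (i + b)"] U hom_block[OF i h] by (simp add: tree_arity_def lsum_def)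
   then have "hom ?x ?k {..<m}" by (rule hom_graft[OF i h])
   from circ_left.IH[OF this] have "lin_ext (evr m ?x ?k (r - tree_degree U)) p = 0" .
   moreover have "(if tree_degree T + tree_degree U = r then circ_term m n' i x k T U else 0) =
     ksign (tree_degree U * (\<Sum>a<i. k a)) *r evr m ?x ?k (r - tree_degree U) T" for T
    using U by (auto simp: circ_term_def evr_def)
   ultimately show ?thesis by (simp add: lin_ext_fun_scale)
  next
   case False
   then have "circ_term m n' i x k T U = 0" for T by (simp add: circ_term_def)
   then show ?thesis by (simp cong: if_cong)
  qed
  then show ?thesis
   unfolding evr_free_circ[OF h i] lin_ext_swap[where x = p and y = q] by simp
 next
  case False
  show ?thesis
  proof (cases "i < m")
   case i: True
   show ?thesis
   proof (cases "n' = 0")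
    case True
    then have "\<not> tree_arity n' U" for U using tree_arity_pos by blast
    then show ?thesis by (simp add: free_circ_def)
   next
    case n': False
    have t: "lin_ext (evr n x k r) (if i < m \<and> tree_arity m T \<and> tree_arity n' U
     then ksign (tree_degree U * degree_after i T) *r tree (graft n' i T U) else 0) = 0" for T U
     using tree_arity_graft[OF _ _ i, of T n' U] False i by (auto simp: lin_ext_scale evr_def dest: tree_arity_unique)
    show ?thesis unfolding free_circ_def lin_ext_compose t by simp
   qed
  qed (simp add: free_circ_def)
 qed
next
 case (circ_right q m n' i p)
 show ?case
 proof (cases "i < m \<and> n = m + n' - 1 \<and> 0 < n'")
  case True
  then have i: "i < m" and n': "0 < n'" and h: "hom x k {..<m + n' - 1}" using circ_right.prems by auto
  have "lin_ext (%U. if tree_degree T + tree_degree U = r then circ_term m n' i x k T U else 0) q = 0" for T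
  proof (cases "tree_arity m T")
   case T: True
   let ?s = "r - tree_degree T"
   have q: "lin_ext (evr n' (%b. x (i + b)) (%b. k (i + b)) ?s) q = 0"
    by (rule circ_right.IH[OF hom_block[OF i h]])
   have "ev (graft_inputs n' i 0 x) (graft_degrees n' i ?s k) T = 0"
    using T i hom_graft[OF i h subspace_0[OF V_subspace], of ?s]
    by (intro ev_zero[of _ _ _ i]) (auto simp: tree_arity_def graft_inputs_def)
   moreover have "(tree_degree T + tree_degree U = r) = (tree_degree U = ?s)" for U by auto
   ultimately show ?thesis by (simp add: circ_term_right[OF h i T] q)
  next
   case False
   then have "circ_term m n' i x k T U = 0" for U by (simp add: circ_term_def)
   then show ?thesis by (simp cong: if_cong)
  qed
  then show ?thesis unfolding evr_free_circ[OF h i] by simp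
 next
  case False
  have t: "lin_ext (evr n x k r) (if i < m \<and> tree_arity m T \<and> tree_arity n' U
    then ksign (tree_degree U * degree_after i T) *r tree (graft n' i T U) else 0) = 0" for T U
   using tree_arity_graft[of m T n' U i] tree_arity_pos[of n' U] False by (auto simp: lin_ext_scale evr_def dest: tree_arity_unique)
  show ?thesis unfolding free_circ_def lin_ext_compose t by simp
 qed
next
 case (perm_act p m si)
 show ?case
 proof (cases "si permutes {..<m} \<and> n = m")
  case True
  then have s: "si permutes {..<m}" and h: "hom x k {..<m}" using perm_act.prems by auto
  have "hom (%a. x (si a)) (%a. k (si a)) {..<m}"
   using h permutes_image[OF s] unfolding hom_def by blast
  then show ?thesis unfolding evr_free_perm_act[OF s h] using perm_act.IH by simp
 next
  case False
  have t: "lin_ext (evr n x k r) (if si permutes {..<m} \<and> tree_arity m T then tree (relabel si T) else 0) = 0" for T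
  proof (cases "si permutes {..<m} \<and> tree_arity m T")
   case True
   then have "lf (relabel si T) = {..<m}"
    using permutes_image[of si "{..<m}"] by (simp add: leaves_relabel tree_arity_def)
   then show ?thesis using True False by (auto simp: evr_def tree_arity_def)
  qed auto
  show ?thesis unfolding free_perm_act_def lin_ext_compose t by simp
 qed
next
 case (diff p)
 have "hom (x(j := dA (x j))) (k(j := k j + 1)) {..<n}" for j
  using diff.prems dA_comp by (auto simp: hom_def)
 note z = diff.IH[OF this] diff.IH[OF diff.prems]
 show ?case
  unfolding evr_free_diff[OF diff.prems] z by (simp add: linear_on_0[OF V_subspace dA_linear])
qed (simp_all add: lin_ext_add lin_ext_scale)

end

section \<open>The algebra structure\<close>

definition hcomp :: "nat => int => (ebv_tree \<Rightarrow>\<^sub>0 real) set" where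
 "hcomp n k = {y. \<forall>T\<in>Poly_Mapping.keys y. tree_arity n T \<and> tree_degree T = k}"

lemma ebv_operad_sel:
 "comps (arity ebv_operad n) k = abs_ebv ` hcomp n k"
 "differential (arity ebv_operad n) = ebv_diff"
 "op_unit ebv_operad = abs_ebv (tree (Leaf 0))"
 "circ ebv_operad = ebv_circ"
 "perm_act ebv_operad = ebv_perm_act"
 by (simp_all add: ebv_operad_def hcomp_def)

lemma hcomp_subspace: "subspace (hcomp n k)"
proof (rule subspaceI)
 show "0 \<in> hcomp n k" by (simp add: hcomp_def)
 show "x + y \<in> hcomp n k" if "x \<in> hcomp n k" "y \<in> hcomp n k" for x y
  using that keys_add[of x y] by (auto simp: hcomp_def)
 show "c *r x \<in> hcomp n k" if "x \<in> hcomp n k" for c x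
  using that keys_scaleR[of c x] by (auto simp: hcomp_def)
qed

lemma tree_hcomp: "tree T \<in> hcomp n k \<longleftrightarrow> tree_arity n T \<and> tree_degree T = k"
 by (simp add: hcomp_def)

lemma homogeneous_iff: "homogeneous A ks xs \<longleftrightarrow> length ks = length xs \<and> (\<forall>j<length xs. xs ! j \<in> comps A (ks ! j))"
 by (auto simp: homogeneous_def list_all2_conv_all_nth)

context ebv_data
begin

lemma free_circ_hcomp: "p \<in> hcomp m k ==> q \<in> hcomp n l ==> free_circ m n i p q \<in> hcomp (m + n - 1) (k + l)"
 unfolding free_circ_def
proof (intro lin_ext_mem hcomp_subspace)
 fix T U assume "p \<in> hcomp m k" "q \<in> hcomp n l" "T \<in> Poly_Mapping.keys p" "U \<in> Poly_Mapping.keys q"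
 then have T: "tree_arity m T" "tree_degree T = k" and U: "tree_arity n U" "tree_degree U = l"
  by (auto simp: hcomp_def)
 show "(if i < m \<and> tree_arity m T \<and> tree_arity n U then ksign (tree_degree U * degree_after i T) *r tree (graft n i T U) else 0)
   \<in> hcomp (m + n - 1) (k + l)"
 proof (cases "i < m")
  case True
  have "tree (graft n i T U) \<in> hcomp (m + n - 1) (k + l)"
   using tree_arity_graft[OF T(1) U(1) True] T U True
   by (simp add: tree_hcomp tree_degree_graft tree_arity_def[of m])
  then show ?thesis by (simp add: subspace_scale[OF hcomp_subspace] subspace_0[OF hcomp_subspace])
 qed (simp add: subspace_0[OF hcomp_subspace])
qed

lemma tree_arity_relabel:
 assumes "si permutes {..<n}" "tree_arity n T" shows "tree_arity n (relabel si T)"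
 using assms permutes_inj_on[OF assms(1)] permutes_image[OF assms(1)]
 by (auto simp: tree_arity_def leaves_relabel distinct_map)

lemma free_perm_act_hcomp: "p \<in> hcomp n k ==> free_perm_act n si p \<in> hcomp n k"
 unfolding free_perm_act_def
proof (intro lin_ext_mem hcomp_subspace)
 fix T assume "p \<in> hcomp n k" "T \<in> Poly_Mapping.keys p"
 then have "tree_arity n T" "tree_degree T = k" by (auto simp: hcomp_def)
 then show "(if si permutes {..<n} \<and> tree_arity n T then tree (relabel si T) else 0) \<in> hcomp n k"
  by (auto simp: subspace_0[OF hcomp_subspace] tree_hcomp tree_arity_relabel tree_degree_relabel)
qed

lemma free_diff_hcomp: "p \<in> hcomp n k ==> free_diff p \<in> hcomp n (k + 1)"
 unfolding free_diff_def
proof (intro lin_ext_mem hcomp_subspace)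
 fix T assume "p \<in> hcomp n k" "T \<in> Poly_Mapping.keys p"
 then have T: "tree_arity n T" "tree_degree T = k" by (auto simp: hcomp_def)
 have "(\<Sum>(c, U)\<leftarrow>l. c *r tree U) \<in> hcomp n (k + 1)" if "set l \<subseteq> set (tree_diff T)" for l
  using that
 proof (induction l)
  case (Cons cU l)
  then have "tree (snd cU) \<in> hcomp n (k + 1)"
   using tree_diff_leaves[of cU T] T by (simp add: tree_hcomp tree_arity_def)
  then show ?case using Cons
   by (simp add: case_prod_unfold subspace_add[OF hcomp_subspace] subspace_scale[OF hcomp_subspace])
 qed (simp add: subspace_0[OF hcomp_subspace])
 then show "(\<Sum>(c, U)\<leftarrow>tree_diff T. c *r tree U) \<in> hcomp n (k + 1)" by blast
qed

lemma abs_ebv_add: "abs_ebv x + abs_ebv y = abs_ebv (x + y)"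
 and abs_ebv_scale: "c *r abs_ebv x = abs_ebv (c *r x)"
 and abs_ebv_0: "abs_ebv 0 = 0"
 by (simp_all add: plus_ebv.abs_eq scaleR_ebv.abs_eq zero_ebv_def)

lemma sum_list_take: "i \<le> length ks ==> sum_list (take i ks) = (\<Sum>a<i. ks ! a)" for ks :: "int list"
 by (simp add: sum_list_sum_nth atLeast0LessThan)

lemma nth_splice:
 assumes "i < m" "a < m" "length xs = m + n - 1"
 shows "(take i xs @ v # drop (i + n) xs) ! a = (if a = i then v else xs ! shift n i a)"
 using assms by (auto simp: nth_append nth_Cons' shift_def intro!: arg_cong[of _ _ "nth xs"])

lemma koszul_sign_inversion:
 assumes "length ks = n" shows "koszul_sign si ks = ksign (inversion_exponent (nth ks) si {..<n})"
proof -
 let ?P = "%p. fst p < snd p \<and> si (snd p) < si (fst p)" and ?f = "%p. ks ! si (fst p) * ks ! si (snd p)"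
 have "inversion_exponent (nth ks) si {..<n} = (\<Sum>p\<in>{..<n} \<times> {..<n}. if ?P p then ?f p else 0)"
  unfolding inversion_exponent_def by (simp add: sum.cartesian_product case_prod_unfold)
 also have "... = (\<Sum>p\<in>{p \<in> {..<n} \<times> {..<n}. ?P p}. ?f p)"
  by (rule sum.inter_filter[symmetric]) simp
 also have "{p \<in> {..<n} \<times> {..<n}. ?P p} = {(i, j). i < j \<and> j < length ks \<and> si i > si j}"
  using assms by auto
 finally have e: "inversion_exponent (nth ks) si {..<n} = (\<Sum>p\<in>{(i, j). i < j \<and> j < length ks \<and> si i > si j}. ?f p)" .
 have "finite {(i, j). i < j \<and> j < length ks \<and> si i > si j}"
  by (rule finite_subset[of _ "{..<n} \<times> {..<n}"]) (use assms in auto)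
 then show ?thesis
  unfolding e koszul_sign_def by (simp add: ksign_sum case_prod_unfold)
qed

lemma hom_nth: "homogeneous A ks xs ==> hom (nth xs) (nth ks) {..<length xs}"
 by (auto simp: homogeneous_iff hom_def)

lemma evr_cong: "(!!a. a < n ==> x a = y a) ==> (!!a. a < n ==> k a = l a) ==> evr n x k r = evr n y l r"
 unfolding evr_def tree_arity_def by (rule ext) (auto intro!: ev_cong)

text \<open>
  The degrees of the inputs are part of the sign but not of the data of an action, hence the choice.
  It is immaterial: a nonzero element has only one degree, and a zero input makes the value zero.
\<close>
definition theta :: "ebv => 'a list => 'a" where
 "theta p xs = lin_ext (%T. if tree_arity (length xs) T
   then ev (nth xs) (%j. SOME k. xs ! j \<in> V k) T else 0) (rep_ebv p)"

lemma theta_abs: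
 assumes "homogeneous A ks xs" "length xs = n" "y \<in> hcomp n r"
 shows "theta (abs_ebv y) xs = lin_ext (evr n (nth xs) (nth ks) r) y"
proof -
 let ?e = "%T. if tree_arity n T then ev (nth xs) (nth ks) T else 0"
 have h: "hom (nth xs) (nth ks) {..<n}" using hom_nth assms by blast
 have "hom (nth xs) (%j. SOME k. xs ! j \<in> V k) {..<n}"
  unfolding hom_def
 proof
  fix j assume "j \<in> {..<n}"
  then have "xs ! j \<in> V (ks ! j)" using h by (auto simp: hom_def)
  then show "xs ! j \<in> V (SOME k. xs ! j \<in> V k)" by (rule someI)
 qed
 then have "theta (abs_ebv y) xs = lin_ext ?e (rep_ebv (abs_ebv y))"
  unfolding theta_def assms(2)
 proof (intro lin_ext_cong if_cong refl)
  fix T assume "hom (nth xs) (%j. SOME k. xs ! j \<in> V k) {..<n}" "tree_arity n T"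
  then show "ev (nth xs) (%j. SOME k. xs ! j \<in> V k) T = ev (nth xs) (nth ks) T"
   using h by (intro ev_degree_irrelevant) (simp_all add: tree_arity_def)
 qed
 also have "... = lin_ext ?e y"
 proof -
  define z where "z = rep_ebv (abs_ebv y) - y"
  have "abs_ebv (rep_ebv (abs_ebv y)) = abs_ebv y" by (rule Quotient3_abs_rep[OF Quotient3_ebv])
  then have z: "z \<in> ebv_ideal" unfolding z_def by (simp only: ebv.abs_eq_iff)
  have "lin_ext ?e z = lin_ext (%T. \<Sum>r\<in>tree_degree ` Poly_Mapping.keys z. evr n (nth xs) (nth ks) r T) z"
  proof (rule lin_ext_cong)
   fix T assume "T \<in> Poly_Mapping.keys z"
   then show "?e T = (\<Sum>r\<in>tree_degree ` Poly_Mapping.keys z. evr n (nth xs) (nth ks) r T)"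
    by (auto simp: evr_def)
  qed
  also have "... = 0"
   unfolding lin_ext_fun_sum by (intro sum.neutral ballI evr_ideal z h)
  finally show ?thesis by (simp add: z_def lin_ext_minus)
 qed
 also have "... = lin_ext (evr n (nth xs) (nth ks) r) y"
  using assms(3) by (intro lin_ext_cong) (auto simp: evr_def hcomp_def)
 finally show ?thesis .
qed

lemma linear_map_on_lin_ext:
 assumes "!!T. linear_map_on W (%v. g v T)" shows "linear_map_on W (%v. lin_ext (g v) y)"
 unfolding linear_map_on_def
proof (intro conjI ballI allI)
 fix a b assume "a \<in> W" "b \<in> W"
 then have "g (a + b) = (%T. g a T + g b T)" using linear_onD(1)[OF assms] by blast
 then show "lin_ext (g (a + b)) y = lin_ext (g a) y + lin_ext (g b) y" by (simp only: lin_ext_fun_add)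
next
 fix c a assume "a \<in> W"
 then have "g (c *r a) = (%T. c *r g a T)" using linear_onD(2)[OF assms] by blast
 then show "lin_ext (g (c *r a)) y = c *r lin_ext (g a) y" by (simp only: lin_ext_fun_scale)
qed

lemma linear_map_on_cong:
 assumes "subspace W" "linear_map_on W f" "!!v. v \<in> W ==> g v = f v" shows "linear_map_on W g"
 using assms subspace_add[OF assms(1)] subspace_scale[OF assms(1)] by (auto simp: linear_map_on_def)

lemma homogeneous_update:
 assumes "homogeneous A ks xs" "j < length xs" "v \<in> V r"
 shows "homogeneous A (ks[j := r]) (xs[j := v])"
 using assms by (auto simp: homogeneous_iff nth_list_update)

lemma linear_map_on_evr:
 assumes "hom x k {..<n}" "j < n" shows "linear_map_on (V (k j)) (%v. evr n (x(j := v)) k r T)"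
proof (cases "tree_arity n T \<and> tree_degree T = r")
 case True
 then have "linear_map_on (V (k j)) (%v. ev (x(j := v)) k T)"
  using assms by (intro ev_linear) (auto simp: tree_arity_def hom_def)
 with True show ?thesis by (simp add: evr_def)
next
 case False
 then show ?thesis unfolding evr_def linear_map_on_def by (simp only: if_False) simp
qed

lemma theta_splice:
 assumes "i < m" "length ks = m + n - 1" "homogeneous A ks xs" "y \<in> hcomp m r"
  and "v \<in> V (s + (\<Sum>c<n. ks ! (i + c)))"
 shows "theta (abs_ebv y) (take i xs @ v # drop (i + n) xs) =
   lin_ext (evr m (graft_inputs n i v (nth xs)) (graft_degrees n i s (nth ks)) r) y"
  and "homogeneous A (take i ks @ (s + (\<Sum>c<n. ks ! (i + c))) # drop (i + n) ks) (take i xs @ v # drop (i + n) xs)"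
  and "length (take i xs @ v # drop (i + n) xs) = m"
proof -
 let ?w = "s + (\<Sum>c<n. ks ! (i + c))"
 let ?xs = "take i xs @ v # drop (i + n) xs" and ?ks = "take i ks @ ?w # drop (i + n) ks"
 have l: "length xs = m + n - 1" using assms by (simp add: homogeneous_iff)
 show len: "length ?xs = m" using l assms(1) by simp
 have x: "?xs ! a = graft_inputs n i v (nth xs) a" and k: "?ks ! a = graft_degrees n i s (nth ks) a" if "a < m" for a
  using nth_splice[OF assms(1) that l, of v] nth_splice[OF assms(1) that assms(2), of ?w]
  by (simp_all only: graft_inputs_def graft_degrees_def)
 have "hom (nth xs) (nth ks) {..<m + n - 1}" using hom_nth[OF assms(3)] l by simp
 from hom_graft[OF assms(1) this assms(5)] show hom: "homogeneous A ?ks ?xs"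
  using len l assms(1,2) x k by (simp add: homogeneous_iff hom_def)
 show "theta (abs_ebv y) ?xs = lin_ext (evr m (graft_inputs n i v (nth xs)) (graft_degrees n i s (nth ks)) r) y"
  unfolding theta_abs[OF hom len assms(4)] using evr_cong[OF x k] by (rule arg_cong)
qed

lemma theta_setup:
 assumes "length ks = n" "homogeneous A ks xs" "p \<in> abs_ebv ` hcomp n k"
 obtains y where "y \<in> hcomp n k" "p = abs_ebv y" "length xs = n" "hom (nth xs) (nth ks) {..<n}"
proof -
 obtain y where "y \<in> hcomp n k" "p = abs_ebv y" using assms(3) by blast
 moreover have "length xs = n" using assms(1,2) by (simp add: homogeneous_iff)
 ultimately show ?thesis using that hom_nth[OF assms(2)] by blast
qed

theorem theta_ebv_algebra: "operad_algebra ebv_operad (A, theta)"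
 unfolding operad_algebra_def prod.case ebv_operad_sel
proof (intro conjI allI impI ballI)
 show "cochain_complex A" by (rule cc)
next
 fix n k ks and xs :: "'a list"
 assume "length ks = n" "homogeneous A ks xs"
 then have H: "homogeneous A ks xs" "length xs = n" by (auto simp: homogeneous_iff)
 show "linear_map_on (abs_ebv ` hcomp n k) (%p. theta p xs)"
  unfolding linear_map_on_def
  by (auto simp: abs_ebv_add abs_ebv_scale theta_abs[OF H, where r = k] subspace_add[OF hcomp_subspace] subspace_scale[OF hcomp_subspace]
    lin_ext_add lin_ext_scale)
next
 fix n k ks and xs :: "'a list" and p
 assume ks: "length ks = n" and h: "homogeneous A ks xs" and "p \<in> abs_ebv ` hcomp n k"
 obtain y where y: "y \<in> hcomp n k" and p: "p = abs_ebv y" and l: "length xs = n" and hom: "hom (nth xs) (nth ks) {..<n}"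
  by (rule theta_setup[OF ks h \<open>p \<in> abs_ebv ` hcomp n k\<close>])
 note H = h l
 show "theta p xs \<in> V (k + sum_list ks)"
  unfolding p theta_abs[OF H y] using lin_ext_evr_comp[OF hom] ks by (simp add: sum_list_sum_nth atLeast0LessThan)
next
 fix n k ks and xs :: "'a list" and p j
 assume ks: "length ks = n" and h: "homogeneous A ks xs" and "p \<in> abs_ebv ` hcomp n k" and j: "j < n"
 obtain y where y: "y \<in> hcomp n k" and p: "p = abs_ebv y" and l: "length xs = n" and hom: "hom (nth xs) (nth ks) {..<n}"
  by (rule theta_setup[OF ks h \<open>p \<in> abs_ebv ` hcomp n k\<close>])
 note H = h l
 have "linear_map_on (V (ks ! j)) (%v. lin_ext (evr n ((nth xs)(j := v)) (nth ks) k) y)"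
  by (rule linear_map_on_lin_ext[OF linear_map_on_evr[OF hom j]])
 then show "linear_map_on (V (ks ! j)) (%v. theta p (xs[j := v]))"
 proof (rule linear_map_on_cong[OF V_subspace])
  fix v assume "v \<in> V (ks ! j)"
  then have "homogeneous A ks (xs[j := v])" using homogeneous_update[OF h, of j v "ks ! j"] j H(2) by simp
  then have "theta p (xs[j := v]) = lin_ext (evr n (nth (xs[j := v])) (nth ks) k) y"
   unfolding p using H(2) y by (intro theta_abs) auto
  also have "evr n (nth (xs[j := v])) (nth ks) k = evr n ((nth xs)(j := v)) (nth ks) k"
   by (rule evr_cong) (simp_all add: H(2) nth_list_update)
  finally show "theta p (xs[j := v]) = lin_ext (evr n ((nth xs)(j := v)) (nth ks) k) y" .
 qed
next
 fix n k ks and xs :: "'a list" and p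
 assume ks: "length ks = n" and h: "homogeneous A ks xs" and "p \<in> abs_ebv ` hcomp n k"
 obtain y where y: "y \<in> hcomp n k" and p: "p = abs_ebv y" and l: "length xs = n" and hom: "hom (nth xs) (nth ks) {..<n}"
  by (rule theta_setup[OF ks h \<open>p \<in> abs_ebv ` hcomp n k\<close>])
 note H = h l
 let ?D = "%j. lin_ext (evr n ((nth xs)(j := dA (xs ! j))) ((nth ks)(j := ks ! j + 1)) k) y"
 have D: "theta p (xs[j := dA (xs ! j)]) = ?D j" if j: "j < n" for j
 proof -
  have "dA (xs ! j) \<in> V (ks ! j + 1)" using hom j dA_comp by (auto simp: hom_def)
  then have "homogeneous A (ks[j := ks ! j + 1]) (xs[j := dA (xs ! j)])" using h j H(2) by (intro homogeneous_update) auto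
  then have "theta p (xs[j := dA (xs ! j)]) = lin_ext (evr n (nth (xs[j := dA (xs ! j)])) (nth (ks[j := ks ! j + 1])) k) y"
   unfolding p using H(2) y by (intro theta_abs) auto
  also have "evr n (nth (xs[j := dA (xs ! j)])) (nth (ks[j := ks ! j + 1])) k = evr n ((nth xs)(j := dA (xs ! j))) ((nth ks)(j := ks ! j + 1)) k"
   by (rule evr_cong) (simp_all add: H(2) ks nth_list_update)
  finally show ?thesis .
 qed
 have "theta (ebv_diff p) xs = lin_ext (evr n (nth xs) (nth ks) (k + 1)) (free_diff y)"
  unfolding p ebv_diff.abs_eq by (rule theta_abs[OF H free_diff_hcomp[OF y]])
 also have "... = dA (theta p xs) - ksign k *r (\<Sum>j<n. ksign (\<Sum>a<j. ks ! a) *r ?D j)"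
  unfolding evr_free_diff[OF hom] p theta_abs[OF H y] by (simp add: ksign_add)
 also have "(\<Sum>j<n. ksign (\<Sum>a<j. ks ! a) *r ?D j) = (\<Sum>j<n. ksign (sum_list (take j ks)) *r theta p (xs[j := dA (xs ! j)]))"
  by (intro sum.cong refl) (simp add: D sum_list_take ks)
 finally show "dA (theta p xs) = theta (ebv_diff p) xs + ksign k *r (\<Sum>j<n. ksign (sum_list (take j ks)) *r theta p (xs[j := dA (xs ! j)]))"
  by simp
next
 fix n k ks and xs :: "'a list" and p si
 assume ks: "length ks = n" and h: "homogeneous A ks xs" and "p \<in> abs_ebv ` hcomp n k" and s: "si permutes {..<n}"
 obtain y where y: "y \<in> hcomp n k" and p: "p = abs_ebv y" and l: "length xs = n" and hom: "hom (nth xs) (nth ks) {..<n}"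
  by (rule theta_setup[OF ks h \<open>p \<in> abs_ebv ` hcomp n k\<close>])
 note H = h l
 have sn: "si j < n" if "j < n" for j using permutes_in_image[OF s, of j] that by simp
 have "homogeneous A (map (%j. ks ! si j) [0..<n]) (map (%j. xs ! si j) [0..<n])"
  using h sn H(2) by (auto simp: homogeneous_iff)
 then have "theta p (map (%j. xs ! si j) [0..<n]) =
   lin_ext (evr n (nth (map (%j. xs ! si j) [0..<n])) (nth (map (%j. ks ! si j) [0..<n])) k) y"
  unfolding p using y by (intro theta_abs) auto
 also have "evr n (nth (map (%j. xs ! si j) [0..<n])) (nth (map (%j. ks ! si j) [0..<n])) k =
   evr n (%j. xs ! si j) (%j. ks ! si j) k"
  by (rule evr_cong) simp_all
 finally have r: "theta p (map (%j. xs ! si j) [0..<n]) = lin_ext (evr n (%j. xs ! si j) (%j. ks ! si j) k) y" .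
 have "theta (ebv_perm_act n si p) xs = lin_ext (evr n (nth xs) (nth ks) k) (free_perm_act n si y)"
  unfolding p ebv_perm_act.abs_eq by (rule theta_abs[OF H free_perm_act_hcomp[OF y]])
 then show "theta (ebv_perm_act n si p) xs = koszul_sign si ks *r theta p (map (%j. xs ! si j) [0..<n])"
  unfolding evr_free_perm_act[OF s hom] koszul_sign_inversion[OF ks] r by simp
next
 fix k x assume "x \<in> V k"
 then have "homogeneous A [k] [x]" by (simp add: homogeneous_def)
 from theta_abs[OF this, of 1 "tree (Leaf 0)" 0] show "theta (abs_ebv (tree (Leaf 0))) [x] = x"
  by (simp add: tree_hcomp tree_arity_def evr_def lessThan_Suc)
next
 fix m n i k l ks and xs :: "'a list" and p q
 assume i: "i < m" and ks: "length ks = m + n - 1" and h: "homogeneous A ks xs"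
  and "p \<in> abs_ebv ` hcomp m k" "q \<in> abs_ebv ` hcomp n l"
 then obtain y z where y: "y \<in> hcomp m k" and p: "p = abs_ebv y" and z: "z \<in> hcomp n l" and q: "q = abs_ebv z" by blast
 have H: "homogeneous A ks xs" "length xs = m + n - 1" using ks h by (auto simp: homogeneous_iff)
 have hom: "hom (nth xs) (nth ks) {..<m + n - 1}" using hom_nth[OF h] H(2) by simp
 let ?v = "lin_ext (evr n (%b. xs ! (i + b)) (%b. ks ! (i + b)) l) z"
 have v: "theta q (take n (drop i xs)) = ?v"
 proof -
  have "homogeneous A (take n (drop i ks)) (take n (drop i xs))"
   using h ks i by (auto simp: homogeneous_iff)
  then have "theta q (take n (drop i xs)) = lin_ext (evr n (nth (take n (drop i xs))) (nth (take n (drop i ks))) l) z"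
   unfolding q using H(2) i z by (intro theta_abs) auto
  also have "evr n (nth (take n (drop i xs))) (nth (take n (drop i ks))) l = evr n (%b. xs ! (i + b)) (%b. ks ! (i + b)) l"
   by (rule evr_cong) (use H(2) ks i in simp_all)
  finally show ?thesis .
 qed
 have vV: "?v \<in> V (l + (\<Sum>c<n. ks ! (i + c)))"
  by (rule lin_ext_evr_comp[OF hom_block[OF i hom]])
 let ?x = "graft_inputs n i ?v (nth xs)" and ?k = "graft_degrees n i l (nth ks)"
 have "theta (ebv_circ m n i p q) xs = lin_ext (evr (m + n - 1) (nth xs) (nth ks) (k + l)) (free_circ m n i y z)"
  unfolding p q ebv_circ.abs_eq by (rule theta_abs[OF H free_circ_hcomp[OF y z]])
 also have "... = lin_ext (%T. lin_ext (%U. if tree_degree T + tree_degree U = k + l then circ_term m n i (nth xs) (nth ks) T U else 0) z) y"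
  unfolding evr_free_circ[OF hom i] by simp
 also have "... = lin_ext (%T. ksign (l * (\<Sum>a<i. ks ! a)) *r evr m ?x ?k k T) y"
 proof (rule lin_ext_cong)
  fix T assume "T \<in> Poly_Mapping.keys y"
  then have T: "tree_arity m T" "tree_degree T = k" using y by (auto simp: hcomp_def)
  show "lin_ext (%U. if tree_degree T + tree_degree U = k + l then circ_term m n i (nth xs) (nth ks) T U else 0) z =
    ksign (l * (\<Sum>a<i. ks ! a)) *r evr m ?x ?k k T"
   using circ_term_right[OF hom i T(1), of l z] T by (simp add: evr_def)
 qed
 also have "... = ksign (l * (\<Sum>a<i. ks ! a)) *r lin_ext (evr m ?x ?k k) y"
  by (rule lin_ext_fun_scale)
 also have "(\<Sum>a<i. ks ! a) = sum_list (take i ks)" using i ks by (simp add: sum_list_take)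
 also have "lin_ext (evr m ?x ?k k) y = theta p (take i xs @ theta q (take n (drop i xs)) # drop (i + n) xs)"
  unfolding v unfolding p by (rule theta_splice(1)[OF i ks h y vV, symmetric])
 finally show "theta (ebv_circ m n i p q) xs =
   ksign (l * sum_list (take i ks)) *r theta p (take i xs @ theta q (take n (drop i xs)) # drop (i + n) xs)" .
qed

theorem theta_is_ebv_structure: "is_ebv_structure A prd iop theta"
 unfolding is_ebv_structure_def
proof (intro conjI allI ballI theta_ebv_algebra)
 fix k l x y assume "x \<in> V k" "y \<in> V l"
 then have "homogeneous A [k, l] [x, y]" by (simp add: homogeneous_def)
 from theta_abs[OF this, of 2 "tree (Mu (Leaf 0) (Leaf 1))" 0] show "theta ebv_mu [x, y] = prd x y"
  by (simp add: ebv_mu_def tree_hcomp tree_arity_def evr_def cross_def lessThan_Suc numeral_2_eq_2 insert_commute)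
next
 fix k x assume "x \<in> V k"
 then have "homogeneous A [k] [x]" by (simp add: homogeneous_def)
 from theta_abs[OF this, of 1 "tree (Iop (Leaf 0))" "-2"] show "theta ebv_i [x] = iop x"
  by (simp add: ebv_i_def tree_hcomp tree_arity_def evr_def lessThan_Suc)
qed

end

section \<open>Uniqueness of the algebra structure\<close>

lemma operad_algebraD:
 assumes "operad_algebra P (A, al)"
 shows operad_algebra_cochain: "cochain_complex A" (is "PROP ?A")
  and operad_algebra_linear: "homogeneous A ks xs ==> length xs = n ==> linear_map_on (comps (arity P n) k) (%p. al p xs)" (is "PROP ?B")
  and operad_algebra_comp: "homogeneous A ks xs ==> length xs = n ==> p \<in> comps (arity P n) k ==> al p xs \<in> comps A (k + sum_list ks)" (is "PROP ?C")
  and operad_algebra_multilinear: "homogeneous A ks xs ==> length xs = n ==> p \<in> comps (arity P n) k ==> j < n ==>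
   linear_map_on (comps A (ks ! j)) (%x. al p (xs[j := x]))" (is "PROP ?D")
  and operad_algebra_diff: "homogeneous A ks xs ==> length xs = n ==> p \<in> comps (arity P n) k ==>
   differential A (al p xs) = al (differential (arity P n) p) xs +
    ksign k *r (\<Sum>j<n. ksign (sum_list (take j ks)) *r al p (xs[j := differential A (xs ! j)]))" (is "PROP ?E")
  and operad_algebra_perm: "homogeneous A ks xs ==> length xs = n ==> p \<in> comps (arity P n) k ==> si permutes {..<n} ==>
   al (perm_act P n si p) xs = koszul_sign si ks *r al p (map (%j. xs ! si j) [0..<n])" (is "PROP ?F")
  and operad_algebra_unit: "x \<in> comps A k ==> al (op_unit P) [x] = x" (is "PROP ?G")
  and operad_algebra_circ: "homogeneous A ks xs ==> length xs = m + n - 1 ==> i < m ==> p \<in> comps (arity P m) k ==> q \<in> comps (arity P n) l ==>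
   al (circ P m n i p q) xs =
    ksign (l * sum_list (take i ks)) *r al p (take i xs @ al q (take n (drop i xs)) # drop (i + n) xs)" (is "PROP ?H")
proof -
 note a = assms[unfolded operad_algebra_def prod.case]
 have l: "length ks = length xs" if "homogeneous A ks xs" for ks xs using that by (simp add: homogeneous_iff)
 show "PROP ?A" using a by (elim conjE) assumption
 show "PROP ?G" using a by (elim conjE) blast
 show "PROP ?H" using a l[of ks xs] by (elim conjE) simp
 note b = conjunct1[OF conjunct2[OF a], rule_format, of ks n xs]
 show "PROP ?B" using b l[of ks xs] by blast
 note c = conjunct2[OF b, THEN bspec, of p]
 show "PROP ?C" "PROP ?D" "PROP ?E" "PROP ?F" using c l[of ks xs] by simp_all
qed

lemma homogeneous_splice:
 assumes "i < m" "length xs = m + n - 1" "homogeneous A ks xs" "v \<in> comps A r"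
 shows "homogeneous A (take i ks @ r # drop (i + n) ks) (take i xs @ v # drop (i + n) xs)"
  and "length (take i xs @ v # drop (i + n) xs) = m"
 using assms unfolding homogeneous_def by (auto simp: list_all2_appendI list_all2_takeI list_all2_dropI)

context ebv_data
begin

definition agree :: "(ebv => 'a list => 'a) => (ebv => 'a list => 'a) => nat => ebv_tree => bool" where
 "agree al be n T \<longleftrightarrow> tree_arity n T \<and>
   (\<forall>ks xs. homogeneous A ks xs --> length xs = n --> al (abs_ebv (tree T)) xs = be (abs_ebv (tree T)) xs)"

lemma abs_tree_comp: "tree_arity n T ==> abs_ebv (tree T) \<in> comps (arity ebv_operad n) (tree_degree T)"
 unfolding ebv_operad_sel by (simp add: tree_hcomp)

context
 fixes al be :: "ebv => 'a list => 'a"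
 assumes al: "is_ebv_structure A prd iop al" and be: "is_ebv_structure A prd iop be"
begin

lemma alg: "operad_algebra ebv_operad (A, al)" "operad_algebra ebv_operad (A, be)"
 using al be by (auto simp: is_ebv_structure_def)

text \<open>Both sides are determined by the values on the two factors, by the same formula.\<close>
lemma agree_graft:
 assumes "agree al be m T" "agree al be n U" "i < m"
 shows "agree al be (m + n - 1) (graft n i T U)"
proof -
 have T: "tree_arity m T" and U: "tree_arity n U" using assms by (auto simp: agree_def)
 let ?T = "abs_ebv (tree T)" and ?U = "abs_ebv (tree U)"
 let ?e = "ksign (tree_degree U * degree_after i T)"
 have "free_circ m n i (tree T) (tree U) = ?e *r tree (graft n i T U)"
  unfolding free_circ_def using T U assms(3) by simp
 then have g: "tree (graft n i T U) = ?e *r free_circ m n i (tree T) (tree U)" by simp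
 have eq: "abs_ebv (tree (graft n i T U)) = ?e *r ebv_circ m n i ?T ?U"
  unfolding g abs_ebv_scale[symmetric] ebv_circ.abs_eq ..
 have "free_circ m n i (tree T) (tree U) \<in> hcomp (m + n - 1) (tree_degree T + tree_degree U)"
  using T U by (intro free_circ_hcomp) (simp_all add: tree_hcomp)
 then have c: "ebv_circ m n i ?T ?U \<in> comps (arity ebv_operad (m + n - 1)) (tree_degree T + tree_degree U)"
  unfolding ebv_circ.abs_eq ebv_operad_sel by (rule imageI)
 have "al (abs_ebv (tree (graft n i T U))) xs = be (abs_ebv (tree (graft n i T U))) xs"
  if h: "homogeneous A ks xs" and l: "length xs = m + n - 1" for ks xs
 proof -
  have sc: "al (?e *r ebv_circ m n i ?T ?U) xs = ?e *r al (ebv_circ m n i ?T ?U) xs"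
   "be (?e *r ebv_circ m n i ?T ?U) xs = ?e *r be (ebv_circ m n i ?T ?U) xs"
   using linear_onD(2)[OF operad_algebra_linear[OF alg(1) h l] c] linear_onD(2)[OF operad_algebra_linear[OF alg(2) h l] c]
   by blast+
  have h': "homogeneous A (take n (drop i ks)) (take n (drop i xs))"
   using h by (simp add: homogeneous_def list_all2_takeI list_all2_dropI)
  have l': "length (take n (drop i xs)) = n" using l assms(3) by simp
  have u: "al ?U (take n (drop i xs)) = be ?U (take n (drop i xs))"
   using assms(2) h' l' by (simp add: agree_def)
  have v: "be ?U (take n (drop i xs)) \<in> V (tree_degree U + sum_list (take n (drop i ks)))"
   by (rule operad_algebra_comp[OF alg(2) h' l' abs_tree_comp[OF U]])
  have "al ?T (take i xs @ be ?U (take n (drop i xs)) # drop (i + n) xs) =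
    be ?T (take i xs @ be ?U (take n (drop i xs)) # drop (i + n) xs)"
   using assms(1) homogeneous_splice[OF assms(3) l h v] by (auto simp: agree_def)
  then show ?thesis
   unfolding eq sc
   using operad_algebra_circ[OF alg(1) h l assms(3) abs_tree_comp[OF T] abs_tree_comp[OF U]]
    operad_algebra_circ[OF alg(2) h l assms(3) abs_tree_comp[OF T] abs_tree_comp[OF U]]
   by (simp add: ebv_operad_sel u)
 qed
 then show ?thesis using tree_arity_graft[OF T U assms(3)] by (simp add: agree_def)
qed

lemma agree_relabel:
 assumes "agree al be n T" "si permutes {..<n}"
 shows "agree al be n (relabel si T)"
proof -
 have T: "tree_arity n T" using assms by (auto simp: agree_def)
 have eq: "abs_ebv (tree (relabel si T)) = ebv_perm_act n si (abs_ebv (tree T))"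
  unfolding ebv_perm_act.abs_eq free_perm_act_def using T assms(2) by simp
 have "al (abs_ebv (tree (relabel si T))) xs = be (abs_ebv (tree (relabel si T))) xs"
  if h: "homogeneous A ks xs" and l: "length xs = n" for ks xs
 proof -
  have "si j < n" if "j < n" for j using permutes_in_image[OF assms(2), of j] that by simp
  then have "homogeneous A (map (%j. ks ! si j) [0..<n]) (map (%j. xs ! si j) [0..<n])"
   using h l by (auto simp: homogeneous_iff)
  then have "al (abs_ebv (tree T)) (map (%j. xs ! si j) [0..<n]) = be (abs_ebv (tree T)) (map (%j. xs ! si j) [0..<n])"
   using assms(1) by (simp add: agree_def)
  then show ?thesis
   unfolding eq
   using operad_algebra_perm[OF alg(1) h l abs_tree_comp[OF T] assms(2)] operad_algebra_perm[OF alg(2) h l abs_tree_comp[OF T] assms(2)]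
   by (simp add: ebv_operad_sel)
 qed
 then show ?thesis using tree_arity_relabel[OF assms(2) T] by (simp add: agree_def)
qed

lemma singleton_list: "homogeneous A ks xs ==> length xs = 1 ==> \<exists>k x. ks = [k] \<and> xs = [x] \<and> x \<in> V k"
 by (auto simp: homogeneous_def length_Suc_conv list_all2_Cons2)

lemma agree_generators:
 "agree al be 1 (Leaf 0)" "agree al be 2 (Mu (Leaf 0) (Leaf 1))" "agree al be 1 (Iop (Leaf 0))" "agree al be 1 (DIop (Leaf 0))"
proof -
 have i: "ga ebv_i [x] = iop x" if "is_ebv_structure A prd iop ga" "x \<in> V k" for ga x k
  using that unfolding is_ebv_structure_def by blast
 have one: "tree_arity 1 (Leaf 0)" "tree_arity 1 (Iop (Leaf 0))" "tree_arity 1 (DIop (Leaf 0))"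
  by (simp_all add: tree_arity_def lessThan_Suc)
 have unary: "agree al be 1 T" if "tree_arity 1 T" "!!x k. x \<in> V k ==> al (abs_ebv (tree T)) [x] = be (abs_ebv (tree T)) [x]" for T
  unfolding agree_def
 proof (intro conjI that(1) allI impI)
  fix ks xs assume "homogeneous A ks xs" "length xs = 1"
  then obtain k x where "xs = [x]" "x \<in> V k" using singleton_list by blast
  then show "al (abs_ebv (tree T)) xs = be (abs_ebv (tree T)) xs" using that(2) by simp
 qed
 show "agree al be 1 (Leaf 0)"
  using operad_algebra_unit[OF alg(1)] operad_algebra_unit[OF alg(2)] by (intro unary[OF one(1)]) (simp add: ebv_operad_sel)
 show "agree al be 1 (Iop (Leaf 0))"
  using i[OF al] i[OF be] by (intro unary[OF one(2)]) (simp add: ebv_i_def)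
 show "agree al be 2 (Mu (Leaf 0) (Leaf 1))"
  unfolding agree_def
 proof (intro conjI allI impI)
  show "tree_arity 2 (Mu (Leaf 0) (Leaf 1))"
   by (simp add: tree_arity_def numeral_2_eq_2 lessThan_Suc insert_commute)
  fix ks xs assume "homogeneous A ks xs" "length xs = 2"
  then obtain k l x y where x: "xs = [x, y]" "x \<in> V k" "y \<in> V l"
   by (auto simp: homogeneous_def numeral_2_eq_2 length_Suc_conv list_all2_Cons2)
  have "ga ebv_mu [x, y] = prd x y" if "is_ebv_structure A prd iop ga" for ga
   using that x(2,3) unfolding is_ebv_structure_def by blast
  from this[OF al] this[OF be] show "al (abs_ebv (tree (Mu (Leaf 0) (Leaf 1)))) xs = be (abs_ebv (tree (Mu (Leaf 0) (Leaf 1)))) xs"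
   by (simp add: ebv_mu_def x(1))
 qed
 show "agree al be 1 (DIop (Leaf 0))"
 proof (rule unary[OF one(3)])
  fix x k assume x: "x \<in> V k"
  then have h: "homogeneous A [k] [x]" "length [x] = 1" by (simp_all add: homogeneous_def)
  have "ga (abs_ebv (tree (DIop (Leaf 0)))) [x] = dA (iop x) - iop (dA x)" if "is_ebv_structure A prd iop ga" for ga
  proof -
   have a: "operad_algebra ebv_operad (A, ga)" using that by (simp add: is_ebv_structure_def)
   have d: "ebv_diff ebv_i = abs_ebv (tree (DIop (Leaf 0)))"
    unfolding ebv_i_def ebv_diff.abs_eq free_diff_def by simp
   have "ebv_i \<in> comps (arity ebv_operad 1) (-2)"
    using abs_tree_comp[OF one(2)] by (simp add: ebv_i_def)
   from operad_algebra_diff[OF a h this]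
   have "dA (ga ebv_i [x]) = ga (abs_ebv (tree (DIop (Leaf 0)))) [x] + ga ebv_i [dA x]"
    by (simp add: ebv_operad_sel d ksign_def)
   then show ?thesis using i[OF that x] i[OF that dA_comp[OF x]] by simp
  qed
  from this[OF al] this[OF be] show "al (abs_ebv (tree (DIop (Leaf 0)))) [x] = be (abs_ebv (tree (DIop (Leaf 0)))) [x]" by simp
 qed
qed

lemma relabel_plus_0: "relabel ((+) 0) T = T"
 by (induction T) auto

text \<open>
  Up to relabelling, every tree is a composite of generators: a product of two trees is the tree \<open>\<mu>\<close>
 with the right tree grafted first and the left one second.  Two structures with the same product and
 operator agree on \<open>d i\<close> too, because an action commutes with differentials.
\<close>
lemma agree_tree:
 assumes "distinct (leaves T)" "bij_betw rh (lf T) {..<n}"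
 shows "agree al be n (relabel rh T)"
 using assms
proof (induction T arbitrary: rh n)
 case (Leaf a)
 then have "rh a < n" "n = 1"
  using bij_betw_same_card[of rh "{a}" "{..<n}"] by (auto simp: bij_betw_def)
 then show ?case using agree_generators(1) by simp
next
 case (Iop T)
 then have "agree al be n (relabel rh T)" by simp
 from agree_graft[OF agree_generators(3) this, of 0] show ?case by (simp add: relabel_plus_0)
next
 case (DIop T)
 then have "agree al be n (relabel rh T)" by simp
 from agree_graft[OF agree_generators(4) this, of 0] show ?case by (simp add: relabel_plus_0)
next
 case (Mu S T)
 let ?a = "card (lf S)" and ?b = "card (lf T)"
 have d: "distinct (leaves S)" "distinct (leaves T)" "lf S \<inter> lf T = {}" using Mu.prems by auto
 obtain rhS rhT where S: "bij_betw rhS (lf S) {..<?a}" and T: "bij_betw rhT (lf T) {..<?b}"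
  using ex_bij_betw_finite_nat[of "lf S"] ex_bij_betw_finite_nat[of "lf T"] by (auto simp: atLeast0LessThan)
 define rh' where "rh' c = (if c \<in> lf S then rhS c else ?a + rhT c)" for c
 have "bij_betw ((+) ?a) {..<?b} {?a..<?a + ?b}"
  unfolding bij_betw_def by (simp add: lessThan_atLeast0 add.commute)
 from bij_betw_trans[OF T this] have "bij_betw rh' (lf T) {?a..<?a + ?b}"
  by (rule bij_betw_cong[THEN iffD1, rotated]) (use d(3) in \<open>auto simp: rh'_def\<close>)
 moreover have "bij_betw rh' (lf S) {..<?a}"
  using S by (rule bij_betw_cong[THEN iffD1, rotated]) (auto simp: rh'_def)
 ultimately have "bij_betw rh' (lf S \<union> lf T) ({..<?a} \<union> {?a..<?a + ?b})"
  by (intro bij_betw_combine) auto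
 moreover have "{..<?a} \<union> {?a..<?a + ?b} = {..<?a + ?b}" by auto
 ultimately have rh': "bij_betw rh' (lf (Mu S T)) {..<?a + ?b}" by simp
 have n: "n = ?a + ?b"
  using bij_betw_same_card[OF Mu.prems(2)] bij_betw_same_card[OF rh'] by simp
 have "agree al be (2 + ?b - 1) (graft ?b 1 (Mu (Leaf 0) (Leaf 1)) (relabel rhT T))"
  by (rule agree_graft[OF agree_generators(2) Mu.IH(2)[OF d(2) T]]) simp
 then have "agree al be (2 + ?b - 1 + ?a - 1) (graft ?a 0 (graft ?b 1 (Mu (Leaf 0) (Leaf 1)) (relabel rhT T)) (relabel rhS S))"
  by (rule agree_graft[OF _ Mu.IH(1)[OF d(1) S]]) simp
 moreover have "graft ?a 0 (graft ?b 1 (Mu (Leaf 0) (Leaf 1)) (relabel rhT T)) (relabel rhS S) = relabel rh' (Mu S T)"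
 proof -
  have "graft ?a 0 (relabel ((+) 1) (relabel rhT T)) (relabel rhS S) = relabel (%c. shift ?a 0 (1 + rhT c)) T"
   by (subst graft_notin) (auto simp: leaves_relabel relabel_relabel)
  also have "... = relabel rh' T"
   using d(3) by (intro relabel_cong) (auto simp: shift_def rh'_def)
  finally have t: "graft ?a 0 (relabel ((+) 1) (relabel rhT T)) (relabel rhS S) = relabel rh' T" .
  have "relabel rhS S = relabel rh' S" by (intro relabel_cong) (simp add: rh'_def)
  then show ?thesis using t by (simp add: relabel_plus_0)
 qed
 ultimately have R: "agree al be n (relabel rh' (Mu S T))" using n by (simp add: add.commute)
 (* an arbitrary labelling differs from the one obtained by grafting by a permutation *)
 define si where "si c = (if c < n then rh (inv_into (lf (Mu S T)) rh' c) else c)" for c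
 have "bij_betw si {..<n} {..<n}"
  using bij_betw_trans[OF bij_betw_inv_into[OF rh'[folded n]] Mu.prems(2)]
  by (rule bij_betw_cong[THEN iffD1, rotated]) (simp add: si_def)
 then have "si permutes {..<n}" by (rule bij_imp_permutes) (simp add: si_def)
 from agree_relabel[OF R this] have "agree al be n (relabel (%c. si (rh' c)) (Mu S T))"
  by (simp only: relabel_relabel)
 moreover have "relabel (%c. si (rh' c)) (Mu S T) = relabel rh (Mu S T)"
 proof (rule relabel_cong)
  fix c assume c: "c \<in> lf (Mu S T)"
  then have "rh' c < n" "inv_into (lf (Mu S T)) rh' (rh' c) = c"
   using rh' n by (auto simp: bij_betw_def intro: inv_into_f_f)
  then show "si (rh' c) = rh c" by (simp add: si_def)
 qed
 ultimately show ?case by simp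
qed

theorem ebv_structure_unique:
 assumes p: "p \<in> comps (arity ebv_operad n) k" and h: "homogeneous A ks xs" and l: "length xs = n"
 shows "al p xs = be p xs"
proof -
 obtain y where y: "y \<in> hcomp n k" and py: "p = abs_ebv y" using p by (auto simp: ebv_operad_sel)
 have t: "al (abs_ebv (tree T)) xs = be (abs_ebv (tree T)) xs" if "tree_arity n T" for T
  using agree_tree[of T "%a. a" n] that h l by (simp add: relabel_id agree_def tree_arity_def bij_betw_def)
 have e: "ga p xs = lin_ext (%T. ga (abs_ebv (tree T)) xs) y" if "operad_algebra ebv_operad (A, ga)" for ga
 proof -
  have "linear_map_on (abs_ebv ` hcomp n k) (%p. ga p xs)"
   using operad_algebra_linear[OF that h l] by (simp add: ebv_operad_sel)
  then have "linear_map_on (hcomp n k) (%y. ga (abs_ebv y) xs)"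
   by (auto simp: linear_map_on_def abs_ebv_add[symmetric] abs_ebv_scale[symmetric])
  from lin_ext_linear_on[OF hcomp_subspace this, of y "%T. tree T"] show ?thesis
   using y by (simp add: lin_ext_singles py tree_hcomp hcomp_def)
 qed
 have "lin_ext (%T. al (abs_ebv (tree T)) xs) y = lin_ext (%T. be (abs_ebv (tree T)) xs) y"
  using y t by (intro lin_ext_cong) (auto simp: hcomp_def)
 then show ?thesis using e[OF alg(1)] e[OF alg(2)] by simp
qed

end

end

section \<open>Quasi-isomorphisms with a section\<close>

lemma cochain_complexD:
 assumes "cochain_complex A"
 shows "subspace (comps A k)" "linear_map_on (comps A k) (differential A)"
  "x \<in> comps A k ==> differential A x \<in> comps A (k + 1)" "x \<in> comps A k ==> differential A (differential A x) = 0"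
 using assms unfolding cochain_complex_def graded_space_def by blast+

lemma cohomologous_equiv:
 assumes "cochain_complex A" shows "equiv (cocycles A k) (cohomologous A k)"
proof -
 note c = cochain_complexD[OF assms]
 let ?B = "differential A ` comps A (k - 1)"
 have lin: "linear_map_on (comps A (k - 1)) (differential A)" by (rule c)
 have 0: "0 \<in> ?B"
  using linear_on_diff[OF c(1) lin subspace_0[OF c(1)] subspace_0[OF c(1)]] subspace_0[OF c(1), of "k - 1"] by force
 have add: "x + y \<in> ?B" if "x \<in> ?B" "y \<in> ?B" for x y
 proof -
  obtain a b where ab: "a \<in> comps A (k - 1)" "b \<in> comps A (k - 1)" "x = differential A a" "y = differential A b"
   using \<open>x \<in> ?B\<close> \<open>y \<in> ?B\<close> by blast
  then have "x + y = differential A (a + b)" using lin unfolding linear_map_on_def by simp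
  then show ?thesis using subspace_add[OF c(1) ab(1,2)] by blast
 qed
 have neg: "- x \<in> ?B" if x: "x \<in> ?B" for x
 proof -
  obtain z where z: "z \<in> comps A (k - 1)" "x = differential A z" using x by blast
  have "differential A ((-1) *r z) = (-1) *r differential A z" using lin z(1) unfolding linear_map_on_def by blast
  then have "- x = differential A ((-1) *r z)" using z(2) by simp
  then show ?thesis using subspace_scale[OF c(1) z(1)] by blast
 qed
 show ?thesis
 proof (rule equivI)
  show "cohomologous A k \<subseteq> cocycles A k \<times> cocycles A k" by (auto simp: cohomologous_def)
  show "refl_on (cocycles A k) (cohomologous A k)"
   using 0 by (auto simp: refl_on_def cohomologous_def)
  show "sym (cohomologous A k)"
  proof (rule symI)
   fix x y assume "(x, y) \<in> cohomologous A k"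
   then show "(y, x) \<in> cohomologous A k" using neg[of "x - y"] by (simp add: cohomologous_def)
  qed
  show "trans (cohomologous A k)"
  proof (rule transI)
   fix x y z assume "(x, y) \<in> cohomologous A k" "(y, z) \<in> cohomologous A k"
   then show "(x, z) \<in> cohomologous A k" using add[of "x - y" "y - z"] by (simp add: cohomologous_def)
  qed
 qed
qed

text \<open>
  It suffices to lift cocycles to cocycles and to detect coboundaries.
\<close>
lemma quasi_iso_mapI:
 assumes A: "cochain_complex A" and B: "cochain_complex B" and f: "cochain_map A B f"
  and surj: "!!k y. y \<in> cocycles B k ==> \<exists>x\<in>cocycles A k. f x = y"
  and inj: "!!k x. x \<in> cocycles A k ==> f x \<in> differential B ` comps B (k - 1) ==> x \<in> differential A ` comps A (k - 1)"
 shows "quasi_iso_map A B f"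
 unfolding quasi_iso_map_def
proof (intro conjI allI f)
 fix k
 let ?R = "cohomologous A k" and ?S = "cohomologous B k"
 note R = cohomologous_equiv[OF A, of k] and S = cohomologous_equiv[OF B, of k]
 have lin: "linear_map_on (comps A k) f" for k using f by (auto simp: cochain_map_def)
 have fc: "f x \<in> cocycles B k" if "x \<in> cocycles A k" for x
 proof -
  have "f 0 = 0"
   using linear_on_diff[OF cochain_complexD(1)[OF A] lin, of 0 0 0] subspace_0[OF cochain_complexD(1)[OF A]] by simp
  then show ?thesis using that f by (auto simp: cocycles_def cochain_map_def) metis
 qed
 have fd: "f (x - y) = f x - f y" if "x \<in> cocycles A k" "y \<in> cocycles A k" for x y
  using that by (intro linear_on_diff[OF cochain_complexD(1)[OF A] lin]) (auto simp: cocycles_def)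
 have fR: "(f x, f y) \<in> ?S" if xy: "(x, y) \<in> ?R" for x y
 proof -
  have c: "x \<in> cocycles A k" "y \<in> cocycles A k" and b: "x - y \<in> differential A ` comps A (k - 1)"
   using xy by (auto simp: cohomologous_def)
  then obtain z where z: "z \<in> comps A (k - 1)" "x - y = differential A z" by blast
  then have "f x - f y = differential B (f z)" "f z \<in> comps B (k - 1)"
   using fd[OF c] f by (auto simp: cochain_map_def)
  then show ?thesis using fc c by (auto simp: cohomologous_def)
 qed
 have cls: "?S `` (f ` (?R `` {x})) = ?S `` {f x}" if x: "x \<in> cocycles A k" for x
 proof
  show "?S `` (f ` (?R `` {x})) \<subseteq> ?S `` {f x}"
   using fR S unfolding equiv_def trans_def by blast
  have "x \<in> ?R `` {x}" using R x unfolding equiv_def refl_on_def by blast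
  then show "?S `` {f x} \<subseteq> ?S `` (f ` (?R `` {x}))" by blast
 qed
 show "bij_betw (%c. ?S `` (f ` c)) (cohomology A k) (cohomology B k)"
  unfolding bij_betw_def
 proof
  show "inj_on (%c. ?S `` (f ` c)) (cohomology A k)"
  proof (rule inj_onI)
   fix c c' assume "c \<in> cohomology A k" "c' \<in> cohomology A k" and eq: "?S `` (f ` c) = ?S `` (f ` c')"
   then obtain x x' where x: "x \<in> cocycles A k" "c = ?R `` {x}" and x': "x' \<in> cocycles A k" "c' = ?R `` {x'}"
    unfolding cohomology_def quotient_def by blast
   have "(f x, f x') \<in> ?S"
    using eq cls x x' eq_equiv_class_iff[OF S fc[OF x(1)] fc[OF x'(1)]] by simp
   then have "f (x - x') \<in> differential B ` comps B (k - 1)" using fd x x' by (simp add: cohomologous_def)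
   moreover have "x - x' \<in> cocycles A k"
    using x(1) x'(1) linear_on_diff[OF cochain_complexD(1,2)[OF A], of x k x'] subspace_diff[OF cochain_complexD(1)[OF A], of x k x']
    by (simp add: cocycles_def)
   ultimately have "(x, x') \<in> ?R" using inj x x' by (simp add: cohomologous_def)
   then show "c = c'" using eq_equiv_class_iff[OF R x(1) x'(1)] x(2) x'(2) by simp
  qed
  show "(%c. ?S `` (f ` c)) ` cohomology A k = cohomology B k"
  proof
   show "(%c. ?S `` (f ` c)) ` cohomology A k \<subseteq> cohomology B k"
   proof
    fix c assume "c \<in> (%c. ?S `` (f ` c)) ` cohomology A k"
    then obtain x where x: "x \<in> cocycles A k" "c = ?S `` (f ` (?R `` {x}))" unfolding cohomology_def quotient_def by blast
    show "c \<in> cohomology B k" unfolding x(2) cls[OF x(1)] cohomology_def using fc[OF x(1)] by (rule quotientI)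
   qed
   show "cohomology B k \<subseteq> (%c. ?S `` (f ` c)) ` cohomology A k"
   proof
    fix c assume "c \<in> cohomology B k"
    then obtain y where y: "y \<in> cocycles B k" "c = ?S `` {y}" unfolding cohomology_def quotient_def by blast
    obtain x where x: "x \<in> cocycles A k" "f x = y" using surj[OF y(1)] by blast
    then have "c = ?S `` (f ` (?R `` {x}))" using cls y by simp
    moreover have "?R `` {x} \<in> cohomology A k" unfolding cohomology_def using x(1) by (rule quotientI)
    ultimately show "c \<in> (%c. ?S `` (f ` c)) ` cohomology A k" by blast
   qed
  qed
 qed
qed

section \<open>Polynomial forms on the interval\<close>

context ebv_data
begin

text \<open>
  \<open>A[t, dt]\<close>, with \<open>u\<close> standing for \<open>\<Sum> e\<^sub>n u\<^sub>n\<close> where \<open>e\<^bsub>2j\<^esub> = t\<^sup>j\<close> and \<open>e\<^bsub>2j+1\<^esub> = t\<^sup>j dt\<close>.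
  Then \<open>e\<^sub>l e\<^sub>m = e\<^bsub>l+m\<^esub>\<close> unless \<open>l\<close> and \<open>m\<close> are both odd, and \<open>d e\<^bsub>2j\<^esub> = j e\<^bsub>2j-1\<^esub>\<close>.  The operator is \<open>t i\<close>,
  a shift of the index by \<open>2\<close>.  Its bracket with \<open>d\<close> is \<open>t [i, d] - dt i\<close> up to sign,
  which commutes with \<open>t i\<close> because \<open>[i, [i, d]] = 0\<close>.
\<close>
definition pcomps :: "int => (nat => 'a) set" where
 "pcomps k = {u. finite {n. u n \<noteq> 0} \<and> (\<forall>n. u n \<in> V (k - int (n mod 2)))}"

definition mon :: "nat => 'a => nat => 'a" where
 "mon n x = (%m. if m = n then x else 0)"

definition pdiff :: "(nat => 'a) => nat => 'a" where
 "pdiff u = (%n. (if even n then dA (u n) else (real (n + 1) / 2) *r u (n + 1) - dA (u n)))"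

text \<open>
  The sign of moving a form of odd degree past \<open>x\<close>; the case distinction reads off the parity of a homogeneous \<open>x\<close>.
\<close>
definition eps :: "nat => 'a => 'a" where
 "eps m x = (if even m \<or> (\<exists>k. even k \<and> x \<in> V k) then x else - x)"

definition pprd :: "(nat => 'a) => (nat => 'a) => nat => 'a" where
 "pprd u v = (%n. \<Sum>l\<le>n. if odd l \<and> odd (n - l) then 0 else prd (eps (n - l) (u l)) (v (n - l)))"

definition piop :: "(nat => 'a) => nat => 'a" where
 "piop u = (%n. if n < 2 then 0 else iop (u (n - 2)))"

definition path :: "(nat => 'a) cochains" where
 "path = \<lparr>comps = pcomps, differential = pdiff\<rparr>"

lemma V_0: "0 \<in> V k"
 by (rule subspace_0[OF V_subspace])

lemma dA_0: "dA 0 = 0"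
 by (rule linear_on_0[OF V_subspace dA_linear])

lemma iop_0: "iop 0 = 0"
 by (rule linear_on_0[OF V_subspace iop_linear])

lemma prd_0_left: "y \<in> V l ==> prd 0 y = 0"
 by (rule linear_on_0[OF V_subspace prd_linear_left])

lemma prd_0_right: "x \<in> V k ==> prd x 0 = 0"
 by (rule linear_on_0[OF V_subspace prd_linear_right])

lemma prd_scale:
 assumes "x \<in> V k" "y \<in> V l"
 shows "prd (c *r x) y = c *r prd x y" "prd x (c *r y) = c *r prd x y"
 using linear_onD(2)[OF prd_linear_left[OF assms(2)] assms(1)] linear_onD(2)[OF prd_linear_right[OF assms(1)] assms(2)] .

lemma eps: "x \<in> V k ==> eps m x = ksign (int m * k) *r x"
proof (cases "x = 0")
 case False
 assume x: "x \<in> V k"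
 have "(\<exists>j. even j \<and> x \<in> V j) \<longleftrightarrow> even k" using degree_unique[OF x _ False] x by blast
 then show ?thesis by (simp add: eps_def ksign_def)
qed (simp add: eps_def)

lemma pcomps_subspace: "subspace (pcomps k)"
proof (rule subspaceI)
 show "0 \<in> pcomps k" by (simp add: pcomps_def V_0)
 show "u + v \<in> pcomps k" if "u \<in> pcomps k" "v \<in> pcomps k" for u v
 proof -
  have "{n. (u + v) n \<noteq> 0} \<subseteq> {n. u n \<noteq> 0} \<union> {n. v n \<noteq> 0}" by auto
  then show ?thesis
   using that subspace_add[OF V_subspace] finite_subset unfolding pcomps_def by fastforce
 qed
 show "c *r u \<in> pcomps k" if "u \<in> pcomps k" for c u
 proof -
  have "{n. (c *r u) n \<noteq> 0} \<subseteq> {n. u n \<noteq> 0}" by (auto simp: scaleR_fun_def)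
  then show ?thesis
   using that subspace_scale[OF V_subspace] finite_subset unfolding pcomps_def by (fastforce simp: scaleR_fun_def)
 qed
qed

lemma pcompsD: "u \<in> pcomps k ==> u n \<in> V (k - int (n mod 2))"
 by (simp add: pcomps_def)

lemma mon_pcomps: "x \<in> V (k - int (n mod 2)) ==> mon n x \<in> pcomps k"
 by (auto simp: pcomps_def mon_def V_0)

lemma mon_0 [simp]: "mon n 0 = 0"
 and mon_add: "mon n (x + y) = mon n x + mon n y"
 and mon_minus: "mon n (x - y) = mon n x - mon n y"
 and mon_scale: "mon n (c *r x) = c *r mon n x"
 by (auto simp: mon_def fun_eq_iff scaleR_fun_def)

text \<open>
  All identities below are additive in each argument, so that they may be checked on monomials.
\<close>
lemma pcomps_induct [consumes 1, case_names mon add]: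
 assumes "u \<in> pcomps k"
  and m: "!!n x. x \<in> V (k - int (n mod 2)) ==> P (mon n x)"
  and a: "!!u v. u \<in> pcomps k ==> v \<in> pcomps k ==> P u ==> P v ==> P (u + v)"
 shows "P u"
proof -
 have "\<forall>u\<in>pcomps k. {n. u n \<noteq> 0} \<subseteq> N --> P u" if "finite N" for N
  using that
 proof (induction N rule: finite_induct)
  case empty
  have "P u" if "u \<in> pcomps k" "{n. u n \<noteq> 0} \<subseteq> {}" for u
  proof -
   have "u = mon 0 0" using that(2) by (auto simp: fun_eq_iff mon_def)
   then show ?thesis using m[OF V_0] by simp
  qed
  then show ?case by blast
 next
  case (insert n N)
  have "P u" if u: "u \<in> pcomps k" "{m. u m \<noteq> 0} \<subseteq> insert n N" for u
  proof -
   have e: "u = mon n (u n) + u(n := 0)" by (auto simp: fun_eq_iff mon_def)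
   have s: "{m. (u(n := 0)) m \<noteq> 0} \<subseteq> N" using u(2) by auto
   have "finite {m. (u(n := 0)) m \<noteq> 0}" using s insert.hyps(1) finite_subset by blast
   then have "u(n := 0) \<in> pcomps k" using u(1) V_0 by (auto simp: pcomps_def)
   moreover from this have "P (u(n := 0))" using insert.IH s by blast
   ultimately show ?thesis
    using e a[of "mon n (u n)" "u(n := 0)"] m mon_pcomps pcompsD[OF u(1)] by metis
  qed
  then show ?case by blast
 qed
 then show ?thesis using assms(1) by (auto simp: pcomps_def)
qed

lemma pdiff_linear: "linear_map_on (pcomps k) pdiff"
 unfolding linear_map_on_def
 by (auto simp: fun_eq_iff pdiff_def scaleR_fun_def linear_onD(1)[OF dA_linear pcompsD pcompsD] linear_onD(2)[OF dA_linear pcompsD]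
   scaleR_add_right scaleR_diff_right)

lemma piop_linear: "linear_map_on (pcomps k) piop"
 unfolding linear_map_on_def
 by (auto simp: fun_eq_iff piop_def scaleR_fun_def linear_onD(1)[OF iop_linear pcompsD pcompsD] linear_onD(2)[OF iop_linear pcompsD])

text \<open>At \<open>n = 0\<close> the coefficient of the monomial with index \<open>n - 1\<close> vanishes.\<close>
lemma pdiff_mon:
 "pdiff (mon n x) = (if even n then mon n (dA x) + (real n / 2) *r mon (n - 1) x else - mon n (dA x))"
 by (cases n) (auto simp: fun_eq_iff pdiff_def mon_def scaleR_fun_def dA_0)

lemma piop_mon: "piop (mon n x) = mon (n + 2) (iop x)"
 by (auto simp: fun_eq_iff piop_def mon_def iop_0)

lemma pprd_linear_left: "v \<in> pcomps l ==> linear_map_on (pcomps k) (%u. pprd u v)"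
proof -
 assume v: "v \<in> pcomps l"
 have t: "prd (eps m ((u + w) n)) (v m) = prd (eps m (u n)) (v m) + prd (eps m (w n)) (v m)"
  "prd (eps m ((c *r u) n)) (v m) = c *r prd (eps m (u n)) (v m)"
  if "u \<in> pcomps k" "w \<in> pcomps k" for u w c m n
 proof -
  let ?s = "ksign (int m * (k - int (n mod 2)))"
  note uw = pcompsD[OF that(1), of n] pcompsD[OF that(2), of n] and vm = pcompsD[OF v, of m]
  note prd = prd_scale[OF uw(1) vm] prd_scale[OF uw(2) vm] prd_scale[OF subspace_add[OF V_subspace uw] vm]
  have "prd (u n + w n) (v m) = prd (u n) (v m) + prd (w n) (v m)"
   by (rule linear_onD(1)[OF prd_linear_left[OF vm] uw])
  then show "prd (eps m ((u + w) n)) (v m) = prd (eps m (u n)) (v m) + prd (eps m (w n)) (v m)"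
   using eps[OF uw(1)] eps[OF uw(2)] eps[OF subspace_add[OF V_subspace uw]] prd by (simp add: scaleR_add_right)
  have "prd (c *r ?s *r u n) (v m) = c *r prd (?s *r u n) (v m)"
   by (rule prd_scale(1)[OF subspace_scale[OF V_subspace uw(1)] vm])
  then show "prd (eps m ((c *r u) n)) (v m) = c *r prd (eps m (u n)) (v m)"
   using eps[OF uw(1)] eps[OF subspace_scale[OF V_subspace uw(1)]] by (simp add: scaleR_fun_def mult.commute)
 qed
 show ?thesis
  unfolding linear_map_on_def
 proof (intro conjI ballI allI)
  fix u w assume uw: "u \<in> pcomps k" "w \<in> pcomps k"
  show "pprd (u + w) v = pprd u v + pprd w v"
   unfolding fun_eq_iff pprd_def plus_fun_def sum.distrib[symmetric]
   using t(1)[OF uw] by (auto intro!: sum.cong)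
 next
  fix c u assume u: "u \<in> pcomps k"
  show "pprd (c *r u) v = c *r pprd u v"
   unfolding fun_eq_iff pprd_def using t(2)[OF u u]
   by (auto simp: scaleR_fun_def scaleR_sum_right intro!: sum.cong)
 qed
qed

lemma pprd_linear_right: "u \<in> pcomps k ==> linear_map_on (pcomps l) (pprd u)"
proof -
 assume u: "u \<in> pcomps k"
 have e: "eps m (u n) \<in> V (k - int (n mod 2))" for m n
  using eps[OF pcompsD[OF u, of n]] pcompsD[OF u, of n] by (simp add: subspace_scale[OF V_subspace])
 show ?thesis
  unfolding linear_map_on_def
 proof (intro conjI ballI allI)
  fix v w assume vw: "v \<in> pcomps l" "w \<in> pcomps l"
  show "pprd u (v + w) = pprd u v + pprd u w"
   unfolding fun_eq_iff pprd_def plus_fun_def sum.distrib[symmetric]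
   using linear_onD(1)[OF prd_linear_right[OF e] pcompsD[OF vw(1)] pcompsD[OF vw(2)]]
   by (auto intro!: sum.cong)
 next
  fix c v assume v: "v \<in> pcomps l"
  show "pprd u (c *r v) = c *r pprd u v"
   unfolding fun_eq_iff pprd_def using linear_onD(2)[OF prd_linear_right[OF e] pcompsD[OF v]]
   by (auto simp: scaleR_fun_def scaleR_sum_right intro!: sum.cong)
 qed
qed

lemma pprd_mon:
 assumes "x \<in> V k" "y \<in> V l"
 shows "pprd (mon a x) (mon b y) = (if odd a \<and> odd b then 0 else ksign (int b * k) *r mon (a + b) (prd x y))"
proof
 fix n
 have z: "prd (eps m (mon a x j)) (mon b y m) = (if j = a \<and> m = b then ksign (int b * k) *r prd x y else 0)" for j m
  using eps[OF assms(1), of m] eps[OF V_0, of m 0] prd_0_left[OF assms(2)] prd_0_left[OF V_0]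
   prd_0_right[OF subspace_scale[OF V_subspace assms(1)]] prd_scale(1)[OF assms]
  by (auto simp: mon_def)
 have "pprd (mon a x) (mon b y) n = (\<Sum>j\<le>n. if j = a then (if n - a = b \<and> \<not> (odd a \<and> odd b) then ksign (int b * k) *r prd x y else 0) else 0)"
  unfolding pprd_def z by (intro sum.cong refl) auto
 also have "... = (if odd a \<and> odd b then 0 else ksign (int b * k) *r mon (a + b) (prd x y)) n"
  by (auto simp: mon_def scaleR_fun_def)
 finally show "pprd (mon a x) (mon b y) n = (if odd a \<and> odd b then 0 else ksign (int b * k) *r mon (a + b) (prd x y)) n" .
qed

lemma V_shift: "x \<in> V k ==> k = l ==> x \<in> V l"
 by simp

lemma pprd_comp:
 assumes "u \<in> pcomps k" "v \<in> pcomps l" shows "pprd u v \<in> pcomps (k + l)"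
 using assms(1)
proof (induction rule: pcomps_induct)
 case (mon a x)
 note x = mon
 from assms(2) show ?case
 proof (induction rule: pcomps_induct)
  case (mon b y)
  show ?case
  proof (cases "odd a \<and> odd b")
   case False
   have "prd x y \<in> V (k + l - int ((a + b) mod 2))"
    by (rule V_shift[OF prd_comp[OF x mon]]) (use False in \<open>auto simp: mod2_eq_if\<close>)
   then show ?thesis
    unfolding pprd_mon[OF x mon] using False by (auto simp: subspace_scale[OF pcomps_subspace] mon_pcomps)
  next
   case True
   then show ?thesis
    unfolding pprd_mon[OF x mon] using subspace_0[OF pcomps_subspace] by (simp only: if_True simp_thms)
  qed
 next
  case (add v w)
  show ?case
   unfolding linear_onD(1)[OF pprd_linear_right[OF mon_pcomps[OF x]] add(1,2)]
   by (rule subspace_add[OF pcomps_subspace add(3,4)])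
 qed
next
 case (add u w)
 show ?case
  unfolding linear_onD(1)[OF pprd_linear_left[OF assms(2)] add(1,2)]
  by (rule subspace_add[OF pcomps_subspace add(3,4)])
qed

lemma pdiff_comp: "u \<in> pcomps k ==> pdiff u \<in> pcomps (k + 1)"
proof (induction rule: pcomps_induct)
 case (mon n x)
 have "mon n (dA x) \<in> pcomps (k + 1)"
  by (rule mon_pcomps[OF V_shift[OF dA_comp[OF mon]]]) simp
 moreover have "(real n / 2) *r mon (n - 1) x \<in> pcomps (k + 1)" if "even n"
 proof (cases n)
  case (Suc m)
  then have "mon m x \<in> pcomps (k + 1)"
   by (intro mon_pcomps V_shift[OF mon]) (use that in \<open>auto simp: mod2_eq_if\<close>)
  then show ?thesis using Suc by (simp add: subspace_scale[OF pcomps_subspace])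
 qed (simp add: subspace_0[OF pcomps_subspace])
 ultimately show ?case
  unfolding pdiff_mon using subspace_add[OF pcomps_subspace] subspace_neg[OF pcomps_subspace] by simp
next
 case (add u v)
 show ?case
  unfolding linear_onD(1)[OF pdiff_linear add(1,2)] by (rule subspace_add[OF pcomps_subspace add(3,4)])
qed

lemma piop_comp: "u \<in> pcomps k ==> piop u \<in> pcomps (k - 2)"
proof (induction rule: pcomps_induct)
 case (mon n x)
 show ?case
  unfolding piop_mon by (rule mon_pcomps[OF V_shift[OF iop_comp[OF mon]]]) simp
next
 case (add u v)
 show ?case
  unfolding linear_onD(1)[OF piop_linear add(1,2)] by (rule subspace_add[OF pcomps_subspace add(3,4)])
qed

lemmas pdiff_scale = linear_onD(2)[OF pdiff_linear]
 and piop_scale = linear_onD(2)[OF piop_linear]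

lemma pdiff_add: "u \<in> pcomps k ==> v \<in> pcomps k ==> pdiff (u + v) = pdiff u + pdiff v"
 by (rule linear_onD(1)[OF pdiff_linear])

lemma piop_add: "u \<in> pcomps k ==> v \<in> pcomps k ==> piop (u + v) = piop u + piop v"
 by (rule linear_onD(1)[OF piop_linear])

lemma pprd_add_left: "u \<in> pcomps k ==> v \<in> pcomps k ==> w \<in> pcomps l ==> pprd (u + v) w = pprd u w + pprd v w"
 by (rule linear_onD(1)[OF pprd_linear_left])

lemma pprd_add_right: "w \<in> pcomps l ==> u \<in> pcomps k ==> v \<in> pcomps k ==> pprd w (u + v) = pprd w u + pprd w v"
 by (rule linear_onD(1)[OF pprd_linear_right])

lemma pprd_scale:
 assumes "u \<in> pcomps k" "v \<in> pcomps l"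
 shows "pprd (c *r u) v = c *r pprd u v" "pprd u (c *r v) = c *r pprd u v"
 using linear_onD(2)[OF pprd_linear_left[OF assms(2)] assms(1)] linear_onD(2)[OF pprd_linear_right[OF assms(1)] assms(2)] .

lemma mon_pcomps': "x \<in> V k ==> mon n x \<in> pcomps (k + int (n mod 2))"
 by (simp add: mon_pcomps)

lemmas pprd_mon_scale = pprd_scale[OF mon_pcomps' mon_pcomps']

lemma piop_mon_scale: "x \<in> V k ==> piop (c *r mon n x) = c *r mon (n + 2) (iop x)"
 using piop_scale[OF mon_pcomps'] by (simp add: piop_mon)

lemma pprd_minus_left: "u \<in> pcomps k ==> v \<in> pcomps l ==> pprd (- u) v = - pprd u v"
 and pprd_minus_right: "u \<in> pcomps k ==> v \<in> pcomps l ==> pprd u (- v) = - pprd u v"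
 using pprd_scale[of u k v l "-1"] by simp_all

lemma pdiff_minus: "u \<in> pcomps k ==> pdiff (- u) = - pdiff u"
 using pdiff_scale[of u k "-1"] by simp

lemma pdiff_pdiff: "u \<in> pcomps k ==> pdiff (pdiff u) = 0"
proof (induction rule: pcomps_induct)
 case (mon n x)
 have dd: "dA (dA x) = 0" by (rule dA_dA[OF mon])
 have d: "mon n (dA x) \<in> pcomps (k + 1)"
  by (rule mon_pcomps[OF V_shift[OF dA_comp[OF mon]]]) simp
 show ?case
 proof (cases "even n \<and> 0 < n")
  case True
  then have m: "mon (n - 1) x \<in> pcomps (k + 1)"
   by (intro mon_pcomps V_shift[OF mon]) (auto simp: mod2_eq_if)
  have e: "pdiff (mon n x) = mon n (dA x) + (real n / 2) *r mon (n - 1) x"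
   using True by (simp only: pdiff_mon if_True)
  have "pdiff (mon n (dA x)) = (real n / 2) *r mon (n - 1) (dA x)" "pdiff (mon (n - 1) x) = - mon (n - 1) (dA x)"
   using True by (simp_all add: pdiff_mon dd)
  then show ?thesis
   unfolding e pdiff_add[OF d subspace_scale[OF pcomps_subspace m]] pdiff_scale[OF m] by (simp only: scaleR_minus_right add.right_inverse)
 next
  case False
  then show ?thesis using pdiff_minus[OF d] by (auto simp: pdiff_mon dd)
 qed
next
 case (add u v)
 show ?case
  unfolding pdiff_add[OF add(1,2)] pdiff_add[OF pdiff_comp[OF add(1)] pdiff_comp[OF add(2)]] add(3,4) by (rule add_0_left)
qed

lemma path_cochain_complex: "cochain_complex path"
 unfolding cochain_complex_def graded_space_def path_def cochains.simps
proof (intro conjI allI impI ballI pcomps_subspace pdiff_linear pdiff_comp pdiff_pdiff)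
 fix K and u :: "int => nat => 'a" and k
 assume K: "finite K" "\<forall>k\<in>K. u k \<in> pcomps k" "(\<Sum>k\<in>K. u k) = 0" "k \<in> K"
 show "u k = 0"
 proof
  fix n
  have inj: "inj_on (%k. k - int (n mod 2)) K" by (simp add: inj_on_def)
  have "(\<Sum>j\<in>(%k. k - int (n mod 2)) ` K. u (j + int (n mod 2)) n) = (\<Sum>k\<in>K. u k n)"
   by (simp add: sum.reindex[OF inj])
  also have "... = (\<Sum>k\<in>K. u k) n" using K(1) by (induction K rule: finite_induct) auto
  finally have "(\<Sum>j\<in>(%k. k - int (n mod 2)) ` K. u (j + int (n mod 2)) n) = 0" using K(3) by simp
  then have "u (k - int (n mod 2) + int (n mod 2)) n = 0"
   using K by (intro V_direct[of "(%k. k - int (n mod 2)) ` K" "%j. u (j + int (n mod 2)) n"]) (auto intro: pcompsD)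
  then show "u k n = 0 n" by simp
 qed
qed

lemma pprd_pprd_mon:
 assumes "x \<in> V k" "y \<in> V l" "z \<in> V m"
 shows "pprd (pprd (mon a x) (mon b y)) (mon c z) =
   (if odd a \<and> odd b \<or> odd a \<and> odd c \<or> odd b \<and> odd c then 0
    else ksign (int b * k + int c * (k + l)) *r mon (a + b + c) (prd (prd x y) z))"
proof -
 note xy = prd_comp[OF assms(1,2)]
 have "pprd 0 (mon c z) = 0"
  using pprd_scale(1)[OF subspace_0[OF pcomps_subspace] mon_pcomps'[OF assms(3), of c], where c = 0] by simp
 then show ?thesis
  using pprd_mon_scale(1)[OF xy assms(3)] pprd_mon[OF assms(1,2)] pprd_mon[OF xy assms(3)]
  by (auto simp: ksign_add)
qed

lemma pprd_piop_pprd_mon: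
 assumes "x \<in> V k" "y \<in> V l" "z \<in> V m"
 shows "pprd (piop (pprd (mon a x) (mon b y))) (mon c z) =
   (if odd a \<and> odd b \<or> odd a \<and> odd c \<or> odd b \<and> odd c then 0
    else ksign (int b * k + int c * (k + l)) *r mon (a + b + c + 2) (prd (iop (prd x y)) z))"
proof -
 note xy = prd_comp[OF assms(1,2)] and ixy = iop_comp[OF prd_comp[OF assms(1,2)]]
 have "piop 0 = 0" using piop_mon[of 0 0] by (simp add: iop_0)
 moreover have "pprd 0 (mon c z) = 0"
  using pprd_scale(1)[OF subspace_0[OF pcomps_subspace] mon_pcomps'[OF assms(3), of c], where c = 0] by simp
 moreover have "ksign (int c * (k + l - 2)) = ksign (int c * (k + l))" by (rule ksign_eqI) (simp add: algebra_simps)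
 ultimately show ?thesis
  using pprd_mon_scale(1)[OF ixy assms(3)] pprd_mon[OF assms(1,2)] piop_mon_scale[OF xy] pprd_mon[OF ixy assms(3), of "a + b + 2" c]
  by (auto simp: ksign_add add_ac)
qed

declare plus_fun_apply [simp del] minus_apply [simp del] uminus_apply [simp del] zero_fun_apply [simp del]

lemma ksign_mult_nat: "ksign (int b * k) = (if even b then 1 else ksign k)"
 by (auto simp: ksign_def)

lemma ksign_mult_eqI: "even (a + b - (c + d)) ==> ksign a * ksign b = ksign c * ksign d"
 unfolding ksign_add[symmetric] by (rule ksign_eqI)

lemma pprd_0: "u \<in> pcomps k ==> pprd 0 u = 0" "u \<in> pcomps k ==> pprd u 0 = 0"
 using linear_on_0[OF pcomps_subspace pprd_linear_left] linear_on_0[OF pcomps_subspace pprd_linear_right] by blast+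

lemma piop_0: "piop 0 = 0"
 by (rule linear_on_0[OF pcomps_subspace piop_linear])

lemma pdiff_0: "pdiff 0 = 0"
 by (rule linear_on_0[OF pcomps_subspace pdiff_linear])

lemma pprd_assoc:
 assumes "u \<in> pcomps k" "v \<in> pcomps l" "w \<in> pcomps m"
 shows "pprd (pprd u v) w = pprd u (pprd v w)"
 using assms(1)
proof (induction rule: pcomps_induct)
 case (mon a x)
 note x = mon
 from assms(2) show ?case
 proof (induction rule: pcomps_induct)
  case (mon b y)
  note y = mon
  from assms(3) show ?case
  proof (induction rule: pcomps_induct)
   case (mon c z)
   note z = mon
   show ?case
   proof (cases "odd b \<and> odd c")
    case True
    then show ?thesis
     using pprd_0(2)[OF mon_pcomps[OF x]] by (simp add: pprd_pprd_mon[OF x y z] pprd_mon[OF y z])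
   next
    case False
    then show ?thesis
     using pprd_mon_scale(2)[OF x prd_comp[OF y z], where n = "b + c" and na = a] pprd_mon[OF x prd_comp[OF y z], of a "b + c"]
     by (auto simp: pprd_pprd_mon[OF x y z] pprd_mon[OF y z] prd_assoc[OF x y z] ksign_add ksign_mult_nat add_ac distrib_right)
   qed
  next
   case (add w w')
   show ?case
    unfolding pprd_add_right[OF pprd_comp[OF mon_pcomps[OF x] mon_pcomps[OF y]] add(1,2)]
     pprd_add_right[OF mon_pcomps[OF y] add(1,2)]
     pprd_add_right[OF mon_pcomps[OF x] pprd_comp[OF mon_pcomps[OF y] add(1)] pprd_comp[OF mon_pcomps[OF y] add(2)]] add(3,4) ..
  qed
 next
  case (add v v')
  note xv = pprd_comp[OF mon_pcomps[OF x] add(1)] pprd_comp[OF mon_pcomps[OF x] add(2)]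
  show ?case
   unfolding pprd_add_right[OF mon_pcomps[OF x] add(1,2)] pprd_add_left[OF xv assms(3)] pprd_add_left[OF add(1,2) assms(3)]
    pprd_add_right[OF mon_pcomps[OF x] pprd_comp[OF add(1) assms(3)] pprd_comp[OF add(2) assms(3)]] add(3,4) ..
 qed
next
 case (add u u')
 show ?case
  unfolding pprd_add_left[OF add(1,2) assms(2)] pprd_add_left[OF add(1,2) pprd_comp[OF assms(2,3)]]
   pprd_add_left[OF pprd_comp[OF add(1) assms(2)] pprd_comp[OF add(2) assms(2)] assms(3)] add(3,4) ..
qed

lemma pprd_commute:
 assumes "u \<in> pcomps k" "v \<in> pcomps l" shows "pprd u v = ksign (k * l) *r pprd v u"
 using assms(1)
proof (induction rule: pcomps_induct)
 case (mon a x)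
 note x = mon
 from assms(2) show ?case
 proof (induction rule: pcomps_induct)
  case (mon b y)
  have "ksign (int b * (k - int (a mod 2)) + (k - int (a mod 2)) * (l - int (b mod 2))) = ksign (k * l + int a * (l - int (b mod 2)))"
   if "\<not> (odd a \<and> odd b)"
   using that by (intro ksign_eqI) auto
  then show ?case
   unfolding pprd_mon[OF x mon] pprd_mon[OF mon x] prd_commute[OF x mon]
   by (auto simp: mon_scale ksign_add[symmetric] add.commute)
 next
  case (add v v')
  show ?case
   unfolding pprd_add_right[OF mon_pcomps[OF x] add(1,2)] pprd_add_left[OF add(1,2) mon_pcomps[OF x]] add(3,4)
   by (rule scaleR_add_right[symmetric])
 qed
next
 case (add u u')
 show ?case
  unfolding pprd_add_left[OF add(1,2) assms(2)] pprd_add_right[OF assms(2) add(1,2)] add(3,4)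
  by (rule scaleR_add_right[symmetric])
qed

lemma pdiff_leibniz_mon:
 assumes x: "x \<in> V (k - int (a mod 2))" and y: "y \<in> V (l - int (b mod 2))"
 shows "pdiff (pprd (mon a x) (mon b y)) = pprd (pdiff (mon a x)) (mon b y) + ksign k *r pprd (mon a x) (pdiff (mon b y))"
proof -
 let ?k = "k - int (a mod 2)"
 note xy = prd_comp[OF x y]
 have dx: "dA x \<in> V (k + 1 - int (a mod 2))" and dy: "dA y \<in> V (l + 1 - int (b mod 2))"
  using V_shift[OF dA_comp[OF x], of "k + 1 - int (a mod 2)"] V_shift[OF dA_comp[OF y], of "l + 1 - int (b mod 2)"] by simp_all
 note mx = mon_pcomps[OF x] and my = mon_pcomps[OF y] and mdx = mon_pcomps[OF dx] and mdy = mon_pcomps[OF dy]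
 have px: "(real a / 2) *r mon (a - 1) x \<in> pcomps (k + 1)" if "even a"
  using subspace_diff[OF pcomps_subspace pdiff_comp[OF mx] mdx] that by (simp add: pdiff_mon)
 have py: "(real b / 2) *r mon (b - 1) y \<in> pcomps (l + 1)" if "even b"
  using subspace_diff[OF pcomps_subspace pdiff_comp[OF my] mdy] that by (simp add: pdiff_mon)
 have X: "pprd ((real a / 2) *r mon (a - 1) x) (mon b y) = (if odd b then 0 else (real a / 2) *r mon (a + b - 1) (prd x y))" if "even a"
 proof (cases "a = 0")
  case False
  with that show ?thesis unfolding pprd_mon_scale(1)[OF x y] pprd_mon[OF x y] by (auto simp: ksign_mult_nat)
 qed (use pprd_0(1)[OF my] in simp)
 have Y: "pprd (mon a x) ((real b / 2) *r mon (b - 1) y) = (if odd a then 0 else (real b / 2) *r ksign ?k *r mon (a + b - 1) (prd x y))" if "even b"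
 proof (cases "b = 0")
  case False
  with that show ?thesis unfolding pprd_mon_scale(2)[OF x y] pprd_mon[OF x y] ksign_mult_nat by auto
 qed (use pprd_0(2)[OF mx] in simp)
 have dX: "pprd (pdiff (mon a x)) (mon b y) = (if even a
   then pprd (mon a (dA x)) (mon b y) + pprd ((real a / 2) *r mon (a - 1) x) (mon b y) else - pprd (mon a (dA x)) (mon b y))"
  unfolding pdiff_mon using pprd_add_left[OF mdx px my] pprd_minus_left[OF mdx my] by simp
 have dY: "pprd (mon a x) (pdiff (mon b y)) = (if even b
   then pprd (mon a x) (mon b (dA y)) + pprd (mon a x) ((real b / 2) *r mon (b - 1) y) else - pprd (mon a x) (mon b (dA y)))"
  unfolding pdiff_mon using pprd_add_right[OF mx mdy py] pprd_minus_right[OF mx mdy] by simp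
 have L: "pdiff (pprd (mon a x) (mon b y)) = (if odd a \<and> odd b then 0 else ksign (int b * ?k) *r pdiff (mon (a + b) (prd x y)))"
  unfolding pprd_mon[OF x y] using pdiff_scale[OF mon_pcomps'[OF xy]] by (simp add: pdiff_0)
 have k: "ksign (k + 1 - int (a mod 2)) = - ksign ?k" by (auto simp: ksign_def)
 note R = pprd_mon[OF dx y, of a b] pprd_mon[OF x dy, of a b]
 note D = leibniz[OF x y]
 show ?thesis
 proof (cases "even a")
  case a: True
  show ?thesis
  proof (cases "even b")
   case True
   then show ?thesis
    unfolding L dX dY R using a X Y
    by (simp add: pdiff_mon D mon_add mon_scale ksign_mult_nat scaleR_add_left scaleR_add_right add_divide_distrib)
  next
   case False
   then show ?thesis
    unfolding L dX dY R using a X k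
    by (simp add: pdiff_mon D mon_add mon_scale ksign_mult_nat scaleR_add_right scaleR_diff_right)
  qed
 next
  case a: False
  then have "ksign k = - ksign ?k" by (auto simp: ksign_def odd_iff_mod_2_eq_one)
  with a show ?thesis
   unfolding L dX dY R using Y
   by (simp add: pdiff_mon D mon_add mon_scale ksign_mult_nat)
 qed
qed

lemma pdiff_leibniz:
 assumes "u \<in> pcomps k" "v \<in> pcomps l"
 shows "pdiff (pprd u v) = pprd (pdiff u) v + ksign k *r pprd u (pdiff v)"
 using assms(1)
proof (induction rule: pcomps_induct)
 case (mon a x)
 note x = mon and mx = mon_pcomps[OF mon]
 from assms(2) show ?case
 proof (induction rule: pcomps_induct)
  case (mon b y)
  show ?case by (rule pdiff_leibniz_mon[OF x mon])
 next
  case (add v v')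
  show ?case
   unfolding pprd_add_right[OF mx add(1,2)] pdiff_add[OF pprd_comp[OF mx add(1)] pprd_comp[OF mx add(2)]]
    pprd_add_right[OF pdiff_comp[OF mx] add(1,2)] pdiff_add[OF add(1,2)]
    pprd_add_right[OF mx pdiff_comp[OF add(1)] pdiff_comp[OF add(2)]] add(3,4)
   by (simp add: scaleR_add_right)
 qed
next
 case (add u u')
 note w = assms(2)
 show ?case
  unfolding pprd_add_left[OF add(1,2) w] pdiff_add[OF pprd_comp[OF add(1) w] pprd_comp[OF add(2) w]]
   pprd_add_left[OF add(1,2) pdiff_comp[OF w]] pdiff_add[OF add(1,2)]
   pprd_add_left[OF pdiff_comp[OF add(1)] pdiff_comp[OF add(2)] w] add(3,4)
  by (simp add: scaleR_add_right)
qed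

lemma pdiff_mon_coefficient:
 "pdiff (mon n x) = ksign (int n) *r mon n (dA x) + (if even n then real n / 2 else 0) *r mon (n - 1) x"
 by (simp add: pdiff_mon ksign_def)

lemma piop_pdiff_mon:
 assumes x: "x \<in> V (k - int (n mod 2))"
 shows "piop (pdiff (mon n x)) = ksign (int n) *r mon (n + 2) (iop (dA x)) + (if even n then real n / 2 else 0) *r mon (n + 1) (iop x)"
proof -
 let ?c = "if even n then real n / 2 else 0"
 have "ksign (int n) *r mon n (dA x) \<in> pcomps (k + 1)"
  by (rule subspace_scale[OF pcomps_subspace mon_pcomps[OF V_shift[OF dA_comp[OF x]]]]) simp
 moreover from subspace_diff[OF pcomps_subspace pdiff_comp[OF mon_pcomps[OF x]] this]
 have "?c *r mon (n - 1) x \<in> pcomps (k + 1)" by (simp add: pdiff_mon_coefficient)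
 moreover have "piop (?c *r mon (n - 1) x) = ?c *r mon (n + 1) (iop x)"
  unfolding piop_mon_scale[OF x] by (cases n) simp_all
 ultimately show ?thesis
  unfolding pdiff_mon_coefficient by (simp only: piop_add piop_mon_scale[OF dA_comp[OF x]])
qed

lemma piop_koszul:
 assumes "u \<in> pcomps k"
 shows "piop (piop (pdiff u)) - 2 *r piop (pdiff (piop u)) + pdiff (piop (piop u)) = 0"
 using assms
proof (induction rule: pcomps_induct)
 case (mon n x)
 note x = mon
 let ?c = "%n. if even n then real n / 2 else 0" and ?s = "ksign (int n)"
 have i: "iop x \<in> V (k - 2 - int ((n + 2) mod 2))" by (rule V_shift[OF iop_comp[OF x]]) simp
 note id = iop_comp[OF dA_comp[OF x]]
 have c1: "?s *r mon (n + 2) (iop (dA x)) \<in> pcomps (k - 1)"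
  by (rule subspace_scale[OF pcomps_subspace mon_pcomps[OF V_shift[OF id]]]) simp
 from subspace_diff[OF pcomps_subspace piop_comp[OF pdiff_comp[OF mon_pcomps[OF x]]], of "?s *r mon (n + 2) (iop (dA x))"] this
 have c2: "?c n *r mon (n + 1) (iop x) \<in> pcomps (k - 1)" by (simp add: piop_pdiff_mon[OF x] algebra_simps)
 have n: "n + 2 + 2 = n + 4" "n + 1 + 2 = n + 3" "n + 2 + 1 = n + 3" "n + 4 - 1 = n + 3" "ksign (int (n + 2)) = ?s" "ksign (int (n + 4)) = ?s"
  by (simp_all add: ksign_def)
 have 1: "piop (piop (pdiff (mon n x))) = ?s *r mon (n + 4) (iop (iop (dA x))) + ?c n *r mon (n + 3) (iop (iop x))"
  unfolding piop_pdiff_mon[OF x] piop_add[OF c1 c2] piop_mon_scale[OF id] piop_mon_scale[OF i] n ..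
 have 2: "piop (pdiff (piop (mon n x))) = ?s *r mon (n + 4) (iop (dA (iop x))) + ?c (n + 2) *r mon (n + 3) (iop (iop x))"
  unfolding piop_mon piop_pdiff_mon[OF i] n ..
 have 3: "pdiff (piop (piop (mon n x))) = ?s *r mon (n + 4) (dA (iop (iop x))) + ?c (n + 4) *r mon (n + 3) (iop (iop x))"
  unfolding piop_mon n pdiff_mon_coefficient ..
 have "?c n - 2 * ?c (n + 2) + ?c (n + 4) = 0" by (simp add: field_simps)
 then have c: "?c n *r z - 2 *r ?c (n + 2) *r z + ?c (n + 4) *r z = 0" for z :: "nat => 'a"
  unfolding scaleR_scaleR scaleR_left_diff_distrib[symmetric] scaleR_left_distrib[symmetric] by (simp only: scaleR_zero_left)
 have "mon (n + 4) (iop (iop (dA x))) - 2 *r mon (n + 4) (iop (dA (iop x))) + mon (n + 4) (dA (iop (iop x))) = 0"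
  unfolding mon_scale[symmetric] mon_minus[symmetric] mon_add[symmetric] iop_koszul[OF x] by (rule mon_0)
 then have "?s *r (mon (n + 4) (iop (iop (dA x))) - 2 *r mon (n + 4) (iop (dA (iop x))) + mon (n + 4) (dA (iop (iop x)))) = 0"
  by (simp only: scaleR_zero_right)
 then have s: "?s *r mon (n + 4) (iop (iop (dA x))) - 2 *r ?s *r mon (n + 4) (iop (dA (iop x))) + ?s *r mon (n + 4) (dA (iop (iop x))) = 0"
  unfolding scaleR_add_right scaleR_diff_right scaleR_scaleR mult.commute[of ?s 2] .
 have "(a + b) - 2 *r (a' + b') + (a'' + b'') = (a - 2 *r a' + a'') + (b - 2 *r b' + b'')" for a b a' b' a'' b'' :: "nat => 'a"
  by (simp add: scaleR_add_right)
 then show ?case unfolding 1 2 3 by (simp only: s c add_0_left)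
next
 case (add u v)
 note p = piop_comp[OF add(1)] piop_comp[OF add(2)] and d = pdiff_comp[OF add(1)] pdiff_comp[OF add(2)]
 note dp = pdiff_comp[OF p(1)] pdiff_comp[OF p(2)] and pd = piop_comp[OF d(1)] piop_comp[OF d(2)] and pp = piop_comp[OF p(1)] piop_comp[OF p(2)]
 have "piop (piop (pdiff (u + v))) - 2 *r piop (pdiff (piop (u + v))) + pdiff (piop (piop (u + v))) =
   (piop (piop (pdiff u)) - 2 *r piop (pdiff (piop u)) + pdiff (piop (piop u))) +
   (piop (piop (pdiff v)) - 2 *r piop (pdiff (piop v)) + pdiff (piop (piop v)))"
  unfolding pdiff_add[OF add(1,2)] piop_add[OF add(1,2)] piop_add[OF d] piop_add[OF pd] pdiff_add[OF p] piop_add[OF dp]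
   piop_add[OF p] pdiff_add[OF pp] by (simp add: algebra_simps)
 then show ?case unfolding add(3,4) by (simp only: add_0_left)
qed

lemma piop_second_order_mon:
 assumes x: "x \<in> V (k - int (a mod 2))" and y: "y \<in> V (l - int (b mod 2))" and z: "z \<in> V (m - int (c mod 2))"
 defines "X \<equiv> mon a x" and "Y \<equiv> mon b y" and "Z \<equiv> mon c z"
 shows "piop (pprd (pprd X Y) Z) = pprd (piop (pprd X Y)) Z + ksign (l * m) *r pprd (piop (pprd X Z)) Y
    + ksign (k * l + k * m) *r pprd (piop (pprd Y Z)) X - pprd (pprd (piop X) Y) Z
    - ksign (k * l) *r pprd (pprd (piop Y) X) Z - ksign (k * m + l * m) *r pprd (pprd (piop Z) X) Y"
proof -
 let ?k = "k - int (a mod 2)" and ?l = "l - int (b mod 2)" and ?m = "m - int (c mod 2)"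
 note i = pprd_pprd_mon[OF iop_comp[OF x] y z] pprd_pprd_mon[OF iop_comp[OF y] x z] pprd_pprd_mon[OF iop_comp[OF z] x y]
  pprd_piop_pprd_mon[OF x y z] pprd_piop_pprd_mon[OF x z y] pprd_piop_pprd_mon[OF y z x]
 note xyz = pprd_pprd_mon[OF x y z]
 show ?thesis
 proof (cases "odd a \<and> odd b \<or> odd a \<and> odd c \<or> odd b \<and> odd c")
  case True
  then show ?thesis unfolding X_def Y_def Z_def piop_mon i xyz by (auto simp: piop_0)
 next
  case False
  let ?s = "int b * ?k + int c * (?k + ?l)" and ?M = "%v. mon (a + b + c + 2) v"
  have scale: "piop (d *r mon n (prd (prd x y) z)) = d *r mon (n + 2) (iop (prd (prd x y) z))" for d n
   by (rule piop_mon_scale[OF prd_comp[OF prd_comp[OF x y] z]])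
  have signs: "ksign (l * m) * ksign (int c * ?k + int b * (?k + ?m)) = ksign ?s * ksign (?l * ?m)"
   "ksign (k * l + k * m) * ksign (int c * ?l + int a * (?l + ?m)) = ksign ?s * ksign (?k * ?l + ?k * ?m)"
   "ksign (int b * (?k - 2) + int c * (?k - 2 + ?l)) = ksign ?s"
   "ksign (k * l) * ksign (int a * (?l - 2) + int c * (?l - 2 + ?k)) = ksign ?s * ksign (?k * ?l)"
   "ksign (k * m + l * m) * ksign (int a * (?m - 2) + int b * (?m - 2 + ?k)) = ksign ?s * ksign (?k * ?m + ?l * ?m)"
   using False by (auto intro!: ksign_mult_eqI ksign_eqI)
  have perm: "a + c + b + 2 = a + b + c + 2" "b + c + a + 2 = a + b + c + 2" "a + 2 + b + c = a + b + c + 2"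
   "b + 2 + a + c = a + b + c + 2" "c + 2 + a + b = a + b + c + 2" by simp_all
  have F: "(if odd a \<and> odd b \<or> odd a \<and> odd c \<or> odd b \<and> odd c then 0 else u) = u"
   "(if odd a \<and> odd c \<or> odd a \<and> odd b \<or> odd c \<and> odd b then 0 else u) = u"
   "(if odd b \<and> odd c \<or> odd b \<and> odd a \<or> odd c \<and> odd a then 0 else u) = u"
   "(if odd (a + 2) \<and> odd b \<or> odd (a + 2) \<and> odd c \<or> odd b \<and> odd c then 0 else u) = u"
   "(if odd (b + 2) \<and> odd a \<or> odd (b + 2) \<and> odd c \<or> odd a \<and> odd c then 0 else u) = u"
   "(if odd (c + 2) \<and> odd a \<or> odd (c + 2) \<and> odd b \<or> odd a \<and> odd b then 0 else u) = u" for u :: "nat => 'a"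
   using False by auto
  have "ksign (l * m) *r pprd (piop (pprd X Z)) Y = ksign ?s *r ksign (?l * ?m) *r ?M (prd (iop (prd x z)) y)"
   "ksign (k * l + k * m) *r pprd (piop (pprd Y Z)) X = ksign ?s *r ksign (?k * ?l + ?k * ?m) *r ?M (prd (iop (prd y z)) x)"
   "pprd (pprd (piop X) Y) Z = ksign ?s *r ?M (prd (prd (iop x) y) z)"
   "ksign (k * l) *r pprd (pprd (piop Y) X) Z = ksign ?s *r ksign (?k * ?l) *r ?M (prd (prd (iop y) x) z)"
   "ksign (k * m + l * m) *r pprd (pprd (piop Z) X) Y = ksign ?s *r ksign (?k * ?m + ?l * ?m) *r ?M (prd (prd (iop z) x) y)"
   "pprd (piop (pprd X Y)) Z = ksign ?s *r ?M (prd (iop (prd x y)) z)"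
   "piop (pprd (pprd X Y) Z) = ksign ?s *r ?M (iop (prd (prd x y) z))"
   unfolding X_def Y_def Z_def piop_mon i xyz F perm scale scaleR_scaleR signs by (rule refl)+
  note t = this
  show ?thesis
   unfolding t iop_second_order[OF x y z]
   by (simp only: mon_add mon_minus mon_scale scaleR_add_right scaleR_diff_right)
 qed
qed

lemma piop_second_order:
 assumes u: "u \<in> pcomps k" and v: "v \<in> pcomps l" and w: "w \<in> pcomps m"
 shows "piop (pprd (pprd u v) w) = pprd (piop (pprd u v)) w + ksign (l * m) *r pprd (piop (pprd u w)) v
    + ksign (k * l + k * m) *r pprd (piop (pprd v w)) u - pprd (pprd (piop u) v) w
    - ksign (k * l) *r pprd (pprd (piop v) u) w - ksign (k * m + l * m) *r pprd (pprd (piop w) u) v"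
proof -
 define F where "F u v w = piop (pprd (pprd u v) w) - pprd (piop (pprd u v)) w - ksign (l * m) *r pprd (piop (pprd u w)) v
    - ksign (k * l + k * m) *r pprd (piop (pprd v w)) u + pprd (pprd (piop u) v) w
    + ksign (k * l) *r pprd (pprd (piop v) u) w + ksign (k * m + l * m) *r pprd (pprd (piop w) u) v" for u v w
 note C = pprd_comp piop_comp
 have 1: "F (u + u') v w = F u v w + F u' v w" if "u \<in> pcomps k" "u' \<in> pcomps k" "v \<in> pcomps l" "w \<in> pcomps m" for u u' v w
 proof -
  note h = that
  note uv = pprd_comp[OF h(1,3)] pprd_comp[OF h(2,3)] and uw = pprd_comp[OF h(1,4)] pprd_comp[OF h(2,4)]
   and vw = pprd_comp[OF h(3,4)] and iv = pprd_comp[OF piop_comp[OF h(3)] h(1)] pprd_comp[OF piop_comp[OF h(3)] h(2)]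
   and iw = pprd_comp[OF piop_comp[OF h(4)] h(1)] pprd_comp[OF piop_comp[OF h(4)] h(2)]
   and iu = piop_comp[OF h(1)] piop_comp[OF h(2)]
  show ?thesis
   unfolding F_def pprd_add_left[OF h(1,2,3)] pprd_add_left[OF h(1,2,4)] pprd_add_left[OF uv h(4)] piop_add[OF uv]
    piop_add[OF pprd_comp[OF uv(1) h(4)] pprd_comp[OF uv(2) h(4)]] pprd_add_left[OF piop_comp[OF uv(1)] piop_comp[OF uv(2)] h(4)]
    piop_add[OF uw] pprd_add_left[OF piop_comp[OF uw(1)] piop_comp[OF uw(2)] h(3)] pprd_add_right[OF piop_comp[OF vw] h(1,2)]
    piop_add[OF h(1,2)] pprd_add_left[OF iu h(3)] pprd_add_left[OF pprd_comp[OF iu(1) h(3)] pprd_comp[OF iu(2) h(3)] h(4)]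
    pprd_add_right[OF piop_comp[OF h(3)] h(1,2)] pprd_add_left[OF iv h(4)]
    pprd_add_right[OF piop_comp[OF h(4)] h(1,2)] pprd_add_left[OF iw h(3)]
   by (simp add: algebra_simps)
 qed
 have 2: "F u (v + v') w = F u v w + F u v' w" if "v \<in> pcomps l" "v' \<in> pcomps l" "u \<in> pcomps k" "w \<in> pcomps m" for u v v' w
 proof -
  note h = that
  note uv = pprd_comp[OF h(3,1)] pprd_comp[OF h(3,2)] and uw = pprd_comp[OF h(3,4)] and iu = piop_comp[OF h(3)]
   and vw = pprd_comp[OF h(1,4)] pprd_comp[OF h(2,4)] and iv = piop_comp[OF h(1)] piop_comp[OF h(2)] and iw = piop_comp[OF h(4)]
  note iuv = pprd_comp[OF iu h(1)] pprd_comp[OF iu h(2)] and ivu = pprd_comp[OF iv(1) h(3)] pprd_comp[OF iv(2) h(3)]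
  show ?thesis
   unfolding F_def pprd_add_right[OF h(3,1,2)] pprd_add_left[OF uv h(4)] piop_add[OF uv]
    piop_add[OF pprd_comp[OF uv(1) h(4)] pprd_comp[OF uv(2) h(4)]] pprd_add_left[OF piop_comp[OF uv(1)] piop_comp[OF uv(2)] h(4)]
    pprd_add_right[OF piop_comp[OF uw] h(1,2)] pprd_add_left[OF h(1,2,4)] piop_add[OF vw]
    pprd_add_left[OF piop_comp[OF vw(1)] piop_comp[OF vw(2)] h(3)]
    pprd_add_right[OF iu h(1,2)] pprd_add_left[OF iuv h(4)] piop_add[OF h(1,2)] pprd_add_left[OF iv h(3)] pprd_add_left[OF ivu h(4)]
    pprd_add_right[OF pprd_comp[OF iw h(3)] h(1,2)]
   by (simp add: algebra_simps)
 qed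
 have 3: "F u v (w + w') = F u v w + F u v w'" if "w \<in> pcomps m" "w' \<in> pcomps m" "u \<in> pcomps k" "v \<in> pcomps l" for u v w w'
 proof -
  note h = that
  note uv = pprd_comp[OF h(3,4)] and uw = pprd_comp[OF h(3,1)] pprd_comp[OF h(3,2)] and iu = piop_comp[OF h(3)]
   and vw = pprd_comp[OF h(4,1)] pprd_comp[OF h(4,2)] and iv = piop_comp[OF h(4)] and iw = piop_comp[OF h(1)] piop_comp[OF h(2)]
  show ?thesis
   unfolding F_def pprd_add_right[OF uv h(1,2)] piop_add[OF pprd_comp[OF uv h(1)] pprd_comp[OF uv h(2)]]
    pprd_add_right[OF piop_comp[OF uv] h(1,2)]
    pprd_add_right[OF h(3,1,2)] piop_add[OF uw] pprd_add_left[OF piop_comp[OF uw(1)] piop_comp[OF uw(2)] h(4)]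
    pprd_add_right[OF h(4,1,2)] piop_add[OF vw] pprd_add_left[OF piop_comp[OF vw(1)] piop_comp[OF vw(2)] h(3)]
    pprd_add_right[OF pprd_comp[OF iu h(4)] h(1,2)] pprd_add_right[OF pprd_comp[OF iv h(3)] h(1,2)]
    piop_add[OF h(1,2)] pprd_add_left[OF iw h(3)] pprd_add_left[OF pprd_comp[OF iw(1) h(3)] pprd_comp[OF iw(2) h(3)] h(4)]
   by (simp add: algebra_simps)
 qed
 have "F u v w = 0"
  using u
 proof (induction rule: pcomps_induct)
  case (mon a x)
  note x = mon
  from v show ?case
  proof (induction rule: pcomps_induct)
   case (mon b y)
   note y = mon
   from w show ?case
   proof (induction rule: pcomps_induct)
    case (mon c z)
    show ?case unfolding F_def piop_second_order_mon[OF x y mon] by simp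
   next
    case (add w w')
    show ?case unfolding 3[OF add(1,2) mon_pcomps[OF x] mon_pcomps[OF y]] add(3,4) by simp
   qed
  next
   case (add v v')
   show ?case unfolding 2[OF add(1,2) mon_pcomps[OF x] w] add(3,4) by simp
  qed
 next
  case (add u u')
  show ?case unfolding 1[OF add(1,2) v w] add(3,4) by simp
 qed
 then show ?thesis unfolding F_def by (simp add: algebra_simps)
qed

theorem path_ebv_data: "ebv_data path pprd piop"
proof -
 have sel: "comps path = pcomps" "differential path = pdiff" by (simp_all add: path_def)
 show ?thesis
  by (rule ebv_data.intro, unfold sel)
    (rule path_cochain_complex pprd_comp pprd_linear_left pprd_linear_right pprd_assoc pprd_commute pdiff_leibniz
     piop_comp piop_linear piop_second_order piop_koszul; assumption)+
qed

subsection \<open>Evaluation at the end points\<close>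

definition at_zero :: "(nat => 'a) => 'a" where "at_zero u = u 0"

definition at_one :: "(nat => 'a) => 'a" where "at_one u = (\<Sum>n | u n \<noteq> 0 \<and> even n. u n)"

definition primitive :: "(nat => 'a) => nat => 'a" where
 "primitive u = (%n. if even n \<and> 0 < n then (2 / real n) *r u (n - 1) else 0)"

lemma at_zero_linear: "linear_map_on W at_zero"
 by (simp add: linear_map_on_def at_zero_def plus_fun_apply scaleR_fun_def)

lemma at_zero_mon: "at_zero (mon n x) = (if n = 0 then x else 0)"
 by (simp add: at_zero_def mon_def)

lemma at_one_eq: "finite N ==> {n. u n \<noteq> 0} \<subseteq> N ==> at_one u = (\<Sum>n\<in>N. if even n then u n else 0)"
proof -
 assume N: "finite N" "{n. u n \<noteq> 0} \<subseteq> N"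
 have "(\<Sum>n\<in>N. if even n then u n else 0) = (\<Sum>n\<in>{n\<in>N. even n}. u n)"
  by (rule sum.inter_filter[symmetric, OF N(1)])
 also have "... = at_one u"
  unfolding at_one_def by (rule sum.mono_neutral_right) (use N in auto)
 finally show ?thesis ..
qed

lemma at_one_linear: "linear_map_on (pcomps k) at_one"
 unfolding linear_map_on_def
proof (intro conjI ballI allI)
 fix u v assume "u \<in> pcomps k" "v \<in> pcomps k"
 then have N: "finite ({n. u n \<noteq> 0} \<union> {n. v n \<noteq> 0})" by (simp add: pcomps_def)
 let ?N = "{n. u n \<noteq> 0} \<union> {n. v n \<noteq> 0}"
 have s: "{n. u n \<noteq> 0} \<subseteq> ?N" "{n. v n \<noteq> 0} \<subseteq> ?N" "{n. (u + v) n \<noteq> 0} \<subseteq> ?N"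
  by (auto simp: plus_fun_apply)
 show "at_one (u + v) = at_one u + at_one v"
  unfolding at_one_eq[OF N s(1)] at_one_eq[OF N s(2)] at_one_eq[OF N s(3)] sum.distrib[symmetric]
  by (rule sum.cong) (auto simp: plus_fun_apply)
next
 fix c u assume "u \<in> pcomps k"
 then have N: "finite {n. u n \<noteq> 0}" by (simp add: pcomps_def)
 have s: "{n. (c *r u) n \<noteq> 0} \<subseteq> {n. u n \<noteq> 0}" by (auto simp: scaleR_fun_def)
 show "at_one (c *r u) = c *r at_one u"
  unfolding at_one_eq[OF N order_refl] at_one_eq[OF N s] scaleR_sum_right
  by (rule sum.cong) (auto simp: scaleR_fun_def)
qed

lemma at_one_mon: "at_one (mon n x) = (if even n then x else 0)"
proof -
 have "{m. mon n x m \<noteq> 0} \<subseteq> {n}" by (auto simp: mon_def)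
 from at_one_eq[OF _ this] show ?thesis by (simp add: mon_def)
qed

lemma at_one_add: "u \<in> pcomps k ==> v \<in> pcomps k ==> at_one (u + v) = at_one u + at_one v"
 by (rule linear_onD(1)[OF at_one_linear])

lemma at_one_minus: "u \<in> pcomps k ==> at_one (- u) = - at_one u"
 using linear_onD(2)[OF at_one_linear, of u k "-1"] by simp

lemma at_one_scale: "u \<in> pcomps k ==> at_one (c *r u) = c *r at_one u"
 by (rule linear_onD(2)[OF at_one_linear])

lemma at_one_comp: "u \<in> pcomps k ==> at_one u \<in> V k"
proof (induction rule: pcomps_induct)
 case (mon n x)
 then show ?case by (auto simp: at_one_mon V_0)
next
 case (add u v)
 show ?case unfolding at_one_add[OF add(1,2)] by (rule subspace_add[OF V_subspace add(3,4)])
qed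

lemma at_one_pdiff: "u \<in> pcomps k ==> at_one (pdiff u) = dA (at_one u)"
proof (induction rule: pcomps_induct)
 case (mon n x)
 have d: "mon n (dA x) \<in> pcomps (k + 1)" by (rule mon_pcomps[OF V_shift[OF dA_comp[OF mon]]]) simp
 show ?case
 proof (cases "even n")
  case True
  have p: "(real n / 2) *r mon (n - 1) x \<in> pcomps (k + 1)"
   using subspace_diff[OF pcomps_subspace pdiff_comp[OF mon_pcomps[OF mon]] d] True by (simp add: pdiff_mon)
  have "at_one ((real n / 2) *r mon (n - 1) x) = (real n / 2) *r at_one (mon (n - 1) x)"
   by (rule at_one_scale[OF mon_pcomps'[OF mon]])
  also have "... = 0" using True by (cases n) (auto simp: at_one_mon)
  finally show ?thesis using True at_one_add[OF d p] by (simp add: pdiff_mon at_one_mon)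
 next
  case False
  then show ?thesis using at_one_minus[OF d] by (simp add: pdiff_mon at_one_mon dA_0)
 qed
next
 case (add u v)
 show ?case
  unfolding at_one_add[OF add(1,2)] pdiff_add[OF add(1,2)] at_one_add[OF pdiff_comp[OF add(1)] pdiff_comp[OF add(2)]] add(3,4)
  by (rule linear_onD(1)[OF dA_linear at_one_comp[OF add(1)] at_one_comp[OF add(2)], symmetric])
qed

lemma at_one_piop: "u \<in> pcomps k ==> at_one (piop u) = iop (at_one u)"
proof (induction rule: pcomps_induct)
 case (mon n x)
 then show ?case by (simp add: piop_mon at_one_mon iop_0)
next
 case (add u v)
 show ?case
  unfolding at_one_add[OF add(1,2)] piop_add[OF add(1,2)] at_one_add[OF piop_comp[OF add(1)] piop_comp[OF add(2)]] add(3,4)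
  by (rule linear_onD(1)[OF iop_linear at_one_comp[OF add(1)] at_one_comp[OF add(2)], symmetric])
qed

lemma at_one_pprd:
 assumes "u \<in> pcomps k" "v \<in> pcomps l" shows "at_one (pprd u v) = prd (at_one u) (at_one v)"
 using assms(1)
proof (induction rule: pcomps_induct)
 case (mon a x)
 note x = mon
 from assms(2) show ?case
 proof (induction rule: pcomps_induct)
  case (mon b y)
  have 0: "at_one 0 = 0" using at_one_mon[of 0 0] by simp
  show ?case
   unfolding pprd_mon[OF x mon]
   by (auto simp: at_one_mon 0 at_one_scale[OF mon_pcomps'[OF prd_comp[OF x mon]]] prd_0_left[OF mon] prd_0_left[OF V_0] prd_0_right[OF x] ksign_mult_nat)
 next
  case (add v w)
  show ?case
   unfolding pprd_add_right[OF mon_pcomps[OF x] add(1,2)] at_one_add[OF pprd_comp[OF mon_pcomps[OF x] add(1)] pprd_comp[OF mon_pcomps[OF x] add(2)]]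
    at_one_add[OF add(1,2)] add(3,4)
   by (rule linear_onD(1)[OF prd_linear_right[OF at_one_comp[OF mon_pcomps[OF x]]] at_one_comp[OF add(1)] at_one_comp[OF add(2)], symmetric])
 qed
next
 case (add u w)
 show ?case
  unfolding pprd_add_left[OF add(1,2) assms(2)] at_one_add[OF pprd_comp[OF add(1) assms(2)] pprd_comp[OF add(2) assms(2)]]
   at_one_add[OF add(1,2)] add(3,4)
  by (rule linear_onD(1)[OF prd_linear_left[OF at_one_comp[OF assms(2)]] at_one_comp[OF add(1)] at_one_comp[OF add(2)], symmetric])
qed

lemma at_zero_comp: "u \<in> pcomps k ==> at_zero u \<in> V k"
 using pcompsD[of u k 0] by (simp add: at_zero_def)

lemma at_zero_pdiff: "at_zero (pdiff u) = dA (at_zero u)"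
 by (simp add: at_zero_def pdiff_def)

lemma at_zero_piop: "at_zero (piop u) = 0"
 by (simp add: at_zero_def piop_def)

lemma at_zero_pprd: "u \<in> pcomps k ==> at_zero (pprd u v) = prd (at_zero u) (at_zero v)"
 by (simp add: at_zero_def pprd_def eps_def)

lemma integral_linear: "linear_map_on W primitive"
 by (auto simp: linear_map_on_def primitive_def fun_eq_iff plus_fun_apply scaleR_fun_def scaleR_add_right mult.commute)

lemma integral_add: "primitive (u + v) = primitive u + primitive v"
 and integral_scale: "primitive (c *r u) = c *r primitive u"
 using linear_onD[OF integral_linear[of UNIV]] by auto

lemma integral_minus: "primitive (- u) = - primitive u"
 using integral_scale[of "-1" u] by simp

lemma integral_mon: "primitive (mon n x) = (if odd n then (2 / real (n + 1)) *r mon (n + 1) x else 0)"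
 by (auto simp: primitive_def mon_def fun_eq_iff scaleR_fun_def zero_fun_apply)

lemma integral_comp: "u \<in> pcomps k ==> primitive u \<in> pcomps (k - 1)"
proof (induction rule: pcomps_induct)
 case (mon n x)
 have "mon (n + 1) x \<in> pcomps (k - 1)" if "odd n"
  by (rule mon_pcomps[OF V_shift[OF mon]]) (use that in \<open>simp add: mod2_eq_if\<close>)
 then show ?case by (simp add: integral_mon subspace_scale[OF pcomps_subspace] subspace_0[OF pcomps_subspace])
next
 case (add u v)
 show ?case unfolding integral_add by (rule subspace_add[OF pcomps_subspace add(3,4)])
qed

text \<open>
  The fundamental theorem of calculus; \<open>primitive\<close> sends \<open>t\<^sup>j dt\<close> to \<open>t\<^bsup>j+1\<^esup> / (j + 1)\<close>.
\<close>
lemma integral_homotopy: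
 "u \<in> pcomps k ==> pdiff (primitive u) + primitive (pdiff u) = u - mon 0 (at_zero u)"
proof (induction rule: pcomps_induct)
 case (mon n x)
 show ?case
 proof (cases "even n")
  case True
  have "primitive (pdiff (mon n x)) = (real n / 2) *r primitive (mon (n - 1) x)"
   using True by (simp add: pdiff_mon integral_add integral_scale integral_mon)
  also have "... = mon n x - mon 0 (at_zero (mon n x))"
  proof -
   have e: "(2 + real j * 2) / (2 + 2 * real j) = 1" for j by (simp add: divide_eq_1_iff)
   show ?thesis using True by (cases n) (auto simp: integral_mon at_zero_mon e)
  qed
  finally show ?thesis using True by (simp add: integral_mon pdiff_0)
 next
  case False
  have n1: "n + 1 - 1 = n" "even (n + 1)" using False by auto
  have "pdiff (primitive (mon n x)) = (2 / real (n + 1)) *r (mon (n + 1) (dA x) + (real (n + 1) / 2) *r mon n x)"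
   using False pdiff_scale[OF mon_pcomps'[OF mon], where n1 = "n + 1"] pdiff_mon[of "n + 1" x] by (simp add: integral_mon)
  also have "... = (2 / real (n + 1)) *r mon (n + 1) (dA x) + mon n x"
  proof -
   have "(2 / real (n + 1)) * (real (n + 1) / 2) = 1" by simp
   then show ?thesis by (simp only: scaleR_add_right scaleR_scaleR scaleR_one)
  qed
  finally show ?thesis
   using False by (simp add: pdiff_mon integral_minus integral_mon at_zero_mon) (auto simp: at_zero_mon)
 qed
next
 case (add u v)
 have z: "at_zero (u + v) = at_zero u + at_zero v" using linear_onD(1)[OF at_zero_linear[of UNIV]] by auto
 have "pdiff (primitive (u + v)) + primitive (pdiff (u + v)) =
   (pdiff (primitive u) + primitive (pdiff u)) + (pdiff (primitive v) + primitive (pdiff v))"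
  unfolding integral_add pdiff_add[OF add(1,2)] pdiff_add[OF integral_comp[OF add(1)] integral_comp[OF add(2)]]
  by (simp add: algebra_simps)
 also have "... = u + v - mon 0 (at_zero (u + v))"
  unfolding add(3,4) z mon_add by (simp add: algebra_simps)
 finally show ?case .
qed

lemma path_sel: "comps path = pcomps" "differential path = pdiff"
 by (simp_all add: path_def)

lemma constant_cocycle: "y \<in> cocycles A k ==> mon 0 y \<in> cocycles path k"
 by (simp add: cocycles_def path_sel mon_pcomps pdiff_mon)

lemma cocycle_homotopy:
 assumes "u \<in> cocycles path k" shows "u = mon 0 (at_zero u) + pdiff (primitive u)"
proof -
 have u: "u \<in> pcomps k" "pdiff u = 0" using assms by (auto simp: cocycles_def path_sel)
 have "primitive 0 = 0" using integral_scale[of 0 0] by simp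
 then show ?thesis using integral_homotopy[OF u(1)] u(2) by (simp add: algebra_simps)
qed

lemma pdiff_mon_0: "pdiff (mon 0 x) = mon 0 (dA x)"
 by (simp add: pdiff_mon)

theorem at_zero_quasi_iso: "quasi_iso_map path A at_zero"
proof (rule quasi_iso_mapI[OF path_cochain_complex cc])
 show "cochain_map path A at_zero"
  by (simp add: cochain_map_def path_sel at_zero_linear at_zero_comp at_zero_pdiff)
 show "\<exists>x\<in>cocycles path k. at_zero x = y" if "y \<in> cocycles A k" for k y
  using constant_cocycle[OF that] by (intro bexI) (simp_all add: at_zero_mon)
 show "x \<in> differential path ` comps path (k - 1)"
  if x: "x \<in> cocycles path k" and z: "at_zero x \<in> dA ` V (k - 1)" for k x
 proof -
  obtain y where y: "y \<in> V (k - 1)" "at_zero x = dA y" using z by blast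
  have m: "mon 0 y \<in> pcomps (k - 1)" using y by (intro mon_pcomps) simp
  have h: "primitive x \<in> pcomps (k - 1)" using x by (intro integral_comp) (simp add: cocycles_def path_sel)
  have "x = pdiff (mon 0 y + primitive x)"
   unfolding pdiff_add[OF m h] pdiff_mon_0 y(2)[symmetric] by (rule cocycle_homotopy[OF x])
  then show ?thesis unfolding path_sel using subspace_add[OF pcomps_subspace m h] by blast
 qed
qed

text \<open>
  On a cocycle the values at the two end points differ by the coboundary of an integral, so this
  reduces to the value at \<open>0\<close>.
\<close>
theorem at_one_quasi_iso: "quasi_iso_map path A at_one"
proof (rule quasi_iso_mapI[OF path_cochain_complex cc])
 show "cochain_map path A at_one"
  by (simp add: cochain_map_def path_sel at_one_linear at_one_comp at_one_pdiff)
 show "\<exists>x\<in>cocycles path k. at_one x = y" if "y \<in> cocycles A k" for k y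
  using constant_cocycle[OF that] by (intro bexI) (simp_all add: at_one_mon)
 show "x \<in> differential path ` comps path (k - 1)"
  if x: "x \<in> cocycles path k" and z: "at_one x \<in> dA ` V (k - 1)" for k x
 proof -
  obtain y where y: "y \<in> V (k - 1)" "at_one x = dA y" using z by blast
  have x': "x \<in> pcomps k" using x by (simp add: cocycles_def path_sel)
  have h: "primitive x \<in> pcomps (k - 1)" by (rule integral_comp[OF x'])
  have c: "mon 0 (at_zero x) \<in> pcomps k" using at_zero_comp[OF x'] by (intro mon_pcomps) simp
  have dh: "pdiff (primitive x) \<in> pcomps k" using pdiff_comp[OF h] by simp
  have "at_one x = at_zero x + dA (at_one (primitive x))"
   using cocycle_homotopy[OF x] at_one_add[OF c dh] at_one_pdiff[OF h] by (simp add: at_one_mon)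
  moreover have h1: "at_one (primitive x) \<in> V (k - 1)" by (rule at_one_comp[OF h])
  ultimately have z: "at_zero x = dA (y - at_one (primitive x))"
   using linear_on_diff[OF V_subspace dA_linear y(1) h1] y(2) by (simp add: algebra_simps)
  have m: "mon 0 (y - at_one (primitive x)) \<in> pcomps (k - 1)"
   using subspace_diff[OF V_subspace y(1) h1] by (intro mon_pcomps) simp
  have "x = pdiff (mon 0 (y - at_one (primitive x)) + primitive x)"
   unfolding pdiff_add[OF m h] pdiff_mon_0 z[symmetric] by (rule cocycle_homotopy[OF x])
  then show ?thesis unfolding path_sel using subspace_add[OF pcomps_subspace m h] by blast
 qed
qed

end

declare plus_fun_apply [simp] minus_apply [simp] uminus_apply [simp] zero_fun_apply [simp]

section \<open>Differentiability on open subsets of a subspace\<close>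

lemma has_derivative_unique_subspace:
 fixes E :: "'a::euclidean_space set"
 assumes E: "subspace E" "x \<in> E" "v \<in> E"
  and A: "(f has_derivative A) (at x within E)" and B: "(f has_derivative B) (at x within E)"
 shows "A v = B v"
proof -
 have *: "((%t. f (x + t *r v)) has_derivative (%t. D (t *r v))) (at (0::real))"
  if D: "(f has_derivative D) (at x within E)" for D
 proof -
  have g: "((%t. x + t *r v) has_derivative (%t. t *r v)) (at (0::real) within UNIV)"
   by (auto intro!: derivative_eq_intros)
  have "(f has_derivative D) (at (x + 0 *r v) within (%t. x + t *r v) ` UNIV)"
   using has_derivative_subset[OF D, of "(%t. x + t *r v) ` UNIV"] E
   by (simp add: image_subset_iff subspace_add subspace_scale)
  from has_derivative_in_compose[OF g this] show ?thesis
   by simp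
 qed
 have "(%t::real. A (t *r v)) = (%t. B (t *r v))"
  by (rule has_derivative_unique[OF *[OF A] *[OF B]])
 from fun_cong[OF this, of 1] show ?thesis
  by simp
qed

lemma eventually_at_within_openin:
 assumes "openin (top_of_set E) W" "x \<in> W" "!!y. y \<in> W ==> P y"
 shows "eventually P (at x within E)"
proof -
 obtain O' where "open O'" "W = E \<inter> O'" using assms(1) by (auto simp: openin_open)
 then show ?thesis using assms(2,3) by (auto simp: eventually_at_topological)
qed

lemma has_derivative_cong_openin:
 assumes W: "openin (top_of_set E) W" "x \<in> W" and eq: "!!y. y \<in> W ==> f y = g y"
 shows "(f has_derivative D) (at x within E) \<longleftrightarrow> (g has_derivative D) (at x within E)"
proof -
 have "x \<in> E" using W openin_imp_subset by blast
 moreover have "eventually (%y. f y = g y) (at x within E)"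
  using W eq by (rule eventually_at_within_openin)
 ultimately show ?thesis
  using eq[OF W(2)] by (auto intro: has_derivative_transform_eventually simp: eq_commute)
qed

lemma cdiff_on_cong:
 assumes "openin (top_of_set E) W" "!!y. y \<in> W ==> f y = g y"
  and "continuously_diff_on r E W f"
 shows "continuously_diff_on r E W g"
 using assms
proof (induction r arbitrary: f g)
 case 0
 then show ?case by (simp cong: continuous_on_cong)
next
 case (Suc r)
 have "(f has_derivative D) (at x within E) \<longleftrightarrow> (g has_derivative D) (at x within E)" if "x \<in> W" for x D
  by (rule has_derivative_cong_openin[OF Suc.prems(1) that Suc.prems(2)])
 then have fr: "frechet_derivative f (at x within E) = frechet_derivative g (at x within E)"
  and di: "f differentiable (at x within E) \<longleftrightarrow> g differentiable (at x within E)"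
  if "x \<in> W" for x
  using that by (auto simp: frechet_derivative_def differentiable_def)
 show ?case
  unfolding continuously_diff_on.simps
 proof (intro conjI ballI)
  fix x assume "x \<in> W"
  then show "g differentiable at x within E" using Suc.prems(3) di by simp
 next
  fix v assume "v \<in> E"
  then have "continuously_diff_on r E W (%x. frechet_derivative f (at x within E) v)"
   using Suc.prems(3) by simp
  then show "continuously_diff_on r E W (%x. frechet_derivative g (at x within E) v)"
   by (rule Suc.IH[OF Suc.prems(1), rotated]) (simp add: fr)
 qed
qed

lemma cdiff_on_subset:
 assumes "continuously_diff_on r E W f" "V \<subseteq> W"
 shows "continuously_diff_on r E V f"
 using assms by (induction r arbitrary: f) (auto intro: continuous_on_subset)

lemma cdiff_on_SucI:
 assumes E: "subspace E" and W: "openin (top_of_set E) W"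
  and D: "!!x. x \<in> W ==> (f has_derivative D x) (at x within E)"
  and C: "!!v. v \<in> E ==> continuously_diff_on r E W (%x. D x v)"
 shows "continuously_diff_on (Suc r) E W f"
proof -
 have "frechet_derivative f (at x within E) v = D x v" if "x \<in> W" "v \<in> E" for x v
 proof (rule has_derivative_unique_subspace[OF E _ that(2)])
  show "x \<in> E" using W that openin_imp_subset by blast
  show "(f has_derivative D x) (at x within E)" by (rule D[OF that(1)])
  then show "(f has_derivative frechet_derivative f (at x within E)) (at x within E)"
   using frechet_derivative_works differentiableI by blast
 qed
 then show ?thesis
  unfolding continuously_diff_on.simps
  using D C by (auto simp: differentiable_def intro: cdiff_on_cong[OF W _ C])
qed

lemma cdiff_on_SucD:
 assumes "continuously_diff_on (Suc r) E W f"
 shows "\<exists>D. (\<forall>x\<in>W. (f has_derivative D x) (at x within E)) \<and>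
  (\<forall>v\<in>E. continuously_diff_on r E W (%x. D x v))"
 using assms
 by (intro exI[of _ "%x. frechet_derivative f (at x within E)"]) (simp add: frechet_derivative_works)

lemma cdiff_on_Suc_lower:
 assumes "W \<subseteq> E" "continuously_diff_on (Suc r) E W f"
 shows "continuously_diff_on r E W f"
 using assms(2)
proof (induction r arbitrary: f)
 case 0
 have "continuous (at x within W) f" if "x \<in> W" for x
  using 0 that assms(1) by (auto intro: differentiable_imp_continuous_within differentiable_within_subset)
 then show ?case by (simp add: continuous_on_eq_continuous_within)
next
 case (Suc r)
 then show ?case unfolding continuously_diff_on.simps(2)[of "Suc r"] continuously_diff_on.simps(2)[of r] by blast
qed

lemma cdiff_on_continuous:
 assumes "W \<subseteq> E" "continuously_diff_on r E W f"
 shows "continuous_on W f"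
 using assms(2)
proof (induction r)
 case (Suc r)
 then show ?case using cdiff_on_Suc_lower[OF assms(1)] by blast
qed simp

lemma at_within_Int_openin:
 assumes "openin (top_of_set W) U" "x \<in> U"
 shows "at x within U = at x within W"
proof -
 obtain O' where "open O'" "U = W \<inter> O'" using assms(1) by (auto simp: openin_open)
 then show ?thesis using assms(2) by (auto intro!: at_within_nhd[where S = O'])
qed

lemma cdiff_on_local:
 assumes "W \<subseteq> E"
  and "!!x. x \<in> W ==> \<exists>U. openin (top_of_set E) U \<and> x \<in> U \<and> continuously_diff_on r E (W \<inter> U) f"
 shows "continuously_diff_on r E W f"
 using assms(2)
proof (induction r arbitrary: f)
 case 0
 have "continuous (at x within W) f" if x: "x \<in> W" for x
 proof -
  obtain U where U: "openin (top_of_set E) U" "x \<in> U" "continuous_on (W \<inter> U) f"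
   using 0 x by auto
  have "openin (top_of_set W) (W \<inter> U)"
   using U(1) assms(1) by (metis inf.absorb_iff2 openin_Int_open openin_open inf_assoc inf_commute)
  with U x show ?thesis
   by (metis IntI at_within_Int_openin continuous_on_eq_continuous_within)
 qed
 then show ?case by (simp add: continuous_on_eq_continuous_within)
next
 case (Suc r)
 show ?case
  unfolding continuously_diff_on.simps
 proof (intro conjI ballI)
  fix x assume "x \<in> W"
  then show "f differentiable at x within E" using Suc.prems[of x] by auto
 next
  fix v assume v: "v \<in> E"
  show "continuously_diff_on r E W (%x. frechet_derivative f (at x within E) v)"
   using v Suc.prems by (intro Suc.IH) fastforce
 qed
qed

context
 fixes E W :: "'a::euclidean_space set"
 assumes E: "subspace E" and W: "openin (top_of_set E) W"
begin

lemma cdiff_on_const: "continuously_diff_on r E W (%_. c :: 'b::real_normed_vector)"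
proof (induction r arbitrary: c)
 case 0
 show ?case by (simp only: continuously_diff_on.simps continuous_on_const)
next
 case (Suc r)
 show ?case
 proof (rule cdiff_on_SucI[OF E W])
  show "((%_. c) has_derivative (%_. 0)) (at x within E)" for x
   by (rule has_derivative_const)
  show "continuously_diff_on r E W (%_. 0 :: 'b)"
   by (rule Suc.IH)
 qed
qed

lemma cdiff_on_id: "continuously_diff_on r E W (%x. x)"
proof (cases r)
 case 0
 then show ?thesis by (simp only: continuously_diff_on.simps continuous_on_id)
next
 case (Suc s)
 show ?thesis
  unfolding Suc
 proof (rule cdiff_on_SucI[OF E W])
  show "((%x. x) has_derivative (%v. v)) (at x within E)" for x
   by (rule has_derivative_ident)
 qed (rule cdiff_on_const)
qed

lemma cdiff_on_bounded_linear:
 assumes L: "bounded_linear L" and f: "continuously_diff_on r E W f"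
 shows "continuously_diff_on r E W (%x. L (f x))"
 using f
proof (induction r arbitrary: f)
 case 0
 then show ?case
  unfolding continuously_diff_on.simps by (rule bounded_linear.continuous_on[OF L])
next
 case (Suc r)
 obtain D where D: "!!x. x \<in> W ==> (f has_derivative D x) (at x within E)"
  "!!v. v \<in> E ==> continuously_diff_on r E W (%x. D x v)"
  using cdiff_on_SucD[OF Suc.prems(1)] by blast
 show ?case
 proof (rule cdiff_on_SucI[OF E W])
  show "((%x. L (f x)) has_derivative (%v. L (D x v))) (at x within E)" if "x \<in> W" for x
   by (rule bounded_linear.has_derivative[OF L D(1)[OF that]])
  show "continuously_diff_on r E W (%x. L (D x v))" if "v \<in> E" for v
   by (rule Suc.IH[OF D(2)[OF that]])
 qed
qed

lemma cdiff_on_add: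
 assumes "continuously_diff_on r E W f" "continuously_diff_on r E W g"
 shows "continuously_diff_on r E W (%x. f x + g x)"
 using assms
proof (induction r arbitrary: f g)
 case 0
 then show ?case unfolding continuously_diff_on.simps by (rule continuous_on_add)
next
 case (Suc r)
 obtain D where D: "!!x. x \<in> W ==> (f has_derivative D x) (at x within E)"
  "!!v. v \<in> E ==> continuously_diff_on r E W (%x. D x v)"
  using cdiff_on_SucD[OF Suc.prems(1)] by blast
 obtain D' where D': "!!x. x \<in> W ==> (g has_derivative D' x) (at x within E)"
  "!!v. v \<in> E ==> continuously_diff_on r E W (%x. D' x v)"
  using cdiff_on_SucD[OF Suc.prems(2)] by blast
 show ?case
 proof (rule cdiff_on_SucI[OF E W])
  show "((%x. f x + g x) has_derivative (%v. D x v + D' x v)) (at x within E)" if "x \<in> W" for x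
   by (rule has_derivative_add[OF D(1)[OF that] D'(1)[OF that]])
  show "continuously_diff_on r E W (%x. D x v + D' x v)" if "v \<in> E" for v
   by (rule Suc.IH[OF D(2)[OF that] D'(2)[OF that]])
 qed
qed

lemma cdiff_on_scaleR:
 assumes "continuously_diff_on r E W f" "continuously_diff_on r E W g"
 shows "continuously_diff_on r E W (%x. f x *r g x)"
 using assms
proof (induction r arbitrary: f g)
 case 0
 then show ?case unfolding continuously_diff_on.simps by (rule continuous_on_scaleR)
next
 case (Suc r)
 note lower = Suc.prems[THEN cdiff_on_Suc_lower[OF openin_imp_subset[OF W]]]
 obtain D where D: "!!x. x \<in> W ==> (f has_derivative D x) (at x within E)"
  "!!v. v \<in> E ==> continuously_diff_on r E W (%x. D x v)"
  using cdiff_on_SucD[OF Suc.prems(1)] by blast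
 obtain D' where D': "!!x. x \<in> W ==> (g has_derivative D' x) (at x within E)"
  "!!v. v \<in> E ==> continuously_diff_on r E W (%x. D' x v)"
  using cdiff_on_SucD[OF Suc.prems(2)] by blast
 show ?case
 proof (rule cdiff_on_SucI[OF E W])
  show "((%x. f x *r g x) has_derivative (%v. f x *r D' x v + D x v *r g x)) (at x within E)"
   if "x \<in> W" for x
   by (rule has_derivative_scaleR[OF D(1)[OF that] D'(1)[OF that]])
  show "continuously_diff_on r E W (%x. f x *r D' x v + D x v *r g x)" if "v \<in> E" for v
   by (rule cdiff_on_add[OF Suc.IH[OF lower(1) D'(2)[OF that]] Suc.IH[OF D(2)[OF that] lower(2)]])
 qed
qed

lemma cdiff_on_sum:
 assumes "!!i. i \<in> I ==> continuously_diff_on r E W (f i)"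
 shows "continuously_diff_on r E W (%x. \<Sum>i\<in>I. f i x)"
 using assms
 by (induction I rule: infinite_finite_induct)
   (auto intro: cdiff_on_const cdiff_on_add)

end

lemma subspace_orthonormal_expansion:
 fixes E :: "'a::euclidean_space set"
 assumes "subspace E"
 obtains B where "finite B" "B \<subseteq> E" "!!b c. b \<in> B ==> c \<in> B ==> b \<bullet> c = (if b = c then 1 else 0)"
  "!!v. v \<in> E ==> v = (\<Sum>b\<in>B. (v \<bullet> b) *r b)"
proof -
 obtain B where B: "B \<subseteq> E" "pairwise orthogonal B" "!!x. x \<in> B ==> norm x = 1"
  "independent B" "span B = E"
  using orthonormal_basis_subspace[OF assms] by metis
 have fin: "finite B" using B(4) by (rule independent_imp_finite)
 have inn: "b \<bullet> c = (if b = c then 1 else 0)" if "b \<in> B" "c \<in> B" for b c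
  using B(2,3) that by (auto simp: pairwise_def orthogonal_def norm_eq_1)
 have "v = (\<Sum>b\<in>B. (v \<bullet> b) *r b)" if "v \<in> E" for v
 proof -
  from that B(5) fin obtain u where u: "v = (\<Sum>b\<in>B. u b *r b)"
   by (auto simp: span_finite)
  have "v \<bullet> c = u c" if "c \<in> B" for c
   using that fin by (simp add: u inner_sum_left inn if_distrib[of "%x. _ * x"] cong: if_cong)
  then show ?thesis using u by simp
 qed
 with that fin B(1) inn show ?thesis by blast
qed

lemma cdiff_on_compose:
 fixes g :: "'a::euclidean_space => 'b::euclidean_space" and f :: "'b => 'c::real_normed_vector"
 assumes E: "subspace E" "openin (top_of_set E) W" and E': "subspace E'" "openin (top_of_set E') W'"
  and g: "continuously_diff_on r E W g" "!!x. x \<in> W ==> g x \<in> W'"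
  and f: "continuously_diff_on r E' W' f"
 shows "continuously_diff_on r E W (%x. f (g x))"
 using g(1) f
proof (induction r arbitrary: f)
 case 0
 then show ?case using g(2) by (auto intro: continuous_on_compose2)
next
 case (Suc r)
 have sub: "W \<subseteq> E" "W' \<subseteq> E'" using E(2) E'(2) by (auto dest: openin_imp_subset)
 obtain D where D: "!!x. x \<in> W ==> (g has_derivative D x) (at x within E)"
  "!!v. v \<in> E ==> continuously_diff_on r E W (%x. D x v)"
  using cdiff_on_SucD[OF Suc.prems(1)] by blast
 obtain F where F: "!!x. x \<in> W' ==> (f has_derivative F x) (at x within E')"
  "!!v. v \<in> E' ==> continuously_diff_on r E' W' (%x. F x v)"
  using cdiff_on_SucD[OF Suc.prems(2)] by blast
 obtain B where B: "finite B" "B \<subseteq> E'" "!!v. v \<in> E' ==> v = (\<Sum>b\<in>B. (v \<bullet> b) *r b)"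
  by (rule subspace_orthonormal_expansion[OF E'(1)]) blast
 have D_range: "D x v = (\<Sum>b\<in>B. (D x v \<bullet> b) *r b)" if "x \<in> W" "v \<in> E" for x v
 proof -
  have bl: "bounded_linear (%y. \<Sum>b\<in>B. (y \<bullet> b) *r b)"
   by (intro bounded_linear_sum bounded_linear_compose[OF bounded_linear_scaleR_left bounded_linear_inner_left])
  have "((%x. \<Sum>b\<in>B. (g x \<bullet> b) *r b) has_derivative (%v. \<Sum>b\<in>B. (D x v \<bullet> b) *r b)) (at x within E)"
   by (rule bounded_linear.has_derivative[OF bl D(1)[OF that(1)]])
  moreover have "g y = (\<Sum>b\<in>B. (g y \<bullet> b) *r b)" if "y \<in> W" for y
   using B(3) g(2) sub that by blast
  ultimately have "(g has_derivative (%v. \<Sum>b\<in>B. (D x v \<bullet> b) *r b)) (at x within E)"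
   using has_derivative_cong_openin[OF E(2) that(1), of g "%x. \<Sum>b\<in>B. (g x \<bullet> b) *r b"] by simp
  then show ?thesis
   using has_derivative_unique_subspace[OF E(1) _ that(2) D(1)[OF that(1)]] sub that by blast
 qed
 show ?case
 proof (rule cdiff_on_SucI[OF E, where D = "%x v. F (g x) (D x v)"])
  fix x assume x: "x \<in> W"
  have fd: "(f has_derivative F (g x)) (at (g x) within g ` W)"
   using F(1) x g(2) sub by (intro has_derivative_subset[OF F(1)]) auto
  have gd: "(g has_derivative D x) (at x within W)"
   by (rule has_derivative_subset[OF D(1)[OF x] sub(1)])
  have "((%x. f (g x)) has_derivative (%v. F (g x) (D x v))) (at x within W)"
   by (rule has_derivative_in_compose[OF gd fd])
  then show "((%x. f (g x)) has_derivative (%v. F (g x) (D x v))) (at x within E)"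
   by (simp add: at_within_Int_openin[OF E(2) x])
 next
  fix v assume v: "v \<in> E"
  have "continuously_diff_on r E W (%x. \<Sum>b\<in>B. (D x v \<bullet> b) *r F (g x) b)"
  proof (rule cdiff_on_sum[OF E], rule cdiff_on_scaleR[OF E])
   fix b assume "b \<in> B"
   show "continuously_diff_on r E W (%x. D x v \<bullet> b)"
    by (rule cdiff_on_bounded_linear[OF E bounded_linear_inner_left D(2)[rule_format, OF v]])
   show "continuously_diff_on r E W (%x. F (g x) b)"
    by (rule Suc.IH[OF cdiff_on_Suc_lower[OF sub(1) Suc.prems(1)]])
      (use B(2) F(2) \<open>b \<in> B\<close> in auto)
  qed
  moreover have "(\<Sum>b\<in>B. (D x v \<bullet> b) *r F (g x) b) = F (g x) (D x v)" if "x \<in> W" for x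
  proof -
   interpret bounded_linear "F (g x)"
    using F(1) g(2) that by (blast intro: has_derivative_bounded_linear)
   have "F (g x) (D x v) = F (g x) (\<Sum>b\<in>B. (D x v \<bullet> b) *r b)"
    using D_range[OF that v] by simp
   then show ?thesis by (simp add: sum scaleR)
  qed
  ultimately show "continuously_diff_on r E W (%x. F (g x) (D x v))"
   by (rule cdiff_on_cong[OF E(2), rotated])
 qed
qed

text \<open>The weights \<open>s ^ j\<close> make the family of these integrals closed under differentiation.\<close>

lemma cdiff_on_segment_integral:
 fixes E :: "'a::euclidean_space set" and h :: "'a => real"
 assumes E: "subspace E" "openin (top_of_set E) W" and W: "convex W" "a \<in> W"
  and h: "continuously_diff_on r E W h"
 shows "continuously_diff_on r E W (%x. integral {0..1} (%s. s ^ j * h (a + s *r (x - a))))"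
 using h
proof (induction r arbitrary: h j)
 have sub: "W \<subseteq> E" using E(2) by (rule openin_imp_subset)
 have seg: "a + s *r (x - a) \<in> W" if "x \<in> W" "0 \<le> s" "s \<le> 1" for x s
  using convexD_alt[OF W that(1,2,3)] by (simp add: algebra_simps)
 have cont: "continuous_on (W \<times> cbox 0 1) (%z. snd z ^ j * k (a + snd z *r (fst z - a)))"
  if "continuous_on W k" for k :: "'a => real" and j
  by (intro continuous_intros continuous_on_compose2[OF that]) (auto simp: seg)
 {
  case 0
  then show ?case
   using integral_continuous_on_param[of W 0 1 "%x s. s ^ j * h (a + s *r (x - a))"] cont[of h j]
   by (simp add: case_prod_unfold)
 next
  case (Suc r)
  have hc: "continuous_on W h"
   by (rule cdiff_on_continuous[OF sub Suc.prems])
  obtain D where D: "\<forall>x\<in>W. (h has_derivative D x) (at x within E)"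
   "\<forall>v\<in>E. continuously_diff_on r E W (%x. D x v)"
   using cdiff_on_SucD[OF Suc.prems] by blast
  obtain B where B: "finite B" "B \<subseteq> E" "!!v. v \<in> E ==> v = (\<Sum>b\<in>B. (v \<bullet> b) *r b)"
   by (rule subspace_orthonormal_expansion[OF E(1)]) blast
  define pr where "pr v = (\<Sum>b\<in>B. (v \<bullet> b) *r b)" for v :: 'a
  have pr: "bounded_linear pr"
   unfolding pr_def
   by (intro bounded_linear_sum bounded_linear_compose[OF bounded_linear_scaleR_left bounded_linear_inner_left])
  have pr_E: "pr v \<in> E" for v
   unfolding pr_def using B(2) E(1) by (auto intro!: subspace_sum subspace_scale)
  have pr_id: "pr v = v" if "v \<in> E" for v
   using B(3)[OF that] unfolding pr_def by simp
  define L where "L y = Blinfun (%v. D y (pr v))" for y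
  have L: "blinfun_apply (L y) v = D y (pr v)" if "y \<in> W" for y v
  proof -
   have "bounded_linear (D y)" using D(1) that by (blast intro: has_derivative_bounded_linear)
   then have "bounded_linear (%v. D y (pr v))" using pr by (rule bounded_linear_compose)
   then show ?thesis by (simp add: L_def bounded_linear_Blinfun_apply)
  qed
  define fx where "fx x t = t ^ Suc j *r L (a + t *r (x - a))" for x t
  have fx: "blinfun_apply (fx x t) v = t ^ Suc j * D (a + t *r (x - a)) (pr v)"
   if "x \<in> W" "t \<in> cbox 0 1" for x t v
   unfolding fx_def using that by (simp add: blinfun.scaleR_left L seg)
  have der: "((%x. t ^ j * h (a + t *r (x - a))) has_derivative blinfun_apply (fx x t)) (at x within W)"
   if x: "x \<in> W" and t: "t \<in> cbox 0 1" for x t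
  proof -
   let ?l = "%x. a + t *r (pr x - a)"
   have l: "?l y = a + t *r (y - a)" if "y \<in> W" for y
    using that sub by (simp add: pr_id subset_iff)
   have dl: "(?l has_derivative (%v. t *r pr v)) (at x within W)"
    by (auto intro!: derivative_eq_intros bounded_linear.has_derivative[OF pr])
   have "?l x \<in> W" using x t by (simp add: l seg)
   then have "(h has_derivative D (?l x)) (at (?l x) within ?l ` W)"
    using D(1) t sub seg by (intro has_derivative_subset[where t = "?l ` W" and s = E]) (auto simp: l)
   from has_derivative_in_compose[OF dl this]
   have "((%x. h (?l x)) has_derivative (%v. D (?l x) (t *r pr v))) (at x within W)" .
   then have "((%x. t ^ j * h (?l x)) has_derivative (%v. t ^ j * D (?l x) (t *r pr v))) (at x within W)"
    by (rule has_derivative_mult_right)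
   moreover have "(%v. t ^ j * D (?l x) (t *r pr v)) = blinfun_apply (fx x t)"
   proof
    fix v
    interpret bounded_linear "D (?l x)"
     using D(1) \<open>?l x \<in> W\<close> by (blast intro: has_derivative_bounded_linear)
    have "D (?l x) (t *r pr v) = t * D (?l x) (pr v)"
     using scaleR[of t "pr v"] by simp
    then show "t ^ j * D (?l x) (t *r pr v) = blinfun_apply (fx x t) v"
     using x t by (simp add: fx l)
   qed
   ultimately have "((%x. t ^ j * h (?l x)) has_derivative blinfun_apply (fx x t)) (at x within W)"
    by simp
   then show ?thesis
    by (rule has_derivative_transform[OF x, rotated]) (simp add: l)
  qed
  have int: "(%t. t ^ j * h (a + t *r (x - a))) integrable_on cbox 0 1" if "x \<in> W" for x
  proof (rule integrable_continuous)
   have "continuous_on (cbox 0 1) (%t::real. (x, t))"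
    by (intro continuous_intros)
   then show "continuous_on (cbox 0 1) (%t. t ^ j * h (a + t *r (x - a)))"
    using continuous_on_compose2[OF cont[OF hc, of j], of "cbox 0 1" "%t. (x, t)"] that by auto
  qed
  have cfx: "continuous_on (W \<times> cbox 0 1) (%(x, t). fx x t)"
  proof (rule continuous_on_blinfun_componentwise)
   fix i :: 'a assume "i \<in> Basis"
   have "continuous_on W (%y. D y (pr i))"
    using D(2) pr_E by (blast intro: cdiff_on_continuous[OF sub])
   from cont[OF this, of "Suc j"]
   show "continuous_on (W \<times> cbox 0 1) (%z. blinfun_apply (case z of (x, t) => fx x t) i)"
    by (rule continuous_on_eq) (auto simp: fx)
  qed
  show ?case
  proof (rule cdiff_on_SucI[OF E])
   fix x assume x: "x \<in> W"
   show "((%x. integral {0..1} (%s. s ^ j * h (a + s *r (x - a)))) has_derivative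
     blinfun_apply (integral {0..1} (fx x))) (at x within E)"
    using leibniz_rule[of W 0 1, OF der int cfx x W(1)]
    unfolding at_within_Int_openin[OF E(2) x] cbox_interval .
  next
   fix v assume v: "v \<in> E"
   have eq: "integral {0..1} (%s. s ^ Suc j * D (a + s *r (x - a)) v) =
     blinfun_apply (integral {0..1} (fx x)) v" if x: "x \<in> W" for x
   proof -
    have "continuous_on (cbox 0 1) (%t. fx x t)"
    proof -
     have "continuous_on (cbox 0 1) (%t::real. (x, t))"
      by (intro continuous_intros)
     then show ?thesis
      using continuous_on_compose2[OF cfx, of "cbox 0 1" "%t. (x, t)"] x by auto
    qed
    then have "fx x integrable_on cbox 0 1" by (rule integrable_continuous)
    then have "blinfun_apply (integral {0..1} (fx x)) v = integral {0..1} (%t. blinfun_apply (fx x t) v)"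
     by (simp add: blinfun_apply_integral)
    also have "... = integral {0..1} (%s. s ^ Suc j * D (a + s *r (x - a)) v)"
     using x v by (intro integral_cong) (simp add: fx pr_id)
    finally show ?thesis by simp
   qed
   have "continuously_diff_on r E W (%x. D x v)" using D(2) v by blast
   from Suc.IH[OF this, of "Suc j"]
   show "continuously_diff_on r E W (%x. blinfun_apply (integral {0..1} (fx x)) v)"
    by (rule cdiff_on_cong[OF E(2), rotated]) (rule eq)
  qed
 }
qed

lemma smooth_onI: "(!!r. continuously_diff_on r E W f) ==> smooth_on E W f"
 by (simp add: smooth_on_def)

lemma smooth_onD: "smooth_on E W f ==> continuously_diff_on r E W f"
 by (simp add: smooth_on_def)

lemma smooth_on_has_derivative:
 assumes "smooth_on E W f" "x \<in> W"
 shows "(f has_derivative frechet_derivative f (at x within E)) (at x within E)"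
 using smooth_onD[OF assms(1), of "Suc 0"] assms(2) by (simp add: frechet_derivative_works)

lemma smooth_on_directional_derivative:
 assumes "smooth_on E W f" "v \<in> E"
 shows "smooth_on E W (%x. frechet_derivative f (at x within E) v)"
proof (rule smooth_onI)
 fix r
 show "continuously_diff_on r E W (%x. frechet_derivative f (at x within E) v)"
  using smooth_onD[OF assms(1), of "Suc r"] assms(2) by simp
qed

lemma hadamard_lemma:
 fixes E :: "'a::euclidean_space set" and h :: "'a => real"
 assumes E: "subspace E" "openin (top_of_set E) W" and W: "convex W" "a \<in> W"
  and h: "smooth_on E W h"
  and B: "finite B" "B \<subseteq> E" "!!v. v \<in> E ==> v = (\<Sum>b\<in>B. (v \<bullet> b) *r b)"
 shows "\<exists>g. \<forall>b\<in>B. smooth_on E W (g b) \<and> g b a = frechet_derivative h (at a within E) b \<and>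
   (\<forall>x\<in>W. h x = h a + (\<Sum>b\<in>B. ((x - a) \<bullet> b) * g b x))"
proof -
 have sub: "W \<subseteq> E" using E(2) by (rule openin_imp_subset)
 have seg: "a + s *r (x - a) \<in> W" if "x \<in> W" "0 \<le> s" "s \<le> 1" for x s
  using convexD_alt[OF W that(1,2,3)] by (simp add: algebra_simps)
 define D where "D x v = frechet_derivative h (at x within E) v" for x v
 have D: "(h has_derivative D x) (at x within E)" if "x \<in> W" for x
  using smooth_on_has_derivative[OF h that] unfolding D_def .
 define g where "g b x = integral {0..1} (%s. D (a + s *r (x - a)) b)" for b x
 have Dc: "continuously_diff_on r E W (%x. D x b)" if "b \<in> B" for b r
  using smooth_on_directional_derivative[OF h, of b] that B(2) unfolding D_def by (auto dest: smooth_onD)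
 have 1: "smooth_on E W (g b)" if b: "b \<in> B" for b
 proof (rule smooth_onI)
  fix r
  show "continuously_diff_on r E W (g b)"
   unfolding g_def
   using cdiff_on_segment_integral[OF E W, of r "%y. D y b" 0] Dc[OF b] by simp
 qed
 have 2: "g b a = D a b" for b
  by (simp add: g_def)
 have 3: "h x = h a + (\<Sum>b\<in>B. ((x - a) \<bullet> b) * g b x)" if x: "x \<in> W" for x
 proof -
  let ?l = "%s. a + s *r (x - a)"
  have xa: "x - a \<in> E" using x W(2) sub E(1) by (auto intro: subspace_diff)
  have "((%s. h (?l s)) has_vector_derivative D (?l s) (x - a)) (at s within {0..1})" if s: "s \<in> {0..1}" for s
  proof -
   have l: "(?l has_derivative (%t. t *r (x - a))) (at s within {0..1})"
    by (auto intro!: derivative_eq_intros)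
   have "(h has_derivative D (?l s)) (at (?l s) within ?l ` {0..1})"
    by (rule has_derivative_subset[OF D]) (use s x sub seg in auto)
   from has_derivative_in_compose[OF l this]
   have *: "((%s. h (?l s)) has_derivative (%t. D (?l s) (t *r (x - a)))) (at s within {0..1})" .
   have "bounded_linear (D (?l s))"
    using s x by (intro has_derivative_bounded_linear[OF D] seg) auto
   then have "(%t. D (?l s) (t *r (x - a))) = (%t. t *r D (?l s) (x - a))"
    by (simp add: bounded_linear.linear linear_scale)
   with * show ?thesis
    by (simp add: has_vector_derivative_def)
  qed
  then have "((%s. D (?l s) (x - a)) has_integral (h (?l 1) - h (?l 0))) {0..1}"
   by (intro fundamental_theorem_of_calculus) auto
  then have "h x - h a = integral {0..1} (%s. D (?l s) (x - a))"
   by (simp add: integral_unique)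
  also have "... = integral {0..1} (%s. \<Sum>b\<in>B. ((x - a) \<bullet> b) * D (?l s) b)"
  proof (rule integral_cong)
   fix s :: real assume s: "s \<in> {0..1}"
   interpret bounded_linear "D (?l s)"
    using s x by (intro has_derivative_bounded_linear[OF D] seg) auto
   have "D (?l s) (x - a) = D (?l s) (\<Sum>b\<in>B. ((x - a) \<bullet> b) *r b)"
    using B(3)[OF xa] by simp
   then show "D (?l s) (x - a) = (\<Sum>b\<in>B. ((x - a) \<bullet> b) * D (?l s) b)"
    unfolding sum scaleR by simp
  qed
  also have "... = (\<Sum>b\<in>B. ((x - a) \<bullet> b) * g b x)"
  proof (subst integral_sum)
   fix b assume b: "b \<in> B"
   have "continuous_on W (%y. D y b)"
    by (rule cdiff_on_continuous[OF sub Dc[OF b]])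
   moreover have "continuous_on {0..1} ?l"
    by (intro continuous_intros)
   ultimately have "continuous_on {0..1} (%s. D (?l s) b)"
    by (rule continuous_on_compose2) (use seg[OF x] in auto)
   then have "(%s. D (?l s) b) integrable_on {0..1}"
    by (rule integrable_continuous_real)
   then show "(%s. ((x - a) \<bullet> b) * D (?l s) b) integrable_on {0..1}"
    by (rule integrable_on_mult_right)
  qed (simp_all add: B(1) g_def)
  finally show ?thesis by simp
 qed
 from 1 2 3 show ?thesis
  by (intro exI[of _ g]) (simp add: D_def)
qed

subsection \<open>A smooth cut-off function\<close>

lemma exp_reciprocal_tendsto_0:
 "((%t::real. exp (- 1 / t) / t ^ n) \<longlongrightarrow> 0) (at_right 0)"
proof -
 have "((%t::real. inverse t ^ n / exp (inverse t)) \<longlongrightarrow> 0) (at_right 0)"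
  by (rule filterlim_compose[OF tendsto_power_div_exp_0 filterlim_inverse_at_top_right])
 then show ?thesis
  by (simp add: exp_minus field_simps)
qed

lemma cdiff_on_exp_reciprocal:
 "continuously_diff_on r UNIV UNIV (%t::real. if t > 0 then exp (- 1 / t) / t ^ n else 0)"
proof (induction r arbitrary: n)
 let ?f = "%n t::real. if t > 0 then exp (- 1 / t) / t ^ n else 0"
 let ?D = "%n t. ?f (n + 2) t - of_nat n * ?f (n + 1) t"
 have der: "(?f n has_real_derivative ?D n t) (at t)" for n t
 proof (cases t "0::real" rule: linorder_cases)
  case less
  have "((%_. 0) has_real_derivative 0) (at t)" by simp
  then have "(?f n has_real_derivative 0) (at t)"
   by (rule has_field_derivative_transform_within_open[where S = "{..<0}"]) (use less in auto)
  then show ?thesis using less by simp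
 next
  case greater
  have "((%t. exp (- 1 / t) / t ^ n) has_real_derivative ?D n t) (at t)"
   using greater
   by (auto intro!: derivative_eq_intros simp: field_simps power2_eq_square)
     (cases n; simp add: field_simps)
  then show ?thesis
   by (rule has_field_derivative_transform_within_open[where S = "{0<..}"]) (use greater in auto)
 next
  case equal
  have "((%t. (?f n t - ?f n 0) / (t - 0)) \<longlongrightarrow> 0) (at 0)"
   unfolding filterlim_at_split
  proof
   have "\<forall>\<^sub>F t in at_left 0. (?f n t - ?f n 0) / (t - 0) = 0"
    by (auto simp: eventually_at_filter)
   then show "((%t. (?f n t - ?f n 0) / (t - 0)) \<longlongrightarrow> 0) (at_left 0)"
    by (rule tendsto_eventually)
   have "\<forall>\<^sub>F t in at_right 0. exp (- 1 / t) / t ^ Suc n = (?f n t - ?f n 0) / (t - 0)"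
    by (auto simp: eventually_at_filter)
   then show "((%t. (?f n t - ?f n 0) / (t - 0)) \<longlongrightarrow> 0) (at_right 0)"
    by (rule Lim_transform_eventually[OF exp_reciprocal_tendsto_0])
  qed
  then show ?thesis
   unfolding equal by (simp add: has_field_derivative_iff)
 qed
 {
  case (0 n)
  have "continuous_on UNIV (?f n)"
   using der by (intro continuous_at_imp_continuous_on) (blast intro: DERIV_isCont)
  then show ?case by simp
 next
  case (Suc r n)
  show ?case
  proof (rule cdiff_on_SucI)
   show "(?f n has_derivative (%v. v *r ?D n t)) (at t within UNIV)" for t
   proof -
    have "(*) (?D n t) = (%v. v *r ?D n t)"
     by (rule ext) (simp only: real_scaleR_def mult.commute)
    then show ?thesis using der[of n t] unfolding has_field_derivative_def by (simp only:)
   qed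
   show "continuously_diff_on r UNIV UNIV (%t. v *r ?D n t)" for v :: real
   proof -
    have o: "openin (top_of_set UNIV) (UNIV :: real set)" by simp
    note u = subspace_UNIV o
    have c: "continuously_diff_on r UNIV UNIV (%t::real. c :: real)" for c
     by (rule cdiff_on_const[OF u])
    have 1: "continuously_diff_on r UNIV UNIV (?f (n + 1))" and 2: "continuously_diff_on r UNIV UNIV (?f (n + 2))"
     by (rule Suc.IH)+
    have "continuously_diff_on r UNIV UNIV (%t. (- of_nat n) *r ?f (n + 1) t)"
     by (rule cdiff_on_scaleR[OF u c 1])
    then have "continuously_diff_on r UNIV UNIV (%t. ?f (n + 2) t + (- of_nat n) *r ?f (n + 1) t)"
     by (rule cdiff_on_add[OF u 2])
    then have "continuously_diff_on r UNIV UNIV (%t. v *r (?f (n + 2) t + (- of_nat n) *r ?f (n + 1) t))"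
     by (rule cdiff_on_scaleR[OF u c])
    moreover have "(%t. v *r (?f (n + 2) t + (- of_nat n) *r ?f (n + 1) t)) = (%t. v *r ?D n t)"
     by (rule ext) (simp only: real_scaleR_def mult_minus_left diff_conv_add_uminus)
    ultimately show ?thesis by (simp only:)
   qed
  qed auto
 }
qed

text \<open>With \<open>f t = exp (- 1 / t)\<close> for \<open>t > 0\<close> and \<open>f t = 0\<close> otherwise, \<open>t \<mapsto> f (f 1 - f t)\<close> is
  the positive constant \<open>f (f 1)\<close> for \<open>t \<le> 0\<close> and vanishes for \<open>t \<ge> 1\<close>, because \<open>f\<close> is increasing.\<close>

lemma smooth_cutoff_real:
 "\<exists>be :: real => real. smooth_on UNIV UNIV be \<and> (\<forall>t\<le>0. be t = 1) \<and> (\<forall>t\<ge>1. be t = 0)"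
proof -
 define f where "f t = (if t > 0 then exp (- 1 / t) else 0)" for t :: real
 have f: "continuously_diff_on r UNIV UNIV f" for r
  using cdiff_on_exp_reciprocal[of r 0] by (simp add: f_def[abs_def] cong: if_cong)
 have o: "openin (top_of_set UNIV) (UNIV :: real set)" by simp
 note u = subspace_UNIV o
 have c: "continuously_diff_on r UNIV UNIV (%t::real. c :: real)" for c r
  by (rule cdiff_on_const[OF u])
 have "continuously_diff_on r UNIV UNIV (%t. f 1 + (-1) *r f t)" for r
  by (rule cdiff_on_add[OF u c cdiff_on_scaleR[OF u c f]])
 from cdiff_on_compose[OF u u this UNIV_I f]
 have "continuously_diff_on r UNIV UNIV (%t. (1 / f (f 1)) *r f (f 1 + (-1) *r f t))" for r
  by (rule cdiff_on_scaleR[OF u c])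
 then have "smooth_on UNIV UNIV (%t. f (f 1 - f t) / f (f 1))"
  by (simp add: smooth_on_def)
 moreover have "f (f 1) \<noteq> 0" by (simp add: f_def)
 moreover have f1: "f 1 - f t \<le> 0" if "t \<ge> 1" for t
  using that by (simp add: f_def field_simps)
 then have "f (f 1 - f t) = 0" if "t \<ge> 1" for t
  using f1[OF that] by (simp add: f_def[of "f 1 - f t"])
 ultimately show ?thesis
  by (intro exI[of _ "%t. f (f 1 - f t) / f (f 1)"]) (simp add: f_def[of t for t] )
qed

lemma smooth_cutoff:
 fixes a :: "'a::euclidean_space"
 assumes E: "subspace E" "openin (top_of_set E) W" and e: "0 < e"
 shows "\<exists>be :: 'a => real. smooth_on E W be \<and> (\<forall>x\<in>ball a e. be x = 1) \<and> (\<forall>x. x \<notin> ball a (2 * e) --> be x = 0)"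
proof -
 obtain be :: "real => real" where be: "smooth_on UNIV UNIV be" "!!t. t \<le> 0 ==> be t = 1" "!!t. t \<ge> 1 ==> be t = 0"
  using smooth_cutoff_real by metis
 define q where "q x = ((x - a) \<bullet> (x - a)) / e\<^sup>2 - 1" for x
 have q: "continuously_diff_on r E W q" for r
 proof -
  have x: "continuously_diff_on r E W (%x. (x - a) \<bullet> b)" for b
   using cdiff_on_add[OF E
     cdiff_on_bounded_linear[OF E bounded_linear_inner_left cdiff_on_id[OF E]]
     cdiff_on_const[OF E], of r b "- (a \<bullet> b)"]
   by (simp add: inner_diff_left)
  have "continuously_diff_on r E W (%x. (\<Sum>b\<in>Basis. ((x - a) \<bullet> b) *r ((x - a) \<bullet> b)))"
   by (rule cdiff_on_sum[OF E cdiff_on_scaleR[OF E x x]])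
  then have "continuously_diff_on r E W (%x. (x - a) \<bullet> (x - a))"
   by (simp add: euclidean_inner[symmetric])
  from cdiff_on_scaleR[OF E cdiff_on_const[OF E, of r "1 / e\<^sup>2"] this]
  have "continuously_diff_on r E W (%x. (1 / e\<^sup>2) *r ((x - a) \<bullet> (x - a)) + (- 1))"
   by (rule cdiff_on_add[OF E _ cdiff_on_const[OF E]])
  then show ?thesis by (simp add: q_def[abs_def])
 qed
 have o: "openin (top_of_set UNIV) (UNIV :: real set)" by simp
 have "smooth_on E W (%x. be (q x))"
  by (rule smooth_onI, rule cdiff_on_compose[OF E subspace_UNIV o q UNIV_I smooth_onD[OF be(1)]])
 moreover have "be (q x) = 1" if "x \<in> ball a e" for x
 proof -
  have "(norm (x - a))\<^sup>2 \<le> e\<^sup>2"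
   using that by (intro power_mono) (auto simp: dist_norm norm_minus_commute)
  then show ?thesis using e by (intro be(2)) (simp add: q_def dot_square_norm field_simps)
 qed
 moreover have "be (q x) = 0" if "x \<notin> ball a (2 * e)" for x
 proof -
  have "(2 * e)\<^sup>2 \<le> (norm (x - a))\<^sup>2"
   using that e by (intro power_mono) (auto simp: dist_norm norm_minus_commute)
  moreover have "2 * e\<^sup>2 \<le> (2 * e)\<^sup>2"
   by (simp add: power_mult_distrib)
  ultimately have "2 * e\<^sup>2 \<le> (norm (x - a))\<^sup>2"
   by (rule order_trans[rotated])
  then show ?thesis using e by (intro be(3)) (simp add: q_def dot_square_norm field_simps)
 qed
 ultimately show ?thesis by blast
qed

section \<open>Tangent vectors and local frames\<close>

lemma sum_fun_apply: "(\<Sum>i\<in>I. f i) x = (\<Sum>i\<in>I. f i x)"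
 by (induction I rule: infinite_finite_induct) auto

locale smooth_mfd =
 fixes M :: "('m, 'e::euclidean_space) manifold"
 assumes mfd: "smooth_manifold M"
begin

abbreviation "S \<equiv> topspace (mtop M)"
abbreviation "F \<equiv> smooth_functions M"
abbreviation "T \<equiv> tangent_space M"
abbreviation "VF \<equiv> vector_fields M"
abbreviation "\<E> \<equiv> model M"

definition one :: "'m => real" where "one p = (if p \<in> S then 1 else 0)"

lemma model_subspace: "subspace \<E>"
 using mfd by (simp add: smooth_manifold_def)

lemma chart_exists:
 assumes "p \<in> S" shows "\<exists>U ph. (U, ph) \<in> atlas M \<and> p \<in> U"
proof -
 have "p \<in> (\<Union>(U, ph)\<in>atlas M. U)"
  using mfd assms by (simp add: smooth_manifold_def)
 then show ?thesis by auto
qed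

lemma chart_image_open:
 assumes c: "(U, ph) \<in> atlas M"
 shows "openin (mtop M) U" "U \<subseteq> S" "openin (top_of_set \<E>) (ph ` U)" "inj_on ph U"
  and "!!V. openin (mtop M) V ==> V \<subseteq> U ==> openin (top_of_set \<E>) (ph ` V)"
  and "!!O'. openin (top_of_set \<E>) O' ==> openin (mtop M) {q \<in> U. ph q \<in> O'}"
  and "!!K. compact K ==> K \<subseteq> ph ` U ==> closedin (mtop M) {q \<in> U. ph q \<in> K}"
proof -
 show U: "openin (mtop M) U" and US: "U \<subseteq> S" and o: "openin (top_of_set \<E>) (ph ` U)"
  using mfd c by (auto simp: smooth_manifold_def dest: openin_subset)
 have h: "homeomorphic_map (subtopology (mtop M) U) (top_of_set (ph ` U)) ph"
  using mfd c by (auto simp: smooth_manifold_def)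
 have top: "topspace (subtopology (mtop M) U) = U" using US by auto
 show inj: "inj_on ph U"
  using homeomorphic_imp_injective_map[OF h] unfolding top .
 show "openin (top_of_set \<E>) (ph ` V)" if V: "openin (mtop M) V" "V \<subseteq> U" for V
 proof -
  have "openin (subtopology (mtop M) U) V"
   using V by (auto simp: openin_subtopology)
  then have "openin (top_of_set (ph ` U)) (ph ` V)"
   using homeomorphic_map_openness_eq[OF h] by blast
  then show ?thesis using o by (rule openin_trans)
 qed
 show "openin (mtop M) {q \<in> U. ph q \<in> O'}" if O': "openin (top_of_set \<E>) O'" for O'
 proof -
  have cm: "continuous_map (subtopology (mtop M) U) (top_of_set (ph ` U)) ph"
   using h by (rule homeomorphic_imp_continuous_map)
  have "openin (top_of_set (ph ` U)) (O' \<inter> ph ` U)"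
   using O' openin_imp_subset[OF o] by (auto simp: openin_open)
  from openin_continuous_map_preimage[OF cm this]
  have "openin (subtopology (mtop M) U) {q \<in> U. ph q \<in> O' \<inter> ph ` U}"
   unfolding top .
  then have "openin (mtop M) {q \<in> U. ph q \<in> O' \<inter> ph ` U}"
   using openin_trans_full[OF _ U] by blast
  moreover have "{q \<in> U. ph q \<in> O' \<inter> ph ` U} = {q \<in> U. ph q \<in> O'}" by auto
  ultimately show ?thesis by simp
 qed
 show "closedin (mtop M) {q \<in> U. ph q \<in> K}" if K: "compact K" "K \<subseteq> ph ` U" for K
 proof -
  obtain g where g: "homeomorphic_maps (subtopology (mtop M) U) (top_of_set (ph ` U)) ph g"
   using h homeomorphic_map_maps by blast
  have "compactin (top_of_set (ph ` U)) K"
   using K by (simp add: compactin_subtopology)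
  then have "compactin (subtopology (mtop M) U) (g ` K)"
   using g image_compactin unfolding homeomorphic_maps_def by blast
  then have "compactin (mtop M) (g ` K)"
   by (simp add: compactin_subtopology)
  moreover have "g ` K = {q \<in> U. ph q \<in> K}"
  proof -
   have "!!q. q \<in> U ==> g (ph q) = q"
    using g unfolding homeomorphic_maps_def top by blast
   with K(2) show ?thesis by (force simp: image_iff)
  qed
  moreover have "Hausdorff_space (mtop M)" using mfd by (simp add: smooth_manifold_def)
  ultimately show ?thesis by (metis compactin_imp_closedin)
 qed
qed

lemma smooth_functions_zero_off: "f \<in> F ==> p \<notin> S ==> f p = 0"
 by (simp add: smooth_functions_def)

lemma smooth_functions_chart:
 "f \<in> F ==> (U, ph) \<in> atlas M ==> smooth_on \<E> (ph ` U) (f \<circ> inv_into U ph)"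
 by (auto simp: smooth_functions_def)

lemma smooth_functionsI:
 assumes "!!p. p \<notin> S ==> f p = 0"
  and "!!U ph r. (U, ph) \<in> atlas M ==> continuously_diff_on r \<E> (ph ` U) (%x. f (inv_into U ph x))"
 shows "f \<in> F"
 using assms by (auto simp: smooth_functions_def smooth_on_def comp_def)

lemma smooth_functionsD:
 assumes "f \<in> F" "(U, ph) \<in> atlas M"
 shows "continuously_diff_on r \<E> (ph ` U) (%x. f (inv_into U ph x))"
 using smooth_functions_chart[OF assms] by (simp add: smooth_on_def comp_def)

lemma smooth_functions_local:
 assumes off: "!!p. p \<notin> S ==> f p = 0"
  and loc: "!!p. p \<in> S ==> \<exists>N. openin (mtop M) N \<and> p \<in> N \<and> (\<exists>g\<in>F. \<forall>q\<in>N. f q = g q)"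
 shows "f \<in> F"
proof (rule smooth_functionsI[OF off])
 fix U ph r assume c: "(U, ph) \<in> atlas M"
 note ch = chart_image_open[OF c]
 show "continuously_diff_on r \<E> (ph ` U) (%x. f (inv_into U ph x))"
 proof (rule cdiff_on_local[OF openin_imp_subset[OF ch(3)]])
  fix x assume "x \<in> ph ` U"
  then obtain p where p: "p \<in> U" "x = ph p" by auto
  then have "p \<in> S" using ch(2) by blast
  from loc[OF this] obtain N g where N: "openin (mtop M) N" "p \<in> N" "g \<in> F" "\<forall>q\<in>N. f q = g q"
   by blast
  have o: "openin (top_of_set \<E>) (ph ` (U \<inter> N))"
   using ch(1) N(1) by (intro ch(5)) auto
  have "continuously_diff_on r \<E> (ph ` (U \<inter> N)) (%x. g (inv_into U ph x))"
   by (rule cdiff_on_subset[OF smooth_functionsD[OF N(3) c]]) auto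
  then have "continuously_diff_on r \<E> (ph ` (U \<inter> N)) (%x. f (inv_into U ph x))"
   by (rule cdiff_on_cong[OF o, rotated]) (use N(4) ch(4) in auto)
  moreover have "ph ` U \<inter> ph ` (U \<inter> N) = ph ` (U \<inter> N)" by auto
  ultimately show "\<exists>O'. openin (top_of_set \<E>) O' \<and> x \<in> O' \<and>
    continuously_diff_on r \<E> (ph ` U \<inter> O') (%x. f (inv_into U ph x))"
   using o p N(2) by (intro exI[of _ "ph ` (U \<inter> N)"]) auto
 qed
qed

lemma one_smooth [simp]: "one \<in> F"
proof (rule smooth_functionsI)
 fix U ph r assume c: "(U, ph) \<in> atlas M"
 note ch = chart_image_open[OF c]
 have "continuously_diff_on r \<E> (ph ` U) (%_. 1 :: real)"
  by (rule cdiff_on_const[OF model_subspace ch(3)])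
 then show "continuously_diff_on r \<E> (ph ` U) (%x. one (inv_into U ph x))"
  by (rule cdiff_on_cong[OF ch(3), rotated]) (use ch(2,4) in \<open>auto simp: one_def\<close>)
qed (simp add: one_def)

lemma add_smooth: "f \<in> F ==> g \<in> F ==> (%q. f q + g q) \<in> F"
 by (rule smooth_functionsI)
   (auto simp: smooth_functions_zero_off
    intro: cdiff_on_add[OF model_subspace chart_image_open(3)] smooth_functionsD)

lemma mult_smooth:
 assumes f: "f \<in> F" and g: "g \<in> F" shows "(%q. f q * g q) \<in> F"
proof (rule smooth_functionsI)
 fix U ph r assume c: "(U, ph) \<in> atlas M"
 show "continuously_diff_on r \<E> (ph ` U) (%x. f (inv_into U ph x) * g (inv_into U ph x))"
  by (rule cdiff_on_scaleR[OF model_subspace chart_image_open(3)[OF c]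
     smooth_functionsD[OF f c] smooth_functionsD[OF g c], unfolded real_scaleR_def])
qed (simp add: smooth_functions_zero_off[OF f])

lemma cmult_smooth:
 assumes f: "f \<in> F" shows "(%q. c * f q) \<in> F"
proof (rule smooth_functionsI)
 fix U ph r assume c: "(U, ph) \<in> atlas M"
 show "continuously_diff_on r \<E> (ph ` U) (%x. c * f (inv_into U ph x))"
  by (rule cdiff_on_bounded_linear[OF model_subspace chart_image_open(3)[OF c]
     bounded_linear_mult_right smooth_functionsD[OF f c]])
qed (simp add: smooth_functions_zero_off[OF f])

lemma zero_smooth: "(%q. 0) \<in> F" "0 \<in> F"
 using cmult_smooth[OF one_smooth, of 0] by (simp_all add: zero_fun_def)

lemma minus_smooth: "f \<in> F ==> (%q. - f q) \<in> F"
 using cmult_smooth[of f "-1"] by simp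

lemma diff_smooth: "f \<in> F ==> g \<in> F ==> (%q. f q - g q) \<in> F"
 using add_smooth[OF _ minus_smooth, of f g] by simp

lemma sum_smooth: "(!!i. i \<in> I ==> f i \<in> F) ==> (%q. \<Sum>i\<in>I. f i q) \<in> F"
 by (induction I rule: infinite_finite_induct) (auto intro: zero_smooth add_smooth)

lemma chart_extension_smooth:
 assumes c: "(U, ph) \<in> atlas M" and W: "openin (top_of_set \<E>) W" "W \<subseteq> ph ` U"
  and h: "smooth_on \<E> W h" and K: "compact K" "K \<subseteq> W" and h0: "!!x. x \<in> ph ` U ==> x \<notin> K ==> h x = 0"
 shows "(%q. if q \<in> U then h (ph q) else 0) \<in> F" (is "?f \<in> F")
proof (rule smooth_functionsI)
 note ch = chart_image_open[OF c]
 show "?f p = 0" if "p \<notin> S" for p using that ch(2) by auto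
 fix V ps r assume d: "(V, ps) \<in> atlas M"
 note dh = chart_image_open[OF d]
 show "continuously_diff_on r \<E> (ps ` V) (%x. ?f (inv_into V ps x))"
 proof (rule cdiff_on_local[OF openin_imp_subset[OF dh(3)]])
  fix y assume "y \<in> ps ` V"
  then obtain q where q: "q \<in> V" "y = ps q" by auto
  show "\<exists>O'. openin (top_of_set \<E>) O' \<and> y \<in> O' \<and> continuously_diff_on r \<E> (ps ` V \<inter> O') (%x. ?f (inv_into V ps x))"
  proof (cases "q \<in> U \<and> ph q \<in> W")
   case True
   let ?N = "V \<inter> {q \<in> U. ph q \<in> W}"
   have oN: "openin (top_of_set \<E>) (ps ` ?N)"
    using dh(1) ch(6)[OF W(1)] by (intro dh(5)) auto
   have "smooth_on \<E> (ps ` (V \<inter> U)) (ph \<circ> inv_into V ps)"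
    using mfd c d unfolding smooth_manifold_def by blast
   then have "continuously_diff_on r \<E> (ps ` (V \<inter> U)) (%x. ph (inv_into V ps x))"
    by (simp add: smooth_on_def comp_def)
   then have t: "continuously_diff_on r \<E> (ps ` ?N) (%x. ph (inv_into V ps x))"
    by (rule cdiff_on_subset) auto
   have "continuously_diff_on r \<E> (ps ` ?N) (%x. h (ph (inv_into V ps x)))"
    by (rule cdiff_on_compose[OF model_subspace oN model_subspace W(1) t _ smooth_onD[OF h]])
      (use dh(4) in auto)
   then have "continuously_diff_on r \<E> (ps ` ?N) (%x. ?f (inv_into V ps x))"
    by (rule cdiff_on_cong[OF oN, rotated]) (use dh(4) in auto)
   moreover have "ps ` V \<inter> ps ` ?N = ps ` ?N" by auto
   ultimately show ?thesis using oN True q by (intro exI[of _ "ps ` ?N"]) auto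
  next
   case False
   let ?N = "V - {q \<in> U. ph q \<in> K}"
   have "closedin (mtop M) {q \<in> U. ph q \<in> K}"
    using K W(2) by (intro ch(7)) auto
   then have oN: "openin (top_of_set \<E>) (ps ` ?N)"
    using dh(1) by (intro dh(5) openin_diff) auto
   have "continuously_diff_on r \<E> (ps ` ?N) (%_. 0 :: real)"
    by (rule cdiff_on_const[OF model_subspace oN])
   then have "continuously_diff_on r \<E> (ps ` ?N) (%x. ?f (inv_into V ps x))"
   proof (rule cdiff_on_cong[OF oN, rotated])
    fix y assume "y \<in> ps ` ?N"
    then obtain q' where "q' \<in> V" "q' \<in> U ==> ph q' \<notin> K" "y = ps q'" by auto
    then show "0 = ?f (inv_into V ps y)" using dh(4) h0[of "ph q'"] by auto
   qed
   moreover have "ps ` V \<inter> ps ` ?N = ps ` ?N" by auto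
   ultimately show ?thesis using oN False q K by (intro exI[of _ "ps ` ?N"]) auto
  qed
 qed
qed

lemma chart_ball:
 assumes c: "(U, ph) \<in> atlas M" and p: "p \<in> U" and N: "openin (mtop M) N" "p \<in> N"
 shows "\<exists>e>0. cball (ph p) e \<inter> \<E> \<subseteq> ph ` (U \<inter> N)"
proof -
 note ch = chart_image_open[OF c]
 have "openin (top_of_set \<E>) (ph ` (U \<inter> N))"
  using ch(1) N(1) by (intro ch(5)) auto
 then show ?thesis
  using p N(2) by (auto simp: openin_contains_cball)
qed

lemma compact_cball_model: "compact (cball a e \<inter> \<E>)"
 by (simp add: closed_subspace model_subspace compact_Int_closed)

lemma ball_model_open: "openin (top_of_set \<E>) (ball a e \<inter> \<E>)"
 by (auto simp: openin_open)

lemma bump_function: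
 assumes N: "openin (mtop M) N" "p \<in> N"
 shows "\<exists>be\<in>F. be p = 1 \<and> (\<forall>q. q \<notin> N --> be q = 0)"
proof -
 have "p \<in> S" using N openin_subset by blast
 then obtain U ph where c: "(U, ph) \<in> atlas M" and p: "p \<in> U" using chart_exists by blast
 note ch = chart_image_open[OF c]
 obtain e where e: "e > 0" "cball (ph p) e \<inter> \<E> \<subseteq> ph ` (U \<inter> N)"
  using chart_ball[OF c p N] by blast
 obtain be :: "'e => real" where be: "smooth_on \<E> (ph ` U) be" "\<forall>x\<in>ball (ph p) (e/2). be x = 1"
   "\<forall>x. x \<notin> ball (ph p) (2 * (e/2)) --> be x = 0"
  using smooth_cutoff[OF model_subspace ch(3), of "e/2" "ph p"] e(1) by auto
 have "(%q. if q \<in> U then be (ph q) else 0) \<in> F"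
  by (rule chart_extension_smooth[OF c ch(3) order_refl be(1) compact_cball_model[of "ph p" e]])
    (use e be(3) openin_imp_subset[OF ch(3)] in auto)
 moreover have "be (ph q) = 0" if "q \<in> U" "q \<notin> N" for q
 proof (rule ccontr)
  assume "be (ph q) \<noteq> 0"
  then have "ph q \<in> cball (ph p) e \<inter> \<E>"
   using be(3) openin_imp_subset[OF ch(3)] that(1) by force
  then have "ph q \<in> ph ` (U \<inter> N)" using e(2) by blast
  then show False using ch(4) that by (auto dest: inj_onD)
 qed
 moreover have "be (ph p) = 1" using be(2) e(1) by auto
 ultimately show ?thesis using p by (intro bexI[of _ "%q. if q \<in> U then be (ph q) else 0"]) auto
qed

lemma tangent_add: "v \<in> T p ==> f \<in> F ==> g \<in> F ==> v (%q. f q + g q) = v f + v g"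
 by (auto simp: tangent_space_def linear_map_on_def plus_fun_def)

lemma tangent_cmult: "v \<in> T p ==> f \<in> F ==> v (%q. c * f q) = c * v f"
 by (auto simp: tangent_space_def linear_map_on_def scaleR_fun_def)

lemma tangent_mult: "v \<in> T p ==> f \<in> F ==> g \<in> F ==> v (%q. f q * g q) = f p * v g + g p * v f"
 by (auto simp: tangent_space_def)

lemma tangent_nonsmooth: "v \<in> T p ==> f \<notin> F ==> v f = 0"
 by (auto simp: tangent_space_def)

lemma tangent_zero: "v \<in> T p ==> v (%q. 0) = 0"
 using tangent_cmult[of v p one 0] by simp

lemma tangent_sum:
 "v \<in> T p ==> (!!i. i \<in> I ==> f i \<in> F) ==> v (%q. \<Sum>i\<in>I. f i q) = (\<Sum>i\<in>I. v (f i))"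
proof (induction I rule: infinite_finite_induct)
 case (insert i I)
 then have "(%q. \<Sum>i\<in>I. f i q) \<in> F" by (intro sum_smooth) auto
 with insert show ?case by (simp add: tangent_add[of v p])
qed (simp_all add: tangent_zero)

lemma tangent_diff: "v \<in> T p ==> f \<in> F ==> g \<in> F ==> v (%q. f q - g q) = v f - v g"
 using tangent_add[of v p f "%q. -1 * g q"] tangent_cmult[of v p g "-1"] cmult_smooth[of g "-1"]
 by simp

lemma tangent_one:
 assumes p: "p \<in> S" and v: "v \<in> T p" shows "v one = 0"
proof -
 have "(%q. one q * one q) = one" by (simp add: one_def fun_eq_iff)
 then show ?thesis using tangent_mult[OF v one_smooth one_smooth] p by (simp add: one_def)
qed

lemma tangent_local:
 assumes v: "v \<in> T p" and fg: "f \<in> F" "g \<in> F"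
  and N: "openin (mtop M) N" "p \<in> N" "!!q. q \<in> N ==> f q = g q"
 shows "v f = v g"
proof -
 obtain be where be: "be \<in> F" "be p = 1" "\<forall>q. q \<notin> N --> be q = 0"
  using bump_function[OF N(1,2)] by blast
 have z: "(%q. be q * (f q - g q)) = (%q. 0)"
  using be(3) N(3) by force
 have "v (%q. be q * (f q - g q)) = be p * v (%q. f q - g q) + (f p - g p) * v be"
  by (rule tangent_mult[OF v be(1) diff_smooth[OF fg]])
 then show ?thesis
  unfolding z using be(2) N(2,3) by (simp add: tangent_zero[OF v] tangent_diff[OF v fg])
qed

text \<open>The derivation \<open>f \<mapsto> rh \<cdot> \<partial>\<^sub>b f\<close> given by a direction \<open>b\<close> in the model space of a chart, cut off by \<open>rh\<close>.\<close>

definition chart_field :: "'m set => ('m => 'e) => ('e => real) => 'e => 'm => 'm tvec" where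
 "chart_field U ph rh b q f =
   (if q \<in> U \<and> f \<in> F then rh (ph q) * frechet_derivative (%x. f (inv_into U ph x)) (at (ph q) within \<E>) b else 0)"

lemma chart_field_vector_field:
 assumes c: "(U, ph) \<in> atlas M" and b: "b \<in> \<E>"
  and rh: "smooth_on \<E> (ph ` U) rh" and K: "compact K" "K \<subseteq> ph ` U" "!!x. x \<in> ph ` U ==> x \<notin> K ==> rh x = 0"
 shows "chart_field U ph rh b \<in> VF"
proof -
 note ch = chart_image_open[OF c]
 define D where "D f x = frechet_derivative (%x. f (inv_into U ph x)) (at x within \<E>) b" for f :: "'m => real" and x
 have sm: "smooth_on \<E> (ph ` U) (%x. f (inv_into U ph x))" if "f \<in> F" for f
  using smooth_functions_chart[OF that c] by (simp add: comp_def)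
 have D_unique: "D f x = A b" if "f \<in> F" "x \<in> ph ` U" "((%x. f (inv_into U ph x)) has_derivative A) (at x within \<E>)" for f x A
  unfolding D_def
  using has_derivative_unique_subspace[OF model_subspace _ b smooth_on_has_derivative[OF sm[OF that(1)] that(2)] that(3)]
   that(2) openin_imp_subset[OF ch(3)] by blast
 have der: "((%x. f (inv_into U ph x)) has_derivative frechet_derivative (%x. f (inv_into U ph x)) (at x within \<E>)) (at x within \<E>)"
  if "f \<in> F" "x \<in> ph ` U" for f x
  by (rule smooth_on_has_derivative[OF sm[OF that(1)] that(2)])
 have Dadd: "D (%q. f q + g q) x = D f x + D g x" if "f \<in> F" "g \<in> F" "x \<in> ph ` U" for f g x
  using D_unique[OF add_smooth[OF that(1,2)] that(3) has_derivative_add[OF der[OF that(1,3)] der[OF that(2,3)]]]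
  by (simp add: D_def)
 have Dcmult: "D (%q. a * f q) x = a * D f x" if "f \<in> F" "x \<in> ph ` U" for f x a
  using D_unique[OF cmult_smooth[OF that(1)] that(2) has_derivative_mult_right[OF der[OF that]]]
  by (simp add: D_def)
 have Dmult: "D (%q. f q * g q) (ph p) = f p * D g (ph p) + g p * D f (ph p)" if "f \<in> F" "g \<in> F" "p \<in> U" for f g p
  using D_unique[OF mult_smooth[OF that(1,2)] _ has_derivative_mult[OF der[OF that(1)] der[OF that(2)]], of "ph p"] that(3) ch(4)
  by (simp add: D_def mult.commute)
 have tan: "chart_field U ph rh b q \<in> T q" if q: "q \<in> S" for q
 proof (cases "q \<in> U")
  case True
  have cf: "chart_field U ph rh b q = (%f. if f \<in> F then rh (ph q) * D f (ph q) else 0)"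
   using True by (simp add: fun_eq_iff chart_field_def D_def)
  show ?thesis
   unfolding tangent_space_def linear_map_on_def mem_Collect_eq cf
   using True by (auto simp: plus_fun_def scaleR_fun_def add_smooth cmult_smooth mult_smooth
     Dadd Dcmult Dmult algebra_simps)
 next
  case False
  then show ?thesis
   by (auto simp: chart_field_def tangent_space_def linear_map_on_def)
 qed
 have smo: "(%q. chart_field U ph rh b q f) \<in> F" if f: "f \<in> F" for f
 proof -
  have "smooth_on \<E> (ph ` U) (%x. rh x *r D f x)"
   unfolding D_def
   by (rule smooth_onI, rule cdiff_on_scaleR[OF model_subspace ch(3) smooth_onD[OF rh]
      smooth_onD[OF smooth_on_directional_derivative[OF sm[OF f] b]]])
  from chart_extension_smooth[OF c ch(3) order_refl this K(1,2)] K(3)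
  have "(%q. if q \<in> U then rh (ph q) *r D f (ph q) else 0) \<in> F" by simp
  moreover have "(%q. if q \<in> U then rh (ph q) *r D f (ph q) else 0) = (%q. chart_field U ph rh b q f)"
   using f by (auto simp: chart_field_def D_def)
  ultimately show ?thesis by simp
 qed
 show ?thesis
  unfolding vector_fields_def mem_Collect_eq
  using tan smo ch(2) by (auto simp: chart_field_def fun_eq_iff)
qed

text \<open>
  By Hadamard's lemma a smooth function is, near \<open>q\<close>, a constant plus \<open>\<Sum> (x\<^sub>b - x\<^sub>b(q)) g\<^sub>b\<close>, so the Leibniz rule
  determines a derivation at \<open>q\<close> by its values on the coordinates.
\<close>
lemma tangent_expansion_chart:
 assumes c: "(U, ph) \<in> atlas M" and q: "q \<in> U" and e: "0 < e" "ball (ph q) e \<inter> \<E> \<subseteq> ph ` U"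
  and B: "finite B" "B \<subseteq> \<E>" "!!v. v \<in> \<E> ==> v = (\<Sum>b\<in>B. (v \<bullet> b) *r b)"
  and x: "!!b. b \<in> B ==> x b \<in> F"
   "!!b q'. b \<in> B ==> q' \<in> U ==> ph q' \<in> ball (ph q) e ==> x b q' = ph q' \<bullet> b"
  and v: "v \<in> T q" and f: "f \<in> F"
 shows "v f = (\<Sum>b\<in>B. v (x b) * frechet_derivative (%x. f (inv_into U ph x)) (at (ph q) within \<E>) b)"
proof -
 note ch = chart_image_open[OF c]
 define W where "W = ball (ph q) e \<inter> \<E>"
 have W: "openin (top_of_set \<E>) W" "W \<subseteq> ph ` U" "convex W" "ph q \<in> W"
  using e openin_imp_subset[OF ch(3)] q model_subspace
   convex_Int[OF convex_ball subspace_imp_convex[OF model_subspace]]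
  by (auto simp: W_def ball_model_open)
 let ?h = "%x. f (inv_into U ph x)"
 have "smooth_on \<E> W ?h"
  using smooth_functionsD[OF f c] by (auto simp: smooth_on_def intro: cdiff_on_subset[OF _ W(2)])
 then obtain g where g: "\<forall>b\<in>B. smooth_on \<E> W (g b) \<and> g b (ph q) = frechet_derivative ?h (at (ph q) within \<E>) b \<and>
   (\<forall>x\<in>W. ?h x = ?h (ph q) + (\<Sum>b\<in>B. ((x - ph q) \<bullet> b) * g b x))"
  using hadamard_lemma[OF model_subspace W(1,3,4) _ B] by blast
 obtain be :: "'e => real" where be: "smooth_on \<E> W be" "\<forall>x\<in>ball (ph q) (e/4). be x = 1"
   "\<forall>x. x \<notin> ball (ph q) (2 * (e/4)) --> be x = 0"
  using smooth_cutoff[OF model_subspace W(1), of "e/4" "ph q"] e(1) by auto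
 define G where "G b q = (if q \<in> U then be (ph q) *r g b (ph q) else 0)" for b q
 have G: "G b \<in> F" if b: "b \<in> B" for b
  unfolding G_def
 proof (rule chart_extension_smooth[OF c W(1,2)])
  show "smooth_on \<E> W (%x. be x *r g b x)"
  proof -
   have gb: "smooth_on \<E> W (g b)" using g b by blast
   show ?thesis
    by (rule smooth_onI, rule cdiff_on_scaleR[OF model_subspace W(1) smooth_onD[OF be(1)] smooth_onD[OF gb]])
  qed
  show "compact (cball (ph q) (e/2) \<inter> \<E>)" by (rule compact_cball_model)
  show "cball (ph q) (e/2) \<inter> \<E> \<subseteq> W" using e(1) by (auto simp: W_def)
  show "be x *r g b x = 0" if "x \<in> ph ` U" "x \<notin> cball (ph q) (e/2) \<inter> \<E>" for x
   using be(3) that openin_imp_subset[OF ch(3)] by auto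
 qed
 define N where "N = {q' \<in> U. ph q' \<in> ball (ph q) (e/4) \<inter> \<E>}"
 have N: "openin (mtop M) N" "q \<in> N"
 proof -
  show "openin (mtop M) N" unfolding N_def by (rule ch(6)[OF ball_model_open])
  show "q \<in> N" using e(1) q W(4) by (auto simp: N_def W_def)
 qed
 let ?f = "%q'. f q * one q' + (\<Sum>b\<in>B. (x b q' - x b q * one q') * G b q')"
 have F1: "(%q'. x b q' - x b q * one q') \<in> F" if "b \<in> B" for b
  using x(1)[OF that] by (intro diff_smooth cmult_smooth) auto
 have F2: "(%q'. (x b q' - x b q * one q') * G b q') \<in> F" if "b \<in> B" for b
  by (rule mult_smooth[OF F1[OF that] G[OF that]])
 have F3: "(%q'. \<Sum>b\<in>B. (x b q' - x b q * one q') * G b q') \<in> F"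
  by (rule sum_smooth[OF F2])
 have qS: "q \<in> S" using q ch(2) by blast
 have "v f = v ?f"
 proof (rule tangent_local[OF v f _ N])
  show "?f \<in> F" by (rule add_smooth[OF cmult_smooth[OF one_smooth] F3])
  fix q' assume q': "q' \<in> N"
  then have *: "q' \<in> U" "ph q' \<in> W" "ph q' \<in> ball (ph q) e" "ph q' \<in> ball (ph q) (e/4)" "q' \<in> S"
   using e(1) ch(2) by (auto simp: N_def W_def)
  show "f q' = ?f q'"
  proof (cases "B = {}")
   case True
   have "\<E> \<subseteq> {0}" using B(3) True by fastforce
   moreover have "ph q' \<in> \<E>" "ph q \<in> \<E>" using *(2) W(4) by (auto simp: W_def)
   ultimately have "ph q' = ph q" by (metis subset_iff singletonD)
   then have "q' = q" by (rule inj_onD[OF ch(4) _ *(1) q])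
   then show ?thesis using True qS by (simp add: one_def)
  next
   case False
   then obtain b0 where "b0 \<in> B" by auto
   then have "?h (ph q') = ?h (ph q) + (\<Sum>b\<in>B. ((ph q' - ph q) \<bullet> b) * g b (ph q'))"
    using g *(2) by blast
   moreover have "(ph q' - ph q) \<bullet> b * g b (ph q') = (x b q' - x b q * one q') * G b q'" if "b \<in> B" for b
    using * be(2) q e(1) that x(2)[of b q'] x(2)[of b q] by (simp add: G_def one_def inner_diff_left)
   ultimately show ?thesis using * q ch(4) by (simp add: one_def)
  qed
 qed
 also have "... = (\<Sum>b\<in>B. v (%q'. (x b q' - x b q * one q') * G b q'))"
  by (simp add: tangent_add[OF v cmult_smooth[OF one_smooth] F3] tangent_cmult[OF v one_smooth] tangent_one[OF qS v]
    tangent_sum[OF v F2])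
 also have "... = (\<Sum>b\<in>B. v (x b) * frechet_derivative ?h (at (ph q) within \<E>) b)"
 proof (rule sum.cong[OF refl])
  fix b assume b: "b \<in> B"
  have "v (%q'. (x b q' - x b q * one q') * G b q') =
    (x b q - x b q * one q) * v (G b) + G b q * v (%q'. x b q' - x b q * one q')"
   by (rule tangent_mult[OF v F1[OF b] G[OF b]])
  also have "v (%q'. x b q' - x b q * one q') = v (x b)"
   by (simp add: tangent_diff[OF v x(1)[OF b] cmult_smooth[OF one_smooth]] tangent_cmult[OF v one_smooth] tangent_one[OF qS v])
  finally show "v (%q'. (x b q' - x b q * one q') * G b q') = v (x b) * frechet_derivative ?h (at (ph q) within \<E>) b"
   using g b be(2) e(1) q qS by (simp add: G_def one_def)
 qed
 finally show ?thesis .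
qed

text \<open>
  Coordinates and coordinate fields, cut off to be defined globally.  Multiplying by \<open>rh\<close>, which is \<open>1\<close>
 near \<open>p\<close>, makes the expansion valid everywhere, and later lets local statements be proved by
 global sums.
\<close>
theorem local_frame:
 assumes p: "p \<in> S"
 shows "\<exists>(B :: 'e set) x X rh. finite B \<and> (\<forall>b\<in>B. x b \<in> F \<and> X b \<in> VF) \<and> rh \<in> F \<and>
  (\<exists>N. openin (mtop M) N \<and> p \<in> N \<and> (\<forall>q\<in>N. rh q = 1)) \<and>
  (\<forall>q\<in>S. \<forall>v\<in>T q. rh q *r v = (\<Sum>b\<in>B. v (x b) *r X b q))"
proof -
 obtain U ph where c: "(U, ph) \<in> atlas M" and pU: "p \<in> U" using chart_exists[OF p] by blast
 note ch = chart_image_open[OF c]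
 obtain e0 where e0: "e0 > 0" "cball (ph p) e0 \<inter> \<E> \<subseteq> ph ` (U \<inter> U)"
  using chart_ball[OF c pU ch(1) pU] by blast
 define e where "e = e0 / 4"
 have e: "e > 0" "cball (ph p) (4 * e) \<inter> \<E> \<subseteq> ph ` U" using e0 by (auto simp: e_def)
 obtain B where B: "finite B" "B \<subseteq> \<E>" "!!v. v \<in> \<E> ==> v = (\<Sum>b\<in>B. (v \<bullet> b) *r b)"
  by (rule subspace_orthonormal_expansion[OF model_subspace]) blast
 obtain be :: "'e => real" where be: "smooth_on \<E> (ph ` U) be" "\<forall>x\<in>ball (ph p) (2 * e). be x = 1"
   "\<forall>x. x \<notin> ball (ph p) (2 * (2 * e)) --> be x = 0"
  using smooth_cutoff[OF model_subspace ch(3), of "2 * e" "ph p"] e(1) by auto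
 obtain ga :: "'e => real" where ga: "smooth_on \<E> (ph ` U) ga" "\<forall>x\<in>ball (ph p) e. ga x = 1"
   "\<forall>x. x \<notin> ball (ph p) (2 * e) --> ga x = 0"
  using smooth_cutoff[OF model_subspace ch(3), of e "ph p"] e(1) by auto
 define x where "x b q = (if q \<in> U then be (ph q) *r (ph q \<bullet> b) else 0)" for b q
 define rh where "rh q = (if q \<in> U then ga (ph q) else 0)" for q
 let ?K = "cball (ph p) (4 * e) \<inter> \<E>" and ?K' = "cball (ph p) (2 * e) \<inter> \<E>"
 have sub: "ph ` U \<subseteq> \<E>" by (rule openin_imp_subset[OF ch(3)])
 have K': "?K' \<subseteq> ph ` U" using e by auto
 have ga0: "ga y = 0" if "y \<in> ph ` U" "y \<notin> ?K'" for y using ga(3) that sub by auto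
 have xF: "x b \<in> F" for b
  unfolding x_def
 proof (rule chart_extension_smooth[OF c ch(3) order_refl])
  show "smooth_on \<E> (ph ` U) (%y. be y *r (y \<bullet> b))"
   by (rule smooth_onI, rule cdiff_on_scaleR[OF model_subspace ch(3) smooth_onD[OF be(1)]
      cdiff_on_bounded_linear[OF model_subspace ch(3) bounded_linear_inner_left
       cdiff_on_id[OF model_subspace ch(3)]]])
  show "compact ?K" by (rule compact_cball_model)
  show "?K \<subseteq> ph ` U" by (rule e(2))
  show "be y *r (y \<bullet> b) = 0" if "y \<in> ph ` U" "y \<notin> ?K" for y
   using be(3) that sub by auto
 qed
 have rhF: "rh \<in> F"
  unfolding rh_def by (rule chart_extension_smooth[OF c ch(3) order_refl ga(1) compact_cball_model K' ga0])
 have XF: "chart_field U ph ga b \<in> VF" if "b \<in> B" for b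
  using chart_field_vector_field[OF c _ ga(1) compact_cball_model K' ga0] that B(2) by blast
 have N: "\<exists>N. openin (mtop M) N \<and> p \<in> N \<and> (\<forall>q\<in>N. rh q = 1)"
 proof (intro exI conjI)
  show "openin (mtop M) {q \<in> U. ph q \<in> ball (ph p) e \<inter> \<E>}" by (intro ch(6) ball_model_open)
  show "p \<in> {q \<in> U. ph q \<in> ball (ph p) e \<inter> \<E>}" using e(1) pU sub by auto
  show "\<forall>q\<in>{q \<in> U. ph q \<in> ball (ph p) e \<inter> \<E>}. rh q = 1" using ga(2) by (auto simp: rh_def)
 qed
 have expansion: "rh q * v f = (\<Sum>b\<in>B. v (x b) * chart_field U ph ga b q f)" if q: "q \<in> S" and v: "v \<in> T q" for q v f
 proof (cases "f \<in> F \<and> q \<in> U \<and> ph q \<in> ball (ph p) (2 * e)")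
  case False
  then have "chart_field U ph ga b q f = 0" for b
   using ga(3) by (auto simp: chart_field_def)
  moreover have "rh q * v f = 0"
   using False ga(3) tangent_nonsmooth[OF v] by (auto simp: rh_def)
  ultimately show ?thesis by simp
 next
  case True
  then have f: "f \<in> F" and qU: "q \<in> U" and qb: "ph q \<in> ball (ph p) (2 * e)" by auto
  from qb obtain d where d: "d > 0" "ball (ph q) d \<subseteq> ball (ph p) (2 * e)"
   by (meson open_ball open_contains_ball)
  have "v f = (\<Sum>b\<in>B. v (x b) * frechet_derivative (%x. f (inv_into U ph x)) (at (ph q) within \<E>) b)"
  proof (rule tangent_expansion_chart[OF c qU d(1) _ B xF _ v f])
   show "ball (ph q) d \<inter> \<E> \<subseteq> ph ` U"
    using d(2) K' by (meson Int_mono ball_subset_cball order_refl order_trans)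
   show "x b q' = ph q' \<bullet> b" if "q' \<in> U" "ph q' \<in> ball (ph q) d" for b q'
    using that d(2) be(2) by (simp add: x_def subset_iff)
  qed
  then show ?thesis using qU f by (simp add: rh_def chart_field_def sum_distrib_left mult_ac)
 qed
 then have ex: "rh q *r v = (\<Sum>b\<in>B. v (x b) *r chart_field U ph ga b q)" if "q \<in> S" "v \<in> T q" for q v
  using that by (simp add: fun_eq_iff scaleR_fun_def sum_fun_apply)
 show ?thesis
  by (rule exI[of _ B], rule exI[of _ x], rule exI[of _ "chart_field U ph ga"], rule exI[of _ rh])
    (intro conjI ballI B(1) xF XF rhF N ex)
qed

end

section \<open>Alternating multilinear functions of lists\<close>

definition alternating :: "'v::real_vector set => nat => ('v list => real) => bool" where
 "alternating V k f \<longleftrightarrow>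
   (\<forall>vs. \<not> (length vs = k \<and> set vs \<subseteq> V) --> f vs = 0) \<and>
   (\<forall>vs. length vs = k --> set vs \<subseteq> V -->
    (\<forall>j<k. linear_map_on V (%v. f (vs[j := v]))) \<and>
    (\<forall>i<k. \<forall>j<k. i \<noteq> j --> vs ! i = vs ! j --> f vs = 0))"

definition cn :: "'v => ('v list => real) => 'v list => real" where
 "cn v f vs = f (v # vs)"

lemma alternating_outside: "alternating V k f ==> \<not> (length vs = k \<and> set vs \<subseteq> V) ==> f vs = 0"
 unfolding alternating_def by blast

lemma alternating_linear:
 "alternating V k f ==> length vs = k ==> set vs \<subseteq> V ==> j < k ==> linear_map_on V (%v. f (vs[j := v]))"
 unfolding alternating_def by blast

lemma alternating_repeat:
 "alternating V k f ==> i < length vs ==> j < length vs ==> i \<noteq> j ==> vs ! i = vs ! j ==> f vs = 0"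
 unfolding alternating_def by metis

lemma alternating_linear_Cons:
 assumes "alternating V k f" "set vs \<subseteq> V"
 shows "linear_map_on V (%v. f (v # vs))"
proof (cases "Suc (length vs) = k")
 case True
 have *: "f (v # vs) = 0" if "v \<notin> V" for v
  using alternating_outside[OF assms(1), of "v # vs"] that by simp
 show ?thesis
 proof (cases "V = {}")
  case False
  then obtain w where "w \<in> V" by auto
  then show ?thesis
   using alternating_linear[OF assms(1), of "w # vs" 0] True assms(2) by auto
 qed (simp add: linear_map_on_def)
next
 case False
 then have "f (v # vs) = 0" for v using alternating_outside[OF assms(1), of "v # vs"] by simp
 then show ?thesis by (simp add: linear_map_on_def)
qed

lemma alternating_swap:
 assumes V: "subspace V" and f: "alternating V k f" and vs: "length vs = k" "set vs \<subseteq> V"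
  and ij: "i < k" "j < k" "i \<noteq> j"
 shows "f (vs[i := vs ! j, j := vs ! i]) = - f vs"
proof -
 let ?G = "%a b. f (vs[i := a, j := b])"
 have in_V: "set (vs[i := a, j := b]) \<subseteq> V" if "a \<in> V" "b \<in> V" for a b
  using vs(2) that by (metis set_update_subsetI)
 have lin2: "linear_map_on V (%b. ?G a b)" if "a \<in> V" for a
  using alternating_linear[OF f, of "vs[i := a]" j] vs ij that by (simp add: set_update_subsetI)
 have lin1: "linear_map_on V (%a. ?G a b)" if "b \<in> V" for b
  using alternating_linear[OF f, of "vs[j := b]" i] vs ij that
  by (simp add: set_update_subsetI list_update_swap[of i j])
 have diag: "?G a a = 0" if "a \<in> V" for a
  using alternating_repeat[OF f, of i "vs[i := a, j := a]" j] vs ij that by simp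
 let ?a = "vs ! i" and ?b = "vs ! j"
 have ab: "?a \<in> V" "?b \<in> V" using vs ij by auto
 have abV: "?a + ?b \<in> V" using ab V by (simp add: subspace_add)
 have "0 = ?G (?a + ?b) (?a + ?b)" using diag[OF abV] by simp
 also have "... = ?G ?a (?a + ?b) + ?G ?b (?a + ?b)"
  by (rule linear_onD(1)[OF lin1[OF abV] ab])
 also have "... = (?G ?a ?a + ?G ?a ?b) + (?G ?b ?a + ?G ?b ?b)"
  using linear_onD(1)[OF lin2[OF ab(1)] ab] linear_onD(1)[OF lin2[OF ab(2)] ab] by (simp only:)
 finally have "?G ?b ?a = - ?G ?a ?b" using diag[OF ab(1)] diag[OF ab(2)] by linarith
 then show ?thesis by simp
qed

lemma alternating_swap_Cons:
 assumes V: "subspace V" and f: "alternating V k f"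
 shows "f (u # w # vs) = - f (w # u # vs)"
proof (cases "length (u # w # vs) = k \<and> set (u # w # vs) \<subseteq> V")
 case True
 then show ?thesis
  using alternating_swap[OF V f, of "w # u # vs" 0 1] by auto
next
 case False
 then have "f (u # w # vs) = 0" "f (w # u # vs) = 0"
  using alternating_outside[OF f, of "u # w # vs"] alternating_outside[OF f, of "w # u # vs"] by auto
 then show ?thesis by simp
qed

lemma alternating_cn:
 assumes "alternating V (Suc k) f" shows "alternating V k (cn v f)"
proof (cases "v \<in> V")
 case True
 show ?thesis
  unfolding alternating_def
 proof (intro conjI allI impI)
  fix vs :: "'a list" and i j
  show "cn v f vs = 0" if "\<not> (length vs = k \<and> set vs \<subseteq> V)"
   using that alternating_outside[OF assms, of "v # vs"] by (auto simp: cn_def)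
  assume vs: "length vs = k" "set vs \<subseteq> V"
  show "linear_map_on V (%w. cn v f (vs[j := w]))" if "j < k"
   using alternating_linear[OF assms, of "v # vs" "Suc j"] vs that True by (simp add: cn_def)
  show "cn v f vs = 0" if "i < k" "j < k" "i \<noteq> j" "vs ! i = vs ! j"
   using alternating_repeat[OF assms, of "Suc i" "v # vs" "Suc j"] vs that by (simp add: cn_def)
 qed
next
 case False
 then have "cn v f = (%_. 0)"
  using alternating_outside[OF assms, of "v # _"] by (auto simp: cn_def fun_eq_iff)
 then show ?thesis by (simp add: alternating_def linear_map_on_def)
qed

lemma alternating_0_cn: "alternating V 0 f ==> cn v f = 0"
 using alternating_outside[of V 0 f] by (auto simp: cn_def fun_eq_iff)

lemma alternating_0_iff: "alternating V 0 f \<longleftrightarrow> (\<forall>vs. vs \<noteq> [] --> f vs = 0)"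
 by (auto simp: alternating_def)

lemma alternating_SucI:
 assumes V: "subspace V"
  and nil: "f [] = 0" and out: "!!v vs. v \<notin> V ==> f (v # vs) = 0"
  and alt: "!!v. v \<in> V ==> alternating V k (cn v f)"
  and lin: "!!vs. set vs \<subseteq> V ==> length vs = k ==> linear_map_on V (%v. f (v # vs))"
  and rep: "!!v vs. v \<in> V ==> set vs \<subseteq> V ==> Suc (length vs) = k ==> f (v # v # vs) = 0"
 shows "alternating V (Suc k) f"
proof -
 have rep0: "f (v # vs) = 0" if v: "v \<in> V" and vs: "length vs = k" "set vs \<subseteq> V" and j: "j < k" "vs ! j = v" for v vs j
 proof (cases j)
  case 0
  then obtain ws where "vs = v # ws" using vs j by (cases vs) auto
  then show ?thesis using rep[of v ws] v vs by auto
 next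
  case (Suc j')
  have "cn v f (vs[0 := vs ! j, j := vs ! 0]) = - cn v f vs"
   by (rule alternating_swap[OF V alt[OF v] vs]) (use j Suc in auto)
  moreover obtain w ws where w: "vs = w # ws" using vs(1) j(1) by (cases vs) auto
  have "set ws \<subseteq> V" "w \<in> V" using vs w by auto
  moreover have "vs[0 := vs ! j, j := vs ! 0] = v # ws[j' := w]"
   using j Suc w by simp
  moreover have "set (ws[j' := w]) \<subseteq> V" using calculation by (metis set_update_subsetI)
  ultimately show ?thesis
   using rep[OF v, of "ws[j' := w]"] vs(1) w by (simp add: cn_def)
 qed
 show ?thesis
  unfolding alternating_def
 proof (intro conjI allI impI)
  fix vs :: "'a list" and i j
  show "f vs = 0" if "\<not> (length vs = Suc k \<and> set vs \<subseteq> V)"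
  proof (cases vs)
   case (Cons v ws)
   show ?thesis
   proof (cases "v \<in> V")
    case True
    then have "cn v f ws = 0" using alternating_outside[OF alt[OF True], of ws] that Cons by auto
    then show ?thesis by (simp add: cn_def Cons)
   qed (simp add: out Cons)
  qed (simp add: nil)
  assume vs: "length vs = Suc k" "set vs \<subseteq> V"
  then obtain v ws where v: "vs = v # ws" "v \<in> V" "set ws \<subseteq> V" "length ws = k" by (cases vs) auto
  show "linear_map_on V (%w. f (vs[j := w]))" if "j < Suc k"
  proof (cases j)
   case 0
   then show ?thesis using lin[OF v(3,4)] by (simp add: v)
  next
   case (Suc j')
   then show ?thesis using alternating_linear[OF alt[OF v(2)] v(4,3), of j'] that by (simp add: v cn_def)
  qed
  show "f vs = 0" if "i < Suc k" "j < Suc k" "i \<noteq> j" "vs ! i = vs ! j"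
  proof (cases "i = 0 \<or> j = 0")
   case True
   then show ?thesis
    using rep0[OF v(2,4,3), of "i - 1"] rep0[OF v(2,4,3), of "j - 1"] that by (auto simp: v nth_Cons')
  next
   case False
   then have "cn v f ws = 0"
    using alternating_repeat[OF alt[OF v(2)], of "i - 1" ws "j - 1"] that v by auto
   then show ?thesis by (simp add: v cn_def)
  qed
 qed
qed

lemma alternating_zero: "alternating V k (%_. 0)" "alternating V k 0"
 by (simp_all add: alternating_def linear_map_on_def)

lemma alternating_add:
 assumes "alternating V k f" "alternating V k g" shows "alternating V k (%vs. f vs + g vs)"
 using assms unfolding alternating_def linear_map_on_def by (auto simp: algebra_simps)

lemma alternating_scale:
 assumes "alternating V k f" shows "alternating V k (%vs. c * f vs)"
 using assms unfolding alternating_def linear_map_on_def by (auto simp: algebra_simps)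

text \<open>An alternating function that ignores vectors in the kernel of a linear surjection descends along it.\<close>

lemma alternating_descends:
 fixes r :: "'v::real_vector => 'w::real_vector"
 assumes V: "subspace V" and f: "alternating V k f" and r: "linear_map_on V r"
  and van: "!!X Xs. X \<in> V ==> r X = 0 ==> set Xs \<subseteq> V ==> f (X # Xs) = 0"
  and Xs: "set Xs \<subseteq> V" "set Ys \<subseteq> V" "map r Xs = map r Ys"
 shows "f Xs = f Ys"
 using f van Xs
proof (induction Xs arbitrary: Ys f k)
 case (Cons X Xs)
 then obtain Y Ys' where Ys: "Ys = Y # Ys'" by (cases Ys) auto
 have XY: "X \<in> V" "Y \<in> V" "r (X - Y) = 0" "X - Y \<in> V"
  using Cons.prems Ys V linear_on_diff[OF V r, of X Y] by (auto simp: subspace_diff)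
 show ?case
 proof (cases k)
  case 0
  then show ?thesis using alternating_outside[OF Cons.prems(1)] by (simp add: Ys)
 next
  case (Suc k')
  have "f (X # Xs) = f (Y # Xs) + f ((X - Y) # Xs)"
   using linear_on_diff[OF V alternating_linear_Cons[OF Cons.prems(1)] XY(1,2), of Xs] Cons.prems by simp
  also have "... = f (Y # Xs)" using Cons.prems(2)[OF XY(4,3)] Cons.prems(3) by simp
  also have "cn Y f Xs = cn Y f Ys'"
  proof (rule Cons.IH)
   show "alternating V k' (cn Y f)" using Cons.prems(1) unfolding Suc by (rule alternating_cn)
   show "cn Y f (Z # Zs) = 0" if "Z \<in> V" "r Z = 0" "set Zs \<subseteq> V" for Z Zs
    using alternating_swap_Cons[OF V Cons.prems(1), of Y Z Zs] Cons.prems(2)[OF that(1,2), of "Y # Zs"] that XY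
    by (simp add: cn_def)
  qed (use Cons.prems Ys in auto)
  then have "f (Y # Xs) = f (Y # Ys')" by (simp add: cn_def)
  finally show ?thesis by (simp add: Ys)
 qed
qed simp

lemma alternating_pushforward:
 fixes r :: "'v::real_vector => 'w::real_vector"
 assumes V: "subspace V" and f: "alternating V k f" and r: "linear_map_on V r" and W: "r ` V = W"
  and van: "!!X Xs. X \<in> V ==> r X = 0 ==> set Xs \<subseteq> V ==> f (X # Xs) = 0"
  and g: "!!Xs. set Xs \<subseteq> V ==> g (map r Xs) = f Xs" and out: "!!vs. \<not> set vs \<subseteq> W ==> g vs = 0"
 shows "alternating W k g"
 unfolding alternating_def
proof (intro conjI allI impI)
 fix vs :: "'w list" and i j
 have lift: "\<exists>Xs. set Xs \<subseteq> V \<and> map r Xs = vs" if "set vs \<subseteq> W" for vs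
  using that
 proof (induction vs)
  case (Cons v vs)
  then obtain Xs X where "set Xs \<subseteq> V" "map r Xs = vs" "X \<in> V" "r X = v" using W by auto
  then show ?case by (intro exI[of _ "X # Xs"]) simp
 qed simp
 show "g vs = 0" if "\<not> (length vs = k \<and> set vs \<subseteq> W)"
 proof (cases "set vs \<subseteq> W")
  case True
  then obtain Xs where "set Xs \<subseteq> V" "map r Xs = vs" using lift by blast
  then show ?thesis using g[of Xs] alternating_outside[OF f, of Xs] that True by auto
 qed (rule out)
 assume vs: "length vs = k" "set vs \<subseteq> W"
 then obtain Xs where Xs: "set Xs \<subseteq> V" "map r Xs = vs" "length Xs = k" using lift by (metis length_map)
 show "linear_map_on W (%v. g (vs[j := v]))" if "j < k"
 proof -
  have *: "g (vs[j := r X]) = f (Xs[j := X])" if "X \<in> V" for X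
   using g[of "Xs[j := X]"] Xs that by (simp add: map_update set_update_subsetI)
  have l: "linear_map_on V (%X. f (Xs[j := X]))" by (rule alternating_linear[OF f Xs(3,1) \<open>j < k\<close>])
  show ?thesis
   unfolding linear_map_on_def W[symmetric]
   using V * linear_onD[OF l] linear_onD[OF r]
   by (auto simp: subspace_add subspace_scale simp flip: linear_onD[OF r])
 qed
 show "g vs = 0" if "i < k" "j < k" "i \<noteq> j" "vs ! i = vs ! j"
 proof -
  have "map r (Xs[j := Xs ! i]) = vs"
   using that Xs by (metis list_update_id map_update nth_map)
  moreover have "set (Xs[j := Xs ! i]) \<subseteq> V"
   by (rule set_update_subsetI) (use Xs that in auto)
  moreover have "f (Xs[j := Xs ! i]) = 0"
   by (rule alternating_repeat[OF f, of i _ j]) (use that Xs in auto)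
  ultimately show ?thesis using g by metis
 qed
qed

section \<open>The exterior product of functions of lists\<close>

text \<open>
  The pointwise wedge product.  All its properties follow by induction on the list from the rule \<open>pw_Cons\<close>:
  contraction with a vector is an antiderivation, \<open>bar\<close> being the sign involved.
\<close>
definition pw :: "('v list => real) => ('v list => real) => 'v list => real" where
 "pw f g vs = (\<Sum>S\<in>Pow {..<length vs}. shuffle_sign (length vs) S * f (nths vs S) * g (nths vs (- S)))"

definition bar :: "('v list => real) => 'v list => real" where
 "bar f vs = (-1) ^ length vs * f vs"

lemma pw_Nil: "pw f g [] = f [] * g []"
 by (simp add: pw_def shuffle_sign_def)

lemma shuffle_sign_Suc:
 assumes "S \<subseteq> {..<n}"
 shows "shuffle_sign (Suc n) (Suc ` S) = (-1) ^ card S * shuffle_sign n S"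
  and "shuffle_sign (Suc n) (insert 0 (Suc ` S)) = shuffle_sign n S"
proof -
 have fin: "finite S" using assms finite_subset by blast
 let ?I = "%n S. {(i, j). i \<in> S \<and> j \<in> {..<n} - S \<and> j < i}"
 have finI: "finite (?I n S)"
  by (rule finite_subset[of _ "S \<times> {..<n}"]) (use fin in auto)
 have inj: "inj_on (%(i, j). (Suc i, Suc j)) A" for A :: "(nat \<times> nat) set"
  by (auto simp: inj_on_def)
 have 1: "?I (Suc n) (Suc ` S) = (%i. (Suc i, 0)) ` S \<union> (%(i, j). (Suc i, Suc j)) ` ?I n S"
 proof (rule set_eqI, clarify)
  fix a b
  show "(a, b) \<in> ?I (Suc n) (Suc ` S) \<longleftrightarrow> (a, b) \<in> (%i. (Suc i, 0)) ` S \<union> (%(i, j). (Suc i, Suc j)) ` ?I n S"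
   by (cases a; cases b) (auto simp: image_iff)
 qed
 have "card (?I (Suc n) (Suc ` S)) = card S + card (?I n S)"
  unfolding 1 using fin finI by (subst card_Un_disjoint) (auto simp: card_image inj inj_on_def)
 then show "shuffle_sign (Suc n) (Suc ` S) = (-1) ^ card S * shuffle_sign n S"
  by (simp add: shuffle_sign_def power_add)
 have 2: "?I (Suc n) (insert 0 (Suc ` S)) = (%(i, j). (Suc i, Suc j)) ` ?I n S"
 proof (rule set_eqI, clarify)
  fix a b
  show "(a, b) \<in> ?I (Suc n) (insert 0 (Suc ` S)) \<longleftrightarrow> (a, b) \<in> (%(i, j). (Suc i, Suc j)) ` ?I n S"
   by (cases a; cases b) (auto simp: image_iff)
 qed
 show "shuffle_sign (Suc n) (insert 0 (Suc ` S)) = shuffle_sign n S"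
  unfolding shuffle_sign_def 2 by (simp add: card_image inj)
qed

lemma pw_Cons: "pw f g (v # vs) = pw (cn v f) g vs + pw (bar f) (cn v g) vs"
proof -
 let ?n = "length vs"
 let ?t = "%S. shuffle_sign (Suc ?n) S * f (nths (v # vs) S) * g (nths (v # vs) (- S))"
 have Pow: "Pow {..<Suc ?n} = (%S. insert 0 (Suc ` S)) ` Pow {..<?n} \<union> (`) Suc ` Pow {..<?n}"
 proof (rule set_eqI)
  fix S
  have "S = (if 0 \<in> S then insert 0 (Suc ` {j. Suc j \<in> S}) else Suc ` {j. Suc j \<in> S})"
   by (auto simp: image_iff) (metis not0_implies_Suc)+
  then show "S \<in> Pow {..<Suc ?n} \<longleftrightarrow> S \<in> (%S. insert 0 (Suc ` S)) ` Pow {..<?n} \<union> (`) Suc ` Pow {..<?n}"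
   by (auto split: if_splits intro!: image_eqI[of _ _ "{j. Suc j \<in> S}"])
 qed
 have "pw f g (v # vs) = (\<Sum>S\<in>Pow {..<Suc ?n}. ?t S)" by (simp add: pw_def)
 also have "... = (\<Sum>S\<in>(%S. insert 0 (Suc ` S)) ` Pow {..<?n}. ?t S) + (\<Sum>S\<in>(`) Suc ` Pow {..<?n}. ?t S)"
  unfolding Pow by (rule sum.union_disjoint) auto
 also have "(\<Sum>S\<in>(%S. insert 0 (Suc ` S)) ` Pow {..<?n}. ?t S) = (\<Sum>S\<in>Pow {..<?n}. ?t (insert 0 (Suc ` S)))"
  by (rule sum.reindex_cong[where l = "%S. insert 0 (Suc ` S)"]) (auto simp: inj_on_def)
 also have "... = pw (cn v f) g vs"
  unfolding pw_def
 proof (rule sum.cong[OF refl])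
  fix S assume "S \<in> Pow {..<?n}"
  then have S: "S \<subseteq> {..<?n}" by simp
  have "{j. Suc j \<in> insert 0 (Suc ` S)} = S" "{j. Suc j \<in> - insert 0 (Suc ` S)} = - S" by auto
  then show "?t (insert 0 (Suc ` S)) = shuffle_sign ?n S * cn v f (nths vs S) * g (nths vs (- S))"
   using shuffle_sign_Suc(2)[OF S] by (simp add: nths_Cons cn_def)
 qed
 also have "(\<Sum>S\<in>(`) Suc ` Pow {..<?n}. ?t S) = (\<Sum>S\<in>Pow {..<?n}. ?t (Suc ` S))"
  by (rule sum.reindex_cong[where l = "(`) Suc"]) (auto simp: inj_on_def)
 also have "... = pw (bar f) (cn v g) vs"
  unfolding pw_def
 proof (rule sum.cong[OF refl])
  fix S assume "S \<in> Pow {..<?n}"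
  then have S: "S \<subseteq> {..<?n}" by simp
  have e: "{j. Suc j \<in> Suc ` S} = S" "{j. Suc j \<notin> Suc ` S} = - S" by auto
  have "{i. i < ?n \<and> i \<in> S} = S" using S by auto
  then have "length (nths vs S) = card S" by (simp add: length_nths)
  then show "?t (Suc ` S) = shuffle_sign ?n S * bar f (nths vs S) * cn v g (nths vs (- S))"
   using shuffle_sign_Suc(1)[OF S] by (simp add: nths_Cons cn_def e bar_def)
 qed
 finally show ?thesis .
qed

lemma pw_linear:
 "pw (%vs. f vs + f' vs) g vs = pw f g vs + pw f' g vs"
 "pw f (%vs. g vs + g' vs) vs = pw f g vs + pw f g' vs"
 "pw (%vs. c * f vs) g vs = c * pw f g vs"
 "pw f (%vs. c * g vs) vs = c * pw f g vs"
 "pw (%_. 0) g vs = 0" "pw f (%_. 0) vs = 0"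
 "pw (%vs. - f vs) g vs = - pw f g vs"
 "pw f (%vs. - g vs) vs = - pw f g vs"
 by (simp_all add: pw_def sum.distrib[symmetric] sum_distrib_left sum_negf[symmetric] algebra_simps)

lemma bar_bar: "bar (bar f) = f"
 by (simp add: bar_def fun_eq_iff power_add[symmetric] mult.assoc[symmetric])

lemma cn_pw: "cn v (pw f g) = (%vs. pw (cn v f) g vs + pw (bar f) (cn v g) vs)"
 by (simp add: fun_eq_iff cn_def[of v "pw f g"] pw_Cons)

lemma cn_bar: "cn v (bar f) = (%vs. - bar (cn v f) vs)"
 by (simp add: fun_eq_iff cn_def bar_def)

lemma bar_pw: "bar (pw f g) = pw (bar f) (bar g)"
proof
 fix vs show "bar (pw f g) vs = pw (bar f) (bar g) vs"
 proof (induction vs arbitrary: f g)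
  case (Cons v vs)
  have "bar (pw f g) (v # vs) = - (bar (pw (cn v f) g) vs + bar (pw (bar f) (cn v g)) vs)"
   by (simp add: bar_def pw_Cons algebra_simps)
  also have "... = pw (bar f) (bar g) (v # vs)"
   unfolding Cons.IH by (simp add: pw_Cons cn_bar pw_linear bar_bar)
  finally show ?case .
 qed (simp add: bar_def pw_Nil)
qed

lemma pw_assoc: "pw (pw f g) h = pw f (pw g h)"
proof
 fix vs show "pw (pw f g) h vs = pw f (pw g h) vs"
  by (induction vs arbitrary: f g h) (simp_all add: pw_Nil pw_Cons cn_pw pw_linear bar_pw)
qed

definition of_degree :: "nat => ('v list => real) => bool" where
 "of_degree k f \<longleftrightarrow> (\<forall>vs. length vs \<noteq> k --> f vs = 0)"

lemma of_degree_bar: "of_degree k f ==> bar f = (%vs. (-1) ^ k * f vs)"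
 by (auto simp: of_degree_def bar_def fun_eq_iff)

lemma of_degree_cn: "of_degree k f ==> of_degree (k - 1) (cn v f)" "of_degree 0 f ==> cn v f = (%_. 0)"
 by (auto simp: of_degree_def cn_def fun_eq_iff)

lemma alternating_of_degree: "alternating V k f ==> of_degree k f"
 by (auto simp: of_degree_def alternating_def)

lemma pw_commute:
 assumes "of_degree k f" "of_degree l g"
 shows "pw f g vs = (-1) ^ (k * l) * pw g f vs"
 using assms
proof (induction vs arbitrary: f g k l)
 case Nil
 then show ?case by (cases k; cases l) (auto simp: pw_Nil of_degree_def)
next
 case (Cons v vs)
 note d = of_degree_cn(1)[OF Cons.prems(1), of v] of_degree_cn(1)[OF Cons.prems(2), of v]
 have 1: "pw (cn v f) g vs = (-1) ^ (k * l) * ((-1) ^ l * pw g (cn v f) vs)"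
 proof (cases k)
  case 0
  then show ?thesis using of_degree_cn(2)[of f v] Cons.prems(1) by (simp add: pw_linear)
 next
  case (Suc k')
  then show ?thesis using Cons.IH[OF d(1) Cons.prems(2)]
   by (simp add: power_add algebra_simps)
 qed
 have 2: "(-1) ^ k * pw f (cn v g) vs = (-1) ^ (k * l) * pw (cn v g) f vs"
 proof (cases l)
  case 0
  then show ?thesis using of_degree_cn(2)[of g v] Cons.prems(2) by (simp add: pw_linear)
 next
  case (Suc l')
  then show ?thesis using Cons.IH[OF Cons.prems(1) d(2)] by (simp add: power_add algebra_simps)
 qed
 show ?case
  by (simp add: pw_Cons of_degree_bar[OF Cons.prems(1)] of_degree_bar[OF Cons.prems(2)] pw_linear 1 2 distrib_left)
qed

lemma alternating_bar: "alternating V k f ==> alternating V k (bar f)"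
 using of_degree_bar[OF alternating_of_degree, of V k f] alternating_scale[of V k f "(-1) ^ k"] by simp

lemma cn_linear:
 assumes f: "alternating V k f" and v: "v \<in> V" "w \<in> V"
 shows "subspace V ==> cn (v + w) f = (%vs. cn v f vs + cn w f vs)"
  and "subspace V ==> cn (c *r v) f = (%vs. c * cn v f vs)"
proof -
 assume V: "subspace V"
 have *: "f (u # vs) = 0" if "\<not> set vs \<subseteq> V" for u vs
  using alternating_outside[OF f, of "u # vs"] that by auto
 show "cn (v + w) f = (%vs. cn v f vs + cn w f vs)"
 proof
  fix vs show "cn (v + w) f vs = cn v f vs + cn w f vs"
   using * linear_onD(1)[OF alternating_linear_Cons[OF f] v, of vs]
   by (cases "set vs \<subseteq> V") (auto simp: cn_def)
 qed
 show "cn (c *r v) f = (%vs. c * cn v f vs)"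
 proof
  fix vs show "cn (c *r v) f vs = c * cn v f vs"
   using * linear_onD(2)[OF alternating_linear_Cons[OF f] v(1), of vs c]
   by (cases "set vs \<subseteq> V") (auto simp: cn_def)
 qed
qed

lemma alternating_pw:
 assumes V: "subspace V" and f: "alternating V k f" and g: "alternating V l g"
 shows "alternating V (k + l) (pw f g)"
 using f g
proof (induction "k + l" arbitrary: k l f g)
 case 0
 have "pw f g (v # vs) = 0" for v vs
  using 0 alternating_0_cn[of V f v] alternating_0_cn[of V g v] by (simp add: pw_Cons zero_fun_def pw_linear)
 then show ?case using 0 by (auto simp: alternating_0_iff neq_Nil_conv)
next
 case (Suc n)
 note f = Suc.prems(1) and g = Suc.prems(2)
 show ?case
  unfolding Suc.hyps(2)[symmetric]
 proof (rule alternating_SucI[OF V])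
  show "pw f g [] = 0"
   using alternating_outside[OF f, of "[]"] alternating_outside[OF g, of "[]"] Suc.hyps(2)
   by (cases k; cases l) (auto simp: pw_Nil)
  show "pw f g (v # vs) = 0" if "v \<notin> V" for v vs
  proof -
   have "cn v f = (%_. 0)" "cn v g = (%_. 0)"
    using alternating_outside[OF f, of "v # _"] alternating_outside[OF g, of "v # _"] that by (auto simp: cn_def fun_eq_iff)
   then show ?thesis by (simp add: pw_Cons pw_linear)
  qed
  show "alternating V n (cn v (pw f g))" if "v \<in> V" for v
   unfolding cn_pw
  proof (rule alternating_add)
   show "alternating V n (pw (cn v f) g)"
   proof (cases k)
    case 0
    then show ?thesis
     using f alternating_0_cn[of V f v] alternating_zero by (simp add: zero_fun_def pw_linear[abs_def])
   next
    case (Suc k')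
    then show ?thesis
     using Suc.hyps(1)[of k' l "cn v f" g] alternating_cn[of V k' f v] f g Suc.hyps(2) by auto
   qed
   show "alternating V n (pw (bar f) (cn v g))"
   proof (cases l)
    case 0
    then show ?thesis
     using g alternating_0_cn[of V g v] alternating_zero by (simp add: zero_fun_def pw_linear[abs_def])
   next
    case (Suc l')
    then show ?thesis
     using Suc.hyps(1)[of k l' "bar f" "cn v g"] alternating_cn[of V l' g v] alternating_bar[OF f] g Suc.hyps(2)
     by auto
   qed
  qed
  show "linear_map_on V (%v. pw f g (v # vs))" for vs
   unfolding linear_map_on_def pw_Cons
   by (auto simp: cn_linear[OF f _ _ V] cn_linear[OF g _ _ V] pw_linear algebra_simps)
  show "pw f g (v # v # vs) = 0" if "v \<in> V" for v vs
  proof -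
   have "cn v (cn v f) = (%_. 0)" "cn v (cn v g) = (%_. 0)"
    using alternating_repeat[OF f, of 0 "v # v # _" 1] alternating_repeat[OF g, of 0 "v # v # _" 1]
    by (auto simp: cn_def fun_eq_iff)
   then show ?thesis by (simp add: pw_Cons cn_bar pw_linear bar_bar)
  qed
 qed
qed

lemma scaleR_fun_apply [simp]: "(c *r f) x = c *r f x"
 by (simp add: scaleR_fun_def)

lemma alternating_cn': "alternating V k f ==> alternating V (k - 1) (cn v f)"
 using alternating_cn[of V "k - 1" f v] alternating_0_cn[of V f v] by (cases k) (auto simp: alternating_zero)

lemma alternating_move:
 assumes V: "subspace V" and f: "alternating V k f" and j: "j < length vs"
 shows "f (w # nths vs (- {j})) = (-1) ^ j * f (vs[j := w])"
 using f j
proof (induction vs arbitrary: f j k)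
 case (Cons v vs)
 show ?case
 proof (cases j)
  case 0
  have "nths vs {j. Suc j \<in> - {0}} = vs" by (simp add: nths_all)
  then show ?thesis using 0 by (simp add: nths_Cons)
 next
  case (Suc j')
  have "{l. Suc l \<in> - {Suc j'}} = - {j'}" by auto
  then have "f (w # nths (v # vs) (- {j})) = f (w # v # nths vs (- {j'}))"
   using Suc by (simp add: nths_Cons)
  also have "... = - cn v f (w # nths vs (- {j'}))"
   using alternating_swap_Cons[OF V Cons.prems(1), of w v "nths vs (- {j'})"] by (simp add: cn_def)
  also have "cn v f (w # nths vs (- {j'})) = (-1) ^ j' * cn v f (vs[j' := w])"
   by (rule Cons.IH[OF alternating_cn'[OF Cons.prems(1)]]) (use Cons.prems Suc in auto)
  finally show ?thesis using Suc by (simp add: cn_def)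
 qed
qed simp

context smooth_mfd
begin

section \<open>Vector fields\<close>

lemma tangent_subspace: "subspace (T p)"
 unfolding subspace_def tangent_space_def linear_map_on_def
 by (auto simp: scaleR_fun_def algebra_simps)

lemma VF_at: "X \<in> VF ==> p \<in> S ==> X p \<in> T p"
 and VF_off: "X \<in> VF ==> p \<notin> S ==> X p = 0"
 and VF_smooth: "X \<in> VF ==> f \<in> F ==> (%p. X p f) \<in> F"
 by (simp_all add: vector_fields_def)

lemma nth_VF: "set Xs \<subseteq> VF ==> i < length Xs ==> Xs ! i \<in> VF"
 using nth_mem by blast

lemma VF_nonsmooth: "X \<in> VF ==> f \<notin> F ==> X p f = 0"
 using VF_at[of X p] VF_off[of X p] tangent_nonsmooth[of "X p" p] by (cases "p \<in> S") auto

lemma VF_zero_fun: "X \<in> VF ==> X p (%q. 0) = 0"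
 using VF_at[of X p] VF_off[of X p] tangent_zero[of "X p" p] by (cases "p \<in> S") auto

lemma VF_add: "X \<in> VF ==> f \<in> F ==> g \<in> F ==> X p (%q. f q + g q) = X p f + X p g"
 using VF_at[of X p] VF_off[of X p] tangent_add[of "X p" p] by (cases "p \<in> S") auto

lemma VF_diff: "X \<in> VF ==> f \<in> F ==> g \<in> F ==> X p (%q. f q - g q) = X p f - X p g"
 using VF_at[of X p] VF_off[of X p] tangent_diff[of "X p" p] by (cases "p \<in> S") auto

lemma VF_cmult: "X \<in> VF ==> f \<in> F ==> X p (%q. c * f q) = c * X p f"
 using VF_at[of X p] VF_off[of X p] tangent_cmult[of "X p" p] by (cases "p \<in> S") auto

lemma VF_mult: "X \<in> VF ==> f \<in> F ==> g \<in> F ==> X p (%q. f q * g q) = f p * X p g + g p * X p f"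
 using VF_at[of X p] VF_off[of X p] tangent_mult[of "X p" p] by (cases "p \<in> S") auto

lemma VF_sum: "X \<in> VF ==> (!!i. i \<in> I ==> f i \<in> F) ==> X p (%q. \<Sum>i\<in>I. f i q) = (\<Sum>i\<in>I. X p (f i))"
 using VF_at[of X p] VF_off[of X p] tangent_sum[of "X p" p I f] by (cases "p \<in> S") auto

lemma VF_subspace: "subspace VF"
 unfolding subspace_def
proof (intro conjI ballI allI)
 show "0 \<in> VF" using subspace_0[OF tangent_subspace] by (simp add: vector_fields_def zero_smooth)
 show "X + Y \<in> VF" if "X \<in> VF" "Y \<in> VF" for X Y
  using that subspace_add[OF tangent_subspace] by (simp add: vector_fields_def add_smooth)
 show "c *r X \<in> VF" if "X \<in> VF" for c X
  using that subspace_scale[OF tangent_subspace] by (simp add: vector_fields_def cmult_smooth)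
qed

lemma lie_bracket_VF:
 assumes X: "X \<in> VF" and Y: "Y \<in> VF" shows "lie_bracket X Y \<in> VF"
proof -
 have sm: "(%p. lie_bracket X Y p f) \<in> F" if "f \<in> F" for f
  unfolding lie_bracket_def by (rule diff_smooth[OF VF_smooth[OF X VF_smooth[OF Y that]] VF_smooth[OF Y VF_smooth[OF X that]]])
 have tan: "lie_bracket X Y p \<in> T p" if "p \<in> S" for p
  unfolding tangent_space_def linear_map_on_def mem_Collect_eq lie_bracket_def
  by (auto simp: plus_fun_def scaleR_fun_def VF_add VF_cmult VF_mult VF_nonsmooth VF_smooth mult_smooth X Y
    VF_zero_fun VF_add[OF X VF_smooth[OF Y] VF_smooth[OF Y]] VF_add[OF Y VF_smooth[OF X] VF_smooth[OF X]]
    VF_cmult[OF X VF_smooth[OF Y]] VF_cmult[OF Y VF_smooth[OF X]]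
    VF_add[OF X mult_smooth[OF _ VF_smooth[OF Y]] mult_smooth[OF _ VF_smooth[OF Y]]]
    VF_add[OF Y mult_smooth[OF _ VF_smooth[OF X]] mult_smooth[OF _ VF_smooth[OF X]]]
    VF_mult[OF X _ VF_smooth[OF Y]] VF_mult[OF Y _ VF_smooth[OF X]] algebra_simps)
 show ?thesis
  using sm tan VF_off[OF X] VF_off[OF Y] by (auto simp: vector_fields_def lie_bracket_def fun_eq_iff)
qed

lemma lie_bracket_antisym: "lie_bracket Y X = - lie_bracket X Y"
 by (simp add: lie_bracket_def fun_eq_iff)

lemma VF_fun_eqI:
 assumes "X \<in> VF" "Y \<in> VF" "!!p f. p \<in> S ==> f \<in> F ==> X p f = Y p f"
 shows "X = Y"
proof (intro ext)
 fix p f show "X p f = Y p f"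
  using assms(3)[of p f] VF_off[OF assms(1)] VF_off[OF assms(2)] VF_nonsmooth[OF assms(1)] VF_nonsmooth[OF assms(2)]
  by (cases "p \<in> S"; cases "f \<in> F") auto
qed

lemma lie_bracket_add:
 assumes "X \<in> VF" "Y \<in> VF" "Z \<in> VF" shows "lie_bracket X (Y + Z) = lie_bracket X Y + lie_bracket X Z"
 using assms VF_subspace
 by (intro VF_fun_eqI) (auto simp: subspace_add lie_bracket_VF, simp add: lie_bracket_def VF_add[OF _ VF_smooth VF_smooth])

lemma lie_bracket_scale:
 assumes "X \<in> VF" "Y \<in> VF" shows "lie_bracket X (c *r Y) = c *r lie_bracket X Y"
 using assms VF_subspace
 by (intro VF_fun_eqI)
   (auto simp: subspace_scale lie_bracket_VF, simp add: lie_bracket_def VF_cmult[OF _ VF_smooth] algebra_simps)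

lemma lie_bracket_jacobi:
 assumes "X \<in> VF" "Y \<in> VF" "Z \<in> VF"
 shows "lie_bracket X (lie_bracket Y Z) = lie_bracket (lie_bracket X Y) Z + lie_bracket Y (lie_bracket X Z)"
 using assms VF_subspace
 by (intro VF_fun_eqI)
   (auto simp: subspace_add lie_bracket_VF, simp add: lie_bracket_def VF_diff[OF _ VF_smooth[OF _ VF_smooth] VF_smooth[OF _ VF_smooth]])

lemma local_frame_nearby:
 assumes p: "p \<in> S"
 shows "\<exists>(B :: 'e set) x X N. (\<forall>b\<in>B. x b \<in> F) \<and> (\<forall>b\<in>B. X b \<in> VF) \<and> openin (mtop M) N \<and> p \<in> N \<and>
  (\<forall>q\<in>N. q \<in> S) \<and> (\<forall>q\<in>N. \<forall>v\<in>T q. v = (\<Sum>b\<in>B. v (x b) *r X b q))"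
proof -
 obtain B :: "'e set" and x X rh where f: "\<forall>b\<in>B. x b \<in> F \<and> X b \<in> VF"
  "\<exists>N. openin (mtop M) N \<and> p \<in> N \<and> (\<forall>q\<in>N. rh q = (1 :: real))"
  "\<forall>q\<in>S. \<forall>v\<in>T q. rh q *r v = (\<Sum>b\<in>B. v (x b) *r X b q)"
  using local_frame[OF p] by blast
 from f(2) obtain N where N: "openin (mtop M) N" "p \<in> N" "\<forall>q\<in>N. rh q = 1" by blast
 have NS: "q \<in> S" if "q \<in> N" for q using N(1) that openin_subset by blast
 have ex: "v = (\<Sum>b\<in>B. v (x b) *r X b q)" if "q \<in> N" "v \<in> T q" for q v
 proof -
  have "rh q *r v = (\<Sum>b\<in>B. v (x b) *r X b q)" using f(3) NS[OF that(1)] that(2) by blast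
  moreover have "rh q = 1" using N(3) that(1) by blast
  ultimately show ?thesis by simp
 qed
 show ?thesis
  by (rule exI[of _ B], rule exI[of _ x], rule exI[of _ X], rule exI[of _ N])
    (intro conjI ballI N(1,2) NS ex, use f(1) in auto)
qed

lemma vector_field_extension:
 assumes p: "p \<in> S" and v: "v \<in> T p" shows "\<exists>X\<in>VF. X p = v"
proof -
 obtain B :: "'e set" and x X N where f: "\<forall>b\<in>B. X b \<in> VF" "p \<in> N"
  "\<forall>q\<in>N. \<forall>v\<in>T q. v = (\<Sum>b\<in>B. v (x b) *r X b q)"
  using local_frame_nearby[OF p] by blast
 have "(\<Sum>b\<in>B. v (x b) *r X b) p = (\<Sum>b\<in>B. v (x b) *r X b p)"
  by (simp add: sum_fun_apply)
 also have "... = v" using f(3)[rule_format, OF f(2) v] by simp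
 finally show ?thesis
  using f(1) VF_subspace by (intro bexI[of _ "\<Sum>b\<in>B. v (x b) *r X b"]) (auto intro!: subspace_sum subspace_scale)
qed

lemma vector_fields_extension:
 assumes p: "p \<in> S" and vs: "set vs \<subseteq> T p" shows "\<exists>Xs. set Xs \<subseteq> VF \<and> map (%X. X p) Xs = vs"
 using vs
proof (induction vs)
 case (Cons v vs)
 then obtain Xs where "set Xs \<subseteq> VF" "map (%X. X p) Xs = vs" by auto
 moreover obtain X where "X \<in> VF" "X p = v"
  using vector_field_extension[OF p, of v] Cons.prems by auto
 ultimately show ?case by (intro exI[of _ "X # Xs"]) simp
qed simp

lemma evaluation_linear: "linear_map_on VF (%X. X p)"
 by (simp add: linear_map_on_def)

lemma evaluation_image: "p \<in> S ==> (%X. X p) ` VF = T p"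
 using vector_field_extension VF_at by blast

section \<open>Differential forms\<close>

definition ev :: "'m form => ('m => 'm tvec) list => 'm => real" where
 "ev om Xs = (%p. om p (map (%X. X p) Xs))"

definition ct :: "('m => 'm tvec) => 'm form => 'm form" where
 "ct X om = (%p. cn (X p) (om p))"

lemma forms_iff:
 "om \<in> forms M k \<longleftrightarrow> (\<forall>p\<in>S. alternating (T p) k (om p)) \<and> (\<forall>p. p \<notin> S --> om p = 0) \<and>
   (\<forall>Xs. length Xs = k --> set Xs \<subseteq> VF --> ev om Xs \<in> F)"
 unfolding forms_def alternating_def ev_def mem_Collect_eq fun_eq_iff zero_fun_apply by blast

lemma forms_alternating: "om \<in> forms M k ==> p \<in> S ==> alternating (T p) k (om p)"
 and forms_off: "om \<in> forms M k ==> p \<notin> S ==> om p vs = 0"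
 and forms_smooth: "om \<in> forms M k ==> length Xs = k ==> set Xs \<subseteq> VF ==> ev om Xs \<in> F"
 unfolding forms_iff by auto

lemma forms_wrong_length: "om \<in> forms M k ==> length vs \<noteq> k ==> om p vs = 0"
 using alternating_outside[OF forms_alternating] forms_off by (cases "p \<in> S") blast+

lemma ev_wrong_length: "om \<in> forms M k ==> length Xs \<noteq> k ==> ev om Xs = (%_. 0)"
 by (simp add: ev_def fun_eq_iff forms_wrong_length)

lemma ev_smooth: "om \<in> forms M k ==> set Xs \<subseteq> VF ==> ev om Xs \<in> F"
 using forms_smooth ev_wrong_length zero_smooth(1) by (cases "length Xs = k") metis+

lemma forms_zero: "0 \<in> forms M k" "(%_ _. 0) \<in> forms M k"
 by (auto simp: forms_iff alternating_zero ev_def zero_smooth)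

lemma forms_add: "om \<in> forms M k ==> et \<in> forms M k ==> om + et \<in> forms M k"
 unfolding forms_iff plus_fun_def ev_def by (auto intro: alternating_add add_smooth)

lemma forms_scale: "om \<in> forms M k ==> c *r om \<in> forms M k"
 unfolding forms_iff ev_def scaleR_fun_def real_scaleR_def by (auto intro: alternating_scale cmult_smooth simp: zero_fun_def)

lemma forms_subspace: "subspace (forms M k)"
 by (simp add: subspace_def forms_zero forms_add forms_scale)

lemma forms_eqI:
 assumes om: "om \<in> forms M k" and et: "et \<in> forms M k"
  and eq: "!!Xs p. set Xs \<subseteq> VF ==> length Xs = k ==> p \<in> S ==> ev om Xs p = ev et Xs p"
 shows "om = et"
proof (intro ext)
 fix p vs show "om p vs = et p vs"
 proof (cases "p \<in> S \<and> length vs = k \<and> set vs \<subseteq> T p")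
  case True
  then obtain Xs where "set Xs \<subseteq> VF" "map (%X. X p) Xs = vs" using vector_fields_extension by blast
  then show ?thesis using eq[of Xs p] True by (auto simp: ev_def)
 next
  case False
  then have "om p vs = 0" "et p vs = 0"
   using alternating_outside[OF forms_alternating[OF om], of p vs] alternating_outside[OF forms_alternating[OF et], of p vs]
    forms_off[OF om] forms_off[OF et] by auto
  then show ?thesis by simp
 qed
qed

lemma ct_forms: "X \<in> VF ==> om \<in> forms M (Suc k) ==> ct X om \<in> forms M k"
 unfolding forms_iff ct_def
proof (intro conjI ballI allI impI; elim conjE)
 fix Xs assume "X \<in> VF" "length Xs = k" "set Xs \<subseteq> VF" "\<forall>Xs. length Xs = Suc k --> set Xs \<subseteq> VF --> ev om Xs \<in> F"
 then have "ev om (X # Xs) \<in> F" by simp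
 then show "ev (%p. cn (X p) (om p)) Xs \<in> F" by (simp add: ev_def cn_def)
qed (auto simp: alternating_cn cn_def fun_eq_iff)

lemma ct_forms_0: "om \<in> forms M 0 ==> ct X om = 0"
 by (simp add: ct_def fun_eq_iff cn_def forms_wrong_length)

lemma ct_forms': "X \<in> VF ==> om \<in> forms M k ==> ct X om \<in> forms M (k - 1)"
 using ct_forms[of X om "k - 1"] ct_forms_0[of om X] forms_zero by (cases k) auto

lemma ev_ct: "ev (ct X om) Xs = ev om (X # Xs)"
 by (simp add: ev_def ct_def cn_def)

lemma forms_Suc_eqI:
 assumes "om \<in> forms M (Suc k)" "et \<in> forms M (Suc k)" "!!X. X \<in> VF ==> ct X om = ct X et"
 shows "om = et"
proof (rule forms_eqI[OF assms(1,2)])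
 fix Xs p assume "set Xs \<subseteq> VF" "length Xs = Suc k" "p \<in> S"
 then obtain X Ys where "Xs = X # Ys" "X \<in> VF" by (cases Xs) auto
 then show "ev om Xs p = ev et Xs p" using assms(3) by (metis ev_ct)
qed

lemma ct_swap: "om \<in> forms M k ==> ct X (ct Y om) = (-1) *r ct Y (ct X om)"
proof (intro ext)
 fix p vs assume om: "om \<in> forms M k"
 show "ct X (ct Y om) p vs = ((-1) *r ct Y (ct X om)) p vs"
  using alternating_swap_Cons[OF tangent_subspace forms_alternating[OF om], of p "Y p" "X p" vs] forms_off[OF om]
  by (cases "p \<in> S") (auto simp: ct_def cn_def)
qed

section \<open>The exterior derivative\<close>

abbreviation E :: "'m form => ('m => 'm tvec) list => 'm => real" where "E \<equiv> ext_deriv_fields"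

lemma length_nths_delete: "i < length Xs ==> length (nths Xs (- {i})) = length Xs - 1"
proof -
 assume "i < length Xs"
 then have "{j. j < length Xs \<and> j \<in> - {i}} = {..<length Xs} - {i}" by auto
 then show ?thesis using \<open>i < length Xs\<close> by (simp add: length_nths)
qed

lemma length_nths_delete2: "i < j ==> j < length Xs ==> length (nths Xs (- {i, j})) = length Xs - 2"
proof -
 assume *: "i < j" "j < length Xs"
 then have "{l. l < length Xs \<and> l \<in> - {i, j}} = {..<length Xs} - {i, j}" by auto
 then show ?thesis using * by (simp add: length_nths card_Diff_subset)
qed

lemma E_eq_ev:
 "E om Xs p = (\<Sum>i<length Xs. (-1) ^ i * (Xs ! i) p (ev om (nths Xs (- {i})))) +
   (\<Sum>(i, j) \<in> {(i, j). i < j \<and> j < length Xs}. (-1) ^ (i + j) *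
    ev om (lie_bracket (Xs ! i) (Xs ! j) # nths Xs (- {i, j})) p)"
 by (simp add: ext_deriv_fields_def ev_def)

lemma nths_VF: "set Xs \<subseteq> VF ==> set (nths Xs A) \<subseteq> VF"
 using set_nths_subset by fastforce

lemma E_singleton: "E om [X] p = X p (ev om [])"
proof -
 have "{(i, j). i < j \<and> j < length [X]} = {}" by auto
 then show ?thesis by (simp only: E_eq_ev sum.empty) (simp add: nths_Cons)
qed

lemma E_wrong_length:
 assumes om: "om \<in> forms M k" and Xs: "set Xs \<subseteq> VF" "length Xs \<noteq> Suc k"
 shows "E om Xs p = 0"
proof -
 have "(Xs ! i) p (ev om (nths Xs (- {i}))) = 0" if "i < length Xs" for i
 proof -
  have "Xs ! i \<in> VF" using that Xs(1) by auto
  moreover have "ev om (nths Xs (- {i})) = (%_. 0)"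
   using that Xs(2) length_nths_delete[OF that] by (intro ev_wrong_length[OF om]) auto
  ultimately show ?thesis by (simp add: VF_zero_fun)
 qed
 moreover have "ev om (lie_bracket (Xs ! i) (Xs ! j) # nths Xs (- {i, j})) p = 0" if "i < j" "j < length Xs" for i j
  using that Xs length_nths_delete2[OF that] ev_wrong_length[OF om, of "lie_bracket (Xs ! i) (Xs ! j) # nths Xs (- {i, j})"]
  by auto
 ultimately show ?thesis by (auto simp: E_eq_ev intro!: sum.neutral)
qed

lemma E_smooth:
 assumes om: "om \<in> forms M k" and Xs: "set Xs \<subseteq> VF"
 shows "E om Xs \<in> F"
proof -
 have 1: "(%p. (-1) ^ i * (Xs ! i) p (ev om (nths Xs (- {i})))) \<in> F" if "i \<in> {..<length Xs}" for i
  using Xs that by (intro cmult_smooth[OF VF_smooth[OF _ ev_smooth[OF om nths_VF]]]) auto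
 have 2: "(%p. (-1) ^ (i + j) * ev om (lie_bracket (Xs ! i) (Xs ! j) # nths Xs (- {i, j})) p) \<in> F"
  if "i < j" "j < length Xs" for i j
  using Xs that nths_VF[OF Xs] by (intro cmult_smooth[OF ev_smooth[OF om]]) (auto intro!: lie_bracket_VF)
 have "(%p. E om Xs p) \<in> F"
  unfolding E_eq_ev split_beta by (intro add_smooth sum_smooth) (use 1 2 in auto)
 then show ?thesis by simp
qed

lemma E_scale:
 assumes om: "om \<in> forms M k" and Xs: "set Xs \<subseteq> VF"
 shows "E (c *r om) Xs p = c * E om Xs p"
proof -
 have *: "ev (c *r om) Ys = (%q. c * ev om Ys q)" for Ys
  by (simp add: ev_def)
 then have "(Xs ! i) p (ev (c *r om) (nths Xs (- {i}))) = c * (Xs ! i) p (ev om (nths Xs (- {i})))"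
  if "i < length Xs" for i
  using that Xs VF_cmult[OF _ ev_smooth[OF om nths_VF[OF Xs, of "- {i}"]], of "Xs ! i" p c] nth_VF[OF Xs that]
  by simp
 then have "(\<Sum>i<length Xs. (-1) ^ i * (Xs ! i) p (ev (c *r om) (nths Xs (- {i})))) =
   c * (\<Sum>i<length Xs. (-1) ^ i * (Xs ! i) p (ev om (nths Xs (- {i}))))"
  unfolding sum_distrib_left by (intro sum.cong) auto
 with * show ?thesis
  by (simp add: E_eq_ev sum_distrib_left distrib_left split_beta mult_ac)
qed

definition Lie_formula :: "('m => 'm tvec) => 'm form => ('m => 'm tvec) list => 'm => real" where
 "Lie_formula X om Xs p = X p (ev om Xs) - (\<Sum>j<length Xs. ev om (Xs[j := lie_bracket X (Xs ! j)]) p)"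

text \<open>
  Cartan's formula \<open>\<iota>\<^sub>X d = L\<^sub>X - d \<iota>\<^sub>X\<close> for the invariant formula.  It turns statements about the
  exterior derivative into inductions on the degree.
\<close>
lemma E_Cons:
 assumes om: "om \<in> forms M k" and p: "p \<in> S"
 shows "E om (X # Xs) p = Lie_formula X om Xs p - E (ct X om) Xs p"
proof -
 let ?n = "length Xs"
 have n0: "nths (X # Xs) (- {0}) = Xs" by (simp add: nths_Cons nths_all)
 have nS: "nths (X # Xs) (- {Suc i}) = X # nths Xs (- {i})" for i
 proof -
  have "{j. Suc j \<in> - {Suc i}} = - {i}" by auto
  then show ?thesis by (simp add: nths_Cons)
 qed
 have n0S: "nths (X # Xs) (- {0, Suc j}) = nths Xs (- {j})" for j
 proof -
  have "{l. Suc l \<in> - {0, Suc j}} = - {j}" by auto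
  then show ?thesis by (simp add: nths_Cons)
 qed
 have nSS: "nths (X # Xs) (- {Suc i, Suc j}) = X # nths Xs (- {i, j})" for i j
 proof -
  have "{l. Suc l \<in> - {Suc i, Suc j}} = - {i, j}" by auto
  then show ?thesis by (simp add: nths_Cons)
 qed
 let ?P = "%n. {(i, j). i < j \<and> j < n} :: (nat \<times> nat) set"
 let ?t = "%Xs (i, j). (-1) ^ (i + j) * ev om (lie_bracket (Xs ! i) (Xs ! j) # nths Xs (- {i, j})) p"
 let ?u = "%(i, j). (-1) ^ (i + j) * ev (ct X om) (lie_bracket (Xs ! i) (Xs ! j) # nths Xs (- {i, j})) p"
 have finP: "finite (?P n)" for n by (rule finite_subset[of _ "{..<n} \<times> {..<n}"]) auto
 have P: "?P (Suc ?n) = (%j. (0, Suc j)) ` {..<?n} \<union> (%(i, j). (Suc i, Suc j)) ` ?P ?n"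
 proof (rule set_eqI, clarify)
  fix a b show "(a, b) \<in> ?P (Suc ?n) \<longleftrightarrow> (a, b) \<in> (%j. (0, Suc j)) ` {..<?n} \<union> (%(i, j). (Suc i, Suc j)) ` ?P ?n"
   by (cases a; cases b) (auto simp: image_iff)
 qed
 have swap: "ev om (Z # X # Zs) p = - ev (ct X om) (Z # Zs) p" for Z Zs
  using alternating_swap_Cons[OF tangent_subspace forms_alternating[OF om p], of "Z p" "X p"]
  by (simp add: ev_def ct_def cn_def)
 have move: "ev om (Z # nths Xs (- {j})) p = (-1) ^ j * ev om (Xs[j := Z]) p" if "j < ?n" for Z j
  using alternating_move[OF tangent_subspace forms_alternating[OF om p], of j "map (%X. X p) Xs" "Z p"] that
  by (simp add: ev_def map_update nths_map)
 have "(\<Sum>ij\<in>?P (Suc ?n). ?t (X # Xs) ij) =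
   (\<Sum>ij\<in>(%j. (0, Suc j)) ` {..<?n}. ?t (X # Xs) ij) + (\<Sum>ij\<in>(%(i, j). (Suc i, Suc j)) ` ?P ?n. ?t (X # Xs) ij)"
  unfolding P by (rule sum.union_disjoint) (auto simp: finP)
 also have "(\<Sum>ij\<in>(%j. (0, Suc j)) ` {..<?n}. ?t (X # Xs) ij) = (\<Sum>j<?n. ?t (X # Xs) (0, Suc j))"
  by (rule sum.reindex_cong[where l = "%j. (0, Suc j)"]) (auto simp: inj_on_def)
 also have "... = - (\<Sum>j<?n. ev om (Xs[j := lie_bracket X (Xs ! j)]) p)"
  unfolding sum_negf[symmetric] by (rule sum.cong) (auto simp: n0S move mult.assoc[symmetric] power_add[symmetric])
 also have "(\<Sum>ij\<in>(%(i, j). (Suc i, Suc j)) ` ?P ?n. ?t (X # Xs) ij) = (\<Sum>(i, j)\<in>?P ?n. ?t (X # Xs) (Suc i, Suc j))"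
  by (rule sum.reindex_cong[where l = "%(i, j). (Suc i, Suc j)"]) (auto simp: inj_on_def)
 also have "... = - (\<Sum>ij\<in>?P ?n. ?u ij)"
  unfolding sum_negf[symmetric] by (rule sum.cong) (auto simp: nSS swap)
 finally have 2: "(\<Sum>ij\<in>?P (Suc ?n). ?t (X # Xs) ij) =
   - (\<Sum>j<?n. ev om (Xs[j := lie_bracket X (Xs ! j)]) p) - (\<Sum>ij\<in>?P ?n. ?u ij)" by simp
 have 1: "(\<Sum>i<Suc ?n. (-1) ^ i * ((X # Xs) ! i) p (ev om (nths (X # Xs) (- {i})))) =
   X p (ev om Xs) - (\<Sum>i<?n. (-1) ^ i * (Xs ! i) p (ev (ct X om) (nths Xs (- {i}))))"
  unfolding sum.lessThan_Suc_shift by (simp add: n0 nS ev_ct sum_negf)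
 show ?thesis
  unfolding E_eq_ev Lie_formula_def using 1 2 by simp
qed

lemma E_swap:
 assumes om: "om \<in> forms M k" and p: "p \<in> S" and V: "X \<in> VF" "Y \<in> VF" "set Zs \<subseteq> VF"
 shows "E om (X # Y # Zs) p = - E om (Y # X # Zs) p"
proof -
 have c: "E om (X # Y # Zs) p = X p (ev om (Y # Zs)) - Y p (ev om (X # Zs)) - ev om (lie_bracket X Y # Zs) p
   - (\<Sum>j<length Zs. ev om (Y # Zs[j := lie_bracket X (Zs ! j)]) p)
   + (\<Sum>j<length Zs. ev om (X # Zs[j := lie_bracket Y (Zs ! j)]) p) + E (ct Y (ct X om)) Zs p"
  if "X \<in> VF" for X Y
  unfolding E_Cons[OF om p] E_Cons[OF ct_forms'[OF that om] p] Lie_formula_def ev_ct length_Cons sum.lessThan_Suc_shift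
  by simp
 have "E (ct Y (ct X om)) Zs p = - E (ct X (ct Y om)) Zs p"
  unfolding ct_swap[OF om, of Y X]
  using E_scale[OF ct_forms'[OF V(1) ct_forms'[OF V(2) om]] V(3), of "-1" p] by simp
 moreover have "ev om (lie_bracket Y X # Zs) p = - ev om (lie_bracket X Y # Zs) p"
 proof (cases "set (map (%X. X p) Zs) \<subseteq> T p")
  case True
  have "lie_bracket X Y p \<in> T p" using V p by (intro VF_at lie_bracket_VF)
  from linear_onD(2)[OF alternating_linear_Cons[OF forms_alternating[OF om p] True] this, of "-1"]
  show ?thesis by (simp add: ev_def lie_bracket_antisym[of Y X])
 qed (use V VF_at[OF _ p] in auto)
 ultimately show ?thesis using c[OF V(1), of Y] c[OF V(2), of X] by simp
qed

lemma ev_alternating: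
 assumes om: "om \<in> forms M k" and Xs: "set Xs \<subseteq> VF"
 shows "X \<in> VF ==> Y \<in> VF ==> ev om (Xs[j := X + Y]) p = ev om (Xs[j := X]) p + ev om (Xs[j := Y]) p \<or> j \<ge> length Xs"
  and "X \<in> VF ==> ev om (Xs[j := c *r X]) p = c * ev om (Xs[j := X]) p \<or> j \<ge> length Xs"
  and "i < length Xs ==> j < length Xs ==> i \<noteq> j ==> Xs ! i = Xs ! j ==> ev om Xs p = 0"
  and "i < length Xs ==> j < length Xs ==> i \<noteq> j ==> ev om (Xs[i := Xs ! j, j := Xs ! i]) p = - ev om Xs p"
proof -
 let ?v = "map (%X. X p) Xs"
 have v: "set ?v \<subseteq> T p" if "p \<in> S" using Xs VF_at[OF _ that] by auto
 show "ev om (Xs[j := X + Y]) p = ev om (Xs[j := X]) p + ev om (Xs[j := Y]) p \<or> j \<ge> length Xs"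
  if "X \<in> VF" "Y \<in> VF"
 proof (cases "p \<in> S \<and> j < k \<and> length Xs = k")
  case True
  then have "linear_map_on (T p) (%v. om p (?v[j := v]))"
   using v by (intro alternating_linear[OF forms_alternating[OF om]]) auto
  from linear_onD(1)[OF this VF_at[OF that(1)] VF_at[OF that(2)]] True
  show ?thesis by (simp add: ev_def map_update)
 qed (auto simp: ev_def forms_off[OF om] forms_wrong_length[OF om])
 show "ev om (Xs[j := c *r X]) p = c * ev om (Xs[j := X]) p \<or> j \<ge> length Xs" if "X \<in> VF"
 proof (cases "p \<in> S \<and> j < k \<and> length Xs = k")
  case True
  then have "linear_map_on (T p) (%v. om p (?v[j := v]))"
   using v by (intro alternating_linear[OF forms_alternating[OF om]]) auto
  from linear_onD(2)[OF this VF_at[OF that], of c] True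
  show ?thesis by (simp add: ev_def map_update)
 qed (auto simp: ev_def forms_off[OF om] forms_wrong_length[OF om])
 show "ev om Xs p = 0" if "i < length Xs" "j < length Xs" "i \<noteq> j" "Xs ! i = Xs ! j"
  using alternating_repeat[OF forms_alternating[OF om], of p i ?v j] forms_off[OF om] that
  by (cases "p \<in> S") (auto simp: ev_def)
 show "ev om (Xs[i := Xs ! j, j := Xs ! i]) p = - ev om Xs p" if "i < length Xs" "j < length Xs" "i \<noteq> j"
 proof (cases "p \<in> S \<and> length Xs = k")
  case True
  then show ?thesis
   using alternating_swap[OF tangent_subspace forms_alternating[OF om], of p ?v i j] that v
   by (simp add: ev_def map_update)
 qed (auto simp: ev_def forms_off[OF om] forms_wrong_length[OF om])
qed

lemma Lie_formula_alternating:
 assumes om: "om \<in> forms M k" and X: "X \<in> VF"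
 shows "alternating VF k (%Xs. if set Xs \<subseteq> VF then Lie_formula X om Xs p else 0)"
 unfolding alternating_def
proof (intro conjI allI impI)
 fix Xs :: "('m => 'm tvec) list" and i j
 show "(if set Xs \<subseteq> VF then Lie_formula X om Xs p else 0) = 0" if "\<not> (length Xs = k \<and> set Xs \<subseteq> VF)"
  using that by (auto simp: Lie_formula_def ev_wrong_length[OF om] VF_zero_fun[OF X])
 assume Xs: "length Xs = k" "set Xs \<subseteq> VF"
 have upd: "set (Xs[j := Y]) \<subseteq> VF" if "Y \<in> VF" for Y j using Xs that by (simp add: set_update_subsetI)
 show "linear_map_on VF (%Y. if set (Xs[j := Y]) \<subseteq> VF then Lie_formula X om (Xs[j := Y]) p else 0)" if j: "j < k"
 proof -
  let ?s = "%Y. \<Sum>i<k. ev om ((Xs[j := Y])[i := lie_bracket X (Xs[j := Y] ! i)]) p"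
  have s_eq: "ev om ((Xs[j := Y])[i := lie_bracket X (Xs[j := Y] ! i)]) p =
    (if i = j then ev om (Xs[j := lie_bracket X Y]) p else ev om ((Xs[i := lie_bracket X (Xs ! i)])[j := Y]) p)"
   if "i < k" for i Y
   using that Xs j by (auto simp: list_update_swap)
  have Xi: "set (Xs[i := lie_bracket X (Xs ! i)]) \<subseteq> VF" if "i < k" for i
   using that Xs by (intro upd lie_bracket_VF X) auto
  have add: "Lie_formula X om (Xs[j := Y + Z]) p = Lie_formula X om (Xs[j := Y]) p + Lie_formula X om (Xs[j := Z]) p"
   if Y: "Y \<in> VF" and Z: "Z \<in> VF" for Y Z
  proof -
   have "ev om (Xs[j := Y + Z]) = (%q. ev om (Xs[j := Y]) q + ev om (Xs[j := Z]) q)"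
    using ev_alternating(1)[OF om Xs(2) Y Z, of j] j Xs(1) by (auto simp: fun_eq_iff)
   then have 1: "X p (ev om (Xs[j := Y + Z])) = X p (ev om (Xs[j := Y])) + X p (ev om (Xs[j := Z]))"
    using VF_add[OF X ev_smooth[OF om upd[OF Y]] ev_smooth[OF om upd[OF Z]]] by simp
   have "?s (Y + Z) = ?s Y + ?s Z"
    unfolding sum.distrib[symmetric]
   proof (rule sum.cong[OF refl])
    fix i assume "i \<in> {..<k}"
    then have i: "i < k" by simp
    show "ev om ((Xs[j := Y + Z])[i := lie_bracket X (Xs[j := Y + Z] ! i)]) p =
      ev om ((Xs[j := Y])[i := lie_bracket X (Xs[j := Y] ! i)]) p + ev om ((Xs[j := Z])[i := lie_bracket X (Xs[j := Z] ! i)]) p"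
     unfolding s_eq[OF i]
     using ev_alternating(1)[OF om Xs(2) lie_bracket_VF[OF X Y] lie_bracket_VF[OF X Z], of j p]
      ev_alternating(1)[OF om Xi[OF i] Y Z, of j p] j Xs(1) by (auto simp: lie_bracket_add[OF X Y Z])
   qed
   with 1 show ?thesis using Xs(1) by (simp add: Lie_formula_def)
  qed
  have scale: "Lie_formula X om (Xs[j := c *r Y]) p = c * Lie_formula X om (Xs[j := Y]) p" if Y: "Y \<in> VF" for Y c
  proof -
   have "ev om (Xs[j := c *r Y]) = (%q. c * ev om (Xs[j := Y]) q)"
    using ev_alternating(2)[OF om Xs(2) Y, of j c] j Xs(1) by (auto simp: fun_eq_iff)
   then have 1: "X p (ev om (Xs[j := c *r Y])) = c * X p (ev om (Xs[j := Y]))"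
    using VF_cmult[OF X ev_smooth[OF om upd[OF Y]]] by simp
   have "?s (c *r Y) = c * ?s Y"
    unfolding sum_distrib_left
   proof (rule sum.cong[OF refl])
    fix i assume "i \<in> {..<k}"
    then have i: "i < k" by simp
    show "ev om ((Xs[j := c *r Y])[i := lie_bracket X (Xs[j := c *r Y] ! i)]) p =
      c * ev om ((Xs[j := Y])[i := lie_bracket X (Xs[j := Y] ! i)]) p"
     unfolding s_eq[OF i]
     using ev_alternating(2)[OF om Xs(2) lie_bracket_VF[OF X Y], of j c p]
      ev_alternating(2)[OF om Xi[OF i] Y, of j c p] j Xs(1) by (auto simp: lie_bracket_scale[OF X Y])
   qed
   with 1 show ?thesis using Xs(1) by (simp add: Lie_formula_def right_diff_distrib)
  qed
  show ?thesis
   unfolding linear_map_on_def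
   using upd add scale VF_subspace by (auto simp: subspace_add subspace_scale)
 qed
 show "(if set Xs \<subseteq> VF then Lie_formula X om Xs p else 0) = 0"
  if ij: "i < k" "j < k" "i \<noteq> j" "Xs ! i = Xs ! j"
 proof -
  let ?Z = "lie_bracket X (Xs ! i)"
  let ?g = "%l. ev om (Xs[l := lie_bracket X (Xs ! l)]) p"
  have Z: "?Z \<in> VF" using X ij Xs by (intro lie_bracket_VF) auto
  have "ev om Xs = (%_. 0)"
   using ev_alternating(3)[OF om Xs(2), of i j] ij Xs(1) by (auto simp: fun_eq_iff)
  then have 1: "X p (ev om Xs) = 0" by (simp add: VF_zero_fun[OF X])
  have "?g l = 0" if "l < k" "l \<noteq> i" "l \<noteq> j" for l
   by (rule ev_alternating(3)[OF om, of _ i j])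
     (use that ij Xs(1) upd[OF lie_bracket_VF[OF X nth_VF[OF Xs(2)]], of l l] in simp_all)
  then have "(\<Sum>l<k. ?g l) = (\<Sum>l\<in>{i, j}. ?g l)"
   using ij by (intro sum.mono_neutral_right) auto
  also have "... = ?g i + ?g j" using ij(3) by simp
  also have "?g j = - ?g i"
  proof -
   have "(Xs[i := ?Z])[i := (Xs[i := ?Z]) ! j, j := (Xs[i := ?Z]) ! i] = Xs[j := lie_bracket X (Xs ! j)]"
    using ij Xs(1) list_update_id[of "Xs[j := lie_bracket X (Xs ! j)]" i]
    by (simp add: list_update_swap[of i j])
   then show ?thesis
    using ev_alternating(4)[OF om upd[OF Z, of i], of i j p] ij Xs(1) by simp
  qed
  finally show ?thesis using 1 Xs(1) by (simp add: Lie_formula_def)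
 qed
qed

lemma E_alternating:
 assumes "om \<in> forms M k" and p: "p \<in> S"
 shows "alternating VF (Suc k) (%Xs. if set Xs \<subseteq> VF then E om Xs p else 0)"
 using assms(1)
proof (induction k arbitrary: om)
 case (0 om)
 note om = 0
 note E1 = E_singleton
 show ?case
  unfolding alternating_def
 proof (intro conjI allI impI)
  fix Xs :: "('m => 'm tvec) list" and j :: nat
  show "(if set Xs \<subseteq> VF then E om Xs p else 0) = 0" if "\<not> (length Xs = Suc 0 \<and> set Xs \<subseteq> VF)"
   using that E_wrong_length[OF om] by auto
  assume Xs: "length Xs = Suc 0" "set Xs \<subseteq> VF"
  then obtain X where "Xs = [X]" by (cases Xs) auto
  then show "linear_map_on VF (%Y. if set (Xs[j := Y]) \<subseteq> VF then E om (Xs[j := Y]) p else 0)" if "j < Suc 0"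
   using VF_subspace that E1 by (simp add: linear_map_on_def subspace_add subspace_scale)
 qed auto
next
 case (Suc k om)
 note om = Suc.prems
 let ?f = "%Xs. if set Xs \<subseteq> VF then E om Xs p else 0"
 have cn: "alternating VF (Suc k) (cn X ?f)" if X: "X \<in> VF" for X
 proof -
  have "alternating VF (Suc k) (%Xs. (if set Xs \<subseteq> VF then Lie_formula X om Xs p else 0)
    + (-1) * (if set Xs \<subseteq> VF then E (ct X om) Xs p else 0))"
   by (rule alternating_add[OF Lie_formula_alternating[OF om X] alternating_scale[OF Suc.IH[OF ct_forms[OF X om]]]])
  moreover have "cn X ?f = (%Xs. (if set Xs \<subseteq> VF then Lie_formula X om Xs p else 0)
    + (-1) * (if set Xs \<subseteq> VF then E (ct X om) Xs p else 0))"
   using X E_Cons[OF om p] by (simp add: fun_eq_iff cn_def)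
  ultimately show ?thesis by simp
 qed
 show ?case
 proof (rule alternating_SucI[OF VF_subspace _ _ cn])
  show "?f [] = 0" by (simp add: E_wrong_length[OF om])
  show "?f (X # Xs) = 0" if "X \<notin> VF" for X Xs using that by simp
  show "linear_map_on VF (%X. ?f (X # Zs))" if Zs: "set Zs \<subseteq> VF" "length Zs = Suc k" for Zs
  proof -
   obtain Z Zs' where Z: "Zs = Z # Zs'" using Zs(2) by (metis length_Suc_conv)
   have "linear_map_on VF (%X. cn Z ?f (X # Zs'))"
    using Zs Z by (intro alternating_linear_Cons[OF cn]) auto
   moreover have "?f (X # Zs) = - cn Z ?f (X # Zs')" if "X \<in> VF" for X
    using that Zs Z E_swap[OF om p, of X Z Zs'] by (simp add: cn_def)
   ultimately show ?thesis
    using VF_subspace by (simp add: linear_map_on_def subspace_add subspace_scale del: list.set)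
  qed
  show "?f (X # X # Xs) = 0" if "X \<in> VF" "set Xs \<subseteq> VF" for X Xs
   using E_swap[OF om p that(1,1,2)] that by simp
 qed
qed

text \<open>A vector field \<open>X\<close> with \<open>X p = 0\<close> is near \<open>p\<close> a combination \<open>\<Sum> X(x\<^sub>b) X\<^sub>b\<close> of a frame, with coefficients vanishing
  at \<open>p\<close>.  Differentiating the coefficients gives both \<open>Z(om(X, \<dots>))\<close> and \<open>[Z, X]\<close> at \<open>p\<close>.\<close>

lemma derivative_of_contraction_at_zero:
 assumes om: "om \<in> forms M k" and p: "p \<in> S" and X: "X \<in> VF" "X p = 0" and Z: "Z \<in> VF" and Zs: "set Zs \<subseteq> VF"
 shows "Z p (ev om (X # Zs)) = ev om (lie_bracket Z X # Zs) p"
proof -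
 obtain B :: "'e set" and x Y N where f0: "\<forall>b\<in>B. x b \<in> F" "\<forall>b\<in>B. Y b \<in> VF"
  and N: "openin (mtop M) N" "p \<in> N" and NS0: "\<forall>q\<in>N. q \<in> S"
  and exN0: "\<forall>q\<in>N. \<forall>v\<in>T q. v = (\<Sum>b\<in>B. v (x b) *r Y b q)"
  using local_frame_nearby[OF p] by blast
 note f = f0[rule_format] and NS = NS0[rule_format] and exN = exN0[rule_format]
 have contr: "om q (v # map (%X. X q) Zs) = (\<Sum>b\<in>B. v (x b) * ev om (Y b # Zs) q)" if q: "q \<in> N" and v: "v \<in> T q" for q v
 proof -
  have "linear_map_on (T q) (%v. om q (v # map (%X. X q) Zs))"
   using Zs VF_at[OF _ NS[OF q]] by (intro alternating_linear_Cons[OF forms_alternating[OF om NS[OF q]]]) auto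
  from linear_on_sum[OF tangent_subspace this, of B "%b. Y b q" "%b. v (x b)"]
  have "om q ((\<Sum>b\<in>B. v (x b) *r Y b q) # map (%X. X q) Zs) = (\<Sum>b\<in>B. v (x b) * ev om (Y b # Zs) q)"
   using f(2) VF_at[OF _ NS[OF q]] by (simp add: ev_def)
  then show ?thesis using exN[OF q v] by simp
 qed
 have evY: "ev om (Y b # Zs) \<in> F" if "b \<in> B" for b using f(2)[OF that] Zs by (intro ev_smooth[OF om]) auto
 have Xx: "(%q. X q (x b)) \<in> F" if "b \<in> B" for b using VF_smooth[OF X(1) f(1)[OF that]] .
 have prodF: "(%q. X q (x b) * ev om (Y b # Zs) q) \<in> F" if "b \<in> B" for b
  by (rule mult_smooth[OF Xx[OF that] evY[OF that]])
 have "Z p (ev om (X # Zs)) = Z p (%q. \<Sum>b\<in>B. X q (x b) * ev om (Y b # Zs) q)"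
 proof (rule tangent_local[OF VF_at[OF Z p] _ sum_smooth[OF prodF] N(1,2)])
  show "ev om (X # Zs) \<in> F" using X Zs by (intro ev_smooth[OF om]) auto
  show "ev om (X # Zs) q = (\<Sum>b\<in>B. X q (x b) * ev om (Y b # Zs) q)" if "q \<in> N" for q
   using contr[OF that VF_at[OF X(1) NS[OF that]]] by (simp add: ev_def)
 qed
 also have "... = (\<Sum>b\<in>B. Z p (%q. X q (x b) * ev om (Y b # Zs) q))"
  by (rule VF_sum[OF Z prodF])
 also have "... = (\<Sum>b\<in>B. lie_bracket Z X p (x b) * ev om (Y b # Zs) p)"
 proof (rule sum.cong[OF refl])
  fix b assume b: "b \<in> B"
  show "Z p (%q. X q (x b) * ev om (Y b # Zs) q) = lie_bracket Z X p (x b) * ev om (Y b # Zs) p"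
   using VF_mult[OF Z Xx[OF b] evY[OF b], of p] X(2) by (simp add: lie_bracket_def)
 qed
 also have "... = ev om (lie_bracket Z X # Zs) p"
  using contr[OF N(2) VF_at[OF lie_bracket_VF[OF Z X(1)] p]] by (simp add: ev_def)
 finally show ?thesis .
qed

lemma ev_zero_at: "om \<in> forms M k ==> p \<in> S ==> X p = 0 ==> set Zs \<subseteq> VF ==> ev om (X # Zs) p = 0"
proof -
 assume *: "om \<in> forms M k" "p \<in> S" "X p = 0" "set Zs \<subseteq> VF"
 then have "linear_map_on (T p) (%v. om p (v # map (%X. X p) Zs))"
  using VF_at by (intro alternating_linear_Cons[OF forms_alternating]) auto
 from linear_on_0[OF tangent_subspace this] show ?thesis by (simp add: ev_def *)
qed

lemma E_tensorial:
 assumes "om \<in> forms M k" and p: "p \<in> S" and X: "X \<in> VF" "X p = 0" and "set Zs \<subseteq> VF"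
 shows "E om (X # Zs) p = 0"
 using assms(1,5)
proof (induction Zs arbitrary: om k)
 case (Nil om)
 show ?case using X(2) by (simp add: E_singleton)
next
 case (Cons Z Zs om)
 note om = Cons.prems(1)
 have Z: "Z \<in> VF" "set Zs \<subseteq> VF" using Cons.prems by auto
 have upd: "set (Zs[j := lie_bracket Z (Zs ! j)]) \<subseteq> VF" if "j < length Zs" for j
  using Z that by (intro set_update_subsetI lie_bracket_VF) auto
 have z: "ev om (X # Zs[j := lie_bracket Z (Zs ! j)]) p = 0" if "j < length Zs" for j
  by (rule ev_zero_at[of om k p X, OF om p X(2) upd[OF that]])
 have "E om (X # Z # Zs) p = - E om (Z # X # Zs) p"
  by (rule E_swap[OF om p X(1) Z])
 also have "... = - Lie_formula Z om (X # Zs) p + E (ct Z om) (X # Zs) p"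
  by (simp add: E_Cons[OF om p, of Z])
 also have "E (ct Z om) (X # Zs) p = 0"
  by (rule Cons.IH[OF ct_forms'[OF Z(1) om] Z(2)])
 also have "Lie_formula Z om (X # Zs) p = 0"
  unfolding Lie_formula_def length_Cons sum.lessThan_Suc_shift
  using derivative_of_contraction_at_zero[OF om p X Z] z by simp
 finally show ?case by simp
qed

abbreviation d :: "'m form => 'm form" where "d \<equiv> ext_deriv M"

text \<open>
  The value of the invariant formula at \<open>p\<close> only depends on the fields at \<open>p\<close>, which makes the extensions chosen
  in the definition of the exterior derivative irrelevant.
\<close>
lemma ev_d:
 assumes om: "om \<in> forms M k" and Xs: "set Xs \<subseteq> VF"
 shows "ev (d om) Xs = E om Xs"
proof
 fix p
 show "ev (d om) Xs p = E om Xs p"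
 proof (cases "p \<in> S")
  case True
  let ?P = "%Ys. set Ys \<subseteq> VF \<and> map (%X. X p) Ys = map (%X. X p) Xs"
  have P: "?P (SOME Ys. ?P Ys)" by (rule someI[of ?P Xs]) (use Xs in auto)
  have "(if set Xs \<subseteq> VF then E om Xs p else 0) =
    (if set (SOME Ys. ?P Ys) \<subseteq> VF then E om (SOME Ys. ?P Ys) p else 0)"
   by (rule alternating_descends[OF VF_subspace E_alternating[OF om True] evaluation_linear[of p]])
     (use Xs P E_tensorial[OF om True] in auto)
  moreover have "set (map (%X. X p) Xs) \<subseteq> T p" using Xs VF_at[OF _ True] by auto
  ultimately show ?thesis using True Xs P by (simp add: ev_def ext_deriv_def)
 next
  case False
  have "(Xs ! i) p f = 0" if "i < length Xs" for i f
   using VF_off[OF nth_VF[OF Xs that] False] by simp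
  moreover have "ev om Ys p = 0" for Ys using forms_off[OF om False] by (simp add: ev_def)
  ultimately have "E om Xs p = 0" by (simp add: E_eq_ev)
  then show ?thesis using False by (simp add: ev_def ext_deriv_def)
 qed
qed

lemma d_forms:
 assumes om: "om \<in> forms M k" shows "d om \<in> forms M (Suc k)"
 unfolding forms_iff
proof (intro conjI ballI allI impI)
 fix p assume p: "p \<in> S"
 show "alternating (T p) (Suc k) (d om p)"
 proof (rule alternating_pushforward[OF VF_subspace E_alternating[OF om p] evaluation_linear[of p] evaluation_image[OF p]])
  show "(if set (X # Xs) \<subseteq> VF then E om (X # Xs) p else 0) = 0" if "X \<in> VF" "X p = 0" "set Xs \<subseteq> VF" for X Xs
   using E_tensorial[OF om p that] by simp
  show "d om p (map (%X. X p) Xs) = (if set Xs \<subseteq> VF then E om Xs p else 0)" if "set Xs \<subseteq> VF" for Xs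
   using ev_d[OF om that] that by (simp add: ev_def fun_eq_iff)
 qed (simp add: ext_deriv_def)
next
 show "d om p = 0" if "p \<notin> S" for p using that by (simp add: ext_deriv_def fun_eq_iff)
 show "ev (d om) Xs \<in> F" if "set Xs \<subseteq> VF" for Xs
  using E_smooth[OF om that] by (simp add: ev_d[OF om that])
qed

end

context smooth_mfd
begin

lemma ct_add: "ct X (om + et) = ct X om + ct X et"
 and ct_diff: "ct X (om - et) = ct X om - ct X et"
 and ct_scale: "ct X (c *r om) = c *r ct X om"
 and ct_zero: "ct X 0 = 0"
 by (simp_all add: ct_def cn_def fun_eq_iff)

lemma ct_field_linear:
 assumes om: "om \<in> forms M k" and X: "X \<in> VF" "Y \<in> VF"
 shows "ct (X + Y) om = ct X om + ct Y om" "ct (c *r X) om = c *r ct X om"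
proof (safe intro!: ext)
 fix p vs
 show "ct (X + Y) om p vs = (ct X om + ct Y om) p vs" "ct (c *r X) om p vs = (c *r ct X om) p vs"
  using cn_linear[OF forms_alternating[OF om] VF_at[OF X(1)] VF_at[OF X(2)] tangent_subspace, of p] forms_off[OF om]
  by (cases "p \<in> S"; simp add: ct_def cn_def)+
qed

lemma E_add:
 assumes om: "om \<in> forms M k" and et: "et \<in> forms M k" and Xs: "set Xs \<subseteq> VF"
 shows "E (om + et) Xs p = E om Xs p + E et Xs p"
proof -
 have *: "ev (om + et) Ys = (%q. ev om Ys q + ev et Ys q)" for Ys
  by (simp add: ev_def)
 have "(Xs ! i) p (ev (om + et) (nths Xs (- {i}))) =
   (Xs ! i) p (ev om (nths Xs (- {i}))) + (Xs ! i) p (ev et (nths Xs (- {i})))"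
  if "i < length Xs" for i
  unfolding * by (rule VF_add[OF nth_VF[OF Xs that] ev_smooth[OF om nths_VF[OF Xs]] ev_smooth[OF et nths_VF[OF Xs]]])
 then have "(\<Sum>i<length Xs. (-1) ^ i * (Xs ! i) p (ev (om + et) (nths Xs (- {i})))) =
   (\<Sum>i<length Xs. (-1) ^ i * (Xs ! i) p (ev om (nths Xs (- {i})))) +
   (\<Sum>i<length Xs. (-1) ^ i * (Xs ! i) p (ev et (nths Xs (- {i}))))"
  unfolding sum.distrib[symmetric] by (intro sum.cong) (auto simp: distrib_left)
 then show ?thesis
  by (simp add: E_eq_ev * distrib_left split_beta sum.distrib)
qed

lemma d_scale: "om \<in> forms M k ==> d (c *r om) = c *r d om"
 by (rule forms_eqI[OF d_forms[OF forms_scale] forms_scale[OF d_forms]])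
   (simp_all add: ev_d[OF forms_scale] E_scale, simp add: ev_def[of "c *r _"] ev_d[unfolded ev_def, symmetric] fun_eq_iff)

lemma d_add:
 assumes "om \<in> forms M k" "et \<in> forms M k" shows "d (om + et) = d om + d et"
proof (rule forms_eqI[OF d_forms[OF forms_add[OF assms]] forms_add[OF d_forms d_forms, OF assms]])
 fix Xs p assume Xs: "set Xs \<subseteq> VF"
 have "ev (d om + d et) Xs p = ev (d om) Xs p + ev (d et) Xs p" by (simp add: ev_def)
 then show "ev (d (om + et)) Xs p = ev (d om + d et) Xs p"
  by (simp add: ev_d[OF forms_add[OF assms] Xs] ev_d[OF assms(1) Xs] ev_d[OF assms(2) Xs] E_add[OF assms Xs])
qed

lemma d_zero: "d 0 = 0"
 using d_scale[OF forms_zero(1), where c = 0] by simp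

lemma d_diff:
 assumes "om \<in> forms M k" "et \<in> forms M k" shows "d (om - et) = d om - d et"
 using d_add[OF assms(1) forms_scale[OF assms(2), of "-1"]] d_scale[OF assms(2), of "-1"] by simp

section \<open>The Lie derivative\<close>

definition L :: "('m => 'm tvec) => 'm form => 'm form" where
 "L X om = ct X (d om) + d (ct X om)"

lemma ct_d: "ct X (d om) = L X om - d (ct X om)"
 by (simp add: L_def)

lemma d_ct_forms: "X \<in> VF ==> om \<in> forms M k ==> d (ct X om) \<in> forms M k"
 using d_forms[OF ct_forms, of X om "k - 1"] ct_forms_0[of om X] by (cases k) (auto simp: d_zero forms_zero)

lemma L_forms: "X \<in> VF ==> om \<in> forms M k ==> L X om \<in> forms M k"
 unfolding L_def by (intro forms_add ct_forms d_forms d_ct_forms)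

lemma ev_L:
 assumes om: "om \<in> forms M k" and X: "X \<in> VF" and Xs: "set Xs \<subseteq> VF"
 shows "ev (L X om) Xs = Lie_formula X om Xs"
proof
 fix p
 have "ev (L X om) Xs p = ev (d om) (X # Xs) p + ev (d (ct X om)) Xs p"
  by (simp add: L_def ev_ct[symmetric]) (simp add: ev_def)
 also have "... = E om (X # Xs) p + E (ct X om) Xs p"
  using X Xs by (simp add: ev_d[OF om] ev_d[OF ct_forms'[OF X om]])
 also have "... = Lie_formula X om Xs p"
 proof (cases "p \<in> S")
  case True
  then show ?thesis by (simp add: E_Cons[OF om])
 next
  case False
  have "E om (X # Xs) p = ev (d om) (X # Xs) p" "E (ct X om) Xs p = ev (d (ct X om)) Xs p"
   using X Xs by (simp_all add: ev_d[OF om] ev_d[OF ct_forms'[OF X om]])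
  then show ?thesis
   using False VF_off[OF X False] by (simp add: ev_def ext_deriv_def Lie_formula_def forms_off[OF om False])
 qed
 finally show "ev (L X om) Xs p = Lie_formula X om Xs p" .
qed

lemma L_add: "X \<in> VF ==> om \<in> forms M k ==> et \<in> forms M k ==> L X (om + et) = L X om + L X et"
 by (simp add: L_def d_add[of om k] ct_add d_add[OF ct_forms' ct_forms'])

lemma L_scale: "X \<in> VF ==> om \<in> forms M k ==> L X (c *r om) = c *r L X om"
 by (simp add: L_def d_scale[of om k] ct_scale d_scale[OF ct_forms'] scaleR_add_right)

lemma L_zero: "L X 0 = 0"
 by (simp add: L_def d_zero ct_zero)

lemma L_diff: "X \<in> VF ==> om \<in> forms M k ==> et \<in> forms M k ==> L X (om - et) = L X om - L X et"
 using L_add[of X om k "(-1) *r et"] L_scale[of X et k "-1"] forms_scale[of et k "-1"] by simp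

lemma L_ct:
 assumes om: "om \<in> forms M k" and X: "X \<in> VF" and Y: "Y \<in> VF"
 shows "L X (ct Y om) = ct Y (L X om) + ct (lie_bracket X Y) om"
proof (rule forms_eqI)
 note XY = lie_bracket_VF[OF X Y]
 show "L X (ct Y om) \<in> forms M (k - 1)" by (intro L_forms ct_forms' X Y om)
 show "ct Y (L X om) + ct (lie_bracket X Y) om \<in> forms M (k - 1)"
  by (intro forms_add ct_forms' L_forms X Y XY om)
 fix Zs p assume Zs: "set Zs \<subseteq> VF"
 have "ev (ct Y (L X om) + ct (lie_bracket X Y) om) Zs p = ev (L X om) (Y # Zs) p + ev om (lie_bracket X Y # Zs) p"
  by (simp add: ev_ct[symmetric]) (simp add: ev_def)
 also have "... = Lie_formula X (ct Y om) Zs p"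
  using Y Zs unfolding Lie_formula_def ev_ct
  by (simp add: ev_L[OF om X] Lie_formula_def sum.lessThan_Suc_shift del: sum.lessThan_Suc)
 also have "... = ev (L X (ct Y om)) Zs p"
  by (simp add: ev_L[OF ct_forms'[OF Y om] X Zs])
 finally show "ev (L X (ct Y om)) Zs p = ev (ct Y (L X om) + ct (lie_bracket X Y) om) Zs p" by simp
qed

lemma ct_L:
 assumes "om \<in> forms M k" "X \<in> VF" "Y \<in> VF"
 shows "ct Y (L X om) = L X (ct Y om) - ct (lie_bracket X Y) om"
 by (simp add: L_ct[OF assms])

lemma L_commutator:
 assumes "om \<in> forms M k" and X: "X \<in> VF" and Y: "Y \<in> VF"
 shows "L X (L Y om) = L Y (L X om) + L (lie_bracket X Y) om"
 using assms(1)
proof (induction k arbitrary: om)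
 case (0 om)
 note om = 0
 note XY = lie_bracket_VF[OF X Y]
 have l: "ev (L Z et) [] = (%p. Z p (ev et []))" if "et \<in> forms M 0" "Z \<in> VF" for Z et
  using ev_L[OF that, of "[]"] by (simp add: Lie_formula_def fun_eq_iff)
 show ?case
 proof (rule forms_eqI[OF L_forms[OF X L_forms[OF Y om]] forms_add[OF L_forms[OF Y L_forms[OF X om]] L_forms[OF XY om]]])
  fix Xs :: "('m => 'm tvec) list" and p assume "length Xs = 0"
  moreover have "ev (L Y (L X om) + L (lie_bracket X Y) om) [] p = ev (L Y (L X om)) [] p + ev (L (lie_bracket X Y) om) [] p"
   by (simp add: ev_def)
  ultimately show "ev (L X (L Y om)) Xs p = ev (L Y (L X om) + L (lie_bracket X Y) om) Xs p"
   by (simp add: l L_forms X Y XY om) (simp add: lie_bracket_def)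
 qed
next
 case (Suc k om)
 note om = Suc.prems
 note XY = lie_bracket_VF[OF X Y]
 show ?case
 proof (rule forms_Suc_eqI[OF L_forms[OF X L_forms[OF Y om]] forms_add[OF L_forms[OF Y L_forms[OF X om]] L_forms[OF XY om]]])
  fix Z assume Z: "Z \<in> VF"
  have c: "ct Z (L X (L Y om)) = L X (L Y (ct Z om)) - L X (ct (lie_bracket Y Z) om) - L Y (ct (lie_bracket X Z) om)
    + ct (lie_bracket Y (lie_bracket X Z)) om" if X: "X \<in> VF" and Y: "Y \<in> VF" for X Y
   by (simp add: ct_L[OF L_forms[OF Y om] X Z] ct_L[OF om Y Z] ct_L[OF om Y lie_bracket_VF[OF X Z]]
     L_diff[OF X L_forms[OF Y ct_forms[OF Z om]] ct_forms[OF lie_bracket_VF[OF Y Z] om]])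
  have J: "ct (lie_bracket X (lie_bracket Y Z)) om = ct (lie_bracket (lie_bracket X Y) Z) om + ct (lie_bracket Y (lie_bracket X Z)) om"
   unfolding lie_bracket_jacobi[OF X Y Z]
   by (rule ct_field_linear(1)[OF om lie_bracket_VF[OF XY Z] lie_bracket_VF[OF Y lie_bracket_VF[OF X Z]]])
  show "ct Z (L X (L Y om)) = ct Z (L Y (L X om) + L (lie_bracket X Y) om)"
   by (simp add: ct_add c[OF X Y] c[OF Y X] ct_L[OF om XY Z] Suc.IH[OF ct_forms[OF Z om]] J algebra_simps)
     (simp add: fun_eq_iff)
 qed
qed

lemma ct_dd:
 assumes om: "om \<in> forms M k" and X: "X \<in> VF" and 0: "d (d (ct X om)) = 0"
 shows "ct X (d (d om)) = L X (d om) - d (L X om)"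
proof -
 have "d (L X om) = d (ct X (d om)) + d (d (ct X om))"
  unfolding L_def by (rule d_add[OF ct_forms[OF X d_forms[OF om]] d_ct_forms[OF X om]])
 then show ?thesis using 0 by (simp add: L_def)
qed

text \<open>Induction on the degree: by Cartan's formula and \<open>L_commutator\<close>, contracting \<open>d d\<close> of a form with two
  fields only leaves \<open>d d\<close> of its contractions.\<close>
theorem d_d:
 assumes "om \<in> forms M k" shows "d (d om) = 0"
 using assms
proof (induction k arbitrary: om rule: less_induct)
 case (less k om)
 note om = less.prems
 have IH: "d (d (ct X om)) = 0" if X: "X \<in> VF" for X
 proof (cases k)
  case 0
  then show ?thesis using ct_forms_0[of om X] om by (simp add: d_zero)
 next
  case (Suc k')
  show ?thesis by (rule less.IH[of k']) (use ct_forms[OF X, of om k'] om Suc in simp_all)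
 qed
 have IH2: "d (d (ct X (ct Y om))) = 0" if X: "X \<in> VF" and Y: "Y \<in> VF" for X Y
 proof (cases k)
  case 0
  then show ?thesis using ct_forms_0[of om Y] om by (simp add: d_zero ct_zero)
 next
  case (Suc k')
  then have "ct X (ct Y om) \<in> forms M (k' - 1)" using ct_forms'[OF X ct_forms[OF Y, of om k']] om by simp
  then show ?thesis by (rule less.IH[rotated]) (use Suc in simp)
 qed
 have z: "ct Y (ct X (d (d om))) = 0" if X: "X \<in> VF" and Y: "Y \<in> VF" for X Y
 proof -
  note XY = lie_bracket_VF[OF X Y]
  note c = ct_forms'[OF Y om]
  have "ct Y (ct X (d (d om))) = ct Y (L X (d om)) - ct Y (d (L X om))"
   by (simp add: ct_dd[OF om X IH[OF X]] ct_diff)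
  also have "ct Y (L X (d om)) = L X (L Y om) - L X (d (ct Y om)) - (L (lie_bracket X Y) om - d (ct (lie_bracket X Y) om))"
   by (simp add: ct_L[OF d_forms[OF om] X Y] ct_d[of Y] ct_d[of "lie_bracket X Y"]
     L_diff[OF X L_forms[OF Y om] d_ct_forms[OF Y om]])
  also have "ct Y (d (L X om)) = L Y (L X om) - (d (L X (ct Y om)) - d (ct (lie_bracket X Y) om))"
   by (simp add: ct_d[of Y "L X om"] ct_L[OF om X Y] d_diff[OF L_forms[OF X c] ct_forms'[OF XY om]])
  finally have "ct Y (ct X (d (d om))) = - (L X (d (ct Y om)) - d (L X (ct Y om)))"
   by (simp add: L_commutator[OF om X Y]) (simp add: fun_eq_iff)
  also have "L X (d (ct Y om)) - d (L X (ct Y om)) = ct X (d (d (ct Y om)))"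
   by (rule ct_dd[OF c X IH2[OF X Y], symmetric])
  finally show ?thesis by (simp add: IH[OF Y] ct_zero fun_eq_iff)
 qed
 note dd = d_forms[OF d_forms[OF om]]
 show ?case
 proof (rule forms_Suc_eqI[OF dd forms_zero(1)])
  fix X assume X: "X \<in> VF"
  show "ct X (d (d om)) = ct X 0"
   by (rule forms_Suc_eqI[OF ct_forms[OF X dd] ct_forms[OF X forms_zero(1)]]) (simp add: z[OF X] ct_zero)
 qed
qed

section \<open>The exterior product\<close>

lemma wedge_pw: "wedge om et = (%p. pw (om p) (et p))"
 by (simp add: wedge_def pw_def fun_eq_iff)

lemma wedge_linear:
 "wedge (om + om') et = wedge om et + wedge om' et" "wedge om (et + et') = wedge om et + wedge om et'"
 "wedge (om - om') et = wedge om et - wedge om' et" "wedge om (et - et') = wedge om et - wedge om et'"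
 "wedge (c *r om) et = c *r wedge om et" "wedge om (c *r et) = c *r wedge om et"
 "wedge 0 et = 0" "wedge om 0 = 0"
 by (simp_all add: wedge_def fun_eq_iff sum.distrib[symmetric] sum_subtractf[symmetric] sum_distrib_left algebra_simps)

lemma forms_of_degree: "om \<in> forms M k ==> of_degree k (om p)"
 by (simp add: of_degree_def forms_wrong_length)

lemma wedge_forms:
 assumes om: "om \<in> forms M k" and et: "et \<in> forms M l" shows "wedge om et \<in> forms M (k + l)"
 unfolding forms_iff
proof (intro conjI ballI allI impI)
 show "alternating (T p) (k + l) (wedge om et p)" if "p \<in> S" for p
  unfolding wedge_pw by (rule alternating_pw[OF tangent_subspace forms_alternating[OF om that] forms_alternating[OF et that]])
 show "wedge om et p = 0" if "p \<notin> S" for p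
  using that by (simp add: wedge_def fun_eq_iff forms_off[OF om])
 fix Xs assume Xs: "set Xs \<subseteq> VF"
 have "ev (wedge om et) Xs = (%p. \<Sum>A\<in>Pow {..<length Xs}. shuffle_sign (length Xs) A * (ev om (nths Xs A) p * ev et (nths Xs (- A)) p))"
  by (simp add: wedge_def ev_def nths_map mult.assoc)
 also have "... \<in> F"
  by (rule sum_smooth, rule cmult_smooth, rule mult_smooth[OF ev_smooth[OF om nths_VF[OF Xs]] ev_smooth[OF et nths_VF[OF Xs]]])
 finally show "ev (wedge om et) Xs \<in> F" .
qed

lemma wedge_assoc: "wedge (wedge om et) ze = wedge om (wedge et ze)"
 by (simp add: wedge_pw pw_assoc)

lemma wedge_commute:
 assumes "om \<in> forms M k" "et \<in> forms M l" shows "wedge om et = (-1) ^ (k * l) *r wedge et om"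
 using pw_commute[OF forms_of_degree[OF assms(1)] forms_of_degree[OF assms(2)]] by (simp add: wedge_pw fun_eq_iff)

lemma ct_wedge:
 assumes "om \<in> forms M k"
 shows "ct X (wedge om et) = wedge (ct X om) et + (-1) ^ k *r wedge om (ct X et)"
 by (simp add: ct_def wedge_pw fun_eq_iff cn_pw of_degree_bar[OF forms_of_degree[OF assms]] pw_linear)

lemma L_wedge:
 assumes "om \<in> forms M k" "et \<in> forms M l" and X: "X \<in> VF"
 shows "L X (wedge om et) = wedge (L X om) et + wedge om (L X et)"
 using assms(1,2)
proof (induction "k + l" arbitrary: k l om et)
 case 0
 then have om: "om \<in> forms M 0" and et: "et \<in> forms M 0" by auto
 have w: "ev (wedge al be) [] = (%p. ev al [] p * ev be [] p)" for al be
  by (simp add: ev_def wedge_pw pw_Nil)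
 have l: "ev (L X et) [] = (%p. X p (ev et []))" if "et \<in> forms M 0" for et
  using ev_L[OF that X, of "[]"] by (simp add: Lie_formula_def fun_eq_iff)
 have wf: "wedge om et \<in> forms M 0" using wedge_forms[OF om et] by simp
 show ?case
 proof (rule forms_eqI[OF L_forms[OF X wf]])
  show "wedge (L X om) et + wedge om (L X et) \<in> forms M 0"
   using forms_add[OF wedge_forms[OF L_forms[OF X om] et] wedge_forms[OF om L_forms[OF X et]]] by simp
  fix Xs :: "('m => 'm tvec) list" and p assume "length Xs = 0"
  moreover have "ev (wedge (L X om) et + wedge om (L X et)) [] p = ev (wedge (L X om) et) [] p + ev (wedge om (L X et)) [] p"
   by (simp add: ev_def)
  ultimately show "ev (L X (wedge om et)) Xs p = ev (wedge (L X om) et + wedge om (L X et)) Xs p"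
   using VF_mult[OF X ev_smooth[OF om, of "[]"] ev_smooth[OF et, of "[]"], of p] by (simp add: w l om et wf)
 qed
next
 case (Suc n)
 note om = Suc.prems(1) and et = Suc.prems(2)
 have wf: "wedge om et \<in> forms M (Suc n)" using wedge_forms[OF om et] Suc.hyps(2) by simp
 have wf2: "wedge (L X om) et + wedge om (L X et) \<in> forms M (Suc n)"
  using forms_add[OF wedge_forms[OF L_forms[OF X om] et] wedge_forms[OF om L_forms[OF X et]]] Suc.hyps(2) by simp
 show ?case
 proof (rule forms_Suc_eqI[OF L_forms[OF X wf] wf2])
  fix Y assume Y: "Y \<in> VF"
  note XY = lie_bracket_VF[OF X Y]
  have 1: "L X (wedge (ct Y om) et) = wedge (L X (ct Y om)) et + wedge (ct Y om) (L X et)"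
   and f1: "wedge (ct Y om) et \<in> forms M n"
  proof -
   have "L X (wedge (ct Y om) et) = wedge (L X (ct Y om)) et + wedge (ct Y om) (L X et) \<and> wedge (ct Y om) et \<in> forms M n"
   proof (cases k)
    case 0
    then show ?thesis using ct_forms_0[of om Y] om by (simp add: wedge_linear L_zero forms_zero)
   next
    case (Suc k')
    then show ?thesis
     using Suc.hyps(1)[of k' l "ct Y om" et] ct_forms[OF Y, of om k'] om et Suc.hyps(2) wedge_forms[of "ct Y om" k' et l] by simp
   qed
   then show "L X (wedge (ct Y om) et) = wedge (L X (ct Y om)) et + wedge (ct Y om) (L X et)" "wedge (ct Y om) et \<in> forms M n"
    by auto
  qed
  have 2: "L X (wedge om (ct Y et)) = wedge (L X om) (ct Y et) + wedge om (L X (ct Y et))"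
   and f2: "wedge om (ct Y et) \<in> forms M n"
  proof -
   have "L X (wedge om (ct Y et)) = wedge (L X om) (ct Y et) + wedge om (L X (ct Y et)) \<and> wedge om (ct Y et) \<in> forms M n"
   proof (cases l)
    case 0
    then show ?thesis using ct_forms_0[of et Y] et by (simp add: wedge_linear L_zero forms_zero)
   next
    case (Suc l')
    then show ?thesis
     using Suc.hyps(1)[of k l' om "ct Y et"] ct_forms[OF Y, of et l'] om et Suc.hyps(2) wedge_forms[of om k "ct Y et" l'] by simp
   qed
   then show "L X (wedge om (ct Y et)) = wedge (L X om) (ct Y et) + wedge om (L X (ct Y et))" "wedge om (ct Y et) \<in> forms M n"
    by auto
  qed
  show "ct Y (L X (wedge om et)) = ct Y (wedge (L X om) et + wedge om (L X et))"
   by (simp add: ct_L[OF wf X Y] ct_add ct_wedge[OF om] ct_wedge[OF L_forms[OF X om]]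
     L_add[OF X f1 forms_scale[OF f2]] L_scale[OF X f2] 1 2 L_ct[OF om X Y] L_ct[OF et X Y] wedge_linear scaleR_add_right)
 qed
qed

theorem d_wedge:
 assumes "om \<in> forms M k" "et \<in> forms M l"
 shows "d (wedge om et) = wedge (d om) et + (-1) ^ k *r wedge om (d et)"
 using assms
proof (induction "k + l" arbitrary: k l om et rule: less_induct)
 case less
 note om = less.prems(1) and et = less.prems(2)
 have wf: "wedge (d om) et + (-1) ^ k *r wedge om (d et) \<in> forms M (Suc (k + l))"
  using wedge_forms[OF d_forms[OF om] et] wedge_forms[OF om d_forms[OF et]] by (auto intro: forms_add forms_scale)
 show ?case
 proof (rule forms_Suc_eqI[OF d_forms[OF wedge_forms[OF om et]] wf])
  fix X assume X: "X \<in> VF"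
  have 1: "d (wedge (ct X om) et) = wedge (d (ct X om)) et - (-1) ^ k *r wedge (ct X om) (d et)
    \<and> wedge (ct X om) et \<in> forms M (k + l - 1)"
  proof (cases k)
   case 0
   then show ?thesis using ct_forms_0[of om X] om by (simp add: wedge_linear d_zero forms_zero)
  next
   case (Suc k')
   then show ?thesis
    using less.hyps[of k' l "ct X om" et] ct_forms[OF X, of om k'] om et wedge_forms[of "ct X om" k' et l] by simp
  qed
  have 2: "d (wedge om (ct X et)) = wedge (d om) (ct X et) + (-1) ^ k *r wedge om (d (ct X et))
    \<and> wedge om (ct X et) \<in> forms M (k + l - 1)"
  proof (cases l)
   case 0
   then show ?thesis using ct_forms_0[of et X] et by (simp add: wedge_linear d_zero forms_zero)
  next
   case (Suc l')
   then show ?thesis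
    using less.hyps[of k l' om "ct X et"] ct_forms[OF X, of et l'] om et wedge_forms[of om k "ct X et" l'] by simp
  qed
  have "d (ct X (wedge om et)) = d (wedge (ct X om) et) + (-1) ^ k *r d (wedge om (ct X et))"
   unfolding ct_wedge[OF om] d_scale[OF conjunct2[OF 2], symmetric]
   by (rule d_add[OF conjunct2[OF 1] forms_scale[OF conjunct2[OF 2]]])
  then have "ct X (d (wedge om et)) = wedge (L X om) et + wedge om (L X et)
    - (wedge (d (ct X om)) et - (-1) ^ k *r wedge (ct X om) (d et)
      + (-1) ^ k *r (wedge (d om) (ct X et) + (-1) ^ k *r wedge om (d (ct X et))))"
   by (simp add: ct_d[of X "wedge om et"] L_wedge[OF om et X] 1 2)
  also have "... = ct X (wedge (d om) et + (-1) ^ k *r wedge om (d et))"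
   by (simp add: ct_add ct_scale ct_wedge[OF om] ct_wedge[OF d_forms[OF om]] ct_d wedge_linear scaleR_add_right
     scaleR_diff_right power_add[symmetric] algebra_simps)
  finally show "ct X (d (wedge om et)) = ct X (wedge (d om) et + (-1) ^ k *r wedge om (d et))" .
 qed
qed

end

lemma sum_list_fun_apply: "(\<Sum>x\<leftarrow>xs. f x) y = (\<Sum>x\<leftarrow>xs. f x y)"
 by (induction xs) auto

lemma decomposable_pair:
 "decomposable [u, w] fs = (if length fs = 2 then u (fs ! 0) * w (fs ! 1) - u (fs ! 1) * w (fs ! 0) else 0)"
proof -
 have two: "{..<length [u, w]} = {0, 1}" by auto
 have P: "{si. si permutes {0::nat, 1}} = {id, Transposition.transpose 0 1}"
  by (auto simp: permutes_doubleton_iff)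
 have ne: "id \<noteq> Transposition.transpose (0::nat) 1"
  by (metis id_apply transpose_apply_first zero_neq_one)
 show ?thesis
  unfolding decomposable_def two P using ne by (auto simp: sign_swap_id)
qed

lemma pw_sum_list:
 "pw (%vs. \<Sum>x\<leftarrow>xs. f x vs) g vs = (\<Sum>x\<leftarrow>xs. pw (f x) g vs)"
 "pw g (%vs. \<Sum>x\<leftarrow>xs. f x vs) vs = (\<Sum>x\<leftarrow>xs. pw g (f x) vs)"
 by (induction xs) (simp_all add: pw_linear)

lemma pw_scalar:
 "pw (%vs. if vs = [] then c else 0) g vs = c * g vs"
proof (induction vs arbitrary: g)
 case (Cons v vs)
 have "cn v (%vs. if vs = [] then c else 0) = (%_. 0)" by (simp add: cn_def fun_eq_iff)
 moreover have "bar (%vs :: 'a list. if vs = [] then c else 0) = (%vs. if vs = [] then c else 0)"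
  by (simp add: bar_def fun_eq_iff)
 ultimately show ?case using Cons.IH[of "cn v g"] by (simp add: pw_Cons pw_linear) (simp add: cn_def)
qed (simp add: pw_Nil)

lemma alternating_expansion:
 assumes V: "subspace V" and f: "alternating V k f" and vs: "set vs \<subseteq> V" and X: "!!b. b \<in> B ==> X b \<in> V"
 shows "f ((\<Sum>b\<in>B. c b *r X b) # vs) = (\<Sum>b\<in>B. c b * f (X b # vs))"
 using linear_on_sum[OF V alternating_linear_Cons[OF f vs], of B X c] X by simp

lemma alternating_bilinear_expansion:
 assumes V: "subspace V" and f: "alternating V k f" and vs: "set vs \<subseteq> V" and X: "!!b. b \<in> B ==> X b \<in> V"
 shows "f ((\<Sum>b\<in>B. c b *r X b) # (\<Sum>b\<in>B. d b *r X b) # vs) =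
  (\<Sum>a\<in>B. \<Sum>b\<in>B. (c a * d b - c b * d a) * f (X a # X b # vs)) / 2"
proof -
 let ?t = "%a b. c a * d b * f (X a # X b # vs)"
 have sw: "f (u # w # vs) = - f (w # u # vs)" for u w
  by (rule alternating_swap_Cons[OF V f])
 have dV: "(\<Sum>b\<in>B. d b *r X b) \<in> V" using V X by (auto intro!: subspace_sum subspace_scale)
 have "f ((\<Sum>b\<in>B. c b *r X b) # (\<Sum>b\<in>B. d b *r X b) # vs) = (\<Sum>a\<in>B. c a * f (X a # (\<Sum>b\<in>B. d b *r X b) # vs))"
  by (rule alternating_expansion[OF V f _ X]) (use vs dV in auto)
 also have "... = (\<Sum>a\<in>B. \<Sum>b\<in>B. ?t a b)"
 proof (rule sum.cong[OF refl])
  fix a assume a: "a \<in> B"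
  have "f (X a # (\<Sum>b\<in>B. d b *r X b) # vs) = - f ((\<Sum>b\<in>B. d b *r X b) # X a # vs)" by (rule sw)
  also have "f ((\<Sum>b\<in>B. d b *r X b) # X a # vs) = (\<Sum>b\<in>B. d b * f (X b # X a # vs))"
   by (rule alternating_expansion[OF V f _ X]) (use vs X[OF a] in auto)
  also have "- (\<Sum>b\<in>B. d b * f (X b # X a # vs)) = (\<Sum>b\<in>B. d b * f (X a # X b # vs))"
   unfolding sum_negf[symmetric] by (rule sum.cong[OF refl]) (use sw[of "X a"] in simp)
  finally have "f (X a # (\<Sum>b\<in>B. d b *r X b) # vs) = (\<Sum>b\<in>B. d b * f (X a # X b # vs))" .
  then show "c a * f (X a # (\<Sum>b\<in>B. d b *r X b) # vs) = (\<Sum>b\<in>B. ?t a b)"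
   by (simp add: sum_distrib_left mult.assoc)
 qed
 finally have 1: "f ((\<Sum>b\<in>B. c b *r X b) # (\<Sum>b\<in>B. d b *r X b) # vs) = (\<Sum>a\<in>B. \<Sum>b\<in>B. ?t a b)" .
 have "(\<Sum>a\<in>B. \<Sum>b\<in>B. c b * d a * f (X a # X b # vs)) = (\<Sum>b\<in>B. \<Sum>a\<in>B. c b * d a * f (X a # X b # vs))"
  by (rule sum.swap)
 also have "... = - (\<Sum>a\<in>B. \<Sum>b\<in>B. ?t a b)"
  unfolding sum_negf[symmetric]
 proof (intro sum.cong refl)
  fix a b show "c b * d a * f (X a # X b # vs) = - ?t b a" using sw[of "X a" "X b"] by simp
 qed
 finally have "(\<Sum>a\<in>B. \<Sum>b\<in>B. (c a * d b - c b * d a) * f (X a # X b # vs)) = 2 * (\<Sum>a\<in>B. \<Sum>b\<in>B. ?t a b)"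
  by (simp add: left_diff_distrib sum_subtractf)
 with 1 show ?thesis by simp
qed

locale poisson_mfd = smooth_mfd M for M :: "('m, 'e::euclidean_space) manifold" +
 fixes \<pi> :: "'m => 'm multivec"
 assumes poisson: "poisson_manifold M \<pi>"
begin

section \<open>The interior product with a bivector field\<close>

definition decomposes :: "'m => ('m tvec \<times> 'm tvec) list => bool" where
 "decomposes p ds \<longleftrightarrow> set ds \<subseteq> T p \<times> T p \<and> \<pi> p = (\<Sum>(u, w)\<leftarrow>ds. decomposable [u, w])"

definition bivector_terms :: "'m => ('m tvec \<times> 'm tvec) list" where
 "bivector_terms p = (SOME ds. decomposes p ds)"

abbreviation i\<pi> :: "'m form => 'm form" where "i\<pi> \<equiv> interior_product M \<pi>"

lemma bivector_off: "p \<notin> S ==> \<pi> p = 0"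
 and bivector_smooth: "f \<in> F ==> g \<in> F ==> (%p. \<pi> p [f, g]) \<in> F"
 using poisson by (auto simp: poisson_manifold_def multivector_fields_def)

lemma decomposition_exists: "\<exists>ds. decomposes p ds"
proof (cases "p \<in> S")
 case True
 then have "\<pi> p \<in> span (decomposable ` {us. length us = 2 \<and> set us \<subseteq> T p})"
  using poisson by (auto simp: poisson_manifold_def multivector_fields_def multivectors_def)
 then have "\<exists>ds. set ds \<subseteq> T p \<times> T p \<and> \<pi> p = (\<Sum>(u, w)\<leftarrow>ds. decomposable [u, w])"
 proof (induction rule: span_induct_alt)
  case base
  show ?case by (rule exI[of _ "[]"]) simp
 next
  case (step c x y)
  then obtain ds where ds: "set ds \<subseteq> T p \<times> T p" "y = (\<Sum>(u, w)\<leftarrow>ds. decomposable [u, w])" by blast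
  from step(1) obtain us where us: "length us = 2" "set us \<subseteq> T p" "x = decomposable us" by auto
  then obtain u w where uw: "us = [u, w]" by (auto simp: numeral_2_eq_2 length_Suc_conv)
  have "c *r x = decomposable [c *r u, w]"
   unfolding us(3) uw by (rule ext) (simp add: decomposable_pair algebra_simps)
  then show ?case
   using ds us(2) uw subspace_scale[OF tangent_subspace]
   by (intro exI[of _ "(c *r u, w) # ds"]) auto
 qed
 then show ?thesis by (simp add: decomposes_def)
next
 case False
 then show ?thesis by (intro exI[of _ "[]"]) (simp add: decomposes_def bivector_off)
qed

lemma bivector_terms: "decomposes p (bivector_terms p)"
 unfolding bivector_terms_def by (rule someI_ex[OF decomposition_exists])

lemma bivector_terms_tangent: "(u, w) \<in> set (bivector_terms p) ==> u \<in> T p \<and> w \<in> T p"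
 using bivector_terms[of p] by (auto simp: decomposes_def)

lemma bivector_terms_subset: "set (bivector_terms p) \<subseteq> T p \<times> T p"
 using bivector_terms[of p] by (simp add: decomposes_def)

lemma bivector_eval: "\<pi> p [f, g] = (\<Sum>(u, w)\<leftarrow>bivector_terms p. u f * w g - u g * w f)"
proof -
 have "\<pi> p = (\<Sum>(u, w)\<leftarrow>bivector_terms p. decomposable [u, w])"
  using bivector_terms[of p] by (simp add: decomposes_def)
 then have "\<pi> p [f, g] = (\<Sum>uw\<leftarrow>bivector_terms p. (case uw of (u, w) => decomposable [u, w]) [f, g])"
  by (simp only: sum_list_fun_apply)
 also have "... = (\<Sum>(u, w)\<leftarrow>bivector_terms p. u f * w g - u g * w f)"
  by (intro arg_cong[where f = sum_list] map_cong) (auto simp: decomposable_pair)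
 finally show ?thesis .
qed

lemma interior_product_eq: "i\<pi> om p vs = (\<Sum>uw\<leftarrow>bivector_terms p. cn (snd uw) (cn (fst uw) (om p)) vs)"
 by (simp add: interior_product_def bivector_terms_def decomposes_def cn_def Let_def case_prod_unfold)

lemma interior_product_linear:
 "i\<pi> (om + et) = i\<pi> om + i\<pi> et" "i\<pi> (c *r om) = c *r i\<pi> om" "i\<pi> (om - et) = i\<pi> om - i\<pi> et" "i\<pi> 0 = 0"
 by (simp_all add: fun_eq_iff interior_product_eq cn_def split_beta sum_list_addf sum_list_const_mult sum_list_subtractf)

lemma alternating_sum_list:
 "(!!x. x \<in> set xs ==> alternating V k (f x)) ==> alternating V k (%vs. \<Sum>x\<leftarrow>xs. f x vs)"
 by (induction xs) (auto intro: alternating_zero alternating_add)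

text \<open>
  In a frame the interior product only involves the smooth functions \<open>\<pi>(x\<^sub>a, x\<^sub>b)\<close>; so it does not depend
  on the decomposition of \<open>\<pi>\<close>, and it preserves smoothness.
\<close>
lemma interior_product_local:
 assumes om: "om \<in> forms M k" and q: "q \<in> S" and vs: "set vs \<subseteq> T q"
  and X: "!!b. b \<in> B ==> X b q \<in> T q" and ex: "!!v. v \<in> T q ==> v = (\<Sum>b\<in>B. v (x b) *r X b q)"
 shows "i\<pi> om q vs = (\<Sum>a\<in>B. \<Sum>b\<in>B. \<pi> q [x a, x b] * om q (X a q # X b q # vs)) / 2"
proof -
 have "i\<pi> om q vs = (\<Sum>(u, w)\<leftarrow>bivector_terms q. om q (u # w # vs))"
  by (simp add: interior_product_eq cn_def case_prod_unfold)
 also have "... = (\<Sum>(u, w)\<leftarrow>bivector_terms q. (\<Sum>a\<in>B. \<Sum>b\<in>B. (u (x a) * w (x b) - u (x b) * w (x a)) * om q (X a q # X b q # vs)) / 2)"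
 proof (intro arg_cong[where f = sum_list] map_cong refl, clarify)
  fix u w assume "(u, w) \<in> set (bivector_terms q)"
  then have "u \<in> T q" "w \<in> T q" using bivector_terms_tangent by auto
  then show "om q (u # w # vs) = (\<Sum>a\<in>B. \<Sum>b\<in>B. (u (x a) * w (x b) - u (x b) * w (x a)) * om q (X a q # X b q # vs)) / 2"
   using alternating_bilinear_expansion[OF tangent_subspace forms_alternating[OF om q] vs,
     where B = B and X = "%b. X b q" and c = "%b. u (x b)" and d = "%b. w (x b)"]
    X ex[of u, symmetric] ex[of w, symmetric] by simp
 qed
 also have "... = (\<Sum>a\<in>B. \<Sum>b\<in>B. \<pi> q [x a, x b] * om q (X a q # X b q # vs)) / 2"
 proof -
  have "(\<Sum>(u, w)\<leftarrow>l. (\<Sum>a\<in>B. \<Sum>b\<in>B. (u (x a) * w (x b) - u (x b) * w (x a)) * g a b) / 2) =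
    (\<Sum>a\<in>B. \<Sum>b\<in>B. (\<Sum>(u, w)\<leftarrow>l. u (x a) * w (x b) - u (x b) * w (x a)) * g a b) / 2"
   for l :: "('m tvec \<times> 'm tvec) list" and g
   by (induction l) (auto simp: sum.distrib[symmetric] add_divide_distrib[symmetric] distrib_right)
  then show ?thesis by (simp add: bivector_eval)
 qed
 finally show ?thesis .
qed

lemma interior_product_forms:
 assumes om: "om \<in> forms M k" shows "i\<pi> om \<in> forms M (k - 2)"
 unfolding forms_iff
proof (intro conjI ballI allI impI)
 show "alternating (T p) (k - 2) (i\<pi> om p)" if p: "p \<in> S" for p
 proof -
  have k: "k - 1 - 1 = k - 2" by simp
  have "alternating (T p) (k - 2) (%vs. \<Sum>uw\<leftarrow>bivector_terms p. cn (snd uw) (cn (fst uw) (om p)) vs)"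
   by (rule alternating_sum_list) (rule alternating_cn'[OF alternating_cn'[OF forms_alternating[OF om p]], unfolded k])
  moreover have "i\<pi> om p = (%vs. \<Sum>uw\<leftarrow>bivector_terms p. cn (snd uw) (cn (fst uw) (om p)) vs)"
   by (rule ext) (rule interior_product_eq)
  ultimately show ?thesis by simp
 qed
 show "i\<pi> om p = 0" if "p \<notin> S" for p
  using that by (simp add: fun_eq_iff interior_product_eq cn_def forms_off[OF om] split_beta)
 fix Xs assume Xs: "set Xs \<subseteq> VF"
 show "ev (i\<pi> om) Xs \<in> F"
 proof (rule smooth_functions_local)
  show "ev (i\<pi> om) Xs p = 0" if "p \<notin> S" for p
   using that by (simp add: ev_def interior_product_eq cn_def forms_off[OF om] split_beta)
  fix p assume p: "p \<in> S"
  obtain B :: "'e set" and x Y N where f0: "\<forall>b\<in>B. x b \<in> F" "\<forall>b\<in>B. Y b \<in> VF"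
   and N: "openin (mtop M) N" "p \<in> N" and NS0: "\<forall>q\<in>N. q \<in> S"
   and ex0: "\<forall>q\<in>N. \<forall>v\<in>T q. v = (\<Sum>b\<in>B. v (x b) *r Y b q)"
   using local_frame_nearby[OF p] by blast
  let ?g = "%q. (1/2) * (\<Sum>a\<in>B. \<Sum>b\<in>B. \<pi> q [x a, x b] * ev om (Y a # Y b # Xs) q)"
  have g: "?g \<in> F"
  proof (rule cmult_smooth, rule sum_smooth, rule sum_smooth, rule mult_smooth)
   fix a b assume ab: "a \<in> B" "b \<in> B"
   show "(%q. \<pi> q [x a, x b]) \<in> F" using ab f0(1) by (intro bivector_smooth) auto
   show "(%q. ev om (Y a # Y b # Xs) q) \<in> F" using ab f0(2) Xs ev_smooth[OF om, of "Y a # Y b # Xs"] by simp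
  qed
  have "ev (i\<pi> om) Xs q = ?g q" if q: "q \<in> N" for q
  proof -
   have qS: "q \<in> S" using q NS0 by blast
   have "i\<pi> om q (map (%X. X q) Xs) =
     (\<Sum>a\<in>B. \<Sum>b\<in>B. \<pi> q [x a, x b] * om q (Y a q # Y b q # map (%X. X q) Xs)) / 2"
    by (rule interior_product_local[OF om qS])
      (use Xs VF_at[OF _ qS] f0(2) ex0 q in auto)
   then show ?thesis by (simp add: ev_def)
  qed
  then show "\<exists>N. openin (mtop M) N \<and> p \<in> N \<and> (\<exists>g\<in>F. \<forall>q\<in>N. ev (i\<pi> om) Xs q = g q)"
   by (intro exI[of _ N] conjI N bexI[OF _ g] ballI)
 qed
qed

lemma interior_product_low: "om \<in> forms M k ==> k < 2 ==> i\<pi> om = 0"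
 by (simp add: fun_eq_iff interior_product_eq cn_def forms_wrong_length split_beta)

lemma interior_product_ct:
 assumes om: "om \<in> forms M k" shows "i\<pi> (ct X om) = ct X (i\<pi> om)"
proof (intro ext)
 fix p vs
 have "om p (X p # u # w # vs) = om p (u # w # X p # vs)" for u w
 proof (cases "p \<in> S")
  case True
  have "om p (X p # u # w # vs) = - cn u (om p) (X p # w # vs)"
   using alternating_swap_Cons[OF tangent_subspace forms_alternating[OF om True], of "X p" u "w # vs"] by (simp add: cn_def)
  also have "... = cn u (om p) (w # X p # vs)"
   using alternating_swap_Cons[OF tangent_subspace alternating_cn'[OF forms_alternating[OF om True]], of u "X p" w vs] by simp
  finally show ?thesis by (simp add: cn_def)
 qed (simp add: forms_off[OF om])
 then show "i\<pi> (ct X om) p vs = ct X (i\<pi> om) p vs"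
  by (simp add: interior_product_eq ct_def cn_def split_beta)
qed

subsection \<open>Second order\<close>

definition graded :: "nat => 'm form => bool" where
 "graded k om \<longleftrightarrow> (\<forall>p. of_degree k (om p))"

lemma graded_forms: "om \<in> forms M k ==> graded k om"
 by (simp add: graded_def forms_of_degree)

lemma graded_ct: "graded k om ==> graded (k - 1) (ct X om)" "graded 0 om ==> ct X om = 0"
  apply (unfold graded_def ct_def, blast intro: of_degree_cn(1))
 apply (simp add: fun_eq_iff of_degree_cn(2))
 done

lemma graded_wedge: "graded k om ==> graded l et ==> graded (k + l) (wedge om et)"
proof -
 assume *: "graded k om" "graded l et"
 have "pw (om p) (et p) vs = 0" if "length vs \<noteq> k + l" for p vs
  unfolding pw_def
 proof (rule sum.neutral, rule ballI)
  fix A assume A: "A \<in> Pow {..<length vs}"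
  have "length (nths vs A) + length (nths vs (- A)) = length vs"
  proof -
   have "{i. i < length vs \<and> i \<in> A} \<union> {i. i < length vs \<and> i \<in> - A} = {..<length vs}" by auto
   moreover have "card ({i. i < length vs \<and> i \<in> A} \<union> {i. i < length vs \<and> i \<in> - A}) =
     card {i. i < length vs \<and> i \<in> A} + card {i. i < length vs \<and> i \<in> - A}"
    by (rule card_Un_disjoint) auto
   ultimately show ?thesis by (simp add: length_nths)
  qed
  then have "length (nths vs A) \<noteq> k \<or> length (nths vs (- A)) \<noteq> l" using that by auto
  then show "shuffle_sign (length vs) A * om p (nths vs A) * et p (nths vs (- A)) = 0"
   using * by (auto simp: graded_def of_degree_def)
 qed
 then show ?thesis by (simp add: graded_def of_degree_def wedge_pw)
qed

lemma graded_ct_wedge: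
 assumes "graded k om"
 shows "ct X (wedge om et) = wedge (ct X om) et + (-1) ^ k *r wedge om (ct X et)"
proof -
 have b: "bar (om p) = (%vs. (-1) ^ k * om p vs)" for p
  using assms by (simp add: graded_def of_degree_bar)
 show ?thesis by (simp add: ct_def wedge_pw fun_eq_iff cn_pw b pw_linear)
qed

lemma graded_wedge_commute:
 assumes "graded k om" "graded l et" shows "wedge om et = (-1) ^ (k * l) *r wedge et om"
proof (intro ext)
 fix p vs
 have "pw (om p) (et p) vs = (-1) ^ (k * l) * pw (et p) (om p) vs"
  by (rule pw_commute) (use assms in \<open>simp_all add: graded_def\<close>)
 then show "wedge om et p vs = ((-1) ^ (k * l) *r wedge et om) p vs" by (simp add: wedge_pw)
qed

lemma graded_wedge_ct_commute:
 assumes "graded k om" "graded l et" shows "wedge om (ct X et) = ((-1) ^ (k * l) * (-1) ^ k) *r wedge (ct X et) om"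
proof (cases l)
 case 0
 then show ?thesis using graded_ct(2) assms by (simp add: wedge_linear)
next
 case (Suc l')
 then show ?thesis using graded_wedge_commute[OF assms(1) graded_ct(1)[OF assms(2)], of X]
  by (simp add: power_add mult_ac)
qed

lemma graded_ct_wedge':
 assumes "graded k om"
 shows "ct X (wedge (ct Y om) et) = wedge (ct X (ct Y om)) et - (-1) ^ k *r wedge (ct Y om) (ct X et)"
proof (cases k)
 case 0
 then show ?thesis using graded_ct(2) assms by (simp add: wedge_linear ct_zero)
next
 case (Suc k')
 then show ?thesis using graded_ct_wedge[OF graded_ct(1)[OF assms], of X Y et] by simp
qed

text \<open>For constant \<open>U\<close> and \<open>W\<close> the composite \<open>\<iota>\<^sub>W \<iota>\<^sub>U\<close> of two odd derivations is a second order operator: its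
  deviation from a derivation, the bidifferential operator \<open>B\<close>, is a derivation in either argument.\<close>

lemma contraction2_wedge:
 assumes "graded k om"
 shows "ct W (ct U (wedge om et)) = wedge (ct W (ct U om)) et + wedge om (ct W (ct U et))
  + (-1) ^ k *r (wedge (ct W om) (ct U et) - wedge (ct U om) (ct W et))"
 by (simp add: graded_ct_wedge[OF assms] ct_add ct_scale graded_ct_wedge'[OF assms] algebra_simps
   power_add[symmetric] scaleR_add_right scaleR_diff_right)

lemma contraction2_second_order:
 fixes U W :: "'m => 'm tvec"
 assumes om: "graded k om" and et: "graded l et" and ze: "graded m ze"
 defines "D \<equiv> %al. ct W (ct U al)"
 shows "D (wedge (wedge om et) ze) = wedge (D (wedge om et)) ze + wedge om (D (wedge et ze))
  + (-1) ^ (l * m) *r wedge (D (wedge om ze)) et - wedge (wedge (D om) et) ze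
  - wedge (wedge om (D et)) ze - (-1) ^ (l * m) *r wedge (wedge om (D ze)) et"
proof -
 define B where "B k om et = (-1) ^ k *r (wedge (ct W om) (ct U et) - wedge (ct U om) (ct W et))" for k :: nat and om et :: "'m form"
 have D: "D (wedge om et) = wedge (D om) et + wedge om (D et) + B k om et" if "graded k om" for k om et
  unfolding D_def B_def by (rule contraction2_wedge[OF that])
 have c: "wedge et (ct X ze) = ((-1) ^ (l * m) * (-1) ^ l) *r wedge (ct X ze) et" for X
  by (rule graded_wedge_ct_commute[OF et ze])
 have B: "B (k + l) (wedge om et) ze = wedge om (B l et ze) + (-1) ^ (l * m) *r wedge (B k om ze) et"
  unfolding B_def
  by (simp add: graded_ct_wedge[OF om] wedge_linear wedge_assoc c power_add scaleR_add_right scaleR_diff_right algebra_simps)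
 have z: "wedge et ze = (-1) ^ (l * m) *r wedge ze et" by (rule graded_wedge_commute[OF et ze])
 have s: "wedge (wedge (D om) ze) et = (-1) ^ (l * m) *r wedge (wedge (D om) et) ze"
  unfolding wedge_assoc z by (simp add: wedge_linear power_add[symmetric])
 show ?thesis
  by (simp add: D[OF graded_wedge[OF om et]] D[OF om] D[OF et] B wedge_linear s scaleR_add_right algebra_simps)
    (simp add: wedge_assoc power_add[symmetric])
qed

lemma interior_product_pointwise:
 "i\<pi> om p vs = (\<Sum>uw\<leftarrow>bivector_terms p. ct (%_. snd uw) (ct (%_. fst uw) om) p vs)"
 by (simp add: interior_product_eq ct_def)

lemma wedge_interior_product:
 "wedge (i\<pi> om) et p vs = (\<Sum>uw\<leftarrow>bivector_terms p. wedge (ct (%_. snd uw) (ct (%_. fst uw) om)) et p vs)"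
 "wedge et (i\<pi> om) p vs = (\<Sum>uw\<leftarrow>bivector_terms p. wedge et (ct (%_. snd uw) (ct (%_. fst uw) om)) p vs)"
 by (simp_all add: wedge_pw pw_sum_list[symmetric] interior_product_eq[abs_def] ct_def)

theorem interior_product_second_order:
 assumes om: "om \<in> forms M k" and et: "et \<in> forms M l" and ze: "ze \<in> forms M m"
 shows "i\<pi> (wedge (wedge om et) ze) = wedge (i\<pi> (wedge om et)) ze + wedge om (i\<pi> (wedge et ze))
  + (-1) ^ (l * m) *r wedge (i\<pi> (wedge om ze)) et - wedge (wedge (i\<pi> om) et) ze
  - wedge (wedge om (i\<pi> et)) ze - (-1) ^ (l * m) *r wedge (wedge om (i\<pi> ze)) et"
proof (intro ext)
 fix p vs
 let ?D = "%uw al. ct (%_. snd uw) (ct (%_. fst uw) al) :: 'm form"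
 have w3: "wedge (wedge (i\<pi> al) be) ga p vs = (\<Sum>uw\<leftarrow>bivector_terms p. wedge (wedge (?D uw al) be) ga p vs)"
  and w3': "wedge (wedge al (i\<pi> be)) ga p vs = (\<Sum>uw\<leftarrow>bivector_terms p. wedge (wedge al (?D uw be)) ga p vs)"
  for al be ga :: "'m form"
  by (simp_all add: wedge_pw pw_sum_list[symmetric] interior_product_eq[abs_def] ct_def)
 have "i\<pi> (wedge (wedge om et) ze) p vs = (\<Sum>uw\<leftarrow>bivector_terms p.
   (wedge (?D uw (wedge om et)) ze + wedge om (?D uw (wedge et ze))
  + (-1) ^ (l * m) *r wedge (?D uw (wedge om ze)) et - wedge (wedge (?D uw om) et) ze
  - wedge (wedge om (?D uw et)) ze - (-1) ^ (l * m) *r wedge (wedge om (?D uw ze)) et) p vs)"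
  unfolding interior_product_pointwise[of "wedge (wedge om et) ze"]
  by (simp only: contraction2_second_order[OF graded_forms[OF om] graded_forms[OF et] graded_forms[OF ze]])
 then show "i\<pi> (wedge (wedge om et) ze) p vs = (wedge (i\<pi> (wedge om et)) ze + wedge om (i\<pi> (wedge et ze))
  + (-1) ^ (l * m) *r wedge (i\<pi> (wedge om ze)) et - wedge (wedge (i\<pi> om) et) ze
  - wedge (wedge om (i\<pi> et)) ze - (-1) ^ (l * m) *r wedge (wedge om (i\<pi> ze)) et) p vs"
  by (simp add: wedge_interior_product w3 w3' sum_list_addf sum_list_subtractf sum_list_const_mult)
qed

section \<open>Hamiltonian vector fields\<close>

definition fn :: "('m => real) => 'm form" where
 "fn f = (%p vs. if vs = [] then f p else 0)"

definition ham :: "('m => real) => 'm => 'm tvec" where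
 "ham f = (%p g. \<pi> p [f, g])"

definition df :: "('m => real) => 'm form => 'm form" where
 "df f om = wedge (d (fn f)) om"

lemma fn_forms: "f \<in> F ==> fn f \<in> forms M 0"
 by (auto simp: forms_iff fn_def alternating_0_iff ev_def smooth_functions_zero_off fun_eq_iff)

lemma wedge_fn: "wedge (fn f) om = (%p vs. f p * om p vs)"
 by (simp add: wedge_pw fn_def pw_scalar fun_eq_iff)

lemma forms_0_fn: "om \<in> forms M 0 ==> om = fn (ev om [])"
 by (simp add: fn_def ev_def fun_eq_iff forms_wrong_length)

lemma ct_d_fn: "f \<in> F ==> X \<in> VF ==> ct X (d (fn f)) = fn (%p. X p f)"
proof -
 assume f: "f \<in> F" and X: "X \<in> VF"
 have "ev (ct X (d (fn f))) [] = (%p. X p f)"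
  using X by (simp add: ev_ct ev_d[OF fn_forms[OF f]] E_singleton fun_eq_iff) (simp add: ev_def fn_def)
 with forms_0_fn[OF ct_forms[OF X d_forms[OF fn_forms[OF f]]]] show ?thesis by simp
qed

lemma cn_d_fn:
 assumes f: "f \<in> F" and p: "p \<in> S" and v: "v \<in> T p"
 shows "cn v (d (fn f) p) = (%vs. if vs = [] then v f else 0)"
proof -
 obtain X where X: "X \<in> VF" "X p = v" using vector_field_extension[OF p v] by blast
 have "cn (X p) (d (fn f) p) = fn (%p. X p f) p"
  using fun_cong[OF ct_d_fn[OF f X(1)], of p] by (simp add: ct_def)
 moreover have "fn (%p. X p f) p = (%vs. if vs = [] then v f else 0)"
  by (rule ext) (simp add: fn_def X(2))
 ultimately show ?thesis unfolding X(2) by (rule trans)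
qed

lemma df_forms: "f \<in> F ==> om \<in> forms M k ==> df f om \<in> forms M (Suc k)"
 unfolding df_def using wedge_forms[OF d_forms[OF fn_forms], of f om k] by simp

lemma df_linear:
 "df f (om + et) = df f om + df f et" "df f (om - et) = df f om - df f et" "df f (c *r om) = c *r df f om" "df f 0 = 0"
 by (simp_all add: df_def wedge_linear)

lemma df_uminus: "df f (- om) = - df f om"
 using df_linear(3)[of f "-1" om] by simp

lemma ct_df: "f \<in> F ==> X \<in> VF ==> ct X (df f om) = wedge (fn (%p. X p f)) om - df f (ct X om)"
 unfolding df_def by (simp add: ct_wedge[OF d_forms[OF fn_forms]] ct_d_fn)

lemma d_df: "f \<in> F ==> om \<in> forms M k ==> d (df f om) = - df f (d om)"
 unfolding df_def by (simp add: d_wedge[OF d_forms[OF fn_forms]] d_d[OF fn_forms] wedge_linear)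

lemma L_fn: "f \<in> F ==> X \<in> VF ==> L X (fn f) = fn (%p. X p f)"
 unfolding L_def by (simp add: ct_d_fn ct_forms_0[OF fn_forms] d_zero)

lemma L_fn_wedge:
 assumes "h \<in> F" "X \<in> VF" "om \<in> forms M k"
 shows "L X (wedge (fn h) om) = wedge (fn (%p. X p h)) om + wedge (fn h) (L X om)"
 using L_wedge[OF fn_forms[OF assms(1)] assms(3,2)] by (simp add: L_fn assms)

lemma L_df:
 assumes g: "g \<in> F" and X: "X \<in> VF" and om: "om \<in> forms M k"
 shows "L X (df g om) = df (%p. X p g) om + df g (L X om)"
proof -
 have "L X (d (fn g)) = d (fn (%p. X p g))"
  by (simp add: L_def ct_d_fn[OF g X] d_d[OF fn_forms[OF g]] ct_zero)
 then show ?thesis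
  unfolding df_def using L_wedge[OF d_forms[OF fn_forms[OF g]] om X] by simp
qed

lemma ham_terms: "ham f p = (\<Sum>uw\<leftarrow>bivector_terms p. fst uw f *r snd uw - snd uw f *r fst uw)"
 by (rule ext) (simp add: ham_def bivector_eval sum_list_fun_apply case_prod_unfold mult.commute)

lemma ham_VF:
 assumes f: "f \<in> F" shows "ham f \<in> VF"
proof -
 have "ham f p \<in> T p" for p
 proof -
  have "(\<Sum>uw\<leftarrow>l. fst uw f *r snd uw - snd uw f *r fst uw) \<in> T p" if "set l \<subseteq> T p \<times> T p" for l
   using that
  proof (induction l)
   case Nil
   then show ?case using subspace_0[OF tangent_subspace] by (simp add: zero_fun_def[symmetric])
  next
   case (Cons uw l)
   then have sub: "set l \<subseteq> T p \<times> T p" and "fst uw \<in> T p" "snd uw \<in> T p" by auto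
   with Cons.IH[OF sub] show ?case
    unfolding list.map sum_list.Cons
    by (intro subspace_add[OF tangent_subspace] subspace_diff[OF tangent_subspace] subspace_scale[OF tangent_subspace])
  qed
  from this[OF bivector_terms_subset] show ?thesis unfolding ham_terms .
 qed
 moreover have "ham f p = 0" if "p \<notin> S" for p
  using bivector_off[OF that] by (simp add: ham_def fun_eq_iff)
 moreover have "(%p. ham f p g) \<in> F" if "g \<in> F" for g
  using bivector_smooth[OF f that] by (simp add: ham_def)
 ultimately show ?thesis by (simp add: vector_fields_def)
qed

text \<open>The commutator of \<open>i\<^sub>\<pi>\<close> with \<open>df \<wedge>\<close> is the contraction with the Hamiltonian vector field of \<open>f\<close>.\<close>

lemma interior_product_df:
 assumes f: "f \<in> F" and om: "om \<in> forms M k"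
 shows "i\<pi> (df f om) = df f (i\<pi> om) + ct (ham f) om"
proof (intro ext)
 fix p vs
 show "i\<pi> (df f om) p vs = (df f (i\<pi> om) + ct (ham f) om) p vs"
 proof (cases "p \<in> S")
  case False
  then show ?thesis
   using forms_off[OF df_forms[OF f om] False] forms_off[OF om False] forms_off[OF df_forms[OF f interior_product_forms[OF om]] False]
   by (simp add: interior_product_eq cn_def ct_def)
 next
  case p: True
  note a = forms_alternating[OF om p]
  let ?al = "d (fn f) p"
  have deg: "of_degree 1 ?al" using forms_of_degree[OF d_forms[OF fn_forms[OF f]]] by simp
  have one: "cn v (pw ?al g) = (%vs. v f * g vs - pw ?al (cn v g) vs)" if "v \<in> T p" for v g
   using of_degree_bar[OF deg] by (simp add: cn_pw cn_d_fn[OF f p that] pw_scalar pw_linear)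
  have two: "cn w (cn u (pw ?al (om p))) vs = u f * cn w (om p) vs - w f * cn u (om p) vs + pw ?al (cn w (cn u (om p))) vs"
   if "u \<in> T p" "w \<in> T p" for u w
  proof -
   have "cn w (cn u (pw ?al (om p))) vs = u f * cn w (om p) vs - cn w (pw ?al (cn u (om p))) vs"
    unfolding one[OF that(1)] by (simp add: cn_def)
   then show ?thesis by (simp add: one[OF that(2)])
  qed
  have ham: "ct (ham f) om p vs = (\<Sum>uw\<leftarrow>bivector_terms p. fst uw f * cn (snd uw) (om p) vs - snd uw f * cn (fst uw) (om p) vs)"
  proof -
   have "cn (\<Sum>uw\<leftarrow>l. fst uw f *r snd uw - snd uw f *r fst uw) (om p) vs =
     (\<Sum>uw\<leftarrow>l. fst uw f * cn (snd uw) (om p) vs - snd uw f * cn (fst uw) (om p) vs) \<and>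
     (\<Sum>uw\<leftarrow>l. fst uw f *r snd uw - snd uw f *r fst uw) \<in> T p" if "set l \<subseteq> T p \<times> T p" for l
    using that
   proof (induction l)
    case Nil
    have "cn 0 (om p) = (%vs. 0 * cn 0 (om p) vs)"
     using cn_linear(2)[OF a subspace_0[OF tangent_subspace] subspace_0[OF tangent_subspace] tangent_subspace, of 0] by simp
    then show ?case using subspace_0[OF tangent_subspace] by (simp add: fun_eq_iff zero_fun_def[symmetric])
   next
    case (Cons uw l)
    obtain u w where uw: "uw = (u, w)" "u \<in> T p" "w \<in> T p" using Cons.prems by auto
    have wu: "u f *r w \<in> T p" "- w f *r u \<in> T p" 
     by (rule subspace_scale[OF tangent_subspace uw(3)], rule subspace_scale[OF tangent_subspace uw(2)])
    have sub: "set l \<subseteq> T p \<times> T p" using Cons.prems by auto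
    note l = conjunct2[OF Cons.IH[OF sub]] and IH = conjunct1[OF Cons.IH[OF sub]]
    have e: "u f *r w - w f *r u = u f *r w + - w f *r u" by simp
    have t: "u f *r w - w f *r u \<in> T p" unfolding e by (rule subspace_add[OF tangent_subspace wu])
    have c: "cn (u f *r w - w f *r u) (om p) vs = u f * cn w (om p) vs - w f * cn u (om p) vs"
     unfolding e cn_linear(1)[OF a wu tangent_subspace] cn_linear(2)[OF a uw(3,3) tangent_subspace]
      cn_linear(2)[OF a uw(2,2) tangent_subspace] by simp
    show ?case
     unfolding list.map sum_list.Cons uw(1) fst_conv snd_conv cn_linear(1)[OF a t l tangent_subspace] IH c
     by (intro conjI refl subspace_add[OF tangent_subspace t l])
   qed
   from conjunct1[OF this[OF bivector_terms_subset]] show ?thesis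
    unfolding ct_def ham_terms .
  qed
  have "i\<pi> (df f om) p vs = (\<Sum>uw\<leftarrow>bivector_terms p. (fst uw f * cn (snd uw) (om p) vs - snd uw f * cn (fst uw) (om p) vs)
    + pw ?al (cn (snd uw) (cn (fst uw) (om p))) vs)"
   unfolding interior_product_eq df_def wedge_pw
   by (intro arg_cong[where f = sum_list] map_cong refl two) (use bivector_terms_tangent[of _ _ p] in auto)
  also have "... = ct (ham f) om p vs + df f (i\<pi> om) p vs"
   by (simp add: sum_list_addf ham df_def wedge_interior_product(2)) (simp add: wedge_pw ct_def)
  finally show ?thesis by simp
 qed
qed

lemma interior_product_fn:
 assumes "h \<in> F" shows "i\<pi> (wedge (fn h) om) = wedge (fn h) (i\<pi> om)"
 by (simp add: wedge_fn fun_eq_iff interior_product_eq cn_def sum_list_const_mult)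

text \<open>
  \<open>[\<pi>, \<pi>] = 0\<close> is the Jacobi identity of the bracket \<open>{f, g} = \<pi>(f, g)\<close>.
\<close>
lemma poisson_jacobi:
 "\<pi> p [%q. \<pi> q [f, g], h] - \<pi> p [%q. \<pi> q [f, h], g] + \<pi> p [%q. \<pi> q [g, h], f] = 0"
proof -
 have J: "schouten_bracket 2 2 \<pi> \<pi> p [f, g, h] = 0"
  using poisson by (simp add: poisson_manifold_def)
 have S: "{S. S \<subseteq> {..<2 + 2 - 1} \<and> card S = 2} = {{0, 1}, {0, 2}, {1, 2 :: nat}}"
 proof -
  have "{..<2 + 2 - 1} = {0, 1, 2 :: nat}" by auto
  moreover have "S \<in> {{0, 1}, {0, 2}, {1, 2 :: nat}}" if S: "S \<subseteq> {0, 1, 2}" "card S = 2" for S :: "nat set"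
  proof -
   obtain x y where xy: "S = {x, y}" "x \<noteq> y" using S(2) by (auto simp: card_2_iff)
   have "x = 0 \<or> x = 1 \<or> x = 2" "y = 0 \<or> y = 1 \<or> y = 2" using S(1) xy(1) by simp_all
   then show ?thesis
    using xy(2) unfolding xy(1) by (elim disjE) (simp_all add: doubleton_eq_iff)
  qed
  moreover have "S \<subseteq> {0, 1, 2} \<and> card S = 2" if "S \<in> {{0, 1}, {0, 2}, {1, 2 :: nat}}" for S
   using that by auto
  ultimately show ?thesis by (intro set_eqI iffI) (simp_all only: mem_Collect_eq)
 qed
 have sg: "shuffle_sign (2 + 2 - 1) {0, 1} = 1" "shuffle_sign (2 + 2 - 1) {0, 2} = -1" "shuffle_sign (2 + 2 - 1) {1, 2} = 1"
 proof -
  have "{(i, j). i \<in> {0, 1} \<and> j \<in> {..<2 + 2 - 1} - {0, 1} \<and> j < i} = ({} :: (nat \<times> nat) set)" by auto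
  then show "shuffle_sign (2 + 2 - 1) {0, 1} = 1" by (simp only: shuffle_sign_def card.empty power_0)
  have "{(i, j). i \<in> {0, 2} \<and> j \<in> {..<2 + 2 - 1} - {0, 2} \<and> j < i} = {(2, 1 :: nat)}" by auto
  then show "shuffle_sign (2 + 2 - 1) {0, 2} = -1" by (simp only: shuffle_sign_def) simp
  have "{(i, j). i \<in> {1, 2} \<and> j \<in> {..<2 + 2 - 1} - {1, 2} \<and> j < i} = {(1, 0), (2, 0 :: nat)}" by auto
  then show "shuffle_sign (2 + 2 - 1) {1, 2} = 1" by (simp only: shuffle_sign_def) simp
 qed
 have c: "nths [f, g, h] A = (if 0 \<in> A then [f] else []) @ (if 1 \<in> A then [g] else []) @ (if 2 \<in> A then [h] else [])" for A
  by (simp add: nths_Cons numeral_2_eq_2)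
 have n: "nths [f, g, h] {0, 1} = [f, g]" "nths [f, g, h] (- {0, 1}) = [h]" "nths [f, g, h] {0, 2} = [f, h]"
  "nths [f, g, h] (- {0, 2}) = [g]" "nths [f, g, h] {1, 2} = [g, h]" "nths [f, g, h] (- {1, 2}) = [f]"
  unfolding c by simp_all
 have sum3: "(\<Sum>S\<in>{{0, 1}, {0, 2}, {1, 2 :: nat}}. t S) = t {0, 1} + t {0, 2} + t {1, 2}" for t :: "nat set => real"
 proof -
  have "{0, 1} \<noteq> {0, 2 :: nat}" "{0, 1} \<noteq> {1, 2 :: nat}" "{0, 2} \<noteq> {1, 2 :: nat}"
   by (simp_all add: doubleton_eq_iff)
  then show ?thesis by simp
 qed
 have k: "ksign ((int 2 - 1) * (int 2 - 1)) = -1" by (simp add: ksign_def)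
 have l3: "length [f, g, h] = 2 + 2 - 1" by simp
 show ?thesis
  using J unfolding schouten_bracket_def if_P[OF l3] S sum3 sg n k by simp
qed

lemma lie_bracket_ham:
 assumes f: "f \<in> F" and g: "g \<in> F" shows "lie_bracket (ham f) (ham g) = ham (%p. ham f p g)"
proof (intro ext)
 fix p h
 have sw: "\<pi> p [a, b] = - \<pi> p [b, a]" for p a b
  by (simp add: bivector_eval uminus_sum_list_map case_prod_unfold o_def)
 have "\<pi> p [f, %q. \<pi> q [g, h]] - \<pi> p [g, %q. \<pi> q [f, h]] = \<pi> p [%q. \<pi> q [f, g], h]"
  using poisson_jacobi[of p f g h] sw[of p f "%q. \<pi> q [g, h]"] sw[of p g "%q. \<pi> q [f, h]"] by simp
 then show "lie_bracket (ham f) (ham g) p h = ham (%p. ham f p g) p h"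
  by (simp add: lie_bracket_def ham_def)
qed

section \<open>Operators determined by their commutators\<close>

text \<open>In a frame \<open>\<Sum>\<^sub>b dx\<^sub>b \<wedge> \<iota>(X\<^sub>b) om\<close> is the degree of \<open>om\<close> times \<open>om\<close>.\<close>

lemma euler_identity:
 assumes x: "!!b. b \<in> B ==> x b \<in> F" and X: "!!b. b \<in> B ==> X b \<in> VF" and rh: "rh \<in> F"
  and ex: "!!q v. q \<in> S ==> v \<in> T q ==> rh q *r v = (\<Sum>b\<in>B. v (x b) *r X b q)"
  and om: "om \<in> forms M k"
 shows "(\<Sum>b\<in>B. df (x b) (ct (X b) om)) = real k *r wedge (fn rh) om"
 using om
proof (induction k arbitrary: om)
 case (0 om)
 then have "df (x b) (ct (X b) om) = 0" for b by (simp only: ct_forms_0 df_linear)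
 then show ?case by simp
next
 case (Suc k om)
 note om = Suc.prems
 have l: "(\<Sum>b\<in>B. df (x b) (ct (X b) om)) \<in> forms M (Suc k)"
  using df_forms[OF x ct_forms[OF X om]] by (intro subspace_sum[OF forms_subspace]) auto
 have r: "real (Suc k) *r wedge (fn rh) om \<in> forms M (Suc k)"
  using wedge_forms[OF fn_forms[OF rh] om] by (intro forms_scale) simp
 show ?case
 proof (rule forms_Suc_eqI[OF l r])
  fix Y assume Y: "Y \<in> VF"
  have ct_sum: "ct Y (\<Sum>b\<in>B. f b) = (\<Sum>b\<in>B. ct Y (f b))" for f
  proof (induction B rule: infinite_finite_induct)
   case (insert b B)
   show ?case unfolding sum.insert[OF insert(1,2)] ct_add insert(3) ..
  qed (simp_all only: sum.empty sum.infinite ct_zero not_False_eq_True)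
  have 1: "ct Y (df (x b) (ct (X b) om)) = wedge (fn (%p. Y p (x b))) (ct (X b) om) + df (x b) (ct (X b) (ct Y om))" if "b \<in> B" for b
   by (simp add: ct_df[OF x[OF that] Y] ct_swap[OF om, of Y "X b"] df_linear df_uminus)
  have 2: "(\<Sum>b\<in>B. wedge (fn (%p. Y p (x b))) (ct (X b) om)) = wedge (fn rh) (ct Y om)"
  proof (intro ext)
   fix p vs
   show "(\<Sum>b\<in>B. wedge (fn (%p. Y p (x b))) (ct (X b) om)) p vs = wedge (fn rh) (ct Y om) p vs"
   proof (cases "p \<in> S \<and> set vs \<subseteq> T p")
    case True
    then have p: "p \<in> S" and vs: "set vs \<subseteq> T p" by auto
    note a = forms_alternating[OF om p]
    have "om p ((rh p *r Y p) # vs) = (\<Sum>b\<in>B. Y p (x b) * om p (X b p # vs))"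
     unfolding ex[OF p VF_at[OF Y p]]
     by (rule alternating_expansion[OF tangent_subspace a vs]) (use VF_at[OF X p] in auto)
    moreover have "om p ((rh p *r Y p) # vs) = rh p * om p (Y p # vs)"
     using linear_onD(2)[OF alternating_linear_Cons[OF a vs] VF_at[OF Y p], of "rh p"] by simp
    ultimately show ?thesis by (simp add: sum_fun_apply wedge_fn ct_def cn_def)
   next
    case False
    have "om p (v # vs) = 0" for v
     using False forms_off[OF om] alternating_outside[OF forms_alternating[OF om], of p "v # vs"] by auto
    then show ?thesis by (simp add: sum_fun_apply wedge_fn ct_def cn_def)
   qed
  qed
  have 3: "ct Y (real (Suc k) *r wedge (fn rh) om) = real (Suc k) *r wedge (fn rh) (ct Y om)"
   by (simp add: wedge_fn ct_def cn_def fun_eq_iff)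
  show "ct Y (\<Sum>b\<in>B. df (x b) (ct (X b) om)) = ct Y (real (Suc k) *r wedge (fn rh) om)"
   unfolding ct_sum 3 using Suc.IH[OF ct_forms[OF Y om]] 1 2
   by (simp add: sum.distrib scaleR_add_left) (simp add: fun_eq_iff)
 qed
qed

text \<open>
  Forms are locally sums of products \<open>df \<and> \<dots>\<close>.  Hence an operator that is linear over functions, commutes
  with all \<open>df \<and>\<close> up to a constant, and vanishes on functions is zero; the Euler identity carries the
  induction on the degree.
\<close>
lemma operator_vanishes:
 assumes add: "!!k om et. om \<in> forms M k ==> et \<in> forms M k ==> Op (om + et) = Op om + Op et"
  and fnl: "!!k om h. om \<in> forms M k ==> h \<in> F ==> Op (wedge (fn h) om) = wedge (fn h) (Op om)"
  and dfl: "!!k om g. om \<in> forms M k ==> g \<in> F ==> Op (df g om) = c *r df g (Op om)"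
  and zero: "!!om. om \<in> forms M 0 ==> Op om = 0"
  and off: "!!k om p vs. om \<in> forms M k ==> p \<notin> S ==> Op om p vs = 0"
  and om: "om \<in> forms M k"
 shows "Op om = (0 :: 'm form)"
 using om
proof (induction k arbitrary: om)
 case (Suc k om)
 note om = Suc.prems
 have "Op om p vs = 0" for p vs
 proof (cases "p \<in> S")
  case True
  obtain B :: "'e set" and x X rh where f0: "\<forall>b\<in>B. x b \<in> F \<and> X b \<in> VF" and rh: "rh \<in> F"
   and N: "\<exists>N. openin (mtop M) N \<and> p \<in> N \<and> (\<forall>q\<in>N. rh q = 1)"
   and ex: "\<forall>q\<in>S. \<forall>v\<in>T q. rh q *r v = (\<Sum>b\<in>B. v (x b) *r X b q)"
   using local_frame[OF True] by blast
  have Op_sum: "Op (\<Sum>b\<in>B. f b) = (\<Sum>b\<in>B. Op (f b)) \<and> (\<Sum>b\<in>B. f b) \<in> forms M (Suc k)"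
   if "!!b. b \<in> B ==> f b \<in> forms M (Suc k)" for f B
   using that
  proof (induction B rule: infinite_finite_induct)
   case (insert b B)
   then have "f b \<in> forms M (Suc k)" and B: "Op (sum f B) = (\<Sum>b\<in>B. Op (f b))" "sum f B \<in> forms M (Suc k)"
    by auto
   then show ?case unfolding sum.insert[OF insert(1,2)] B(1)[symmetric]
    by (intro conjI add[of _ "Suc k"] forms_add)
  qed (simp_all only: sum.empty sum.infinite zero[OF forms_zero(1)] forms_zero simp_thms if_False if_True not_False_eq_True)
  have "real (Suc k) *r wedge (fn rh) om = wedge (fn (%p. real (Suc k) * rh p)) om"
   by (simp add: wedge_fn fun_eq_iff)
  then have "wedge (fn (%p. real (Suc k) * rh p)) (Op om) = Op (\<Sum>b\<in>B. df (x b) (ct (X b) om))"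
   using euler_identity[of B x X rh om "Suc k"] f0 rh ex om fnl[OF om cmult_smooth[OF rh, of "real (Suc k)"]] by simp
  also have "... = (\<Sum>b\<in>B. Op (df (x b) (ct (X b) om)))"
   using Op_sum[of B "%b. df (x b) (ct (X b) om)"] df_forms[OF _ ct_forms[OF _ om]] f0 by blast
  also have "... = 0"
  proof (rule sum.neutral, rule ballI)
   fix b assume b: "b \<in> B"
   then have "ct (X b) om \<in> forms M k" using f0 ct_forms[OF _ om] by blast
   moreover have "x b \<in> F" using f0 b by blast
   ultimately show "Op (df (x b) (ct (X b) om)) = 0"
    by (simp only: dfl Suc.IH df_linear scaleR_zero_right)
  qed
  finally have "wedge (fn (%p. real (Suc k) * rh p)) (Op om) = 0" .
  from fun_cong[OF fun_cong[OF this, of p], of vs] have "real (Suc k) * rh p * Op om p vs = 0"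
   by (simp add: wedge_fn)
  moreover have "rh p = 1" using N by auto
  ultimately show ?thesis by simp
 qed (rule off[OF om])
 then show ?case by (simp add: fun_eq_iff)
qed (rule zero)

lemma L_ham_interior_product:
 assumes f: "f \<in> F" and om: "om \<in> forms M k"
 shows "L (ham f) (i\<pi> om) = i\<pi> (L (ham f) om)"
proof -
 note X = ham_VF[OF f]
 have off: "et p vs = 0" if "et \<in> forms M l" "p \<notin> S" for et l p vs using forms_off[OF that] .
 have "L (ham f) (i\<pi> om) - i\<pi> (L (ham f) om) = 0"
 proof (rule operator_vanishes[where Op = "%om. L (ham f) (i\<pi> om) - i\<pi> (L (ham f) om)" and c = 1, OF _ _ _ _ _ om])
  fix k om et h g and p :: 'm and vs
  assume om: "om \<in> forms M k"
  note i_om = interior_product_forms[OF om]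
  show "L (ham f) (i\<pi> (om + et)) - i\<pi> (L (ham f) (om + et)) =
    L (ham f) (i\<pi> om) - i\<pi> (L (ham f) om) + (L (ham f) (i\<pi> et) - i\<pi> (L (ham f) et))" if "et \<in> forms M k"
   by (simp add: interior_product_linear L_add[OF X i_om interior_product_forms[OF that]] L_add[OF X om that])
  show "L (ham f) (i\<pi> (wedge (fn h) om)) - i\<pi> (L (ham f) (wedge (fn h) om)) =
    wedge (fn h) (L (ham f) (i\<pi> om) - i\<pi> (L (ham f) om))" if h: "h \<in> F"
   by (simp add: interior_product_fn h VF_smooth[OF X] L_fn_wedge[OF h X i_om] L_fn_wedge[OF h X om] interior_product_linear wedge_linear)
  show "L (ham f) (i\<pi> (df g om)) - i\<pi> (L (ham f) (df g om)) =
    1 *r df g (L (ham f) (i\<pi> om) - i\<pi> (L (ham f) om))" if g: "g \<in> F"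
  proof -
   have h: "(%p. ham f p g) \<in> F" by (rule VF_smooth[OF X g])
   have m: "df g (i\<pi> om) \<in> forms M (k - 1)"
   proof (cases "k < 2")
    case True
    then show ?thesis by (simp only: interior_product_low[OF om] df_linear forms_zero)
   next
    case False
    then have "k - 1 = Suc (k - 2)" by simp
    then show ?thesis using df_forms[OF g i_om] by simp
   qed
   have "L (ham f) (i\<pi> (df g om)) = df (%p. ham f p g) (i\<pi> om) + df g (L (ham f) (i\<pi> om))
     + (ct (ham g) (L (ham f) om) + ct (ham (%p. ham f p g)) om)"
    by (simp only: interior_product_df[OF g om] L_add[OF X m ct_forms'[OF ham_VF[OF g] om]] L_df[OF g X i_om]
      L_ct[OF om X ham_VF[OF g]] lie_bracket_ham[OF f g])
   moreover have "i\<pi> (L (ham f) (df g om)) = df (%p. ham f p g) (i\<pi> om) + ct (ham (%p. ham f p g)) om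
     + (df g (i\<pi> (L (ham f) om)) + ct (ham g) (L (ham f) om))"
    by (simp only: L_df[OF g X om] interior_product_linear interior_product_df[OF h om]
      interior_product_df[OF g L_forms[OF X om]])
   ultimately show ?thesis by (simp only: df_linear scaleR_one) (simp add: fun_eq_iff)
  qed
  show "(L (ham f) (i\<pi> om) - i\<pi> (L (ham f) om)) p vs = 0" if "p \<notin> S"
   using off[OF L_forms[OF X i_om] that] off[OF interior_product_forms[OF L_forms[OF X om]] that] by simp
 next
  fix om assume om: "om \<in> forms M 0"
  show "L (ham f) (i\<pi> om) - i\<pi> (L (ham f) om) = 0"
   using interior_product_low[OF om] interior_product_low[OF L_forms[OF X om]] by (simp add: L_zero)
 qed
 then show ?thesis by simp
qed

text \<open>Writing \<open>i\<close>, \<open>e\<close>, \<open>\<iota>\<close>, \<open>\<L>\<close> for \<open>i\<^sub>\<pi>\<close>, \<open>df \<wedge>\<close> and the contraction and Lie derivative along the Hamiltonian field of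
  \<open>f\<close>, the relations \<open>d e = - e d\<close>, \<open>i e = e i + \<iota>\<close>, \<open>i \<iota> = \<iota> i\<close> give
  \<open>R e + e R = 2 (\<L> i - i \<L>) = 0\<close> for \<open>R = i i d - 2 i d i + d i i\<close>.\<close>

theorem interior_product_koszul:
 assumes om: "om \<in> forms M k"
 shows "i\<pi> (i\<pi> (d om)) - 2 *r i\<pi> (d (i\<pi> om)) + d (i\<pi> (i\<pi> om)) = 0"
proof -
 define R where "R om = i\<pi> (i\<pi> (d om)) - 2 *r i\<pi> (d (i\<pi> om)) + d (i\<pi> (i\<pi> om))" for om
 note ip = interior_product_forms
 have R_low: "R om = 0" if om: "om \<in> forms M k" and k: "k < 2" for om k
 proof -
  have 1: "i\<pi> (i\<pi> (d om)) = 0"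
   by (rule interior_product_low[OF ip[OF d_forms[OF om]]]) (use k in simp)
  show ?thesis
   unfolding R_def 1 interior_product_low[OF om k] d_zero interior_product_linear by simp
 qed
 have "R om = 0"
 proof (rule operator_vanishes[where Op = R and c = "-1", OF _ _ _ _ _ om])
  fix k om et h g and p :: 'm and vs
  assume om: "om \<in> forms M k"
  note i1 = ip[OF om] and i2 = ip[OF ip[OF om]] and d1 = d_forms[OF om]
  show "R (om + et) = R om + R et" if et: "et \<in> forms M k"
   unfolding R_def interior_product_linear d_add[OF om et] d_add[OF i1 ip[OF et]] d_add[OF i2 ip[OF ip[OF et]]]
   by (simp add: fun_eq_iff)
  show "R om p vs = 0" if "p \<notin> S"
   unfolding R_def
   using forms_off[OF ip[OF ip[OF d1]] that] forms_off[OF ip[OF d_forms[OF i1]] that] forms_off[OF d_forms[OF i2] that]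
   by simp
  show "R (wedge (fn h) om) = wedge (fn h) (R om)" if h: "h \<in> F"
  proof -
   have dh: "d (wedge (fn h) al) = df h al + wedge (fn h) (d al)" if "al \<in> forms M l" for al l
    using d_wedge[OF fn_forms[OF h] that] by (simp add: df_def)
   note e = interior_product_df[OF h]
   have 1: "i\<pi> (i\<pi> (d (wedge (fn h) om))) = df h (i\<pi> (i\<pi> om)) + ct (ham h) (i\<pi> om) + ct (ham h) (i\<pi> om) + wedge (fn h) (i\<pi> (i\<pi> (d om)))"
    unfolding dh[OF om] interior_product_linear e[OF om] e[OF i1] interior_product_ct[OF om] interior_product_fn[OF h] ..
   have 2: "i\<pi> (d (i\<pi> (wedge (fn h) om))) = df h (i\<pi> (i\<pi> om)) + ct (ham h) (i\<pi> om) + wedge (fn h) (i\<pi> (d (i\<pi> om)))"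
    unfolding interior_product_fn[OF h] dh[OF i1] interior_product_linear e[OF i1] ..
   have 3: "d (i\<pi> (i\<pi> (wedge (fn h) om))) = df h (i\<pi> (i\<pi> om)) + wedge (fn h) (d (i\<pi> (i\<pi> om)))"
    unfolding interior_product_fn[OF h] dh[OF i2] ..
   show ?thesis
    unfolding R_def 1 2 3 wedge_linear by (simp add: fun_eq_iff)
  qed
  show "R (df g om) = (-1) *r df g (R om)" if g: "g \<in> F"
  proof -
   let ?c = "ct (ham g)"
   note X = ham_VF[OF g]
   note e = interior_product_df[OF g] and de = d_df[OF g] and c = interior_product_ct
   have im: "i\<pi> (- al) = - i\<pi> al" for al using interior_product_linear(2)[of "-1" al] by simp
   have m: "df g al \<in> forms M (l - 1)" if "al \<in> forms M (l - 2)" "l < 2 ==> al = 0" for al l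
   proof (cases "l < 2")
    case True
    show ?thesis unfolding that(2)[OF True] df_linear by (rule forms_zero)
   next
    case False
    then have "l - 1 = Suc (l - 2)" by simp
    then show ?thesis using df_forms[OF g that(1)] by simp
   qed
   have 1: "i\<pi> (i\<pi> (d (df g om))) = - (df g (i\<pi> (i\<pi> (d om))) + ?c (i\<pi> (d om)) + ?c (i\<pi> (d om)))"
    unfolding de[OF om] im e[OF d1] interior_product_linear e[OF ip[OF d1]] c[OF d1] ..
   have dd: "d (df g (i\<pi> om) + ?c om) = - df g (d (i\<pi> om)) + d (?c om)"
    using d_add[OF m[OF i1 interior_product_low[OF om]] ct_forms'[OF X om]] de[OF i1] by simp
   have 2: "i\<pi> (d (i\<pi> (df g om))) = - (df g (i\<pi> (d (i\<pi> om))) + ?c (d (i\<pi> om))) + i\<pi> (d (?c om))"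
    unfolding e[OF om] dd interior_product_linear im e[OF d_forms[OF i1]] ..
   have ii: "i\<pi> (i\<pi> (df g om)) = df g (i\<pi> (i\<pi> om)) + 2 *r ?c (i\<pi> om)"
    unfolding e[OF om] interior_product_linear e[OF i1] c[OF om] by (simp add: fun_eq_iff)
   have "d (df g (i\<pi> (i\<pi> om)) + 2 *r ?c (i\<pi> om)) = d (df g (i\<pi> (i\<pi> om))) + d (2 *r ?c (i\<pi> om))"
    by (rule d_add[OF m[OF i2 interior_product_low[OF i1]] forms_scale[OF ct_forms'[OF X i1]]])
   then have 3: "d (i\<pi> (i\<pi> (df g om))) = - df g (d (i\<pi> (i\<pi> om))) + 2 *r d (?c (i\<pi> om))"
    unfolding ii de[OF i2] d_scale[OF ct_forms'[OF X i1]] .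
   have L: "?c (d (i\<pi> om)) + d (?c (i\<pi> om)) = ?c (i\<pi> (d om)) + i\<pi> (d (?c om))"
    using L_ham_interior_product[OF g om]
    unfolding L_def interior_product_linear c[OF d1] .
   have "R (df g om) = - df g (R om) + 2 *r ((?c (d (i\<pi> om)) + d (?c (i\<pi> om))) - (?c (i\<pi> (d om)) + i\<pi> (d (?c om))))"
    unfolding R_def 1 2 3 df_linear by (simp add: fun_eq_iff)
   then show ?thesis unfolding L by (simp add: fun_eq_iff)
  qed
 next
  fix om assume "om \<in> forms M 0"
  then show "R om = 0" by (rule R_low) simp
 qed
 then show ?thesis by (simp add: R_def)
qed

end

section \<open>Naturality and restriction of scalars\<close>

lemma homogeneous_map: "cochain_map A B f ==> homogeneous A ks xs ==> homogeneous B ks (map f xs)"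
 by (auto simp: homogeneous_iff cochain_map_def)

text \<open>A map compatible with product, operator and differential is compatible with the value of every tree.\<close>
lemma theta_natural:
 assumes "ebv_data A prd iop" "ebv_data B prd' iop'" and f: "cochain_map A B f"
  and fprd: "!!k l x y. x \<in> comps A k ==> y \<in> comps A l ==> f (prd x y) = prd' (f x) (f y)"
  and fiop: "!!k x. x \<in> comps A k ==> f (iop x) = iop' (f x)"
  and p: "p \<in> comps (arity ebv_operad n) r" and h: "homogeneous A ks xs" "length xs = n"
 shows "f (ebv_data.theta A prd iop p xs) = ebv_data.theta B prd' iop' p (map f xs)"
proof -
 interpret A: ebv_data A prd iop by fact
 interpret B: ebv_data B prd' iop' by fact
 have lin: "linear_map_on (comps A k) f" and fd: "x \<in> comps A k ==> f (differential A x) = differential B (f x)" for k x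
  using f by (auto simp: cochain_map_def)
 have fdi: "f (A.di x) = B.di (f x)" if x: "x \<in> comps A k" for x k
 proof -
  have "differential A (iop x) \<in> comps A (k - 1)" "iop (differential A x) \<in> comps A (k - 1)"
   using A.dA_comp[OF A.iop_comp[OF x]] A.iop_comp[OF A.dA_comp[OF x]] by (simp_all add: algebra_simps)
  then show ?thesis
   unfolding A.di_def B.di_def
   using linear_on_diff[OF A.V_subspace lin] fd[OF A.iop_comp[OF x]] fiop[OF x] fiop[OF A.dA_comp[OF x]] fd[OF x] by simp
 qed
 have e: "f (A.ev x k T) = B.ev (%a. f (x a)) k T" if "distinct (leaves T)" "A.hom x k (set (leaves T))" for x k T
  using that
 proof (induction T)
  case (Mu S T)
  then have h: "A.hom x k (set (leaves S))" "A.hom x k (set (leaves T))" and d: "distinct (leaves S)" "distinct (leaves T)"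
   by (auto simp: A.hom_def)
  note c = A.ev_comp[OF d(1) h(1)] A.ev_comp[OF d(2) h(2)]
  show ?case
   using Mu.IH(1)[OF d(1) h(1)] Mu.IH(2)[OF d(2) h(2)] linear_onD(2)[OF lin A.prd_comp[OF c]] fprd[OF c] by simp
 next
  case (Iop T)
  then show ?case using fiop[OF A.ev_comp, of T x k] by simp
 next
  case (DIop T)
  then show ?case using fdi[OF A.ev_comp, of T x k] by simp
 qed simp
 obtain y where y: "y \<in> hcomp n r" and py: "p = abs_ebv y" using p by (auto simp: ebv_operad_sel)
 have hx: "A.hom (nth xs) (nth ks) {..<n}" using A.hom_nth[OF h(1)] h(2) by simp
 have "f (A.theta p xs) = lin_ext (%T. f (A.evr n (nth xs) (nth ks) r T)) y"
  unfolding py A.theta_abs[OF h y] by (rule A.lin_ext_linear_on[OF A.V_subspace lin A.evr_comp[OF hx]])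
 also have "... = lin_ext (B.evr n (%a. f (xs ! a)) (nth ks) r) y"
 proof (rule lin_ext_cong)
  fix T
  show "f (A.evr n (nth xs) (nth ks) r T) = B.evr n (%a. f (xs ! a)) (nth ks) r T"
   using e[of T "nth xs" "nth ks"] hx linear_on_0[OF A.V_subspace lin] by (auto simp: A.evr_def B.evr_def tree_arity_def)
 qed
 also have "B.evr n (%a. f (xs ! a)) (nth ks) r = B.evr n (nth (map f xs)) (nth ks) r"
  by (rule B.evr_cong) (simp_all add: h(2))
 also have "lin_ext (B.evr n (nth (map f xs)) (nth ks) r) y = B.theta p (map f xs)"
  unfolding py by (rule B.theta_abs[symmetric]) (use homogeneous_map[OF f h(1)] h(2) y in auto)
 finally show ?thesis .
qed

lemma operad_morphismD:
 assumes "operad_morphism P Q ps"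
 shows "p \<in> comps (arity P n) k ==> ps n p \<in> comps (arity Q n) k" (is "PROP ?A")
  and "linear_map_on (comps (arity P n) k) (ps n)" (is "PROP ?B")
  and "p \<in> comps (arity P n) k ==> ps n (differential (arity P n) p) = differential (arity Q n) (ps n p)" (is "PROP ?C")
  and "ps 1 (op_unit P) = op_unit Q" (is "PROP ?D")
  and "i < m ==> p \<in> comps (arity P m) k ==> q \<in> comps (arity P n) l ==>
   ps (m + n - 1) (circ P m n i p q) = circ Q m n i (ps m p) (ps n q)" (is "PROP ?E")
  and "si permutes {..<n} ==> p \<in> comps (arity P n) k ==> ps n (perm_act P n si p) = perm_act Q n si (ps n p)" (is "PROP ?F")
proof -
 note a = assms[unfolded operad_morphism_def]
 note c = conjunct1[OF a, THEN spec, of n, unfolded cochain_map_def]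
 show "PROP ?A" "PROP ?C" using conjunct2[OF c] by blast+
 show "PROP ?B" using conjunct1[OF c] by blast
 show "PROP ?D" by (rule conjunct1[OF conjunct2[OF a]])
 show "PROP ?E" using conjunct1[OF conjunct2[OF conjunct2[OF a]]] by blast
 show "PROP ?F" using conjunct2[OF conjunct2[OF conjunct2[OF a]]] by blast
qed

lemma restrict_scalars_algebra:
 assumes "operad_algebra Q (A, al)" and ps: "operad_morphism P Q ps"
 shows "operad_algebra P (restrict_scalars ps (A, al))"
 unfolding operad_algebra_def restrict_scalars_def prod.case
proof (intro conjI allI impI ballI)
 note a = operad_algebraD[OF assms(1)] and m = operad_morphismD[OF ps]
 show "cochain_complex A" by (rule a)
 show "al (ps (length [x]) (op_unit P)) [x] = x" if "x \<in> comps A k" for k x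
  using a(7)[OF that] m(4) by simp
 show "linear_map_on (comps (arity P n) k) (%p. al (ps (length xs) p) xs)"
  if h: "length ks = n" "homogeneous A ks xs" for n k ks xs
 proof -
  have l: "length xs = n" using h by (simp add: homogeneous_iff)
  show ?thesis
   using a(2)[OF h(2) l, of k] m(2)[of n k] m(1)[of _ n k] unfolding l linear_map_on_def by simp
 qed
 fix n k ks xs p assume h: "length ks = n" "homogeneous A ks xs" and p: "p \<in> comps (arity P n) k"
 have l: "length xs = n" using h by (simp add: homogeneous_iff)
 note h = h(2) l and psp = m(1)[OF p]
 show "al (ps (length xs) p) xs \<in> comps A (k + sum_list ks)"
  unfolding l by (rule a(3)[OF h psp])
 show "linear_map_on (comps A (ks ! j)) (%x. al (ps (length (xs[j := x])) p) (xs[j := x]))" if "j < n" for j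
  unfolding length_list_update l by (rule a(4)[OF h psp that])
 show "differential A (al (ps (length xs) p) xs) = al (ps (length xs) (differential (arity P n) p)) xs +
   ksign k *r (\<Sum>j<n. ksign (sum_list (take j ks)) *r
    al (ps (length (xs[j := differential A (xs ! j)])) p) (xs[j := differential A (xs ! j)]))"
  unfolding length_list_update l m(3)[OF p] by (rule a(5)[OF h psp])
 show "al (ps (length xs) (perm_act P n si p)) xs =
   koszul_sign si ks *r al (ps (length (map (%j. xs ! si j) [0..<n])) p) (map (%j. xs ! si j) [0..<n])"
  if "si permutes {..<n}" for si
  unfolding l m(6)[OF that p] using a(6)[OF h psp that] by simp
next
 note a = operad_algebraD[OF assms(1)] and m = operad_morphismD[OF ps]
 fix m n i k l ks xs p q
 assume i: "i < m" and h: "length ks = m + n - 1" "homogeneous A ks xs"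
  and pq: "p \<in> comps (arity P m) k" "q \<in> comps (arity P n) l"
 have len: "length xs = m + n - 1" using h by (simp add: homogeneous_iff)
 have l: "length (take n (drop i xs)) = n" "length (take i xs @ v # drop (i + n) xs) = m" for v
  using len i by simp_all
 show "al (ps (length xs) (circ P m n i p q)) xs = ksign (l * sum_list (take i ks)) *r
   al (ps (length (take i xs @ al (ps (length (take n (drop i xs))) q) (take n (drop i xs)) # drop (i + n) xs)) p)
    (take i xs @ al (ps (length (take n (drop i xs))) q) (take n (drop i xs)) # drop (i + n) xs)"
  unfolding l len m(5)[OF i pq] by (rule a(8)[OF h(2) len i m(1)[OF pq(1)] m(1)[OF pq(2)]])
qed

lemma degree0_retraction_eq:
 assumes "dg_operad P" "p \<in> comps (arity P n) k"
 shows "degree0_retraction P n p = (if k = 0 then p else 0)"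
proof -
 have c: "cochain_complex (arity P n)" using assms(1) by (simp add: dg_operad_def Let_def)
 have "p = 0" if "k \<noteq> 0" "p \<in> comps (arity P n) 0"
 proof -
  have "(if k = k then p else - p) = 0"
   using c subspace_neg[OF cochain_complexD(1)[OF c] that(2)] that assms(2)
   unfolding cochain_complex_def graded_space_def
   by (elim conjE allE[of _ "{k, 0}"] allE[of _ "%j. if j = k then p else - p"]) simp
  then show ?thesis by simp
 qed
 then show ?thesis using assms(2) by (auto simp: degree0_retraction_def degree0_suboperad_def)
qed

lemma dg_operadD:
 assumes "dg_operad P"
 shows "cochain_complex (arity P n)" (is "PROP ?A") "op_unit P \<in> comps (arity P 1) 0" (is "PROP ?B")
  and "i < m ==> p \<in> comps (arity P m) k ==> q \<in> comps (arity P n) l ==>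
   circ P m n i p q \<in> comps (arity P (m + n - 1)) (k + l) \<and> linear_map_on (comps (arity P n) l) (circ P m n i p) \<and>
   linear_map_on (comps (arity P m) k) (%p. circ P m n i p q)" (is "PROP ?C")
  and "si permutes {..<n} ==> cochain_map (arity P n) (arity P n) (perm_act P n si)" (is "PROP ?D")
proof -
 note a = assms[unfolded dg_operad_def Let_def]
 note b = conjunct2[OF conjunct2[OF a]]
 show "PROP ?A" using conjunct1[OF a] by blast
 show "PROP ?B" by (rule conjunct1[OF conjunct2[OF a]])
 show "PROP ?C" using conjunct1[OF b] by blast
 show "PROP ?D" using conjunct1[OF conjunct2[OF conjunct2[OF conjunct2[OF conjunct2[OF b]]]]] by blast
qed

lemma degree0_retraction_morphism:
 assumes "graded_operad P" "nonpositively_graded P"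
 shows "operad_morphism P P (degree0_retraction P)"
 unfolding operad_morphism_def cochain_map_def
proof (intro conjI allI ballI impI)
 have P: "dg_operad P" and d0: "p \<in> comps (arity P n) k ==> differential (arity P n) p = 0" for p n k
  using assms(1) by (auto simp: graded_operad_def)
 note r = degree0_retraction_eq[OF P] and g = dg_operadD[OF P]
 note sub = cochain_complexD(1)[OF g(1)]
 show "linear_map_on (comps (arity P n) k) (degree0_retraction P n)" for n k
  using r[of _ n k] subspace_add[OF sub[of n k]] subspace_scale[OF sub[of n k]] by (auto simp: linear_map_on_def)
 show rc: "degree0_retraction P n p \<in> comps (arity P n) k" if "p \<in> comps (arity P n) k" for n k p
  using r[OF that] that subspace_0[OF sub] by (cases "k = 0") simp_all
 show "degree0_retraction P n (differential (arity P n) p) = differential (arity P n) (degree0_retraction P n p)"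
  if p: "p \<in> comps (arity P n) k" for n k p
  using d0[OF p] d0[OF rc[OF p]] r[OF subspace_0[OF sub], of n 0] by simp
 show "degree0_retraction P 1 (op_unit P) = op_unit P" using r[OF g(2)] by simp
 show "degree0_retraction P (m + n - 1) (circ P m n i p q) = circ P m n i (degree0_retraction P m p) (degree0_retraction P n q)"
  if i: "i < m" and p: "p \<in> comps (arity P m) k" and q: "q \<in> comps (arity P n) l" for m n i k l p q
 proof -
  note c = g(3)[OF i p q]
  have z: "circ P m n i 0 q = 0" "circ P m n i p 0 = 0" "circ P m n i 0 0 = 0"
   using c g(3)[OF i p subspace_0[OF sub]] linear_on_0[OF sub] by blast+
  have zl: "circ P m n i 0 q' = 0" if "q' \<in> comps (arity P n) l" for q'
   using g(3)[OF i p that] linear_on_0[OF sub] by blast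
  show ?thesis
  proof (cases "k = 0 \<and> l = 0")
   case True
   then show ?thesis using r[OF p] r[OF q] r[OF conjunct1[OF c]] by simp
  next
   case False
   have "degree0_retraction P (m + n - 1) (circ P m n i p q) = 0"
   proof (cases "k + l = 0")
    case True
    (* factors of opposite degrees: one of them has positive degree, hence is zero *)
    then have "0 < k \<or> 0 < l" using False by linarith
    then have "p = 0 \<or> q = 0" using p q assms(2) unfolding nonpositively_graded_def by blast
    then show ?thesis using z r[OF conjunct1[OF c]] by auto
   qed (use r[OF conjunct1[OF c]] in simp)
   then show ?thesis using z zl r[OF p] r[OF q] False by auto
  qed
 qed
 show "degree0_retraction P n (perm_act P n si p) = perm_act P n si (degree0_retraction P n p)"
  if s: "si permutes {..<n}" and p: "p \<in> comps (arity P n) k" for n k si p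
 proof -
  have "perm_act P n si p \<in> comps (arity P n) k" and l: "linear_map_on (comps (arity P n) k) (perm_act P n si)"
   using g(4)[OF s] p by (auto simp: cochain_map_def)
  then show ?thesis using r r[OF p] linear_on_0[OF sub l] by simp
 qed
qed

section \<open>Formality of the action\<close>

lemma tree_degree_nonpos: "tree_degree T \<le> 0"
 by (induction T) auto

context ebv_data
begin

lemma trivial_ebv_data: "ebv_data A prd (%x. 0)"
proof (rule ebv_data.intro)
 show "linear_map_on (V k) (%x. 0 :: 'a)" for k by (simp add: linear_map_on_def)
 show "0 = prd 0 z + ksign (l * m) *r prd 0 y + ksign (k * l + k * m) *r prd 0 x - prd (prd 0 y) z
   - ksign (k * l) *r prd (prd 0 x) z - ksign (k * m + l * m) *r prd (prd 0 x) y"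
  if "x \<in> V k" "y \<in> V l" "z \<in> V m" for k l m x y z
  using that by (simp add: prd_0_left)
qed ((rule cc prd_comp prd_linear_left prd_linear_right prd_assoc prd_commute leibniz V_0; assumption) | (simp add: dA_0))+

text \<open>
  The degree of a tree counts its operators, with negative weights.  With the zero operator, trees of
  nonzero degree therefore evaluate to zero, whereas those of degree zero only involve the product.
\<close>
lemma theta_degree_0:
 assumes p: "p \<in> comps (arity ebv_operad n) k" and h: "homogeneous A ks xs" "length xs = n"
 shows "ebv_data.theta A prd (%x. 0) p xs = (if k = 0 then theta p xs else 0)"
proof -
 interpret N: ebv_data A prd "%x. 0" by (rule trivial_ebv_data)
 have same: "N.ev x k T = ev x k T" if "tree_degree T = 0" for x k T
  using that
 proof (induction T)
  case (Mu S T)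
  then have "tree_degree S = 0" "tree_degree T = 0"
   using tree_degree_nonpos[of S] tree_degree_nonpos[of T] by auto
  with Mu show ?case by simp
 next
  case (Iop T)
  then show ?case using tree_degree_nonpos[of T] by simp
 next
  case (DIop T)
  then show ?case using tree_degree_nonpos[of T] by simp
 qed simp
 have zero: "N.ev x k T = 0" if "distinct (leaves T)" "hom x k (lf T)" "tree_degree T \<noteq> 0" for x k T
  using that
 proof (induction T)
  case (Mu S T)
  then have h: "hom x k (lf S)" "hom x k (lf T)" and d: "distinct (leaves S)" "distinct (leaves T)"
   by (auto simp: hom_def)
  have c: "N.ev x k S \<in> V (tree_degree S + lsum k S)" "N.ev x k T \<in> V (tree_degree T + lsum k T)"
   using N.ev_comp[OF d(1)] N.ev_comp[OF d(2)] h by (auto simp: N.hom_def hom_def)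
  have "tree_degree S \<noteq> 0 \<or> tree_degree T \<noteq> 0" using Mu.prems(3) by auto
  then show ?case
   using Mu.IH(1)[OF d(1) h(1)] Mu.IH(2)[OF d(2) h(2)] prd_0_left[OF c(2)] prd_0_right[OF c(1)] by auto
 qed (simp_all add: N.di_def dA_0)
 obtain y where y: "y \<in> hcomp n k" and py: "p = abs_ebv y" using p by (auto simp: ebv_operad_sel)
 have hx: "hom (nth xs) (nth ks) {..<n}" using hom_nth[OF h(1)] h(2) by simp
 have "N.evr n (nth xs) (nth ks) k = (if k = 0 then evr n (nth xs) (nth ks) k else (%T. 0))"
  unfolding N.evr_def evr_def using same zero hx by (auto simp: fun_eq_iff tree_arity_def)
 then show ?thesis
  unfolding py N.theta_abs[OF h y] theta_abs[OF h y] by simp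
qed

text \<open>
  At the end points \<open>1\<close> and \<open>0\<close> of the interval the operator \<open>t i\<close> becomes \<open>i\<close> and \<open>0\<close>,
  and the action on \<open>A\<close> with the zero operator is the trivial action.
\<close>
theorem action_quasi_isomorphic_trivial:
 fixes P :: "'p::real_vector operad"
 assumes P: "graded_operad P" "nonpositively_graded P" and ph: "operad_morphism P ebv_operad ph"
  and th: "is_ebv_structure A prd iop th"
 shows "quasi_isomorphic TYPE(nat => 'a) P (restrict_scalars ph (A, th)) (trivial_algebra P (restrict_scalars ph (A, th)))"
proof -
 let ?C_th = "ebv_data.theta path pprd piop"
 let ?C = "restrict_scalars ph (path, ?C_th)"
 have a: "operad_algebra ebv_operad (A, th)" using th by (simp add: is_ebv_structure_def)
 have algA: "operad_algebra P (restrict_scalars ph (A, th))" by (rule restrict_scalars_algebra[OF a ph])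
 have algC: "operad_algebra P ?C" by (rule restrict_scalars_algebra[OF ebv_data.theta_ebv_algebra[OF path_ebv_data] ph])
 have algT: "operad_algebra P (trivial_algebra P (restrict_scalars ph (A, th)))"
  using restrict_scalars_algebra[OF _ degree0_retraction_morphism[OF P]] algA
  unfolding trivial_algebra_def restrict_scalars_def by simp
 have P': "dg_operad P" using P(1) by (simp add: graded_operad_def)
 have unique: "th q ys = theta q ys" if "q \<in> comps (arity ebv_operad n) k" "homogeneous A ks ys" "length ys = n" for q n k ks ys
  by (rule ebv_structure_unique[OF th theta_is_ebv_structure that])
 have one: "algebra_quasi_iso P ?C (restrict_scalars ph (A, th))"
  unfolding algebra_quasi_iso_def
 proof (intro conjI exI[of _ at_one] algA algC)
  show "quasi_iso_map (fst ?C) (fst (restrict_scalars ph (A, th))) at_one"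
   using at_one_quasi_iso by (simp add: restrict_scalars_def)
  have f: "cochain_map path A at_one" using at_one_quasi_iso by (simp add: quasi_iso_map_def)
  show "algebra_morphism P ?C (restrict_scalars ph (A, th)) at_one"
   unfolding algebra_morphism_def restrict_scalars_def prod.case
  proof (intro conjI f allI impI ballI)
   fix n k ks xs p assume "length ks = n" and h: "homogeneous path ks xs" and p: "p \<in> comps (arity P n) k"
   then have l: "length xs = n" by (simp add: homogeneous_iff)
   note q = operad_morphismD(1)[OF ph p]
   have "at_one (?C_th (ph n p) xs) = theta (ph n p) (map at_one xs)"
    by (rule theta_natural[OF path_ebv_data ebv_data_axioms f _ _ q h l])
      (auto simp: path_sel at_one_pprd at_one_piop)
   then show "at_one (?C_th (ph (length xs) p) xs) = th (ph (length (map at_one xs)) p) (map at_one xs)"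
    using unique[OF q homogeneous_map[OF f h]] l by simp
  qed
 qed
 have zero: "algebra_quasi_iso P ?C (trivial_algebra P (restrict_scalars ph (A, th)))"
  unfolding algebra_quasi_iso_def
 proof (intro conjI exI[of _ at_zero] algT algC)
  show "quasi_iso_map (fst ?C) (fst (trivial_algebra P (restrict_scalars ph (A, th)))) at_zero"
   using at_zero_quasi_iso by (simp add: restrict_scalars_def trivial_algebra_def)
  have f: "cochain_map path A at_zero" using at_zero_quasi_iso by (simp add: quasi_iso_map_def)
  show "algebra_morphism P ?C (trivial_algebra P (restrict_scalars ph (A, th))) at_zero"
   unfolding algebra_morphism_def restrict_scalars_def trivial_algebra_def prod.case
  proof (intro conjI f allI impI ballI)
   fix n k ks xs p assume "length ks = n" and h: "homogeneous path ks xs" and p: "p \<in> comps (arity P n) k"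
   then have l: "length xs = n" by (simp add: homogeneous_iff)
   note q = operad_morphismD(1)[OF ph p] and h0 = homogeneous_map[OF f h]
   have l0: "length (map at_zero xs) = n" using l by simp
   have "at_zero (?C_th (ph n p) xs) = ebv_data.theta A prd (%x. 0) (ph n p) (map at_zero xs)"
    by (rule theta_natural[OF path_ebv_data trivial_ebv_data f _ _ q h l])
      (auto simp: path_sel at_zero_pprd at_zero_piop)
   also have "... = (if k = 0 then th (ph n p) (map at_zero xs) else 0)"
    unfolding theta_degree_0[OF q h0 l0] unique[OF q h0 l0] ..
   also have "... = th (ph n (degree0_retraction P n p)) (map at_zero xs)"
   proof -
    have "ph n 0 = 0"
     by (rule linear_on_0[OF cochain_complexD(1)[OF dg_operadD(1)[OF P']] operad_morphismD(2)[OF ph]])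
    moreover have "subspace (comps (arity ebv_operad n) 0)"
     unfolding ebv_operad_sel subspace_def
     using subspace_0[OF hcomp_subspace] subspace_add[OF hcomp_subspace] subspace_scale[OF hcomp_subspace]
     by (auto simp: abs_ebv_add abs_ebv_scale abs_ebv_0[symmetric])
    from linear_on_0[OF this operad_algebra_linear[OF a h0 l0]] have "th 0 (map at_zero xs) = 0" .
    ultimately show ?thesis using degree0_retraction_eq[OF P' p] by simp
   qed
   finally show "at_zero (?C_th (ph (length xs) p) xs) =
     th (ph (length (map at_zero xs)) (degree0_retraction P (length (map at_zero xs)) p)) (map at_zero xs)"
    using l by simp
  qed
 qed
 show ?thesis
  unfolding quasi_isomorphic_def zigzag_link_def using one zero by blast
qed

end

section \<open>The de Rham complex of a Poisson manifold\<close>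

lemma ksign_int: "ksign (int n) = (-1) ^ n"
 by (simp add: ksign_def)

context smooth_mfd
begin

abbreviation Om :: "int => 'm form set" where "Om \<equiv> comps (de_rham M)"

lemma de_rham_diff: "differential (de_rham M) = d"
 by (simp add: de_rham_def)

lemma Om_int: "Om (int n) = forms M n"
 by (simp add: de_rham_def)

lemma Om_cases:
 assumes "om \<in> Om k" obtains "om = 0" | n where "k = int n" "om \<in> forms M n"
proof (cases "k < 0")
 case True
 then show ?thesis using assms that(1) by (simp add: de_rham_def)
next
 case False
 then obtain n where n: "k = int n" using nonneg_int_cases[of k] by auto
 then show ?thesis using assms that(2)[OF n] by (simp add: de_rham_def)
qed

lemma Om_subspace: "subspace (Om k)"
 using forms_subspace by (simp add: de_rham_def)

lemma Om_off: "om \<in> Om k ==> int (length vs) \<noteq> k ==> om p vs = 0"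
 by (erule Om_cases) (auto simp: forms_wrong_length)

lemma de_rham_complex: "cochain_complex (de_rham M)"
 unfolding cochain_complex_def graded_space_def de_rham_diff
proof (intro conjI allI impI ballI Om_subspace)
 fix K and x :: "int => 'm form" and k
 assume K: "finite K" "\<forall>k\<in>K. x k \<in> Om k" "(\<Sum>k\<in>K. x k) = 0" "k \<in> K"
 show "x k = 0"
 proof (intro ext)
  fix p vs
  show "x k p vs = 0 p vs"
  proof (cases "int (length vs) = k")
   case True
   have "0 = (\<Sum>k\<in>K. x k p vs)" using K(3) by (simp add: sum_fun_apply fun_eq_iff)
   also have "... = (\<Sum>j\<in>K. if j = k then x k p vs else 0)"
    using K(2) True by (intro sum.cong refl) (auto intro!: Om_off)
   finally show ?thesis using K(1,4) by simp
  qed (use K(2,4) Om_off in auto)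
 qed
next
 show "linear_map_on (Om k) d" for k
  unfolding linear_map_on_def
 proof (intro conjI ballI allI)
  fix om et assume "om \<in> Om k" "et \<in> Om k"
  then show "d (om + et) = d om + d et"
   by (elim Om_cases) (auto simp: d_zero d_add)
 next
  fix c om assume "om \<in> Om k"
  then show "d (c *r om) = c *r d om" by (elim Om_cases) (auto simp: d_zero d_scale)
 qed
 show "d om \<in> Om (k + 1)" if "om \<in> Om k" for k om
  using that
 proof (cases rule: Om_cases)
  case (2 n)
  then show ?thesis using d_forms[OF 2(2)] Om_int[of "Suc n"] by (simp add: add.commute)
 qed (simp add: d_zero subspace_0[OF Om_subspace])
 show "d (d om) = 0" if "om \<in> Om k" for k om
  using that by (elim Om_cases) (auto simp: d_zero d_d)
qed

lemma Om_wedge: "om \<in> Om k ==> et \<in> Om l ==> wedge om et \<in> Om (k + l)"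
 using wedge_forms Om_int[of "_ + _"]
 by (elim Om_cases) (simp_all add: wedge_linear subspace_0[OF Om_subspace])

lemma Om_commute:
 assumes "om \<in> Om k" "et \<in> Om l" shows "wedge om et = ksign (k * l) *r wedge et om"
proof (cases rule: Om_cases[OF assms(1)])
 case om: (2 n)
 show ?thesis
 proof (cases rule: Om_cases[OF assms(2)])
  case (2 m)
  have "ksign (k * l) = (-1) ^ (n * m)" using ksign_int[of "n * m"] om(1) 2(1) by simp
  then show ?thesis using wedge_commute[OF om(2) 2(2)] by (simp only:)
 qed (simp add: wedge_linear)
qed (simp add: wedge_linear)

lemma Om_leibniz: "om \<in> Om k ==> et \<in> Om l ==> d (wedge om et) = wedge (d om) et + ksign k *r wedge om (d et)"
 by (elim Om_cases) (auto simp: wedge_linear d_wedge d_zero ksign_int)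

end

context poisson_mfd
begin

lemma Om_interior_product: "om \<in> Om k ==> i\<pi> om \<in> Om (k - 2)"
proof (elim Om_cases)
 fix n assume n: "k = int n" "om \<in> forms M n"
 show ?thesis
 proof (cases "n < 2")
  case False
  then have "k - 2 = int (n - 2)" using n by simp
  then show ?thesis using interior_product_forms[OF n(2)] by (simp only: Om_int)
 qed (simp add: interior_product_low[OF n(2)] subspace_0[OF Om_subspace])
qed (simp add: interior_product_linear subspace_0[OF Om_subspace])

lemma Om_second_order:
 assumes om: "om \<in> Om k" and et: "et \<in> Om l" and ze: "ze \<in> Om m"
 shows "i\<pi> (wedge (wedge om et) ze) = wedge (i\<pi> (wedge om et)) ze + ksign (l * m) *r wedge (i\<pi> (wedge om ze)) et
    + ksign (k * l + k * m) *r wedge (i\<pi> (wedge et ze)) om - wedge (wedge (i\<pi> om) et) ze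
    - ksign (k * l) *r wedge (wedge (i\<pi> et) om) ze - ksign (k * m + l * m) *r wedge (wedge (i\<pi> ze) om) et"
proof -
 have c: "wedge om (i\<pi> (wedge et ze)) = ksign (k * l + k * m) *r wedge (i\<pi> (wedge et ze)) om"
  "wedge om (i\<pi> et) = ksign (k * l) *r wedge (i\<pi> et) om" "wedge om (i\<pi> ze) = ksign (k * m) *r wedge (i\<pi> ze) om"
  unfolding Om_commute[OF om Om_interior_product[OF Om_wedge[OF et ze]]] Om_commute[OF om Om_interior_product[OF et]]
   Om_commute[OF om Om_interior_product[OF ze]]
  by (intro arg_cong2[where f = scaleR] refl ksign_eqI; simp add: algebra_simps)+
 have "i\<pi> (wedge (wedge om et) ze) = wedge (i\<pi> (wedge om et)) ze + wedge om (i\<pi> (wedge et ze))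
  + ksign (l * m) *r wedge (i\<pi> (wedge om ze)) et - wedge (wedge (i\<pi> om) et) ze
  - wedge (wedge om (i\<pi> et)) ze - ksign (l * m) *r wedge (wedge om (i\<pi> ze)) et"
  using om et ze
  by (elim Om_cases) (auto simp: wedge_linear interior_product_linear interior_product_second_order ksign_int of_nat_mult[symmetric] simp del: of_nat_mult)
 then show ?thesis unfolding c wedge_linear by (simp add: ksign_add mult.commute algebra_simps)
qed

theorem de_rham_ebv_data: "ebv_data (de_rham M) wedge i\<pi>"
proof (rule ebv_data.intro, unfold de_rham_diff)
 show "i\<pi> (i\<pi> (d om)) - 2 *r i\<pi> (d (i\<pi> om)) + d (i\<pi> (i\<pi> om)) = 0" if "om \<in> Om k" for k om
  using that by (elim Om_cases) (auto simp: d_zero interior_product_linear interior_product_koszul)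
qed (rule de_rham_complex Om_wedge Om_commute Om_leibniz Om_interior_product Om_second_order; assumption
 | simp add: linear_map_on_def wedge_linear interior_product_linear wedge_assoc)+

end

theorem corollary4p26:
  fixes M :: "('m, 'e::euclidean_space) manifold"
    and \<pi> :: "'m \<Rightarrow> 'm multivec"
    and P :: "'p::real_vector operad"
    and \<phi> :: "nat \<Rightarrow> 'p \<Rightarrow> ebv"
  assumes "poisson_manifold M \<pi>"
    and "graded_operad P"
    and "nonpositively_graded P"
    and "operad_morphism P ebv_operad \<phi>"
  shows "(\<exists>\<theta>. is_ebv_structure (de_rham M) wedge (interior_product M \<pi>) \<theta>) \<and>
    (\<forall>\<theta>. is_ebv_structure (de_rham M) wedge (interior_product M \<pi>) \<theta> \<longrightarrow>
      quasi_isomorphic TYPE(nat \<Rightarrow> 'm form) P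
        (restrict_scalars \<phi> (de_rham M, \<theta>))
        (trivial_algebra P (restrict_scalars \<phi> (de_rham M, \<theta>))))"
proof -
 interpret poisson_mfd M \<pi>
  using assms(1) by (auto simp: poisson_mfd_def poisson_mfd_axioms_def smooth_mfd_def poisson_manifold_def)
 interpret D: ebv_data "de_rham M" wedge "interior_product M \<pi>" by (rule de_rham_ebv_data)
 show ?thesis
  using D.theta_is_ebv_structure D.action_quasi_isomorphic_trivial[OF assms(2-4)] by blast
qed

end
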